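(* Let $n\ge1$, $R_n=\mathrm H_{\mathbb E}(\mathbb{CP}^n)$, and let $\gamma_n=[\mathbb{CP}^{n-1}]_{\mathbb E}\in R_n^2$ be the Grassmann class of a complex hyperplane. (1) We have $\gamma_n=\frac n\pi[P_n]$, and $\ell(\gamma_n^j)=\pi^{-j}\frac{n!}{(n-j)!}$ for $0\le j\le n$. (2) Every complex submanifold $Y\subseteq\mathbb{CP}^n$ is cohomogeneous. If $Y$ has complex codimension $j$, then the class of its associated zonoid equals $$[Y]_{\mathbb E}=\frac{\mathrm{vol}(Y)}{\mathrm{vol}(\mathbb{CP}^{n-j})}\,\gamma_n^j.$$ In particular, $[\mathbb{CP}^{n-j}]_{\mathbb E}=\gamma_n^j$.
   Context: Zonoids. For a finite-dimensional Euclidean space $W$, $\widehat{\mathcal Z}_o(W)$ is the real vector space of formal differences (Minkowski addition) of centered zonoids (zonoids = Hausdorff limits of finite Minkowski sums of segments; centered = symmetric about $0$). For an integrable random vector $\xi\in W$, $K(\xi)$ is the centered zonoid with support function $\frac12\mathbb E|\langle u,\xi\rangle|$; every centered zonoid is of this form. $\ell$ is the linear functional with $\ell(K(\xi))=\mathbb E\|\xi\|$. Algebra. For a Euclidean space $V$, $\Lambda^dV$ (over $\mathbb R$) has the induced inner product; $\bigoplus_d\widehat{\mathcal Z}_o(\Lambda^dV)$ is a graded commutative algebra with bilinear product determined by $K(\xi_1)\wedge K(\xi_2)=K(\xi_1\wedge\xi_2)$ for independent integrable $\xi_i$. $\widehat{\mathcal G}_o^d(V)$ is the span of the $K(\xi)$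 with $\xi\in\Lambda^dV$ integrable and a.s. simple ($=v_1\wedge\dots\wedge v_d$). With the pairing $\langle K(\xi),K(\zeta)\rangle=\mathbb E|\langle\xi,\zeta\rangle|$ ($\xi,\zeta$ independent), $\mathcal I^d(V)=\{K\in\widehat{\mathcal G}_o^d(V):\langle K,L\rangle=0\ \forall L\in\widehat{\mathcal G}_o^d(V)\}$; $\bigoplus_d\mathcal I^d(V)$ is an ideal on which $\ell$ vanishes, and $\mathcal Q_o(V)=\bigoplus_d\widehat{\mathcal G}_o^d(V)/\mathcal I^d(V)$ carries the induced $\ell$. Products in $\mathcal Q_o(V)$ are written without $\wedge$. Space. $M=\mathbb{CP}^n=G/H$, $G=\mathrm U(n+1)$, $H=\mathrm U(1)\times\mathrm U(n)$, with the Fubini–Study metric normalized so that $\mathrm{vol}(\mathbb{CP}^m)=\pi^m/m!$ for all $m$; $\mathbf o=eH$, $V=T^*_{\mathbf o}M\cong\mathbb C^n=\mathbb R^{2n}$ isometrically, where the $H$-action amounts to the standard $\mathrm U(n)$-action. $R_n=\mathrm H_{\mathbb E}(\mathbb{CP}^n)=\mathcal Q_o(\mathbb C^n)^{\mathrm U(n)}=\bigoplus_{d=0}^{2n}R_n^d$. $P_n:=K(g(e_1\wedge\sqrt{-1}\,e_1))\in\widehat{\mathcal G}^2_o(\mathbb C^n)$ with $g\in\mathrm U(n)$ uniformly random. Classes. For $\eta\in T_y^*M$, $g\eta=(D_{gy}a_{g^{-1}})^*\eta\in T^*_{gy}M$ with $a_g(x)=gx$. Fix a measurable $\tau:M\to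 G$ with $\tau(y)y=\mathbf o$. For a submanifold $Y$ of real codimension $d$ and finite volume let $\pm\nu_Y(y)\in\Lambda^dT_y^*M$ be the unit simple vector representing the conormal space at $y$; with $(h,y,\varepsilon)\in H\times Y\times\{\pm1\}$ uniform, $\xi_Y=\varepsilon\nu_{h\tau(y)Y}(\mathbf o)\in\Lambda^dV$, $K(Y)=\frac{\mathrm{vol}(Y)}{\mathrm{vol}(M)}K(\xi_Y)$ and $[Y]_{\mathbb E}=[K(Y)]$. $Y$ is cohomogeneous if for all $y_1,y_2\in Y$ there is $g\in G$ with $gy_1=y_2$ and $g\,N_{y_1}Y=N_{y_2}Y$, where $N_yY\subseteq T_y^*M$ is the conormal space. *)

theory Defs
  imports "HOL-Probability.Probability" "HOL-Algebra.QuotRing"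
begin

section \<open>Centered zonoids and virtual zonoids\<close>

definition zonotope :: "'a::euclidean_space set \<Rightarrow> bool"
  where "zonotope Z \<longleftrightarrow> (\<exists>xs. Z = sum_list (map (\<lambda>(a, b). closed_segment a b) xs))"

definition hausdorff_close :: "real \<Rightarrow> 'a::euclidean_space set \<Rightarrow> 'a set \<Rightarrow> bool"
  where "hausdorff_close \<epsilon> K L \<longleftrightarrow> K \<subseteq> L + cball 0 \<epsilon> \<and> L \<subseteq> K + cball 0 \<epsilon>"

definition centered_zonoid :: "'a::euclidean_space set \<Rightarrow> bool"
  where "centered_zonoid K \<longleftrightarrow>
    compact K \<and> K \<noteq> {} \<and> (\<forall>\<epsilon>>0. \<exists>Z. zonotope Z \<and> hausdorff_close \<epsilon> K Z) \<and> uminus ` K = K"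

definition vz_rel :: "'a::euclidean_space set \<times> 'a set \<Rightarrow> 'a set \<times> 'a set \<Rightarrow> bool"
  where "vz_rel = (\<lambda>(K, L) (K', L').
    centered_zonoid K \<and> centered_zonoid L \<and> centered_zonoid K' \<and> centered_zonoid L' \<and> K + L' = K' + L)"

definition support_fun :: "'a::euclidean_space set \<Rightarrow> 'a \<Rightarrow> real"
  where "support_fun K u = (SUP x\<in>K. u \<bullet> x)"

lemma zonotope_0: "zonotope {0}"
  unfolding zonotope_def by (rule exI[of _ "[]"]) simp

lemma zonotope_plus:
  assumes "zonotope Z" "zonotope W" shows "zonotope (Z + W)"
proof -
  obtain xs ys where "Z = sum_list (map (\<lambda>(a, b). closed_segment a b) xs)"
    "W = sum_list (map (\<lambda>(a, b). closed_segment a b) ys)"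
    using assms unfolding zonotope_def by blast
  then have "Z + W = sum_list (map (\<lambda>(a, b). closed_segment a b) (xs @ ys))" by simp
  then show ?thesis unfolding zonotope_def by blast
qed

lemma scaleR_set_plus: "(\<lambda>x. r *\<^sub>R x) ` (A + B) = (\<lambda>x. r *\<^sub>R x) ` A + (\<lambda>x. r *\<^sub>R x) ` (B :: 'a::real_vector set)"
  by (auto simp: set_plus_def image_iff scaleR_add_right) (metis scaleR_add_right)+

lemma closed_segment_scaleR:
  "(\<lambda>x. r *\<^sub>R x) ` closed_segment a b = closed_segment (r *\<^sub>R a) (r *\<^sub>R b)"
  by (rule closed_segment_linear_image[symmetric]) simp

lemma zonotope_scaleR:
  assumes "zonotope Z" shows "zonotope ((\<lambda>x. r *\<^sub>R x) ` Z)"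
proof -
  obtain xs where Z: "Z = sum_list (map (\<lambda>(a, b). closed_segment a b) xs)"
    using assms unfolding zonotope_def by blast
  have "(\<lambda>x. r *\<^sub>R x) ` sum_list (map (\<lambda>(a, b). closed_segment a b) xs) =
      sum_list (map (\<lambda>(a, b). closed_segment a b) (map (\<lambda>(a, b). (r *\<^sub>R a, r *\<^sub>R b)) xs))"
    by (induction xs) (auto simp: scaleR_set_plus closed_segment_scaleR)
  then show ?thesis unfolding zonotope_def Z by blast
qed

lemma zonotope_convex: "zonotope Z \<Longrightarrow> convex Z"
proof -
  have "convex (sum_list (map (\<lambda>(a, b). closed_segment a b) (xs :: ('a \<times> 'a) list)))" for xs
    by (induction xs) (auto intro: convex_set_plus)
  then show "zonotope Z \<Longrightarrow> convex Z" unfolding zonotope_def by blast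
qed

lemma centered_zonoid_convex:
  assumes "centered_zonoid K" shows "convex K"
proof (rule convexI)
  fix x y and u v :: real
  assume xy: "x \<in> K" "y \<in> K" and uv: "0 \<le> u" "0 \<le> v" "u + v = 1"
  have "u *\<^sub>R x + v *\<^sub>R y \<in> closure K"
  proof (unfold closure_approachable, intro allI impI)
    fix e :: real assume "0 < e"
    then have "0 < e / 4" by simp
    then obtain Z where Z: "zonotope Z" and c: "K \<subseteq> Z + cball 0 (e/4)" "Z \<subseteq> K + cball 0 (e/4)"
      using assms unfolding centered_zonoid_def hausdorff_close_def by blast
    obtain a p where a: "x = a + p" "a \<in> Z" "norm p \<le> e/4" using c(1) xy(1) by (force elim: set_plus_elim)
    obtain b q where b: "y = b + q" "b \<in> Z" "norm q \<le> e/4" using c(1) xy(2) by (force elim: set_plus_elim)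
    have "u *\<^sub>R a + v *\<^sub>R b \<in> Z" using zonotope_convex[OF Z] a b uv by (auto simp: convex_def)
    then obtain k r where k: "u *\<^sub>R a + v *\<^sub>R b = k + r" "k \<in> K" "norm r \<le> e/4"
      using c(2) by (force elim: set_plus_elim)
    have "k - (u *\<^sub>R x + v *\<^sub>R y) = - r - u *\<^sub>R p - v *\<^sub>R q"
      using k(1) a(1) b(1) by (simp add: algebra_simps)
    moreover have "norm (- r - u *\<^sub>R p - v *\<^sub>R q) \<le> norm r + norm (u *\<^sub>R p) + norm (v *\<^sub>R q)"
      by (metis (no_types, opaque_lifting) add_mono_thms_linordered_semiring(3) norm_minus_cancel norm_triangle_ineq4 order_trans)
    moreover have "norm (u *\<^sub>R p) \<le> 1 * (e/4)" unfolding norm_scaleR using uv a by (intro mult_mono) auto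
    moreover have "norm (v *\<^sub>R q) \<le> 1 * (e/4)" unfolding norm_scaleR using uv b by (intro mult_mono) auto
    ultimately have "dist k (u *\<^sub>R x + v *\<^sub>R y) < e" using k(3) \<open>0 < e\<close> by (simp add: dist_norm)
    then show "\<exists>y'\<in>K. dist y' (u *\<^sub>R x + v *\<^sub>R y) < e" using k(2) by blast
  qed
  then show "u *\<^sub>R x + v *\<^sub>R y \<in> K"
    using assms by (simp add: centered_zonoid_def compact_imp_closed closure_closed)
qed

lemma centered_zonoid_0: "centered_zonoid {0}"
  unfolding centered_zonoid_def hausdorff_close_def
  by (auto intro!: exI[of _ "{0}"] zonotope_0 simp: set_plus_def)

lemma cball_plus_half: "cball 0 (e/2) + cball 0 (e/2) \<subseteq> cball (0::'a::real_normed_vector) e"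
  by (force elim!: set_plus_elim intro: norm_triangle_le)

lemma centered_zonoid_plus:
  assumes "centered_zonoid K" "centered_zonoid L" shows "centered_zonoid (K + L)"
  unfolding centered_zonoid_def
proof (intro conjI allI impI)
  show "compact (K + L)"
  proof -
    have "K + L = {x + y | x y. x \<in> K \<and> y \<in> L}" by (auto simp: set_plus_def)
    then show ?thesis using assms compact_sums[of K L] by (simp add: centered_zonoid_def)
  qed
  show "K + L \<noteq> {}" using assms by (simp add: centered_zonoid_def set_plus_def) blast
  have "uminus ` (K + L) = uminus ` K + uminus ` L"
    using scaleR_set_plus[of "-1" K L] by (simp add: image_def)
  then show "uminus ` (K + L) = K + L" using assms by (simp add: centered_zonoid_def)
next
  fix e :: real assume "0 < e"
  then have "0 < e / 2" by simp
  then obtain Z W where Z: "zonotope Z" "hausdorff_close (e/2) K Z"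
    and W: "zonotope W" "hausdorff_close (e/2) L W"
    using assms unfolding centered_zonoid_def by meson
  have *: "A + B \<subseteq> (A' + B') + cball 0 e"
    if "A \<subseteq> A' + cball 0 (e/2)" "B \<subseteq> B' + cball 0 (e/2)" for A B A' B' :: "'a set"
  proof -
    have "A + B \<subseteq> (A' + cball 0 (e/2)) + (B' + cball 0 (e/2))" by (rule set_plus_mono2[OF that])
    also have "\<dots> = (A' + B') + (cball 0 (e/2) + cball 0 (e/2))" by (simp add: ac_simps)
    also have "\<dots> \<subseteq> (A' + B') + cball 0 e" by (rule set_plus_mono2[OF subset_refl cball_plus_half])
    finally show ?thesis .
  qed
  have "hausdorff_close e (K + L) (Z + W)"
    using Z W * unfolding hausdorff_close_def by blast
  then show "\<exists>Z. zonotope Z \<and> hausdorff_close e (K + L) Z" using zonotope_plus Z W by blast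
qed

lemma centered_zonoid_scaleR:
  assumes "centered_zonoid K" shows "centered_zonoid ((\<lambda>x. r *\<^sub>R x) ` K)"
  unfolding centered_zonoid_def
proof (intro conjI allI impI)
  show "compact ((\<lambda>x. r *\<^sub>R x) ` K)" using assms by (simp add: centered_zonoid_def compact_scaling)
  show "(\<lambda>x. r *\<^sub>R x) ` K \<noteq> {}" using assms by (simp add: centered_zonoid_def)
  have "uminus ` (\<lambda>x. r *\<^sub>R x) ` K = (\<lambda>x. r *\<^sub>R x) ` (uminus ` K)" by (simp add: image_image)
  then show "uminus ` (\<lambda>x. r *\<^sub>R x) ` K = (\<lambda>x. r *\<^sub>R x) ` K" using assms by (simp add: centered_zonoid_def)
next
  fix e :: real assume e: "0 < e"
  define d where "d = e / (\<bar>r\<bar> + 1)"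
  have d: "0 < d" "\<bar>r\<bar> * d \<le> e" using e by (auto simp: d_def field_simps)
  obtain Z where Z: "zonotope Z" "hausdorff_close d K Z"
    using assms d unfolding centered_zonoid_def by meson
  have *: "(\<lambda>x. r *\<^sub>R x) ` A \<subseteq> (\<lambda>x. r *\<^sub>R x) ` B + cball 0 e" if "A \<subseteq> B + cball 0 d" for A B :: "'a set"
  proof -
    have "(\<lambda>x. r *\<^sub>R x) ` A \<subseteq> (\<lambda>x. r *\<^sub>R x) ` B + (\<lambda>x. r *\<^sub>R x) ` cball 0 d"
      using that by (metis image_mono scaleR_set_plus)
    also have "\<dots> \<subseteq> (\<lambda>x. r *\<^sub>R x) ` B + cball 0 e"
      using d(2) by (intro set_plus_mono2) (auto intro: order_trans[OF mult_left_mono[OF _ abs_ge_zero] d(2)])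
    finally show ?thesis .
  qed
  have "hausdorff_close e ((\<lambda>x. r *\<^sub>R x) ` K) ((\<lambda>x. r *\<^sub>R x) ` Z)"
    using Z * unfolding hausdorff_close_def by blast
  then show "\<exists>Z. zonotope Z \<and> hausdorff_close e ((\<lambda>x. r *\<^sub>R x) ` K) Z" using zonotope_scaleR Z by blast
qed

lemma support_fun_bdd:
  assumes "compact K" shows "bdd_above ((\<lambda>x. u \<bullet> x) ` K)"
  by (intro bounded_imp_bdd_above compact_imp_bounded compact_continuous_image assms continuous_intros)

lemma support_fun_plus:
  assumes "centered_zonoid K" "centered_zonoid L"
  shows "support_fun (K + L) u = support_fun K u + support_fun L u"
proof -
  have K: "compact K" "K \<noteq> {}" and L: "compact L" "L \<noteq> {}"
    using assms by (auto simp: centered_zonoid_def)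
  have KL: "compact (K + L)" "K + L \<noteq> {}"
    using centered_zonoid_plus[OF assms] by (auto simp: centered_zonoid_def)
  show ?thesis
  proof (rule antisym)
    show "support_fun (K + L) u \<le> support_fun K u + support_fun L u"
      unfolding support_fun_def
    proof (rule cSUP_least[OF KL(2)])
      fix z assume "z \<in> K + L"
      then obtain x y where "x \<in> K" "y \<in> L" "z = x + y" by (auto elim: set_plus_elim)
      then show "u \<bullet> z \<le> (SUP x\<in>K. u \<bullet> x) + (SUP x\<in>L. u \<bullet> x)"
        by (auto simp: inner_add_right intro!: add_mono cSUP_upper support_fun_bdd K L)
    qed
    obtain x where x: "x \<in> K" "\<forall>y\<in>K. u \<bullet> y \<le> u \<bullet> x"
      using continuous_attains_sup[OF K continuous_on_inner[OF continuous_on_const continuous_on_id], of u] by auto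
    obtain y where y: "y \<in> L" "\<forall>z\<in>L. u \<bullet> z \<le> u \<bullet> y"
      using continuous_attains_sup[OF L continuous_on_inner[OF continuous_on_const continuous_on_id], of u] by auto
    have "support_fun K u \<le> u \<bullet> x" "support_fun L u \<le> u \<bullet> y"
      unfolding support_fun_def using x y K L by (auto intro: cSUP_least)
    moreover have "u \<bullet> (x + y) \<le> support_fun (K + L) u"
      unfolding support_fun_def using x y by (intro cSUP_upper support_fun_bdd KL) auto
    ultimately show "support_fun K u + support_fun L u \<le> support_fun (K + L) u"
      by (simp add: inner_add_right)
  qed
qed

lemma support_fun_scaleR:
  assumes "centered_zonoid K"
  shows "support_fun ((\<lambda>x. r *\<^sub>R x) ` K) u = \<bar>r\<bar> * support_fun K u"
proof -
  have sym: "uminus ` K = K" and K: "compact K" "K \<noteq> {}" using assms by (auto simp: centered_zonoid_def)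
  have pos: "support_fun ((\<lambda>x. s *\<^sub>R x) ` K) u = s * support_fun K u" if "0 \<le> s" for s
  proof -
    have sK: "compact ((\<lambda>x. s *\<^sub>R x) ` K)" using K compact_scaling by blast
    obtain x where x: "x \<in> K" "\<forall>y\<in>K. u \<bullet> y \<le> u \<bullet> x"
      using continuous_attains_sup[OF K continuous_on_inner[OF continuous_on_const continuous_on_id], of u] by auto
    have "support_fun K u = u \<bullet> x"
      unfolding support_fun_def using x by (intro cSup_eq_maximum) auto
    moreover have "support_fun ((\<lambda>x. s *\<^sub>R x) ` K) u = s * (u \<bullet> x)"
      unfolding support_fun_def using x that
      by (intro cSup_eq_maximum) (auto simp: mult_left_mono image_image)
    ultimately show ?thesis by simp
  qed
  show ?thesis
  proof (cases "0 \<le> r")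
    case True then show ?thesis using pos by simp
  next
    case False
    have "(\<lambda>x. r *\<^sub>R x) ` K = (\<lambda>x. (- r) *\<^sub>R x) ` (uminus ` K)" by (simp add: image_image)
    then show ?thesis using pos[of "- r"] False sym by simp
  qed
qed

lemma support_fun_subset:
  assumes "centered_zonoid K" "centered_zonoid L" "support_fun K = support_fun L"
  shows "K \<subseteq> L"
proof (rule ccontr)
  assume "\<not> K \<subseteq> L"
  then obtain x where x: "x \<in> K" "x \<notin> L" by blast
  have L: "convex L" "compact L" "L \<noteq> {}" and K: "compact K"
    using assms centered_zonoid_convex by (auto simp: centered_zonoid_def)
  obtain a b where ab: "a \<bullet> x < b" "\<And>y. y \<in> L \<Longrightarrow> b < a \<bullet> y"
    using separating_hyperplane_closed_point[of L x] L x compact_imp_closed by blast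
  have "support_fun L (- a) \<le> - b"
    unfolding support_fun_def using ab L by (intro cSUP_least) (auto intro: less_imp_le)
  moreover have "(- a) \<bullet> x \<le> support_fun K (- a)"
    unfolding support_fun_def using x by (intro cSUP_upper support_fun_bdd K) auto
  ultimately show False using assms(3) ab(1) by simp
qed

lemma support_fun_inj:
  assumes "centered_zonoid K" "centered_zonoid L" "support_fun K = support_fun L"
  shows "K = L"
  using support_fun_subset[OF assms] support_fun_subset[OF assms(2,1) assms(3)[symmetric]] by blast

lemma vz_rel_iff:
  "vz_rel (K, L) (K', L') \<longleftrightarrow>
    centered_zonoid K \<and> centered_zonoid L \<and> centered_zonoid K' \<and> centered_zonoid L' \<and>
    (\<forall>u. support_fun K u - support_fun L u = support_fun K' u - support_fun L' u)"
proof -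
  have "K + L' = K' + L \<longleftrightarrow>
      (\<forall>u. support_fun K u - support_fun L u = support_fun K' u - support_fun L' u)"
    if z: "centered_zonoid K" "centered_zonoid L" "centered_zonoid K'" "centered_zonoid L'"
  proof -
    have "K + L' = K' + L \<longleftrightarrow> support_fun (K + L') = support_fun (K' + L)"
      using z support_fun_inj centered_zonoid_plus by metis
    also have "\<dots> \<longleftrightarrow> (\<forall>u. support_fun K u + support_fun L' u = support_fun K' u + support_fun L u)"
      using z by (simp add: fun_eq_iff support_fun_plus)
    finally show ?thesis by (simp add: algebra_simps)
  qed
  then show ?thesis unfolding vz_rel_def by auto
qed

text \<open>Formal differences \<open>K - L\<close> of centered zonoids, under Minkowski addition.\<close>

quotient_type (overloaded) 'a vzonoid = "('a::euclidean_space) set \<times> 'a set" / partial: vz_rel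
proof (rule part_equivpI)
  show "\<exists>x. vz_rel x x" using centered_zonoid_0 by (intro exI[of _ "({0}, {0})"]) (simp add: vz_rel_iff)
  show "symp vz_rel" by (rule sympI) (auto simp: vz_rel_iff)
  show "transp vz_rel" by (rule transpI) (auto simp: vz_rel_iff)
qed

lift_definition vz_support :: "'a::euclidean_space vzonoid \<Rightarrow> 'a \<Rightarrow> real"
  is "\<lambda>(K, L) u. support_fun K u - support_fun L u"
  by (auto simp: vz_rel_iff fun_eq_iff)

lemma vz_support_eqI: "(\<And>u. vz_support A u = vz_support B u) \<Longrightarrow> A = B"
  by transfer (auto simp: vz_rel_iff)

instantiation vzonoid :: (euclidean_space) real_vector
begin

lift_definition zero_vzonoid :: "'a vzonoid" is "({0}, {0})"
  by (simp add: vz_rel_iff centered_zonoid_0)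

lift_definition plus_vzonoid :: "'a vzonoid \<Rightarrow> 'a vzonoid \<Rightarrow> 'a vzonoid"
  is "\<lambda>(K, L) (K', L'). (K + K', L + L')"
  by (auto simp: vz_rel_iff centered_zonoid_plus support_fun_plus) (smt (verit))

lift_definition uminus_vzonoid :: "'a vzonoid \<Rightarrow> 'a vzonoid" is "\<lambda>(K, L). (L, K)"
  by (auto simp: vz_rel_iff) (smt (verit))

definition minus_vzonoid :: "'a vzonoid \<Rightarrow> 'a vzonoid \<Rightarrow> 'a vzonoid"
  where "minus_vzonoid A B = A + (- B)"

text \<open>Since \<open>K\<close> and \<open>L\<close> are symmetric, \<open>r K = \<bar>r\<bar> K\<close>; a negative factor exchanges the two terms.\<close>

lift_definition scaleR_vzonoid :: "real \<Rightarrow> 'a vzonoid \<Rightarrow> 'a vzonoid"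
  is "\<lambda>r (K, L). if 0 \<le> r then ((\<lambda>x. r *\<^sub>R x) ` K, (\<lambda>x. r *\<^sub>R x) ` L)
                 else ((\<lambda>x. r *\<^sub>R x) ` L, (\<lambda>x. r *\<^sub>R x) ` K)"
  by (auto simp: vz_rel_iff centered_zonoid_scaleR support_fun_scaleR simp flip: right_diff_distrib)

instance
proof
  have z [simp]: "vz_support 0 u = 0" for u :: 'a
    by transfer (simp add: support_fun_def)
  have p [simp]: "vz_support (A + B) u = vz_support A u + vz_support B u" for A B :: "'a vzonoid" and u
    by transfer (auto simp: vz_rel_iff support_fun_plus)
  have m [simp]: "vz_support (- A) u = - vz_support A u" for A :: "'a vzonoid" and u
    by transfer auto
  have s [simp]: "vz_support (r *\<^sub>R A) u = r * vz_support A u" for A :: "'a vzonoid" and r u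
    by transfer (auto simp: vz_rel_iff support_fun_scaleR algebra_simps)
  fix A B C :: "'a vzonoid" and r q :: real
  show "A + B + C = A + (B + C)" by (rule vz_support_eqI) simp
  show "A + B = B + A" by (rule vz_support_eqI) simp
  show "0 + A = A" by (rule vz_support_eqI) simp
  show "- A + A = 0" by (rule vz_support_eqI) simp
  show "A - B = A + - B" by (simp add: minus_vzonoid_def)
  show "r *\<^sub>R (A + B) = r *\<^sub>R A + r *\<^sub>R B" by (rule vz_support_eqI) (simp add: algebra_simps)
  show "(r + q) *\<^sub>R A = r *\<^sub>R A + q *\<^sub>R A" by (rule vz_support_eqI) (simp add: algebra_simps)
  show "r *\<^sub>R q *\<^sub>R A = (r * q) *\<^sub>R A" by (rule vz_support_eqI) simp
  show "1 *\<^sub>R A = A" by (rule vz_support_eqI) simp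
qed

end

text \<open>
  \<open>K(\<xi>)\<close> for a random vector \<open>\<xi>\<close> on the probability space \<open>M\<close>: the convex body with
  support function \<open>u \<mapsto> 1/2 E|\<langle>u, \<xi>\<rangle>|\<close>, described as an intersection of half-spaces.
\<close>

definition random_zonoid :: "'w measure \<Rightarrow> ('w \<Rightarrow> 'a::euclidean_space) \<Rightarrow> 'a set"
  where "random_zonoid M \<xi> = {x. \<forall>u. u \<bullet> x \<le> 1/2 * (\<integral>\<omega>. \<bar>u \<bullet> \<xi> \<omega>\<bar> \<partial>M)}"

definition vz :: "'w measure \<Rightarrow> ('w \<Rightarrow> 'a::euclidean_space) \<Rightarrow> 'a vzonoid"
  where "vz M \<xi> = abs_vzonoid (random_zonoid M \<xi>, {0})"

text \<open>
  As \<open>K(\<xi>)\<close> depends only on the distribution of \<open>\<xi>\<close>, quantification over all integrable random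
  vectors is quantification over their laws.
\<close>

definition integrable_law :: "'a::euclidean_space measure \<Rightarrow> bool"
  where "integrable_law \<mu> \<longleftrightarrow> prob_space \<mu> \<and> sets \<mu> = sets borel \<and> integrable \<mu> (\<lambda>x. x)"

text \<open>
  The functional \<open>\<ell>\<close>, the pairing and (below) the product are introduced through their values on
  the \<open>K(\<xi>)\<close>. These values determine them, because every centered zonoid is some \<open>K(\<xi>)\<close>. A
  product measure stands for a pair of independent random vectors.
\<close>

definition vz_length :: "'a::euclidean_space vzonoid \<Rightarrow> real"
  where "vz_length = (SOME f. linear f \<and>
    (\<forall>\<mu>. integrable_law \<mu> \<longrightarrow> f (vz \<mu> (\<lambda>x. x)) = (\<integral>x. norm x \<partial>\<mu>)))"

definition vz_pairing :: "'a::euclidean_space vzonoid \<Rightarrow> 'a vzonoid \<Rightarrow> real"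
  where "vz_pairing = (SOME f. bilinear f \<and>
    (\<forall>\<mu> \<nu>. integrable_law \<mu> \<longrightarrow> integrable_law \<nu> \<longrightarrow>
      f (vz \<mu> (\<lambda>x. x)) (vz \<nu> (\<lambda>y. y)) = (\<integral>(x, y). \<bar>x \<bullet> y\<bar> \<partial>(\<mu> \<Otimes>\<^sub>M \<nu>))))"

definition vz_map :: "('a::euclidean_space \<Rightarrow> 'b::euclidean_space) \<Rightarrow> 'a vzonoid \<Rightarrow> 'b vzonoid"
  where "vz_map T A = (case rep_vzonoid A of (K, L) \<Rightarrow> abs_vzonoid (T ` K, T ` L))"


section \<open>The exterior algebra of \<open>\<complex>\<^sup>n\<close> as a real Euclidean space\<close>

text \<open>
  All degrees live in one Euclidean space, with orthonormal basis \<open>e\<^sub>S = axis S 1\<close> for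
  \<open>S \<subseteq> 'n \<times> bool\<close>: the pairs \<open>(i, False)\<close>, \<open>(i, True)\<close> index the real basis \<open>e\<^sub>i\<close>,
  \<open>\<i> e\<^sub>i\<close> of \<open>\<complex>\<^sup>n\<close>, and \<open>e\<^sub>S\<close> is the product of the basis vectors in \<open>S\<close> in increasing order of
  \<^const>\<open>to_nat\<close>. The \<open>d\<close>-th exterior power is the span of the \<open>e\<^sub>S\<close> with \<open>card S = d\<close>; the
  inner product on it is the induced one.
\<close>

type_synonym 'n ext = "real ^ (('n \<times> bool) set)"

definition wedge :: "'n::finite ext \<Rightarrow> 'n ext \<Rightarrow> 'n ext"
  where "wedge x y = (\<chi> U. \<Sum>S\<in>Pow U.
    (-1) ^ card {(s, t). s \<in> S \<and> t \<in> U - S \<and> to_nat t < to_nat s} * x $ S * y $ (U - S))"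

definition ext_vec :: "complex ^ 'n \<Rightarrow> 'n::finite ext"
  where "ext_vec w = (\<Sum>i\<in>UNIV. Re (w $ i) *\<^sub>R axis {(i, False)} 1 + Im (w $ i) *\<^sub>R axis {(i, True)} 1)"

definition wedge_list :: "(complex ^ 'n) list \<Rightarrow> 'n::finite ext"
  where "wedge_list ws = foldr (\<lambda>w x. wedge (ext_vec w) x) ws (axis {} 1)"

text \<open>
  In degree \<open>0\<close> this singles out the scalar \<open>1\<close>. As \<open>K(c) = E|c| K(1)\<close> for a random scalar \<open>c\<close>,
  the span \<open>grass_deg 0\<close> below is the same as with all scalars.
\<close>

definition simple_vector :: "nat \<Rightarrow> 'n::finite ext \<Rightarrow> bool"
  where "simple_vector d x \<longleftrightarrow> (\<exists>ws. length ws = d \<and> x = wedge_list ws)"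

definition ext_map :: "complex ^ 'n ^ 'n \<Rightarrow> 'n::finite ext \<Rightarrow> 'n ext"
  where "ext_map g = (THE T. linear T \<and> (\<forall>ws. T (wedge_list ws) = wedge_list (map ((*v) g) ws)))"


section \<open>The algebra \<open>Q\<^sub>o(\<complex>\<^sup>n)\<close>\<close>

text \<open>
  The product is defined on the virtual zonoids of the whole exterior algebra, in which the direct
  sum over \<open>d\<close> of the virtual zonoids of the \<open>d\<close>-th exterior powers is embedded as a subalgebra.
\<close>

definition vz_wedge :: "'n::finite ext vzonoid \<Rightarrow> 'n ext vzonoid \<Rightarrow> 'n ext vzonoid"
  where "vz_wedge = (SOME f. bilinear f \<and>
    (\<forall>\<mu> \<nu>. integrable_law \<mu> \<longrightarrow> integrable_law \<nu> \<longrightarrow>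
      f (vz \<mu> (\<lambda>x. x)) (vz \<nu> (\<lambda>y. y)) = vz (\<mu> \<Otimes>\<^sub>M \<nu>) (\<lambda>(x, y). wedge x y)))"

definition grass_deg :: "nat \<Rightarrow> 'n::finite ext vzonoid set"
  where "grass_deg d = span {vz \<mu> (\<lambda>x. x) | \<mu>. integrable_law \<mu> \<and> (AE x in \<mu>. simple_vector d x)}"

definition null_deg :: "nat \<Rightarrow> 'n::finite ext vzonoid set"
  where "null_deg d = {A \<in> grass_deg d. \<forall>L \<in> grass_deg d. vz_pairing A L = 0}"

definition grass_algebra :: "'n::finite ext vzonoid ring"
  where "grass_algebra =
    \<lparr>carrier = span (\<Union>d. grass_deg d), mult = vz_wedge,
     one = vz (return borel (axis {} 1)) (\<lambda>x. x), zero = 0, add = (+)\<rparr>"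

definition null_ideal :: "'n::finite ext vzonoid set"
  where "null_ideal = span (\<Union>d. null_deg d)"

definition Q_algebra :: "'n::finite ext vzonoid set ring"
  where "Q_algebra = grass_algebra Quot null_ideal"

definition Q_class :: "'n::finite ext vzonoid \<Rightarrow> 'n ext vzonoid set"
  where "Q_class A = null_ideal +>\<^bsub>grass_algebra\<^esub> A"

definition Q_scale :: "real \<Rightarrow> 'n::finite ext vzonoid set \<Rightarrow> 'n ext vzonoid set"
  where "Q_scale r X = (\<Union>A\<in>X. Q_class (r *\<^sub>R A))"

definition Q_length :: "'n::finite ext vzonoid set \<Rightarrow> real"
  where "Q_length X = (THE r. \<forall>A\<in>X. vz_length A = r)"


section \<open>Unitary groups\<close>

definition adj :: "complex ^ 'm ^ 'm \<Rightarrow> complex ^ 'm ^ 'm::finite"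
  where "adj g = (\<chi> i j. cnj (g $ j $ i))"

definition unitary_group :: "(complex ^ 'm ^ 'm::finite) set"
  where "unitary_group = {g. g ** adj g = mat 1 \<and> adj g ** g = mat 1}"

text \<open>The uniform distribution on a compact group of matrices.\<close>

definition haar_prob :: "(complex ^ 'm ^ 'm::finite) set \<Rightarrow> (complex ^ 'm ^ 'm) measure \<Rightarrow> bool"
  where "haar_prob G \<mu> \<longleftrightarrow> prob_space \<mu> \<and> sets \<mu> = sets (restrict_space borel G) \<and>
    (\<forall>g\<in>G. distr \<mu> \<mu> (\<lambda>h. g ** h) = \<mu>)"

text \<open>The degree \<open>d\<close> part of \<open>R\<^sub>n\<close>, the \<open>U(n)\<close>-invariants of \<^const>\<open>Q_algebra\<close>.\<close>

definition R_deg :: "nat \<Rightarrow> 'n::finite ext vzonoid set set"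
  where "R_deg d = {X \<in> carrier Q_algebra. (\<exists>A\<in>grass_deg d. X = Q_class A) \<and>
    (\<forall>g\<in>unitary_group. vz_map (ext_map g) ` X = X)}"

definition P_zonoid :: "(complex ^ 'n ^ 'n) measure \<Rightarrow> 'n \<Rightarrow> 'n::finite ext vzonoid"
  where "P_zonoid \<mu> k = vz \<mu> (\<lambda>g. ext_map g (wedge_list [axis k 1, \<i> *s axis k 1]))"


section \<open>Complex projective space\<close>

text \<open>
  \<open>\<complex>\<^sup>n\<^sup>+\<^sup>1\<close> has the coordinates \<open>None\<close>, \<open>Some i\<close>. A line in it is identified with the orthogonal
  projection onto it, so that \<open>CP\<close> is a submanifold of the space of matrices on which \<open>U(n+1)\<close>
  acts by conjugation, and \<open>D a\<^sub>g\<close> is conjugation by \<open>g\<close> as well. The tangent vector at the unit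
  vector \<open>v\<close> with horizontal lift \<open>w \<bottom> v\<close> is the matrix \<open>w v\<^sup>* + v w\<^sup>*\<close>, of Frobenius norm squared
  \<open>2 |w|\<^sup>2\<close>. Hence half the Frobenius inner product is the quotient metric of the unit sphere, which
  is the Fubini-Study metric with volume \<open>\<pi>\<^sup>m/m!\<close> on projective \<open>m\<close>-space.
\<close>

type_synonym 'n hmat = "complex ^ ('n option) ^ ('n option)"

definition pt :: "complex ^ ('n option) \<Rightarrow> 'n::finite hmat"
  where "pt z = (\<chi> i j. z $ i * cnj (z $ j) / complex_of_real ((norm z)\<^sup>2))"

definition CP :: "'n::finite hmat set"
  where "CP = pt ` (- {0})"

definition base_pt :: "'n::finite hmat"
  where "base_pt = pt (axis None 1)"

definition act :: "'n hmat \<Rightarrow> 'n hmat \<Rightarrow> 'n::finite hmat"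
  where "act g y = g ** y ** adj g"

definition stabilizer :: "'n::finite hmat set"
  where "stabilizer = {h \<in> unitary_group. \<forall>i. h $ None $ Some i = 0 \<and> h $ Some i $ None = 0}"

definition orbit_section :: "('n hmat \<Rightarrow> 'n::finite hmat) \<Rightarrow> bool"
  where "orbit_section \<tau> \<longleftrightarrow> \<tau> \<in> borel_measurable (restrict_space borel CP) \<and>
    (\<forall>y\<in>CP. \<tau> y \<in> unitary_group \<and> act (\<tau> y) y = base_pt)"

definition proj_subspace :: "nat \<Rightarrow> 'n::finite hmat set \<Rightarrow> bool"
  where "proj_subspace m X \<longleftrightarrow>
    (\<exists>L. vec.subspace L \<and> vec.dim L = m + 1 \<and> X = pt ` (L - {0}))"

definition fs_metric :: "'n::finite hmat \<Rightarrow> 'n hmat \<Rightarrow> real"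
  where "fs_metric X Z = X \<bullet> Z / 2"

definition tangent_space :: "'a::real_normed_vector set \<Rightarrow> 'a \<Rightarrow> 'a set"
  where "tangent_space Y y =
    {X. \<exists>c :: real \<Rightarrow> 'a. c 0 = y \<and> (\<forall>t. c t \<in> Y) \<and> (c has_vector_derivative X) (at 0)}"

definition cotangent_space :: "'n::finite hmat \<Rightarrow> ('n hmat \<Rightarrow> real) set"
  where "cotangent_space y = {restrict f (tangent_space CP y) | f. linear f}"

definition conormal_space :: "'n::finite hmat set \<Rightarrow> 'n hmat \<Rightarrow> ('n hmat \<Rightarrow> real) set"
  where "conormal_space Y y = {\<eta> \<in> cotangent_space y. \<forall>X\<in>tangent_space Y y. \<eta> X = 0}"

definition cotangent_act :: "'n hmat \<Rightarrow> 'n hmat \<Rightarrow> ('n hmat \<Rightarrow> real) \<Rightarrow> 'n::finite hmat \<Rightarrow> real"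
  where "cotangent_act g y \<eta> = restrict (\<lambda>X. \<eta> (act (adj g) X)) (tangent_space CP (act g y))"

definition cohomogeneous :: "'n::finite hmat set \<Rightarrow> bool"
  where "cohomogeneous Y \<longleftrightarrow> (\<forall>y1\<in>Y. \<forall>y2\<in>Y. \<exists>g\<in>unitary_group. act g y1 = y2 \<and>
    cotangent_act g y1 ` conormal_space Y y1 = conormal_space Y y2)"


section \<open>Riemannian volume\<close>

text \<open>Lebesgue measure on the coordinate subspace spanned by a set \<open>B\<close> of basis vectors.\<close>

definition lborel_on :: "'p::euclidean_space set \<Rightarrow> 'p measure"
  where "lborel_on B = distr (\<Pi>\<^sub>M b\<in>B. lborel) borel (\<lambda>f. \<Sum>b\<in>B. f b *\<^sub>R b)"

text \<open>
  An injective \<open>C\<^sup>1\<close> immersion \<open>\<psi>\<close>, with derivative \<open>D\<close>, of an open subset \<open>U\<close> of an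
  \<open>m\<close>-dimensional coordinate space into \<open>Y\<close>. The coordinate spaces are taken inside \<open>\<complex>\<^sup>n\<close>, which
  suffices for \<open>m \<le> 2 n\<close>.
\<close>

definition local_param :: "nat \<Rightarrow> 'n::finite hmat set \<Rightarrow> (complex ^ 'n) set \<Rightarrow> (complex ^ 'n) set \<Rightarrow>
    (complex ^ 'n \<Rightarrow> 'n hmat) \<Rightarrow> (complex ^ 'n \<Rightarrow> complex ^ 'n \<Rightarrow> 'n hmat) \<Rightarrow> bool"
  where "local_param m Y B U \<psi> D \<longleftrightarrow>
    B \<subseteq> Basis \<and> card B = m \<and> openin (top_of_set (span B)) U \<and> inj_on \<psi> U \<and> \<psi> ` U \<subseteq> Y \<and>
    (\<forall>x\<in>U. (\<psi> has_derivative D x) (at x within U) \<and> inj_on (D x) (span B)) \<and>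
    (\<forall>b\<in>B. continuous_on U (\<lambda>x. D x b))"

definition gram_det :: "(complex ^ 'n) set \<Rightarrow> (complex ^ 'n \<Rightarrow> 'n::finite hmat) \<Rightarrow> real"
  where "gram_det B T =
    (\<Sum>p | p permutes B. of_int (sign p) * (\<Prod>b\<in>B. fs_metric (T b) (T (p b))))"

text \<open>
  The Riemannian volume measure of an \<open>m\<close>-dimensional submanifold \<open>Y\<close> of \<open>CP\<close> is the least
  measure on \<open>Y\<close> dominating the image of \<open>sqrt (det g) dx\<close> under each local parametrization.
\<close>

definition fs_volume :: "nat \<Rightarrow> 'n::finite hmat set \<Rightarrow> 'n hmat measure"
  where "fs_volume m Y = Sup {distr
      (density (restrict_space (lborel_on B) U) (\<lambda>x. ennreal (sqrt (gram_det B (D x)))))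
      (restrict_space borel Y) \<psi> | B U \<psi> D. local_param m Y B U \<psi> D}"

definition vol :: "nat \<Rightarrow> 'n::finite hmat set \<Rightarrow> real"
  where "vol m Y = measure (fs_volume m Y) Y"

definition finite_volume :: "nat \<Rightarrow> 'n::finite hmat set \<Rightarrow> bool"
  where "finite_volume m Y \<longleftrightarrow> emeasure (fs_volume m Y) Y < \<infinity>"


section \<open>Complex submanifolds\<close>

definition holomorphic_several :: "(complex ^ 'n \<Rightarrow> complex) \<Rightarrow> (complex ^ 'n::finite) set \<Rightarrow> bool"
  where "holomorphic_several f U \<longleftrightarrow>
    (\<forall>x\<in>U. \<exists>D. (f has_derivative D) (at x) \<and> (\<forall>c v. D (c *s v) = c * D v))"

definition complex_submanifold_affine :: "nat \<Rightarrow> (complex ^ 'n::finite) set \<Rightarrow> bool"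
  where "complex_submanifold_affine j S \<longleftrightarrow> (\<forall>p\<in>S. \<exists>U f. open U \<and> p \<in> U \<and>
    (\<forall>k<j. holomorphic_several (f k) U) \<and> S \<inter> U = {w \<in> U. \<forall>k<j. f k w = 0} \<and>
    (\<forall>w\<in>U. \<forall>c :: nat \<Rightarrow> complex. \<exists>v. \<forall>k<j. frechet_derivative (f k) (at w) v = c k))"

text \<open>
  \<open>w \<mapsto> [g (1, w)]\<close> for \<open>g \<in> U(n+1)\<close> are the affine charts of \<open>CP\<close>, in all unitary frames.
\<close>

definition affine_chart :: "'n hmat \<Rightarrow> complex ^ 'n \<Rightarrow> 'n::finite hmat"
  where "affine_chart g w = pt (g *v (\<chi> i. case i of None \<Rightarrow> 1 | Some k \<Rightarrow> w $ k))"

definition complex_submanifold :: "nat \<Rightarrow> 'n::finite hmat set \<Rightarrow> bool"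
  where "complex_submanifold j Y \<longleftrightarrow> Y \<subseteq> CP \<and>
    (\<forall>g\<in>unitary_group. complex_submanifold_affine j {w. affine_chart g w \<in> Y})"


section \<open>Grassmann classes\<close>

text \<open>
  The isometry of \<open>\<complex>\<^sup>n\<close> with the cotangent space at the base point: \<open>horizontal w\<close> is the
  tangent vector \<open>w v\<^sup>* + v w\<^sup>*\<close> with \<open>v = axis None 1\<close>, and the metric turns it into a covector.
\<close>

definition horizontal :: "complex ^ 'n \<Rightarrow> 'n::finite hmat"
  where "horizontal w = (\<chi> a b. case (a, b) of
    (Some i, None) \<Rightarrow> w $ i | (None, Some i) \<Rightarrow> cnj (w $ i) | _ \<Rightarrow> 0)"

definition covector :: "complex ^ 'n \<Rightarrow> 'n::finite hmat \<Rightarrow> real"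
  where "covector w = restrict (fs_metric (horizontal w)) (tangent_space CP base_pt)"

definition conormal_base :: "'n hmat set \<Rightarrow> (complex ^ 'n::finite) set"
  where "conormal_base Z = {w. covector w \<in> conormal_space Z base_pt}"

text \<open>
  One of the two unit simple vectors representing the conormal space at the base point. Which one
  does not matter, as \<open>K(\<xi>)\<close> involves \<open>\<xi>\<close> only through the \<open>|\<langle>u, \<xi>\<rangle>|\<close>.
\<close>

definition conormal_unit :: "nat \<Rightarrow> 'n hmat set \<Rightarrow> 'n::finite ext"
  where "conormal_unit d Z = (SOME \<nu>. norm \<nu> = 1 \<and>
    (\<exists>ws. length ws = d \<and> span (set ws) = conormal_base Z \<and> \<nu> = wedge_list ws))"

definition grass_zonoid :: "'n hmat measure \<Rightarrow> ('n hmat \<Rightarrow> 'n hmat) \<Rightarrow> nat \<Rightarrow> 'n hmat set \<Rightarrow>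
    'n::finite ext vzonoid"
  where "grass_zonoid \<eta> \<tau> d Y =
    (vol (2 * CARD('n) - d) Y / vol (2 * CARD('n)) (CP :: 'n hmat set)) *\<^sub>R
    vz (\<eta> \<Otimes>\<^sub>M (uniform_measure (fs_volume (2 * CARD('n) - d) Y) Y \<Otimes>\<^sub>M uniform_count_measure {-1, 1}))
      (\<lambda>(h, y, \<epsilon>). \<epsilon> *\<^sub>R conormal_unit d (act (h ** \<tau> y) ` Y))"

definition grass_class :: "'n hmat measure \<Rightarrow> ('n hmat \<Rightarrow> 'n hmat) \<Rightarrow> nat \<Rightarrow> 'n hmat set \<Rightarrow>
    'n::finite ext vzonoid set"
  where "grass_class \<eta> \<tau> d Y = Q_class (grass_zonoid \<eta> \<tau> d Y)"

end

theory Submission imports Defs begin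

text \<open>
  A complex submanifold is complex in the affine charts, so its conormal spaces are complex subspaces, and
  \<open>U(n)\<close> is transitive on complex subspaces of a fixed dimension: this is cohomogeneity, and it shows that the
  zonoid of \<open>Y\<close> is a multiple of the zonoid of a uniformly rotated complex \<open>j\<close>-frame. Powers of \<open>P\<^sub>n\<close> are such
  multiples too: wedging with an independent random complex line replaces a frame by a longer one, scaled by the
  squared distance of a random unit vector from a \<open>j\<close>-dimensional subspace, whose mean is \<open>(n - j)/n\<close>. The
  remaining constants are the volumes \<open>\<pi>\<^sup>m/m!\<close>, which are those of unit balls in Darboux coordinates.
\<close>

section \<open>Virtual zonoids and random vectors\<close>

text \<open>\<open>vz_length\<close>, \<open>vz_pairing\<close> and \<open>vz_wedge\<close> are
  picked by SOME from their values on the K(xi), so each must be shown to exist. The means is the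
  support function: a linear relation between zonoids is one between the functions u |-> E|<u, xi>|,
  and it survives integration against a second, independent law. The same device moves a factor of a
  product across the pairing, which makes the null classes an ideal, and expresses the length in
  degree d as a multiple of the pairing with one Grassmann zonoid, which makes the length descend to
  the quotient. On the geometric side \<open>conormal_unit\<close> is also a choice, made anew for
  each position of Y. Only |<u, nu>| enters a zonoid, and it is measurable because locally it is a
  Borel function of the differentials of defining equations. Volumes are suprema over all
  parametrizations, so one Darboux chart must be shown to dominate all of them; the volume of Y
  itself is never computed. The constant n/pi is vol(CP^(n-1))/vol(CP^n).\<close>

lemma support_fun_attained:
	assumes "compact K" "K ~= {}"
	obtains x where "x : K" "support_fun K u = u \<bullet> x"
proof -
	obtain x where x: "x : K" "ALL y:K. u \<bullet> y <= u \<bullet> x"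
		using continuous_attains_sup[OF assms continuous_on_inner[OF continuous_on_const continuous_on_id], of u] by auto
	hence "support_fun K u = u \<bullet> x"
		unfolding support_fun_def by (intro cSup_eq_maximum) auto
	with x that show ?thesis by blast
qed

lemma support_fun_upper:
	assumes "compact K" "x : K" shows "u \<bullet> x <= support_fun K u"
	unfolding support_fun_def using assms by (intro cSUP_upper support_fun_bdd)

lemma subset_plus_cballI:
	fixes A B :: "'a::euclidean_space set"
	assumes "compact B" "convex B" "B ~= {}" "0 <= eps"
		and le: "!!u x. x : A ==> u \<bullet> x <= support_fun B u + eps * norm u"
	shows "A \<subseteq> B + cball 0 eps"
proof (rule ccontr)
	assume "\<not> A \<subseteq> B + cball 0 eps"
	then obtain x where x: "x : A" "x ~: B + cball 0 eps" by blast
	have eq: "B + cball 0 eps = {x + y | x y. x : B & y : cball 0 eps}" unfolding set_plus_def by blast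
	have c: "convex (B + cball 0 eps)" using assms by (intro convex_set_plus) auto
	have "compact (B + cball 0 eps)" unfolding eq using assms by (intro compact_sums) auto
	hence cl: "closed (B + cball 0 eps)" by (rule compact_imp_closed)
	obtain a b where ab: "a \<bullet> x < b" "!!y. y : B + cball 0 eps ==> b < a \<bullet> y"
		using separating_hyperplane_closed_point[OF c cl x(2)] by blast
	obtain z where z: "z : B" "support_fun B (- a) = (- a) \<bullet> z"
		using support_fun_attained[of B] assms by blast
	have "norm ((eps / norm a) *\<^sub>R (- a)) <= eps" using \<open>0 <= eps\<close> by (cases "a = 0") auto
	\<comment> \<open>The point of \<open>B + cball 0 eps\<close> that is lowest in direction
	  \<open>a\<close>; for \<open>a = 0\<close> the division by zero makes the second summand
	  vanish.\<close>
	hence "z + (eps / norm a) *\<^sub>R (- a) : B + cball 0 eps"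
		using z by (intro set_plus_intro) auto
	from ab(2)[OF this] have "b < a \<bullet> z - (eps / norm a) * (a \<bullet> a)"
		by (simp add: inner_add_right inner_diff_right)
	also have "(eps / norm a) * (a \<bullet> a) = eps * norm a"
		by (cases "a = 0") (auto simp: dot_square_norm power2_eq_square)
	finally show False using le[OF x(1), of "- a"] z(2) ab(1) by simp
qed

lemma centered_segment:
	fixes y :: "'a::euclidean_space"
	shows "zonotope (closed_segment (- y) y)" "centered_zonoid (closed_segment (- y) y)"
		"support_fun (closed_segment (- y) y) u = abs (u \<bullet> y)"
proof -
	show z: "zonotope (closed_segment (- y) y)"
		unfolding zonotope_def by (rule exI[of _ "[(- y, y)]"]) simp
	have "uminus ` closed_segment (- y) y = closed_segment (- y) y"
		using closed_segment_scaleR[of "-1" "- y" y] by (simp add: closed_segment_commute)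
	moreover have "hausdorff_close eps Z Z" if "0 < eps" for eps and Z :: "'a set"
	proof -
		have "Z \<subseteq> Z + cball 0 eps"
		proof
			fix x assume "x : Z"
			hence "x + 0 : Z + cball 0 eps" using that by (intro set_plus_intro) auto
			thus "x : Z + cball 0 eps" by simp
		qed
		thus ?thesis unfolding hausdorff_close_def by blast
	qed
	ultimately show "centered_zonoid (closed_segment (- y) y)"
		unfolding centered_zonoid_def using z by auto
	show "support_fun (closed_segment (- y) y) u = abs (u \<bullet> y)"
		unfolding support_fun_def
	proof (rule cSup_eq_maximum)
		show "\<bar>u \<bullet> y\<bar> : (\<bullet>) u ` closed_segment (- y) y"
			by (cases "0 <= u \<bullet> y") (auto intro!: image_eqI[of _ _ y] image_eqI[of _ _ "- y"])
		fix r assume "r : (\<bullet>) u ` closed_segment (- y) y"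
		then obtain t where t: "0 <= t" "t <= 1" "r = u \<bullet> ((1 - t) *\<^sub>R (- y) + t *\<^sub>R y)"
			by (auto simp: closed_segment_def)
		hence "r = (2 * t - 1) * (u \<bullet> y)" by (simp add: inner_add_right algebra_simps)
		hence "\<bar>r\<bar> = abs (2 * t - 1) * abs (u \<bullet> y)" by (simp add: abs_mult)
		also have "... <= 1 * abs (u \<bullet> y)" using t by (intro mult_right_mono) auto
		finally show "r <= abs (u \<bullet> y)" by simp
	qed
qed

text \<open>These are the zonotopes of random vectors with finitely many values: the segment between
  \<open>- (p y *\<^sub>R y)\<close> and \<open>p y *\<^sub>R y\<close> contributes one term, and
  Minkowski sums add support functions.\<close>

lemma zonotope_finite_sum:
	fixes p :: "'a::euclidean_space => real"
	assumes "finite F" "!!y. y : F ==> 0 <= p y"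
	obtains Z where "zonotope Z" "centered_zonoid Z" "!!u. support_fun Z u = (SUM y:F. p y * abs (u \<bullet> y))"
	using assms
proof (induction F arbitrary: thesis rule: finite_induct)
	case empty
	show ?case by (rule empty.prems(1)[OF zonotope_0 centered_zonoid_0]) (simp add: support_fun_def)
next
	case (insert y F)
	obtain Z where Z: "zonotope Z" "centered_zonoid Z" "!!u. support_fun Z u = (SUM y:F. p y * abs (u \<bullet> y))"
		using insert.IH insert.prems(2) by (metis insertCI)
	let ?S = "closed_segment (- (p y *\<^sub>R y)) (p y *\<^sub>R y)"
	show ?case
	proof (rule insert.prems(1))
		show "zonotope (?S + Z)" "centered_zonoid (?S + Z)"
			using centered_segment Z by (blast intro: zonotope_plus centered_zonoid_plus)+
		have "0 <= p y" using insert.prems(2) by blast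
		thus "support_fun (?S + Z) u = (SUM y:insert y F. p y * abs (u \<bullet> y))" for u
			using insert.hyps by (simp add: support_fun_plus centered_segment Z abs_mult)
	qed
qed

lemma integrable_abs_inner:
	fixes xi :: "'w => 'a::euclidean_space"
	shows "integrable M xi ==> integrable M (%om. abs (u \<bullet> xi om))"
	by (intro integrable_abs integrable_inner_right) auto

text \<open>All half-spaces in the definition of the body are active: the maximum in direction
  \<open>u\<close> is attained at half the mean of sgn(<u, xi>) xi. This identifies the support
  function and shows that the body is nonempty.\<close>

lemma random_zonoid_support_point:
	fixes xi :: "'w => 'a::euclidean_space"
	assumes "integrable M xi"
	shows "EX x : random_zonoid M xi. u \<bullet> x = 1/2 * (LINT om|M. abs (u \<bullet> xi om))"
proof -
	define s where "s om = sgn (u \<bullet> xi om)" for om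
	have meas: "xi : borel_measurable M" using assms by (rule borel_measurable_integrable)
	have s: "s : borel_measurable M" unfolding s_def using meas by measurable
	have "integrable M (%om. s om *\<^sub>R xi om)"
	proof (rule Bochner_Integration.integrable_bound[OF assms])
		show "AE x in M. norm (s x *\<^sub>R xi x) <= norm (xi x)" by (auto simp: s_def sgn_if)
	qed (use s meas in measurable)
	hence int: "v \<bullet> (LINT om|M. s om *\<^sub>R xi om) = (LINT om|M. s om * (v \<bullet> xi om))"
		"integrable M (%om. s om * (v \<bullet> xi om))" for v
		using integral_inner_right[of v M "%om. s om *\<^sub>R xi om"] integrable_inner_right[of v M "%om. s om *\<^sub>R xi om"] by auto
	let ?x = "(1/2) *\<^sub>R (LINT om|M. s om *\<^sub>R xi om)"
	have "v \<bullet> ?x <= 1/2 * (LINT om|M. abs (v \<bullet> xi om))" for v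
	proof -
		have "(LINT om|M. s om * (v \<bullet> xi om)) <= (LINT om|M. abs (v \<bullet> xi om))"
			by (rule integral_mono[OF int(2) integrable_abs_inner[OF assms]]) (auto simp: s_def sgn_if)
		thus ?thesis by (simp add: int(1))
	qed
	moreover have "u \<bullet> ?x = 1/2 * (LINT om|M. abs (u \<bullet> xi om))"
	proof -
		have "s om * (u \<bullet> xi om) = abs (u \<bullet> xi om)" for om by (simp add: s_def abs_sgn mult.commute)
		thus ?thesis by (simp add: int(1))
	qed
	ultimately show ?thesis unfolding random_zonoid_def by blast
qed

lemma compact_random_zonoid:
	fixes xi :: "'w => 'a::euclidean_space"
	shows "compact (random_zonoid M xi)"
proof -
	let ?h = "%u. 1/2 * (LINT om|M. abs (u \<bullet> xi om))"
	have eq: "random_zonoid M xi = (\<Inter>u. {x. u \<bullet> x <= ?h u})" by (auto simp: random_zonoid_def)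
	have "closed (random_zonoid M xi)" unfolding eq by (intro closed_INT ballI closed_halfspace_le)
	moreover have "bounded (random_zonoid M xi)"
	proof (unfold bounded_iff, intro exI ballI)
		fix x assume x: "x : random_zonoid M xi"
		have "\<bar>x \<bullet> b\<bar> <= ?h b" for b
		proof -
			have "b \<bullet> x <= ?h b" "(- b) \<bullet> x <= ?h (- b)" using x by (simp_all only: random_zonoid_def mem_Collect_eq)
			thus ?thesis by (simp add: inner_commute)
		qed
		hence "(SUM b:Basis. abs (x \<bullet> b)) <= (SUM b:Basis. ?h b)" by (intro sum_mono)
		thus "norm x <= (SUM b:Basis. ?h b)" using norm_le_l1[of x] by linarith
	qed
	ultimately show ?thesis by (simp add: compact_eq_bounded_closed)
qed

lemma support_fun_random_zonoid:
	fixes xi :: "'w => 'a::euclidean_space"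
	assumes "integrable M xi"
	shows "support_fun (random_zonoid M xi) u = 1/2 * (LINT om|M. abs (u \<bullet> xi om))"
	unfolding support_fun_def using random_zonoid_support_point[OF assms, of u]
	by (intro cSup_eq_maximum) (auto simp: image_iff random_zonoid_def)

lemma convex_random_zonoid: "convex (random_zonoid M (xi :: 'w => 'a::euclidean_space))"
proof -
	have eq: "random_zonoid M xi = (\<Inter>u. {x. u \<bullet> x <= 1/2 * (LINT om|M. abs (u \<bullet> xi om))})"
		by (auto simp: random_zonoid_def)
	show ?thesis unfolding eq by (intro convex_INT convex_halfspace_le)
qed

lemma simple_approximation_L1:
	fixes xi :: "'w => 'a::euclidean_space"
	assumes "integrable M xi" "0 < e"
	obtains s where "simple_function M s" "integrable M s" "(LINT om|M. norm (xi om - s om)) < e"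
proof -
	obtain i where "has_bochner_integral M xi i" using assms(1) by (auto simp: integrable.simps)
	then obtain s where s: "!!i. Bochner_Integration.simple_bochner_integrable M (s i)"
		and lim: "(%i. \<integral>\<^sup>+ x. ennreal (norm (xi x - s i x)) \<partial>M) \<longlonglongrightarrow> 0"
		unfolding has_bochner_integral.simps by blast
	have "eventually (%i. (\<integral>\<^sup>+ x. ennreal (norm (xi x - s i x)) \<partial>M) < ennreal e) sequentially"
		using lim assms(2) by (intro order_tendstoD(2)) auto
	then obtain k where k: "(\<integral>\<^sup>+ x. ennreal (norm (xi x - s k x)) \<partial>M) < ennreal e"
		by (auto simp: eventually_sequentially)
	have sk: "integrable M (s k)"
		using has_bochner_integral_simple_bochner_integrable[OF s] by (auto simp: integrable.simps)
	have "ennreal (LINT om|M. norm (xi om - s k om)) = (\<integral>\<^sup>+ x. ennreal (norm (xi x - s k x)) \<partial>M)"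
		using assms(1) sk by (intro nn_integral_eq_integral[symmetric]) auto
	with k have "(LINT om|M. norm (xi om - s k om)) < e"
		by (metis ennreal_less_iff integral_nonneg_AE AE_I2 norm_ge_zero)
	moreover have "simple_function M (s k)" using s[of k] by (auto simp: simple_bochner_integrable.simps)
	ultimately show ?thesis using sk that by blast
qed

lemma abs_inner_integral_diff:
	fixes xi ze :: "'w => 'a::euclidean_space"
	assumes "integrable M xi" "integrable M ze"
	shows "(LINT om|M. abs (u \<bullet> xi om)) <= (LINT om|M. abs (u \<bullet> ze om)) + norm u * (LINT om|M. norm (xi om - ze om))"
proof -
	have "(LINT om|M. abs (u \<bullet> xi om)) <= (LINT om|M. abs (u \<bullet> ze om) + norm u * norm (xi om - ze om))"
	proof (rule integral_mono)
		fix om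
		have "\<bar>u \<bullet> (xi om - ze om)\<bar> <= norm u * norm (xi om - ze om)" by (rule Cauchy_Schwarz_ineq2)
		thus "\<bar>u \<bullet> xi om\<bar> <= abs (u \<bullet> ze om) + norm u * norm (xi om - ze om)" by (simp add: inner_diff_right)
	qed (use assms in \<open>auto intro!: integrable_abs_inner Bochner_Integration.integrable_add integrable_norm\<close>)
	also have "... = (LINT om|M. abs (u \<bullet> ze om)) + norm u * (LINT om|M. norm (xi om - ze om))"
		using assms by (subst Bochner_Integration.integral_add) (auto intro!: integrable_abs_inner)
	finally show ?thesis .
qed

text \<open>By \<open>abs_inner_integral_diff\<close>, replacing \<open>xi\<close> by a simple
  function \<open>s\<close> moves the support function by at most half the L1 distance times
  \<open>norm u\<close>. The body of \<open>s\<close> is a zonotope, so zonotopes come arbitrarily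
  close.\<close>

lemma centered_zonoid_random_zonoid:
	fixes xi :: "'w => 'a::euclidean_space"
	assumes int: "integrable M xi"
	shows "centered_zonoid (random_zonoid M xi)"
	unfolding centered_zonoid_def
proof (intro conjI allI impI)
	let ?K = "random_zonoid M xi"
	show cK: "compact ?K" by (rule compact_random_zonoid)
	show neK: "?K ~= {}" using random_zonoid_support_point[OF int, of 0] by blast
	have "- x : ?K" if "x : ?K" for x
		using that unfolding random_zonoid_def
	proof (safe)
		fix u assume "ALL u. u \<bullet> x <= 1 / 2 * (LINT om|M. abs (u \<bullet> xi om))"
		hence "(- u) \<bullet> x <= 1 / 2 * (LINT om|M. abs ((- u) \<bullet> xi om))" by blast
		thus "u \<bullet> - x <= 1 / 2 * (LINT om|M. abs (u \<bullet> xi om))" by simp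
	qed
	thus "uminus ` ?K = ?K" by (force simp: image_iff)
	fix e :: real assume e: "0 < e"
	obtain s where s: "simple_function M s" "integrable M s" "(LINT om|M. norm (xi om - s om)) < e"
		using simple_approximation_L1[OF int e] by blast
	\<comment> \<open>Half the probability of each value, to match the factor 1/2 in the support
	  function.\<close>
	define p where "p y = 1/2 * measure M {om : space M. s om = y}" for y
	have fin: "finite (s ` space M)" using s(1) by (simp add: simple_function_def)
	obtain Z where Z: "zonotope Z" "centered_zonoid Z"
		"!!u. support_fun Z u = (SUM y:s ` space M. p y * abs (u \<bullet> y))"
		using zonotope_finite_sum[OF fin, of p] by (auto simp: p_def)
	have hs: "1/2 * (LINT om|M. abs (u \<bullet> s om)) = support_fun Z u" for u
	proof -
		have sb: "Bochner_Integration.simple_bochner_integrable M s"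
			using s(1,2) by (simp add: integrable_iff_bounded simple_bochner_integrableI_bounded)
		have "simple_function M (%om. abs (u \<bullet> s om))" using simple_function_compose2[OF s(1,1), of "%a _. abs (u \<bullet> a)"] by simp
		have sb2: "Bochner_Integration.simple_bochner_integrable M (%om. abs (u \<bullet> s om))"
			by (intro simple_bochner_integrable_compose2[OF _ sb sb, of "%a _. abs (u \<bullet> a)", simplified])
		have "(LINT om|M. abs (u \<bullet> s om)) = Bochner_Integration.simple_bochner_integral M (%om. abs (u \<bullet> s om))"
			using has_bochner_integral_simple_bochner_integrable[OF sb2] by (rule has_bochner_integral_integral_eq)
		also have "... = (SUM y:s ` space M. measure M {om : space M. s om = y} *\<^sub>R \<bar>u \<bullet> y\<bar>)"
			by (rule simple_bochner_integral_partition[OF sb2 s(1)]) auto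
		finally show ?thesis
			unfolding Z(3) p_def sum_distrib_left by (simp add: sum_divide_distrib)
	qed
	have cZ: "compact Z" "convex Z" "Z ~= {}" using Z(2) centered_zonoid_convex by (auto simp: centered_zonoid_def)
	have e': "norm u * (LINT om|M. norm (xi om - s om)) <= 2 * (e * norm u)" for u
	proof -
		have "norm u * (LINT om|M. norm (xi om - s om)) <= norm u * e" using s(3) by (intro mult_left_mono) auto
		moreover have "0 <= e * norm u" using e by simp
		ultimately show ?thesis by (simp add: mult.commute)
	qed
	have "?K \<subseteq> Z + cball 0 e"
	proof (rule subset_plus_cballI[OF cZ less_imp_le[OF e]])
		fix u x assume "x : ?K"
		hence "u \<bullet> x <= 1/2 * (LINT om|M. abs (u \<bullet> xi om))" by (simp add: random_zonoid_def)
		with abs_inner_integral_diff[OF int s(2), of u] hs[of u] e'[of u]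
		show "u \<bullet> x <= support_fun Z u + e * norm u" by simp
	qed
	moreover have "Z \<subseteq> ?K + cball 0 e"
	proof (rule subset_plus_cballI[OF cK convex_random_zonoid neK less_imp_le[OF e]])
		fix u x assume "x : Z"
		hence "u \<bullet> x <= support_fun Z u" using cZ support_fun_upper by blast
		with abs_inner_integral_diff[OF s(2) int, of u] hs[of u] e'[of u] support_fun_random_zonoid[OF int, of u]
		show "u \<bullet> x <= support_fun ?K u + e * norm u" by (simp add: norm_minus_commute)
	qed
	ultimately show "EX Z. zonotope Z & hausdorff_close e ?K Z"
		using Z(1) unfolding hausdorff_close_def by blast
qed

section \<open>Support functions of virtual zonoids\<close>

lemma vz_support_abs:
	assumes "centered_zonoid K" "centered_zonoid L"
	shows "vz_support (abs_vzonoid (K, L)) u = support_fun K u - support_fun L u"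
proof -
	have "vz_rel (K, L) (K, L)" using assms by (simp add: vz_rel_iff)
	hence "vz_support (abs_vzonoid (K, L)) = (%u. support_fun K u - support_fun L u)"
		by (simp add: vz_support.abs_eq)
	thus ?thesis by simp
qed

lemma support_fun_0 [simp]: "support_fun {0} u = 0"
	by (simp add: support_fun_def)

lemma vz_support_zero [simp]: "vz_support 0 u = 0"
	by transfer simp

lemma vz_support_plus [simp]: "vz_support (A + B) u = vz_support A u + vz_support B u"
	by transfer (auto simp: vz_rel_iff support_fun_plus)

lemma vz_support_uminus [simp]: "vz_support (- A) u = - vz_support A u"
	by transfer auto

lemma vz_support_scaleR [simp]: "vz_support (r *\<^sub>R A) u = r * vz_support A u"
	by transfer (auto simp: vz_rel_iff support_fun_scaleR algebra_simps)

lemma vz_support_sum: "vz_support (SUM i:I. f i) u = (SUM i:I. vz_support (f i) u)"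
	by (induction I rule: infinite_finite_induct) auto

lemma vz_support_vz:
	fixes xi :: "'w => 'a::euclidean_space"
	assumes "integrable M xi"
	shows "vz_support (vz M xi) u = 1/2 * (LINT om|M. abs (u \<bullet> xi om))"
	unfolding vz_def
	by (simp add: vz_support_abs centered_zonoid_random_zonoid[OF assms] centered_zonoid_0
			support_fun_random_zonoid[OF assms])

lemma vz_eqI:
	fixes xi :: "'w => 'a::euclidean_space" and ze :: "'v => 'a"
	assumes "!!u. (LINT om|M. abs (u \<bullet> xi om)) = (LINT om|N. abs (u \<bullet> ze om))"
	shows "vz M xi = vz N ze"
	using assms by (simp add: vz_def random_zonoid_def)

lemma vz_distr:
	fixes xi :: "'w => 'a::euclidean_space"
	assumes "xi : borel_measurable M"
	shows "vz (distr M borel xi) (%x. x) = vz M xi"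
	using assms by (intro vz_eqI) (simp add: integral_distr)

lemma integrable_law_distr:
	fixes xi :: "'w => 'a::euclidean_space"
	assumes "prob_space M" "integrable M xi"
	shows "integrable_law (distr M borel xi)"
proof -
	have m: "xi : borel_measurable M" using assms by auto
	show ?thesis unfolding integrable_law_def
		using prob_space.prob_space_distr[OF assms(1) m] assms(2) by (simp add: integrable_distr_eq[OF m])
qed

section \<open>Extension by linearity and the pairing\<close>

lemma integrable_pair_bound:
	fixes f :: "'b \<times> 'c => 'd::{banach, second_countable_topology}"
	assumes "prob_space M" "prob_space N"
		and f: "f : borel_measurable (M \<Otimes>\<^sub>M N)"
		and a: "integrable M a" and b: "integrable N b"
		and bnd: "!!x y. x : space M ==> y : space N ==> norm (f (x, y)) <= a x * b y"
	shows "integrable (M \<Otimes>\<^sub>M N) f"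
proof -
	interpret M: prob_space M by fact
	interpret N: prob_space N by fact
	interpret pair_sigma_finite M N ..
	have g: "integrable (M \<Otimes>\<^sub>M N) (%(x, y). a x * b y)"
	proof (rule Fubini_integrable)
		have [measurable]: "a : borel_measurable M" "b : borel_measurable N" using a b by auto
		show "(%(x, y). a x * b y) : borel_measurable (M \<Otimes>\<^sub>M N)" by measurable
		show "integrable M (%x. \<integral>y. norm (case (x, y) of (x, y) => a x * b y) \<partial>N)"
			using a by (simp add: abs_mult)
		show "AE x in M. integrable N (%y. case (x, y) of (x, y) => a x * b y)" using b by simp
	qed
	show ?thesis
		by (rule Bochner_Integration.integrable_bound[OF g f])
			(use bnd in \<open>auto simp: space_pair_measure intro!: AE_I2 order_trans[OF _ abs_ge_self]\<close>)
qed

text \<open>The family is indexed by laws and not by zonoids, since different laws may have the same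
  zonoid; respecting every linear relation covers this ambiguity too. A basis is chosen among the
  \<open>k i\<close>, and the remaining values follow from the relation that expands
  \<open>k i\<close> in the basis.\<close>

lemma linear_extension:
	fixes k :: "'i => 'v::real_vector" and g :: "'i => 'w::real_vector"
	assumes compat: "!!t c. finite t ==> t \<subseteq> I ==> (SUM i:t. c i *\<^sub>R k i) = 0 ==> (SUM i:t. c i *\<^sub>R g i) = 0"
	obtains f where "linear f" "!!i. i : I ==> f (k i) = g i"
proof -
	obtain B where B: "B \<subseteq> k ` I" "independent B" "k ` I \<subseteq> span B"
		using maximal_independent_subset[of "k ` I"] by blast
	define r where "r b = (SOME i. i : I & k i = b)" for b
	have r: "r b : I" "k (r b) = b" if "b : B" for b
		using someI_ex[of "%i. i : I & k i = b"] B(1) that unfolding r_def by blast+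
	define f where "f = construct B (%b. g (r b))"
	have lin: "linear f" unfolding f_def by (rule linear_construct[OF B(2)])
	have fb: "f b = g (r b)" if "b : B" for b unfolding f_def by (rule construct_basis[OF B(2) that])
	have "f (k i) = g i" if i: "i : I" for i
	proof -
		have "k i : span B" using B(3) i by blast
		then obtain t c where t: "finite t" "t \<subseteq> B" "k i = (SUM b:t. c b *\<^sub>R b)"
			unfolding span_explicit by blast
		have inj: "inj_on r t" using r(2) t(2) by (metis inj_onI subsetD)
		have f1: "f (k i) = (SUM b:t. c b *\<^sub>R g (r b))"
			using t(2) fb by (simp add: t(3) linear_sum[OF lin] linear_scale[OF lin] subset_iff)
		\<comment> \<open>The relation between \<open>k i\<close> and its expansion, with coefficients
		  collected by index, so that it stays correct when \<open>i\<close> is itself one of the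
		  representatives \<open>r b\<close>.\<close>
		define d where "d j = (SUM b:t. if r b = j then c b else 0) - (if j = i then 1 else 0)" for j
		have dsum: "(SUM j:insert i (r ` t). d j *\<^sub>R h j) = (SUM b:t. c b *\<^sub>R h (r b)) - h i"
			for h :: "'i => 'z::real_vector"
		proof -
			have fin: "finite (insert i (r ` t))" using t(1) by simp
			have "(SUM j:insert i (r ` t). d j *\<^sub>R h j) =
					(SUM j:insert i (r ` t). SUM b:t. (if r b = j then c b *\<^sub>R h (r b) else 0)) -
					(SUM j:insert i (r ` t). if j = i then h j else 0)"
			proof -
				have "d j *\<^sub>R h j = (SUM b:t. (if r b = j then c b *\<^sub>R h (r b) else 0)) - (if j = i then h j else 0)" for j
					unfolding d_def scaleR_diff_left scaleR_sum_left by (auto intro!: sum.cong)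
				thus ?thesis by (simp add: sum_subtractf)
			qed
			also have "(SUM j:insert i (r ` t). SUM b:t. (if r b = j then c b *\<^sub>R h (r b) else 0)) = (SUM b:t. c b *\<^sub>R h (r b))"
				using fin by (subst sum.swap) (auto intro!: sum.cong)
			also have "(SUM j:insert i (r ` t). if j = i then h j else 0) = h i" using fin by simp
			finally show ?thesis .
		qed
		have "(SUM j:insert i (r ` t). d j *\<^sub>R k j) = 0"
			unfolding dsum using r(2) t(2,3) by (simp add: subset_iff)
		moreover have "insert i (r ` t) \<subseteq> I" using r(1) t(2) i by auto
		ultimately have "(SUM j:insert i (r ` t). d j *\<^sub>R g j) = 0" using t(1) by (intro compat) auto
		thus ?thesis unfolding dsum f1 by simp
	qed
	with lin show ?thesis by (rule that)
qed

text \<open>Relations in the first argument give a linear map \<open>L j\<close> for each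
  \<open>j\<close>. Extending from basis representatives in the second argument yields a bilinear
  map, and relations in the second argument show that it takes the prescribed value at every
  pair.\<close>

lemma bilinear_extension:
	fixes k :: "'i => 'v::real_vector" and T :: "'i => 'i => 'w::real_vector"
	assumes c1: "!!t c j. finite t ==> t \<subseteq> I ==> j : I ==> (SUM i:t. c i *\<^sub>R k i) = 0 ==> (SUM i:t. c i *\<^sub>R T i j) = 0"
		and c2: "!!t c j. finite t ==> t \<subseteq> I ==> j : I ==> (SUM i:t. c i *\<^sub>R k i) = 0 ==> (SUM i:t. c i *\<^sub>R T j i) = 0"
	obtains f where "bilinear f" "!!i j. i : I ==> j : I ==> f (k i) (k j) = T i j"
proof -
	obtain B where B: "B \<subseteq> k ` I" "independent B" "k ` I \<subseteq> span B"
		using maximal_independent_subset[of "k ` I"] by blast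
	have "EX L. linear L & (ALL i:I. L (k i) = T i j)" if "j : I" for j
		using linear_extension[of I k "%i. T i j"] c1 that by metis
	then obtain L where L: "!!j. j : I ==> linear (L j)" "!!i j. i : I ==> j : I ==> L j (k i) = T i j"
		by metis
	define r where "r b = (SOME i. i : I & k i = b)" for b
	have r: "r b : I" "k (r b) = b" if "b : B" for b
		using someI_ex[of "%i. i : I & k i = b"] B(1) that unfolding r_def by blast+
	define f where "f x y = construct B (%b. L (r b) x) y" for x y
	have lin2: "linear (f x)" for x unfolding f_def by (rule linear_construct[OF B(2)])
	have lin1: "linear (%x. f x y)" for y
	proof (rule linearI)
		show "f (x + x') y = f x y + f x' y" for x x'
			unfolding f_def construct_add[OF B(2), symmetric]
			by (rule fun_cong[OF construct_cong]) (simp add: linear_add[OF L(1)] r)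
		show "f (c *\<^sub>R x) y = c *\<^sub>R f x y" for c x
			unfolding f_def construct_scale[OF B(2), symmetric]
			by (rule fun_cong[OF construct_cong]) (simp add: linear_scale[OF L(1)] r)
	qed
	have "f (k i) (k j) = T i j" if ij: "i : I" "j : I" for i j
	proof -
		obtain g where g: "linear g" "!!j. j : I ==> g (k j) = T i j"
			using linear_extension[of I k "T i"] c2 ij by metis
		have "f (k i) b = g b" if "b : B" for b
		proof -
			have "f (k i) b = L (r b) (k i)" unfolding f_def by (rule construct_basis[OF B(2) that])
			also have "... = T i (r b)" using L(2) r that ij by blast
			also have "... = g b" using g(2)[of "r b"] r[OF that] by simp
			finally show ?thesis .
		qed
		hence "f (k i) (k j) = g (k j)"
			using linear_eq_on_span[OF lin2 g(1), of B] B(3) ij by blast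
		thus ?thesis using g(2) ij by simp
	qed
	moreover have "bilinear f" unfolding bilinear_def using lin1 lin2 by blast
	ultimately show ?thesis using that by blast
qed

lemma integrable_law_prob: "integrable_law mu ==> prob_space mu"
	and integrable_law_sets: "integrable_law mu ==> sets mu = sets borel"
	and integrable_law_integrable: "integrable_law mu ==> integrable mu (%x. x)"
	by (auto simp: integrable_law_def)

lemma integrable_law_support:
	"integrable_law mu ==> vz_support (vz mu (%x. x)) u = 1/2 * (LINT x|mu. abs (u \<bullet> x))"
	by (intro vz_support_vz integrable_law_integrable)

text \<open>A relation between zonoids becomes an identity between functions of \<open>u\<close>,
  which may be evaluated at transported vectors and integrated. This is how the compatibility
  conditions of the extension lemmas are met.\<close>

lemma integrable_law_relation:
	fixes c :: "'a::euclidean_space measure => real"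
	assumes "t \<subseteq> {mu. integrable_law mu}" "(SUM mu:t. c mu *\<^sub>R vz mu (%x. x)) = 0"
	shows "(SUM mu:t. c mu * (LINT x|mu. abs (u \<bullet> x))) = 0"
proof -
	have "0 = vz_support (SUM mu:t. c mu *\<^sub>R vz mu (%x. x)) u" using assms(2) by simp
	also have "... = (SUM mu:t. c mu * (1/2 * (LINT x|mu. abs (u \<bullet> x))))"
		unfolding vz_support_sum vz_support_scaleR
		by (intro sum.cong refl) (use assms(1) in \<open>auto simp: integrable_law_support\<close>)
	also have "... = 1/2 * (SUM mu:t. c mu * (LINT x|mu. abs (u \<bullet> x)))"
		by (simp add: sum_distrib_left mult_ac)
	finally show ?thesis by simp
qed

lemma measurable_law_pair:
	assumes "integrable_law mu" "integrable_law nu" "f : borel_measurable (borel \<Otimes>\<^sub>M borel)"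
	shows "f : borel_measurable (mu \<Otimes>\<^sub>M nu)"
	using assms(3) by (subst measurable_cong_sets[OF sets_pair_measure_cong[OF integrable_law_sets[OF assms(1)]
		integrable_law_sets[OF assms(2)]] refl])

lemma integrable_law_pair:
	fixes f :: "'a::euclidean_space \<times> 'b::euclidean_space => 'c::euclidean_space"
	assumes "integrable_law mu" "integrable_law nu" "f : borel_measurable (borel \<Otimes>\<^sub>M borel)"
		and "!!x y. norm (f (x, y)) <= C * norm x * norm y"
	shows "integrable (mu \<Otimes>\<^sub>M nu) f"
	by (rule integrable_pair_bound[where a="%x. C * norm x" and b=norm])
		(use assms in \<open>auto intro!: measurable_law_pair integrable_law_prob integrable_norm integrable_law_integrable\<close>)

lemma integral_law_pair:
	fixes f :: "'a::euclidean_space \<times> 'b::euclidean_space => 'c::euclidean_space"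
	assumes "integrable_law mu" "integrable_law nu" "f : borel_measurable (borel \<Otimes>\<^sub>M borel)"
		and "!!x y. norm (f (x, y)) <= C * norm x * norm y"
	shows "(LINT z|(mu \<Otimes>\<^sub>M nu). f z) = (LINT x|mu. \<integral>y. f (x, y) \<partial>nu)"
		"(LINT z|(mu \<Otimes>\<^sub>M nu). f z) = (LINT y|nu. \<integral>x. f (x, y) \<partial>mu)"
		"integrable mu (%x. \<integral>y. f (x, y) \<partial>nu)" "integrable nu (%y. \<integral>x. f (x, y) \<partial>mu)"
proof -
	interpret M: prob_space mu by (rule integrable_law_prob[OF assms(1)])
	interpret N: prob_space nu by (rule integrable_law_prob[OF assms(2)])
	interpret P: pair_sigma_finite mu nu ..
	have i: "integrable (mu \<Otimes>\<^sub>M nu) f" by (rule integrable_law_pair[OF assms])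
	hence i': "integrable (mu \<Otimes>\<^sub>M nu) (case_prod (%x y. f (x, y)))" by simp
	show "(LINT z|(mu \<Otimes>\<^sub>M nu). f z) = (LINT x|mu. \<integral>y. f (x, y) \<partial>nu)" by (rule P.integral_fst'[OF i, symmetric])
	show "(LINT z|(mu \<Otimes>\<^sub>M nu). f z) = (LINT y|nu. \<integral>x. f (x, y) \<partial>mu)" using P.integral_snd[OF i'] by simp
	show "integrable mu (%x. \<integral>y. f (x, y) \<partial>nu)" by (rule P.integrable_fst'[OF i])
	show "integrable nu (%y. \<integral>x. f (x, y) \<partial>mu)" by (rule P.integrable_snd[OF i'])
qed

text \<open>By Fubini the prescribed value is the integral, over one law, of twice the support
  function of the other zonoid; so it respects linear relations in either argument.\<close>

lemma vz_pairing_exists: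
	"EX f. bilinear f & (ALL mu nu. integrable_law mu --> integrable_law nu -->
			f (vz mu (%x. x)) (vz nu (%y. y)) = (LINT (x, y)|(mu \<Otimes>\<^sub>M (nu :: 'a::euclidean_space measure)). \<bar>x \<bullet> y\<bar>))"
proof -
	have eq: "(LINT (x, y)|(mu \<Otimes>\<^sub>M nu). abs (x \<bullet> y)) = (LINT y|nu. \<integral>x. abs (y \<bullet> x) \<partial>mu)"
		"(LINT (x, y)|(mu \<Otimes>\<^sub>M nu). abs (x \<bullet> y)) = (LINT x|mu. \<integral>y. abs (x \<bullet> y) \<partial>nu)"
		"integrable nu (%y. \<integral>x. abs (y \<bullet> x) \<partial>mu)" "integrable mu (%x. \<integral>y. abs (x \<bullet> y) \<partial>nu)"
		if l: "integrable_law mu" "integrable_law nu" for mu nu :: "'a measure"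
		using integral_law_pair[OF l, of "%(x, y). abs (x \<bullet> y)" 1] by (auto simp: Cauchy_Schwarz_ineq2 inner_commute)
	have c1: "(SUM mu:t. c mu *\<^sub>R (LINT (x, y)|(mu \<Otimes>\<^sub>M nu). abs (x \<bullet> y))) = 0"
		if "t \<subseteq> {mu. integrable_law mu}" "nu : {mu. integrable_law mu}"
			"(SUM mu:t. c mu *\<^sub>R vz mu (%x. x)) = 0" for t c and nu :: "'a measure"
	proof -
		have "(SUM mu:t. c mu *\<^sub>R (LINT (x, y)|(mu \<Otimes>\<^sub>M nu). abs (x \<bullet> y))) = (SUM mu:t. \<integral>y. c mu * (LINT x|mu. abs (y \<bullet> x)) \<partial>nu)"
			using that by (intro sum.cong) (auto simp: eq(1))
		also have "... = (LINT y|nu. (SUM mu:t. c mu * (LINT x|mu. abs (y \<bullet> x))))"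
			using that by (intro Bochner_Integration.integral_sum[symmetric] integrable_mult_right eq(3)) auto
		also have "... = 0" using integrable_law_relation[OF that(1,3)] by simp
		finally show ?thesis .
	qed
	have c2: "(SUM mu:t. c mu *\<^sub>R (LINT (x, y)|(nu \<Otimes>\<^sub>M mu). abs (x \<bullet> y))) = 0"
		if "t \<subseteq> {mu. integrable_law mu}" "nu : {mu. integrable_law mu}"
			"(SUM mu:t. c mu *\<^sub>R vz mu (%x. x)) = 0" for t c and nu :: "'a measure"
	proof -
		have "(LINT (x, y)|(nu \<Otimes>\<^sub>M mu). abs (x \<bullet> y)) = (LINT (x, y)|(mu \<Otimes>\<^sub>M nu). abs (x \<bullet> y))" if "mu : t" for mu
			using \<open>t \<subseteq> _\<close> \<open>nu : _\<close> that by (subst eq(1), simp, blast, subst eq(2)) (auto simp: inner_commute)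
		thus ?thesis using c1[OF that] by simp
	qed
	obtain f where "bilinear f" "!!mu nu. mu : {mu. integrable_law mu} ==> nu : {mu. integrable_law mu} ==>
			f (vz mu (%x. x)) (vz nu (%x. x)) = (LINT (x, y)|(mu \<Otimes>\<^sub>M (nu :: 'a measure)). \<bar>x \<bullet> y\<bar>)"
		using bilinear_extension[of "{mu. integrable_law mu}" "%mu. vz mu (%x. x)"
			"%mu nu. \<integral>(x, y). abs (x \<bullet> y) \<partial>(mu \<Otimes>\<^sub>M (nu :: 'a measure))"] c1 c2 by blast
	thus ?thesis by blast
qed

lemma bilinear_vz_pairing: "bilinear vz_pairing"
	and vz_pairing_law: "integrable_law mu ==> integrable_law nu ==>
		vz_pairing (vz mu (%x. x)) (vz nu (%y. y)) = (LINT (x, y)|(mu \<Otimes>\<^sub>M nu). \<bar>x \<bullet> y\<bar>)"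
	using someI_ex[OF vz_pairing_exists] unfolding vz_pairing_def[symmetric] by blast+

lemma vz_pairing_support:
	assumes "integrable_law mu" "integrable_law nu"
	shows "vz_pairing (vz mu (%x. x)) (vz nu (%y. y)) = 2 * (LINT y|nu. vz_support (vz mu (%x. x)) y)"
		"integrable nu (%y. vz_support (vz mu (%x. x)) y)"
proof -
	have *: "(LINT (x, y)|(mu \<Otimes>\<^sub>M nu). abs (x \<bullet> y)) = (LINT y|nu. \<integral>x. abs (y \<bullet> x) \<partial>mu)" "integrable nu (%y. \<integral>x. abs (y \<bullet> x) \<partial>mu)"
		using integral_law_pair[OF assms, of "%(x, y). abs (x \<bullet> y)" 1] by (auto simp: Cauchy_Schwarz_ineq2 inner_commute)
	thus "vz_pairing (vz mu (%x. x)) (vz nu (%y. y)) = 2 * (LINT y|nu. vz_support (vz mu (%x. x)) y)"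
		"integrable nu (%y. vz_support (vz mu (%x. x)) y)"
		using assms by (simp_all add: vz_pairing_law integrable_law_support)
qed

text \<open>An element of the span is a formal difference and has no law of its own, but pairing it
  with a law is still twice the integral of its support function.\<close>

lemma vz_pairing_span_support:
	assumes "A : span {vz mu (%x. x) | mu. integrable_law mu}" "integrable_law nu"
	shows "vz_pairing A (vz nu (%y. y)) = 2 * (LINT y|nu. vz_support A y) & integrable nu (%y. vz_support A y)"
	using assms(1)
proof (induction rule: span_induct_alt)
	case base
	thus ?case using bilinear_lzero[OF bilinear_vz_pairing] by simp
next
	case (step c x y)
	thus ?case
		using vz_pairing_support[OF _ assms(2)]
		by (auto simp: bilinear_ladd[OF bilinear_vz_pairing] bilinear_lmul[OF bilinear_vz_pairing])
qed

section \<open>Linear images\<close>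

lemma linear_vz_supportI:
	fixes T :: "'a::euclidean_space => 'b::euclidean_space"
	assumes T: "linear T" and K: "compact K" "K ~= {}"
	shows "support_fun (T ` K) u = support_fun K (adjoint T u)"
	unfolding support_fun_def image_image by (simp add: adjoint_works[OF T] inner_commute)

lemma centered_zonoid_linear_image:
	fixes T :: "'a::euclidean_space => 'b::euclidean_space"
	assumes T: "linear T" and K: "centered_zonoid K"
	shows "centered_zonoid (T ` K)"
	unfolding centered_zonoid_def
proof (intro conjI allI impI)
	have plus: "T ` (A + B) = T ` A + T ` B" for A B
		by (force simp: set_plus_def image_iff linear_add[OF T])
	show "compact (T ` K)" using K T
		by (intro compact_continuous_image linear_continuous_on_compose[OF continuous_on_id]) (auto simp: centered_zonoid_def)
	show "T ` K ~= {}" using K by (auto simp: centered_zonoid_def)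
	have "uminus ` T ` K = T ` (uminus ` K)" by (simp add: image_image linear_neg[OF T])
	thus "uminus ` T ` K = T ` K" using K by (simp add: centered_zonoid_def)
	fix e :: real assume e: "0 < e"
	obtain C where C: "0 < C" "!!x. norm (T x) <= C * norm x"
		using linear_bounded_pos[OF T] by blast
	obtain Z where Z: "zonotope Z" "hausdorff_close (e / C) K Z"
		using K e C(1) unfolding centered_zonoid_def by (meson divide_pos_pos)
	have zT: "zonotope (T ` Z)"
	proof -
		obtain xs where xs: "Z = sum_list (map (%(a, b). closed_segment a b) xs)"
			using Z(1) unfolding zonotope_def by blast
		have "T ` sum_list (map (%(a, b). closed_segment a b) xs) =
				sum_list (map (%(a, b). closed_segment a b) (map (%(a, b). (T a, T b)) xs))"
			by (induction xs) (auto simp: plus closed_segment_linear_image[OF T] linear_0[OF T])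
		thus ?thesis unfolding zonotope_def xs by blast
	qed
	have "T ` A \<subseteq> T ` B + cball 0 e" if "A \<subseteq> B + cball 0 (e / C)" for A B
	proof -
		have "T ` A \<subseteq> T ` B + T ` cball 0 (e / C)" using that plus by (metis image_mono)
		also have "T ` cball 0 (e / C) \<subseteq> cball 0 e"
		proof
			fix y assume "y : T ` cball 0 (e / C)"
			then obtain x where "y = T x" "norm x <= e / C" by auto
			thus "y : cball 0 e" using C(2)[of x] C(1) by (simp add: field_simps)
		qed
		hence "T ` B + T ` cball 0 (e / C) \<subseteq> T ` B + cball 0 e" by (intro set_plus_mono2) auto
		finally show ?thesis .
	qed
	hence "hausdorff_close e (T ` K) (T ` Z)" using Z(2) unfolding hausdorff_close_def by blast
	with zT show "EX Z. zonotope Z & hausdorff_close e (T ` K) Z" by blast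
qed

text \<open>Taking images precomposes the support function with the adjoint. In particular the
  result does not depend on the pair that \<open>rep_vzonoid\<close> picks.\<close>

lemma vz_support_vz_map:
	fixes T :: "'a::euclidean_space => 'b::euclidean_space"
	assumes T: "linear T"
	shows "vz_support (vz_map T A) u = vz_support A (adjoint T u)"
proof -
	obtain K L where r: "rep_vzonoid A = (K, L)" by fastforce
	have "vz_rel (K, L) (K, L)" using Quotient3_rep_reflp[OF Quotient3_vzonoid, of A] by (simp add: r)
	hence KL: "centered_zonoid K" "centered_zonoid L" by (auto simp: vz_rel_iff)
	have A: "A = abs_vzonoid (K, L)" using Quotient3_abs_rep[OF Quotient3_vzonoid, of A] by (simp add: r)
	have c: "compact K" "K ~= {}" "compact L" "L ~= {}" using KL by (auto simp: centered_zonoid_def)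
	have "vz_support A (adjoint T u) = support_fun K (adjoint T u) - support_fun L (adjoint T u)"
		unfolding A by (rule vz_support_abs[OF KL])
	thus ?thesis
		by (simp add: vz_map_def r vz_support_abs centered_zonoid_linear_image T KL linear_vz_supportI c)
qed

lemma linear_vz_map: "linear T ==> linear (vz_map T)"
	by (rule linearI; rule vz_support_eqI) (simp_all add: vz_support_vz_map)

lemma vz_map_vz:
	fixes T :: "'a::euclidean_space => 'b::euclidean_space"
	assumes T: "linear T" and i: "integrable M xi"
	shows "vz_map T (vz M xi) = vz M (%om. T (xi om))"
proof (rule vz_support_eqI)
	have "integrable M (%om. T (xi om))"
		using integrable_bounded_linear[OF linear_conv_bounded_linear[THEN iffD1, OF T] i] .
	thus "vz_support (vz_map T (vz M xi)) u = vz_support (vz M (%om. T (xi om))) u" for u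
		by (simp add: vz_support_vz_map T vz_support_vz i adjoint_works[OF T] adjoint_clauses(2)[OF T])
qed

section \<open>Rotation invariant laws and the length\<close>

typedef (overloaded) 'a eidx = "{..<DIM('a::euclidean_space)}"
	by (rule exI[of _ 0]) (simp add: DIM_positive)

instantiation eidx :: (euclidean_space) wellorder
begin

definition less_eq_eidx :: "'a eidx => 'a eidx => bool"
	where "less_eq_eidx x y \<longleftrightarrow> Rep_eidx x <= Rep_eidx y"

definition less_eidx :: "'a eidx => 'a eidx => bool"
	where "less_eidx x y \<longleftrightarrow> Rep_eidx x < Rep_eidx y"

instance
proof
	fix P :: "'a eidx => bool" and a
	assume *: "!!x. (!!y. y < x ==> P y) ==> P x"
	show "P a"
		by (induction a rule: measure_induct_rule[of Rep_eidx]) (rule *, simp add: less_eidx_def)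
qed (auto simp: less_eq_eidx_def less_eidx_def Rep_eidx_inject)

end

lemma bij_betw_Rep_eidx: "bij_betw Rep_eidx (UNIV :: 'a::euclidean_space eidx set) {..<DIM('a)}"
	using type_definition.Rep_range[OF type_definition_eidx] Rep_eidx_inject
	by (metis bij_betw_def inj_onI)

instance eidx :: (euclidean_space) finite
	by standard (metis bij_betw_Rep_eidx bij_betw_finite finite_lessThan)

lemma card_eidx: "CARD('a::euclidean_space eidx) = DIM('a)"
	using bij_betw_same_card[OF bij_betw_Rep_eidx] by simp

text \<open>\<open>'a eidx\<close> has \<open>DIM('a)\<close> elements and a well-order. Through
  this isometry, facts about Lebesgue measure on coordinate spaces with a well-ordered index type
  become available on any Euclidean space.\<close>

lemma isometry_eidx:
	obtains J :: "real ^ ('a::euclidean_space eidx) => 'a" and K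
	where "linear J" "linear K" "!!x. norm (J x) = norm x" "!!x. norm (K x) = norm x" "!!x. J (K x) = x" "!!x. K (J x) = x"
proof -
	have "DIM(real ^ ('a eidx)) = DIM('a)" by (simp add: card_eidx)
	from isomorphisms_UNIV_UNIV[OF this] show ?thesis by (metis that)
qed

lemma linear_borel:
	fixes f :: "'a::euclidean_space => 'b::euclidean_space"
	shows "linear f ==> f : borel_measurable borel"
	by (intro borel_measurable_continuous_onI linear_continuous_on) (simp add: linear_conv_bounded_linear)

text \<open>The reflection in the hyperplane orthogonal to \<open>a - b\<close>. It fixes the
  vectors that have equal inner products with \<open>a\<close> and \<open>b\<close>, which later
  allows orthonormal lists to be matched one vector at a time.\<close>

lemma orthogonal_transformation_maps:
	fixes a b :: "'a::euclidean_space"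
	assumes "norm a = norm b"
	obtains f where "orthogonal_transformation f" "f a = b" "!!z. z \<bullet> a = z \<bullet> b ==> f z = z"
proof (cases "a = b")
	case True
	thus ?thesis using that[of "%x. x"] by simp
next
	case False
	define w where "w = a - b"
	have w: "w \<bullet> w ~= 0" using False by (simp add: w_def)
	have "a \<bullet> a = b \<bullet> b" using assms by (simp add: norm_eq)
	hence aw: "2 * (a \<bullet> w) = w \<bullet> w" by (simp add: w_def inner_diff inner_commute)
	define f where "f z = z - (2 * (z \<bullet> w) / (w \<bullet> w)) *\<^sub>R w" for z
	have "f a = b" using w unfolding f_def aw by (simp add: w_def)
	moreover have "orthogonal_transformation f"
		unfolding orthogonal_transformation_def
	proof (intro conjI allI)
		show "linear f"
			by (rule linearI) (simp_all add: f_def inner_add_left algebra_simps add_divide_distrib)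
		show "f v \<bullet> f u = v \<bullet> u" for v u
		proof -
			define c where "c z = 2 * (z \<bullet> w) / (w \<bullet> w)" for z
			have fz: "f z = z - c z *\<^sub>R w" for z by (simp add: f_def c_def)
			have c: "c z * (w \<bullet> w) = 2 * (z \<bullet> w)" "c v * (u \<bullet> w) = c u * (v \<bullet> w)" for z using w by (auto simp: c_def)
			have "f v \<bullet> f u = v \<bullet> u - c u * (v \<bullet> w) - c v * (u \<bullet> w) + c u * (c v * (w \<bullet> w))"
				unfolding fz inner_diff_left inner_diff_right inner_scaleR_left inner_scaleR_right inner_commute[of w u]
				by (simp add: algebra_simps)
			also have "c u * (c v * (w \<bullet> w)) = c u * (v \<bullet> w) + c v * (u \<bullet> w)"
				unfolding c(1)[of v] c(2) by simp
			also have "v \<bullet> u - c u * (v \<bullet> w) - c v * (u \<bullet> w) + (c u * (v \<bullet> w) + c v * (u \<bullet> w)) = v \<bullet> u"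
				by linarith
			finally show ?thesis .
		qed
	qed
	moreover have "f z = z" if "z \<bullet> a = z \<bullet> b" for z
		using that by (simp add: f_def w_def inner_diff_right)
	ultimately show ?thesis using that by blast
qed

lemma distr_lborel_orthogonal:
	fixes f :: "real ^ 'k::{finite, wellorder} => real ^ 'k::_"
	assumes f: "orthogonal_transformation f"
	shows "distr lborel borel f = lborel"
proof (rule sym, rule lborel_eqI)
	have lin: "linear f" using f by (rule orthogonal_transformation_linear)
	hence mf: "f : borel_measurable borel" by (rule linear_borel)
	fix l u assume lu: "!!b. b : (Basis :: (real ^ 'k::_) set) ==> inner l b <= inner u b"
	have g: "orthogonal_transformation (inv_into UNIV f)" using f by (rule orthogonal_transformation_inv)
	have "bij f" using f by (rule orthogonal_transformation_bij)
	hence eq: "f -` box l u = inv_into UNIV f ` box l u" by (simp add: bij_vimage_eq_inv_image)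
	have bx: "box l u : lmeasurable" by simp
	have "f -` box l u : sets borel" using measurable_sets[OF mf, of "box l u"] by simp
	hence "emeasure (distr lborel borel f) (box l u) = emeasure lebesgue (f -` box l u)"
		using mf by (simp add: emeasure_distr emeasure_completion)
	also have "... = ennreal (measure lebesgue (box l u))"
		unfolding eq measure_orthogonal_image[OF g bx, symmetric]
		by (rule emeasure_eq_measure2[OF measurable_orthogonal_image[OF g bx]])
	also have "... = (PROD b:Basis. (u - l) \<bullet> b)" using lu by (simp add: measure_completion measure_lborel_box)
	finally show "emeasure (distr lborel borel f) (box l u) = (PROD b:Basis. (u - l) \<bullet> b)" .
qed simp

lemma distr_uniform_cball_orthogonal:
	fixes f :: "real ^ 'k::{finite, wellorder} => real ^ 'k::_"
	assumes f: "orthogonal_transformation f"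
	shows "distr (uniform_measure lborel (cball 0 1)) borel f = uniform_measure lborel (cball 0 1)"
proof (rule measure_eqI)
	have lin: "linear f" using f by (rule orthogonal_transformation_linear)
	hence mf: "f : borel_measurable borel" by (rule linear_borel)
	fix A assume "A : sets (distr (uniform_measure lborel (cball 0 1)) borel f)"
	hence A: "A : sets borel" by simp
	hence fA: "f -` A : sets borel" using measurable_sets[OF mf A] by simp
	have eq: "cball 0 1 Int f -` A = f -` (cball 0 1 Int A)"
		using orthogonal_transformation_norm[OF f] by auto
	have "emeasure lborel (cball 0 1 Int f -` A) = emeasure (distr lborel borel f) (cball 0 1 Int A)"
		unfolding eq using mf A by (subst emeasure_distr) auto
	also have "... = emeasure lborel (cball 0 1 Int A)" by (simp add: distr_lborel_orthogonal[OF f])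
	finally show "emeasure (distr (uniform_measure lborel (cball 0 1)) borel f) A = emeasure (uniform_measure lborel (cball 0 1)) A"
		using A fA mf by (simp add: emeasure_distr emeasure_uniform_measure)
qed simp

text \<open>Pairing with such a law is a multiple of the length (\<open>isotropic_law_norm\<close>),
  so the length becomes an instance of the pairing. The last clause makes the multiple
  positive.\<close>

definition isotropic_law :: "'a::euclidean_space measure => bool"
	where "isotropic_law ga \<longleftrightarrow> integrable_law ga & (ALL f. orthogonal_transformation f --> distr ga borel f = ga) &
		(ALL v. v ~= 0 --> 0 < (LINT x|ga. \<bar>v \<bullet> x\<bar>))"

text \<open>The uniform distribution on the unit ball of the coordinate space, transported by the
  isometry. If the mean of |<v, x>| vanished for some nonzero \<open>v\<close>, the ball would lie
  in a hyperplane up to a null set.\<close>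

lemma isotropic_law_exists: "EX ga :: 'a::euclidean_space measure. isotropic_law ga"
proof -
	let ?U = "uniform_measure lborel (cball 0 1) :: (real ^ ('a eidx)) measure"
	obtain J :: "real ^ ('a eidx) => 'a" and K where J: "linear J" "linear K" "!!x. norm (J x) = norm x"
		"!!x. norm (K x) = norm x" "!!x. J (K x) = x" "!!x. K (J x) = x"
		using isometry_eidx by blast
	define ga where "ga = distr ?U borel J"
	have fin: "emeasure lborel (cball (0 :: real ^ ('a eidx)) 1) ~= \<infinity>"
		by (simp add: emeasure_cball)
	have pos: "emeasure lborel (cball (0 :: real ^ ('a eidx)) 1) ~= 0"
		by (simp add: emeasure_cball unit_ball_vol_pos ennreal_eq_0_iff not_le)
	interpret U: prob_space ?U using pos fin by (rule prob_space_uniform_measure)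
	have mJ': "J : borel_measurable borel" using J(1) by (rule linear_borel)
	hence mJ: "J : borel_measurable ?U" by simp
	have cJ: "inner v (J x) = inner (K v) x" for v x
	proof -
		have "v \<bullet> J x = J (K v) \<bullet> J x" by (simp add: J(5))
		also have "... = K v \<bullet> x"
			using J(1,3) orthogonal_transformation[of J] 
			by (simp add: linear_add[OF J(1), symmetric] dot_norm)
		finally show ?thesis .
	qed
	have bnd: "AE x in ?U. norm (J x) <= 1"
		by (rule AE_uniform_measureI) (auto simp: J(3))
	have intJ: "integrable ?U J" by (rule U.integrable_const_bound[OF bnd mJ])
	have law: "integrable_law ga" unfolding ga_def by (rule integrable_law_distr[OF U.prob_space_axioms intJ])
	moreover have "distr ga borel f = ga" if f: "orthogonal_transformation f" for f
	proof -
		have lf: "linear f" using f by (rule orthogonal_transformation_linear)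
		hence mf: "f : borel_measurable borel" by (rule linear_borel)
		let ?g = "K o f o J"
		have g: "orthogonal_transformation ?g"
			unfolding orthogonal_transformation using f J lf
			by (auto simp: orthogonal_transformation_norm intro: linear_compose)
		have mg: "?g : borel_measurable borel"
			by (intro linear_borel orthogonal_transformation_linear[OF g])
		have "distr ga borel f = distr ?U borel (f o J)" unfolding ga_def using mJ mf by (simp add: distr_distr)
		also have "f o J = J o ?g" using J(5) by (auto simp: o_def)
		also have "distr ?U borel (J o ?g) = distr (distr ?U borel ?g) borel J"
			using mJ' mg by (subst distr_distr) auto
		also have "distr ?U borel ?g = ?U" by (rule distr_uniform_cball_orthogonal[OF g])
		finally show ?thesis unfolding ga_def .
	qed
	moreover have "0 < (LINT x|ga. abs (v \<bullet> x))" if v: "v ~= 0" for v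
	proof (rule ccontr)
		assume "\<not> 0 < (LINT x|ga. abs (v \<bullet> x))"
		moreover have "0 <= (LINT x|ga. abs (v \<bullet> x))" by simp
		ultimately have "(LINT x|ga. abs (v \<bullet> x)) = 0" by linarith
		hence 0: "(LINT x|?U. abs (v \<bullet> J x)) = 0" unfolding ga_def using mJ by (simp add: integral_distr)
		have "AE x in ?U. abs (v \<bullet> J x) = 0"
			by (subst integral_nonneg_eq_0_iff_AE[symmetric]) (use 0 intJ in \<open>auto intro!: integrable_abs_inner\<close>)
		hence "AE x in lborel. x : cball 0 1 --> v \<bullet> J x = 0"
			by (subst (asm) AE_uniform_measure) (use pos fin in \<open>auto simp: less_top\<close>)
		moreover have "K v ~= 0" using J(4)[of v] v by auto
		hence "negligible {x. K v \<bullet> x = 0}" by (intro negligible_hyperplane) auto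
		hence "AE x in lebesgue. x ~: {x. K v \<bullet> x = 0}"
			by (metis negligible_iff_null_sets AE_not_in)
		hence "AE x in lborel. K v \<bullet> x ~= 0" by (simp add: AE_completion_iff)
		ultimately have "AE x in lborel. x ~: cball (0 :: real ^ ('a eidx)) 1"
			by eventually_elim (auto simp: cJ)
		hence "emeasure lborel (cball (0 :: real ^ ('a eidx)) 1) = 0"
			by (subst (asm) AE_iff_measurable[OF _ refl]) (auto simp: cball_def)
		with pos show False by simp
	qed
	ultimately show ?thesis unfolding isotropic_law_def by blast
qed

text \<open>A rotation carries \<open>norm x *\<^sub>R b\<close> to \<open>x\<close>, so the mean
  depends on \<open>norm x\<close> alone, and \<open>c\<close> is its value at a basis vector
  \<open>b\<close>.\<close>

lemma isotropic_law_norm: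
	assumes "isotropic_law (ga :: 'a::euclidean_space measure)"
	obtains c where "0 < c" "!!x. (LINT u|ga. abs (x \<bullet> u)) = c * norm x"
proof -
	obtain b :: 'a where b: "b : Basis" using nonempty_Basis by blast
	have law: "integrable_law ga" and inv: "!!f. orthogonal_transformation f ==> distr ga borel f = ga"
		using assms by (auto simp: isotropic_law_def)
	let ?c = "\<integral>u. abs (b \<bullet> u) \<partial>ga"
	have "(LINT u|ga. abs (x \<bullet> u)) = ?c * norm x" for x
	proof -
		have "norm (norm x *\<^sub>R b) = norm x" using b by simp
		then obtain f where f: "orthogonal_transformation f" "f (norm x *\<^sub>R b) = x"
			by (rule orthogonal_transformation_maps)
		have mf: "f : borel_measurable ga" 
			using orthogonal_transformation_linear[OF f(1)]
			by (subst measurable_cong_sets[OF integrable_law_sets[OF law] refl])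
				(rule linear_borel)
		have "(LINT u|ga. abs (x \<bullet> u)) = (LINT u|distr ga borel f. abs (x \<bullet> u))" by (simp add: inv[OF f(1)])
		also have "... = (LINT u|ga. abs (f (norm x *\<^sub>R b) \<bullet> f u))" using mf by (simp add: integral_distr f(2))
		also have "... = (LINT u|ga. abs ((norm x *\<^sub>R b) \<bullet> u))"
			using f(1) by (simp add: orthogonal_transformation_def)
		also have "... = ?c * norm x" by (simp add: abs_mult mult.commute)
		finally show ?thesis .
	qed
	moreover have "b ~= 0" using b by auto
	hence "0 < ?c" using assms by (simp add: isotropic_law_def)
	ultimately show ?thesis using that by blast
qed

lemma vz_length_exists:
	"EX f. linear f & (ALL mu. integrable_law mu --> f (vz mu (%x. x)) = (LINT x|mu. norm (x :: 'a::euclidean_space)))"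
proof -
	obtain ga :: "'a measure" where ga: "isotropic_law ga" using isotropic_law_exists by blast
	obtain c where c: "0 < c" "!!x. (LINT u|ga. abs (x \<bullet> u)) = c * norm x" using isotropic_law_norm[OF ga] by blast
	have law: "integrable_law ga" using ga by (simp add: isotropic_law_def)
	let ?K = "vz ga (%x. x)"
	have "vz_pairing (vz mu (%x. x)) ?K = c * (LINT x|mu. norm x)" if "integrable_law mu" for mu
	proof -
		have "vz_pairing (vz mu (%x. x)) ?K = (LINT z|(mu \<Otimes>\<^sub>M ga). (case z of (x, y) => \<bar>x \<bullet> y\<bar>))"
			by (rule vz_pairing_law[OF that law])
		also have "... = (LINT x|mu. \<integral>u. abs (x \<bullet> u) \<partial>ga)"
			by (subst integral_law_pair(1)[OF that law, where C=1]) (auto simp: Cauchy_Schwarz_ineq2)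
		finally show ?thesis by (simp add: c(2))
	qed
	moreover have "linear (%A. (1 / c) *\<^sub>R vz_pairing A ?K)"
		using bilinear_vz_pairing unfolding bilinear_def by (intro linear_compose_scale_right) blast
	ultimately have "linear (%A. (1 / c) *\<^sub>R vz_pairing A ?K) &
			(ALL mu. integrable_law mu --> (1 / c) *\<^sub>R vz_pairing (vz mu (%x. x)) ?K = (LINT x|mu. norm x))"
		using c(1) by simp
	thus ?thesis by (rule exI[of _ "%A. (1 / c) *\<^sub>R vz_pairing A ?K"])
qed

lemma linear_vz_length: "linear vz_length"
	and vz_length_law: "integrable_law mu ==> vz_length (vz mu (%x. x)) = (LINT x|mu. norm x)"
	using someI_ex[OF vz_length_exists] unfolding vz_length_def[symmetric] by blast+

section \<open>The exterior algebra\<close>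

text \<open>The sign of the permutation that sorts the elements of \<open>S\<close> followed by
  those of \<open>T\<close>, for disjoint sets; it is the coefficient in the product of two basis
  vectors (\<open>wedge_axis\<close>).\<close>

definition shuffle_sign :: "'b::countable set => 'b set => real"
	where "shuffle_sign S T = (-1) ^ card {(s, t). s : S & t : T & to_nat t < to_nat s}"

lemma shuffle_sign_Un_right:
	fixes S T T' :: "'b::{finite,countable} set"
	assumes "T Int T' = {}"
	shows "shuffle_sign S (T Un T') = shuffle_sign S T * shuffle_sign S T'"
proof -
	have "{(s, t). s : S & t : T Un T' & to_nat t < to_nat s} =
			{(s, t). s : S & t : T & to_nat t < to_nat s} Un {(s, t). s : S & t : T' & to_nat t < to_nat s}"
		by auto
	moreover have "card ({(s, t). s : S & t : T & to_nat t < to_nat s} \<union>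
			{(s, t). s : S & t : T' & to_nat t < to_nat s}) =
			card {(s, t). s : S & t : T & to_nat t < to_nat s} + card {(s, t). s : S & t : T' & to_nat t < to_nat s}"
		using assms by (intro card_Un_disjoint finite) auto
	ultimately show ?thesis by (simp add: shuffle_sign_def power_add)
qed

lemma shuffle_sign_Un_left:
	fixes S S' T :: "'b::{finite,countable} set"
	assumes "S Int S' = {}"
	shows "shuffle_sign (S Un S') T = shuffle_sign S T * shuffle_sign S' T"
proof -
	have "{(s, t). s : S Un S' & t : T & to_nat t < to_nat s} =
			{(s, t). s : S & t : T & to_nat t < to_nat s} Un {(s, t). s : S' & t : T & to_nat t < to_nat s}"
		by auto
	moreover have "card ({(s, t). s : S & t : T & to_nat t < to_nat s} \<union>
			{(s, t). s : S' & t : T & to_nat t < to_nat s}) =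
			card {(s, t). s : S & t : T & to_nat t < to_nat s} + card {(s, t). s : S' & t : T & to_nat t < to_nat s}"
		using assms by (intro card_Un_disjoint finite) auto
	ultimately show ?thesis by (simp add: shuffle_sign_def power_add)
qed

lemma shuffle_sign_empty [simp]: "shuffle_sign {} T = 1" "shuffle_sign S {} = 1"
	by (simp_all add: shuffle_sign_def)

lemma shuffle_sign_square [simp]: "shuffle_sign S T * shuffle_sign S T = 1"
	by (simp add: shuffle_sign_def flip: power_mult_distrib)

lemma shuffle_sign_singletons:
	"shuffle_sign {a} {b} = (if to_nat b < to_nat a then - 1 else 1)"
proof -
	have "{(s, t). s : {a} & t : {b} & to_nat t < to_nat s} = (if to_nat b < to_nat a then {(a, b)} else {})" by auto
	thus ?thesis by (simp add: shuffle_sign_def)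
qed

lemma shuffle_sign_singletons_anti: "a ~= b ==> shuffle_sign {a} {b} = - shuffle_sign {b} {a}"
	using inj_to_nat by (auto simp: shuffle_sign_singletons linorder_not_less inj_eq dest: le_antisym)

lemma wedge_nth:
	"wedge x y $ U = (SUM S:Pow U. shuffle_sign S (U - S) * x $ S * y $ (U - S))"
	by (simp add: wedge_def shuffle_sign_def)

lemma bilinear_wedge: "bilinear wedge"
	unfolding bilinear_def
proof (intro conjI allI)
	show "linear (wedge x)" for x :: "'a ext"
		by (rule linearI) (simp_all add: vec_eq_iff wedge_nth algebra_simps sum.distrib sum_distrib_left)
	show "linear (%x. wedge x y)" for y :: "'a ext"
		by (rule linearI) (simp_all add: vec_eq_iff wedge_nth algebra_simps sum.distrib sum_distrib_left)
qed

lemmas wedge_linear_simps =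
	bilinear_ladd[OF bilinear_wedge] bilinear_radd[OF bilinear_wedge]
	bilinear_lmul[OF bilinear_wedge] bilinear_rmul[OF bilinear_wedge]
	bilinear_lneg[OF bilinear_wedge] bilinear_rneg[OF bilinear_wedge]
	bilinear_lzero[OF bilinear_wedge] bilinear_rzero[OF bilinear_wedge]
	bilinear_lsub[OF bilinear_wedge] bilinear_rsub[OF bilinear_wedge]

lemma linear_wedge_right: "linear (wedge x)" and linear_wedge_left: "linear (%x. wedge x y)"
	using bilinear_wedge unfolding bilinear_def by blast+

lemma wedge_axis:
	"wedge (axis S 1) (axis T 1) = (if S Int T = {} then shuffle_sign S T *\<^sub>R axis (S Un T) 1 else 0)"
proof (rule vec_eq_iff[THEN iffD2, rule_format])
	fix U :: "('a \<times> bool) set"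
	have "wedge (axis S 1) (axis T 1) $ U =
			(SUM S':Pow U. if S' = S then shuffle_sign S (U - S) * (if U - S = T then 1 else 0) else 0)"
		unfolding wedge_nth by (intro sum.cong) (auto simp: axis_def)
	also have "... = (if S \<subseteq> U then shuffle_sign S (U - S) * (if U - S = T then 1 else 0) else 0)" by simp
	also have "... = (if S Int T = {} then shuffle_sign S T *\<^sub>R axis (S Un T) 1 else 0 :: 'a ext) $ U"
		by (auto simp: axis_def)
	finally show "wedge (axis S 1) (axis T 1) $ U = (if S Int T = {} then shuffle_sign S T *\<^sub>R axis (S Un T) 1 else 0 :: 'a ext) $ U" .
qed

lemma linear_eq_on_axis:
	fixes f g :: "real ^ 'k => 'c::real_vector"
	assumes "linear f" "linear g" "!!k. f (axis k 1) = g (axis k 1)"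
	shows "f x = g x"
proof -
	have "f b = g b" if "b : Basis" for b
		using that assms(3) by (auto simp: Basis_vec_def)
	thus ?thesis using linear_eq_on_span[OF assms(1,2), of Basis x] by simp
qed

text \<open>On basis vectors both bracketings carry the product of the signs of the three pairs,
  since \<open>shuffle_sign\<close> is multiplicative on disjoint unions. The rest is linearity in
  each argument.\<close>

lemma wedge_assoc: "wedge (wedge x y) z = wedge x (wedge y z)"
proof -
	have basis: "wedge (wedge (axis A 1) (axis B 1)) (axis C 1) = wedge (axis A 1) (wedge (axis B 1) (axis C 1 :: 'a ext))" for A B C
		by (auto simp: wedge_axis wedge_linear_simps shuffle_sign_Un_left shuffle_sign_Un_right Un_assoc Int_Un_distrib Int_Un_distrib2)
	have 1: "wedge (wedge (axis A 1) (axis B 1)) z = wedge (axis A 1) (wedge (axis B 1) z)" for A B and z :: "'a ext"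
	proof (rule linear_eq_on_axis[of "wedge (wedge (axis A 1) (axis B 1))"])
		show "linear (%z. wedge (axis A 1) (wedge (axis B 1) z))"
			by (rule linear_compose[OF linear_wedge_right linear_wedge_right, unfolded o_def])
	qed (rule linear_wedge_right, rule basis)
	have 2: "wedge (wedge (axis A 1) y) z = wedge (axis A 1) (wedge y z)" for A and y z :: "'a ext"
	proof (rule linear_eq_on_axis[of "%y. wedge (wedge (axis A 1) y) z"])
		show "linear (%y. wedge (wedge (axis A 1) y) z)"
			by (rule linear_compose[OF linear_wedge_right linear_wedge_left, unfolded o_def])
		show "linear (%y. wedge (axis A 1) (wedge y z))"
			by (rule linear_compose[OF linear_wedge_left linear_wedge_right, unfolded o_def])
	qed (rule 1)
	show ?thesis
	proof (rule linear_eq_on_axis[of "%x. wedge (wedge x y) z"])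
		show "linear (%x. wedge (wedge x y) z)"
			by (rule linear_compose[OF linear_wedge_left linear_wedge_left, unfolded o_def])
	qed (rule linear_wedge_left, rule 2)
qed

lemma wedge_one_left [simp]: "wedge (axis {} 1) x = x"
	by (rule linear_eq_on_axis[OF linear_wedge_right linear_ident]) (simp add: wedge_axis)

lemma wedge_one_right [simp]: "wedge x (axis {} 1) = x"
	by (rule linear_eq_on_axis[OF linear_wedge_left linear_ident]) (simp add: wedge_axis)

definition real_coord :: "complex ^ 'n => 'n \<times> bool => real"
	where "real_coord w b = (if snd b then Im (w $ fst b) else Re (w $ fst b))"

definition real_basis :: "'n \<times> bool => complex ^ 'n"
	where "real_basis b = axis (fst b) (if snd b then \<i> else 1)"

lemma sum_UNIV_bool_prod: "(SUM b:(UNIV :: ('n::finite \<times> bool) set). f b) = (SUM i:UNIV. f (i, False) + f (i, True))"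
proof -
	have "(SUM b:(UNIV :: ('n \<times> bool) set). f b) = (SUM i:UNIV. SUM c:UNIV. f (i, c))"
		by (simp add: sum.cartesian_product UNIV_Times_UNIV[symmetric] del: UNIV_Times_UNIV)
	thus ?thesis by (simp add: UNIV_bool add.commute)
qed

lemma ext_vec_eq: "ext_vec w = (SUM b:UNIV. real_coord w b *\<^sub>R axis {b} 1)"
	by (simp add: ext_vec_def sum_UNIV_bool_prod real_coord_def)

lemma inner_eq_real_coord: "v \<bullet> w = (SUM b:UNIV. real_coord v b * real_coord w b)"
	by (simp add: inner_vec_def sum_UNIV_bool_prod real_coord_def inner_complex_def)

lemma linear_ext_vec: "linear ext_vec"
	by (rule linearI) (simp_all add: ext_vec_def algebra_simps sum.distrib scaleR_sum_right)

lemma ext_vec_basis [simp]: "ext_vec (real_basis b) = axis {b} 1"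
proof -
	have "real_coord (real_basis b) c = (if c = b then 1 else 0)" for c
		by (cases b; cases c) (auto simp: real_coord_def real_basis_def axis_def)
	thus ?thesis by (simp add: ext_vec_eq if_distrib[of "%r. r *\<^sub>R _"] cong: if_cong)
qed

lemma real_basis_expand: "w = (SUM b:UNIV. real_coord w b *\<^sub>R real_basis b)"
proof (rule vec_eq_iff[THEN iffD2, rule_format])
	fix i
	have "(SUM b:UNIV. real_coord w b *\<^sub>R real_basis b) $ i =
			(SUM j:UNIV. if j = i then w $ i else 0)"
		unfolding sum_UNIV_bool_prod sum_component
		by (intro sum.cong refl) (auto simp: real_coord_def real_basis_def axis_def complex_eq_iff)
	also have "... = w $ i" by simp
	finally show "w $ i = (SUM b:UNIV. real_coord w b *\<^sub>R real_basis b) $ i" by simp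
qed

lemma linear_eq_on_real_basis:
	fixes f g :: "complex ^ 'n::finite => 'c::real_vector"
	assumes "linear f" "linear g" "!!b. f (real_basis b) = g (real_basis b)"
	shows "f w = g w"
	by (subst (1 2) real_basis_expand) (simp add: linear_sum linear_scale assms)

abbreviation vec_wedge :: "complex ^ 'n => 'n::finite ext => 'n ext"
	where "vec_wedge v x \<equiv> wedge (ext_vec v) x"

lemma linear_vec_wedge: "linear (%v. vec_wedge v x)"
	using linear_compose[OF linear_ext_vec linear_wedge_left] by (simp add: o_def)

lemma vec_wedge_sum: "vec_wedge v x = (SUM b:UNIV. real_coord v b *\<^sub>R wedge (axis {b} 1) x)"
	by (simp add: ext_vec_eq linear_sum[OF linear_wedge_left] wedge_linear_simps)

lemma wedge_axis_nth:
	"wedge (axis {a} 1) x $ U = (if a : U then shuffle_sign {a} (U - {a}) * x $ (U - {a}) else 0)"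
proof -
	have "wedge (axis {a} 1) x $ U =
			(SUM S:Pow U. if S = {a} then shuffle_sign {a} (U - {a}) * x $ (U - {a}) else 0)"
		unfolding wedge_nth by (intro sum.cong) (auto simp: axis_def)
	thus ?thesis by simp
qed

lemma vec_wedge_anticommute: "vec_wedge v (vec_wedge w x) = - vec_wedge w (vec_wedge v x)"
proof -
	have b: "wedge (axis {a} 1) (axis {b} 1) = - wedge (axis {b} 1) (axis {a} 1 :: 'a ext)" for a b
		using shuffle_sign_singletons_anti[of a b] by (auto simp: wedge_axis insert_commute)
	have 1: "wedge (axis {a} 1) (ext_vec w) = - wedge (ext_vec w) (axis {a} 1)" for a
		unfolding ext_vec_eq linear_sum[OF linear_wedge_right] linear_sum[OF linear_wedge_left] wedge_linear_simps
		by (simp add: b[of a] sum_negf)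
	have "wedge (ext_vec v) (ext_vec w) = - wedge (ext_vec w) (ext_vec v)"
		unfolding ext_vec_eq[of v] linear_sum[OF linear_wedge_right] linear_sum[OF linear_wedge_left] wedge_linear_simps
		by (simp add: 1 sum_negf)
	thus ?thesis by (simp add: wedge_linear_simps flip: wedge_assoc)
qed

lemma vec_wedge_self [simp]: "vec_wedge v (vec_wedge v x) = 0"
	using vec_wedge_anticommute[of v v x] by (simp add: eq_neg_iff_add_eq_0 flip: scaleR_2)

section \<open>Contraction by a vector\<close>

definition contraction :: "complex ^ 'n => 'n::finite ext => 'n ext"
	where "contraction w = adjoint (vec_wedge w)"

definition basis_contraction :: "'n \<times> bool => 'n::finite ext => 'n ext"
	where "basis_contraction a x = (\<chi> U. if a ~: U then shuffle_sign {a} U * x $ insert a U else 0)"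

lemma inner_contraction: "vec_wedge w x \<bullet> y = x \<bullet> contraction w y"
	unfolding contraction_def by (rule adjoint_works[OF linear_wedge_right, symmetric])

lemma linear_contraction: "linear (contraction w)"
	unfolding contraction_def by (rule adjoint_linear[OF linear_wedge_right])

lemma inner_basis_contraction: "wedge (axis {a} 1) x \<bullet> y = x \<bullet> basis_contraction a y"
proof -
	have "wedge (axis {a} 1) x \<bullet> y = (\<Sum>U | a : U. shuffle_sign {a} (U - {a}) * x $ (U - {a}) * y $ U)"
		unfolding inner_vec_def wedge_axis_nth by (intro sum.mono_neutral_cong_right) auto
	also have "... = (\<Sum>U | a ~: U. x $ U * (shuffle_sign {a} U * y $ insert a U))"
		by (rule sum.reindex_bij_witness[of _ "insert a" "%U. U - {a}"]) (auto simp: insert_absorb)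
	also have "... = x \<bullet> basis_contraction a y"
		unfolding inner_vec_def basis_contraction_def by (intro sum.mono_neutral_cong_left) auto
	finally show ?thesis .
qed

lemma contraction_eq: "contraction w y = (SUM b:UNIV. real_coord w b *\<^sub>R basis_contraction b y)"
proof (rule vector_eq_ldot[THEN iffD1, rule_format])
	fix x
	have "x \<bullet> contraction w y = (SUM b:UNIV. real_coord w b *\<^sub>R wedge (axis {b} 1) x) \<bullet> y"
		by (simp add: vec_wedge_sum flip: inner_contraction)
	thus "x \<bullet> contraction w y = x \<bullet> (SUM b:UNIV. real_coord w b *\<^sub>R basis_contraction b y)"
		by (simp add: inner_sum_left inner_sum_right inner_basis_contraction)
qed

text \<open>The anticommutation relation between contracting by one basis vector and multiplying by
  another. Both terms are present in a component \<open>U\<close> only for distinct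
  \<open>a\<close>, \<open>b\<close> with \<open>a\<close> outside and \<open>b\<close> inside
  \<open>U\<close>, and there exchanging \<open>a\<close> and \<open>b\<close> reverses the
  sign.\<close>

lemma basis_contraction_wedge:
	"basis_contraction a (wedge (axis {b} 1) x) + wedge (axis {b} 1) (basis_contraction a x) = (if a = b then x else 0)"
proof (rule vec_eq_iff[THEN iffD2, rule_format])
	fix U
	consider "a = b" "a : U" | "a = b" "a ~: U" | "a ~= b" "a : U \<or> b ~: U" | "a ~= b" "a ~: U" "b : U" by blast
	thus "(basis_contraction a (wedge (axis {b} 1) x) + wedge (axis {b} 1) (basis_contraction a x)) $ U =
			(if a = b then x else 0) $ U"
	proof cases
		case 4
		have "shuffle_sign {a} U = shuffle_sign {a} (U - {b}) * shuffle_sign {a} {b}"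
			using shuffle_sign_Un_right[of "U - {b}" "{b}" "{a}"] 4 by (simp add: insert_absorb)
		moreover have "shuffle_sign {b} (insert a (U - {b})) = shuffle_sign {b} (U - {b}) * shuffle_sign {b} {a}"
			using shuffle_sign_Un_right[of "U - {b}" "{a}" "{b}"] 4 by simp
		moreover have "insert a U - {b} = insert a (U - {b})" using 4 by auto
		ultimately show ?thesis
			using 4 shuffle_sign_singletons_anti[of a b]
			by (simp add: basis_contraction_def wedge_axis_nth)
	qed (auto simp: basis_contraction_def wedge_axis_nth insert_absorb mult.assoc[symmetric])
qed

text \<open>The antiderivation rule, from the basis case by bilinearity. With it, inner products of
  wedge products are evaluated by moving one factor at a time to the other side.\<close>

lemma contraction_vec_wedge:
	"contraction w (vec_wedge v x) = (w \<bullet> v) *\<^sub>R x - vec_wedge v (contraction w x)"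
proof -
	have lin: "linear (basis_contraction a)" for a :: "'a \<times> bool"
		by (rule linearI) (simp_all add: basis_contraction_def vec_eq_iff algebra_simps)
	have "contraction w (vec_wedge v x) + vec_wedge v (contraction w x) =
		 (SUM a:UNIV. SUM b:UNIV. (real_coord w a * real_coord v b) *\<^sub>R
			 (basis_contraction a (wedge (axis {b} 1) x) + wedge (axis {b} 1) (basis_contraction a x)))"
	proof -
		have "contraction w (vec_wedge v x) = (SUM a:UNIV. SUM b:UNIV. (real_coord w a * real_coord v b) *\<^sub>R
			 basis_contraction a (wedge (axis {b} 1) x))"
			by (simp add: contraction_eq vec_wedge_sum linear_sum[OF lin] linear_scale[OF lin] scaleR_sum_right)
		moreover have "vec_wedge v (contraction w x) = (SUM a:UNIV. SUM b:UNIV. (real_coord w a * real_coord v b) *\<^sub>R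
			 wedge (axis {b} 1) (basis_contraction a x))"
			by (simp add: contraction_eq vec_wedge_sum linear_sum[OF linear_wedge_right] wedge_linear_simps scaleR_sum_right
					mult.commute)
		ultimately show ?thesis by (simp add: scaleR_add_right sum.distrib)
	qed
	also have "... = (SUM a:UNIV. SUM b:UNIV. if a = b then (real_coord w a * real_coord v b) *\<^sub>R x else 0)"
		unfolding basis_contraction_wedge by (intro sum.cong) auto
	also have "... = (w \<bullet> v) *\<^sub>R x" by (simp add: inner_eq_real_coord scaleR_sum_left)
	finally show ?thesis by (simp add: eq_diff_eq)
qed

lemma contraction_one [simp]: "contraction w (axis {} 1) = 0"
proof -
	have "basis_contraction b (axis {} 1) = 0" for b :: "'a \<times> bool"
		by (rule vec_eq_iff[THEN iffD2]) (simp add: basis_contraction_def axis_def)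
	thus ?thesis by (simp add: contraction_eq)
qed

section \<open>Wedge products of lists and induced maps\<close>

lemma wedge_list_Nil [simp]: "wedge_list [] = axis {} 1"
	and wedge_list_Cons [simp]: "wedge_list (w # ws) = vec_wedge w (wedge_list ws)"
	by (simp_all add: wedge_list_def)

lemma wedge_list_append: "wedge_list (xs @ ys) = wedge (wedge_list xs) (wedge_list ys)"
	by (induction xs) (simp_all add: wedge_assoc)

lemma vec_wedge_mem: "v : set ws ==> vec_wedge v (wedge_list ws) = 0"
proof (induction ws)
	case (Cons w ws)
	thus ?case
		by (cases "v = w") (auto simp: vec_wedge_anticommute[of v w] wedge_linear_simps)
qed simp

text \<open>Each entry smaller than \<open>a\<close> costs one transposition, which is where the
  count in \<open>shuffle_sign\<close> meets the order of a list. When an entry is repeated, both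
  sides vanish.\<close>

lemma wedge_list_insort:
	assumes "sorted l" "a ~: set l"
	shows "wedge_list (map f (insort a l)) = (-1) ^ card {t : set l. t < a} *\<^sub>R vec_wedge (f a) (wedge_list (map f l))"
	using assms
proof (induction l)
	case (Cons x l)
	show ?case
	proof (cases "a <= x")
		case True
		hence "{t : set (x # l). t < a} = {}" using Cons.prems by auto
		hence c0: "card {t : set (x # l). t < a} = 0" by (simp only: card.empty)
		show ?thesis unfolding c0 using True by simp
	next
		case False
		show ?thesis
		proof (cases "x : set l")
			case True
			hence 0: "vec_wedge (f x) (wedge_list (map f l)) = 0" by (intro vec_wedge_mem) auto
			have "vec_wedge (f x) (wedge_list (map f (insort a l))) = 0"
				using True by (intro vec_wedge_mem) (auto simp: set_insort_key)
			with 0 False show ?thesis by (simp add: wedge_linear_simps)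
		next
			case x: False
			have "{t : set (x # l). t < a} = insert x {t : set l. t < a}" using False by auto
			hence "card {t : set (x # l). t < a} = Suc (card {t : set l. t < a})" using x by simp
			thus ?thesis
				using False Cons by (simp add: wedge_linear_simps vec_wedge_anticommute[of "f x"])
		qed
	qed
qed simp

definition basis_list :: "('b::countable) set => 'b list"
	where "basis_list S = map from_nat (sorted_list_of_set (to_nat ` S))"

lemma set_basis_list: "set (basis_list (S :: 'b::{finite,countable} set)) = S"
	by (simp add: basis_list_def image_image)

lemma wedge_list_basis_insert:
	fixes S :: "'b::{finite,countable} set" and f :: "'b => complex ^ 'n::finite"
	assumes "a ~: S"
	shows "wedge_list (map f (basis_list (insert a S))) =
		shuffle_sign {a} S *\<^sub>R vec_wedge (f a) (wedge_list (map f (basis_list S)))"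
proof -
	have na: "to_nat a ~: to_nat ` S" using assms by (auto simp: inj_image_mem_iff)
	have "{(s, t). s : {a} & t : S & to_nat t < to_nat s} = (%t. (a, t)) ` {t : S. to_nat t < to_nat a}" by auto
	hence "card {(s, t). s : {a} & t : S & to_nat t < to_nat s} = card {t : S. to_nat t < to_nat a}"
		by (simp add: card_image inj_on_def)
	also have "... = card (to_nat ` {t : S. to_nat t < to_nat a})" by (simp add: card_image inj_on_def)
	also have "to_nat ` {t : S. to_nat t < to_nat a} = {t : to_nat ` S. t < to_nat a}" by auto
	finally have c: "card {(s, t). s : {a} & t : S & to_nat t < to_nat s} = card {t : to_nat ` S. t < to_nat a}" .
	have "basis_list (insert a S) = map from_nat (insort (to_nat a) (sorted_list_of_set (to_nat ` S)))"
		using na by (simp add: basis_list_def sorted_list_of_set_insert)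
	thus ?thesis
		using wedge_list_insort[of "sorted_list_of_set (to_nat ` S)" "to_nat a" "%k. f (from_nat k)"] na
		by (simp only: basis_list_def shuffle_sign_def c o_def map_map) (simp add: o_def)
qed

lemma axis_eq_wedge_list: "(axis S 1 :: 'n::finite ext) = wedge_list (map real_basis (basis_list S))"
proof (induction S rule: finite_induct[OF finite])
	case 1
	thus ?case by (simp add: basis_list_def)
next
	case (2 a S)
	thus ?case by (simp add: wedge_list_basis_insert wedge_axis flip: 2(3))
qed

text \<open>Every basis vector \<open>axis S 1\<close> is itself a wedge product, so wedge products
  span. This is the uniqueness behind the THE in \<open>ext_map\<close>.\<close>

lemma linear_eq_on_wedge_list:
	fixes f g :: "'n::finite ext => 'c::real_vector"
	assumes "linear f" "linear g" "!!ws. f (wedge_list ws) = g (wedge_list ws)"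
	shows "f x = g x"
	by (rule linear_eq_on_axis[OF assms(1,2)]) (simp add: axis_eq_wedge_list assms(3))

text \<open>The induced map for every real-linear \<open>T\<close>; complex matrices give
  \<open>ext_map\<close>. Real orthogonal maps are included because they act transitively on
  orthonormal lists of a given length, which the unitary ones do not.\<close>

definition ext_lin :: "(complex ^ 'n => complex ^ 'n) => 'n::finite ext => 'n ext"
	where "ext_lin T x = (SUM S:UNIV. x $ S *\<^sub>R wedge_list (map (%b. T (real_basis b)) (basis_list S)))"

lemma linear_ext_lin: "linear (ext_lin T)"
	by (rule linearI) (simp_all add: ext_lin_def scaleR_add_left sum.distrib scaleR_sum_right)

lemma ext_lin_axis: "ext_lin T (axis S 1) = wedge_list (map (%b. T (real_basis b)) (basis_list S))"
	by (simp add: ext_lin_def axis_def if_distrib[of "%r. r *\<^sub>R _"] cong: if_cong)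

lemma ext_lin_one [simp]: "ext_lin T (axis {} 1) = axis {} 1"
	by (simp add: ext_lin_axis basis_list_def)

text \<open>On basis vectors: for \<open>a\<close> in \<open>S\<close> both sides vanish by
  repetition, and otherwise the sign of inserting \<open>a\<close> into the sorted list of
  \<open>S\<close> appears on both sides.\<close>

lemma ext_lin_vec_wedge:
	assumes T: "linear T"
	shows "ext_lin T (vec_wedge v x) = vec_wedge (T v) (ext_lin T x)"
proof -
	have basis: "ext_lin T (wedge (axis {a} 1) (axis S 1)) = vec_wedge (T (real_basis a)) (ext_lin T (axis S 1))" for a S
	proof (cases "a : S")
		case True
		thus ?thesis
			by (simp add: wedge_axis linear_0[OF linear_ext_lin] ext_lin_axis vec_wedge_mem set_basis_list)
	next
		case False
		thus ?thesis
			by (simp add: wedge_axis linear_scale[OF linear_ext_lin] ext_lin_axis wedge_list_basis_insert[of a S])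
	qed
	have 1: "ext_lin T (wedge (axis {a} 1) x) = vec_wedge (T (real_basis a)) (ext_lin T x)" for a x
	proof (rule linear_eq_on_axis[of "%x. ext_lin T (wedge (axis {a} 1) x)"])
		show "linear (%x. ext_lin T (wedge (axis {a} 1) x))"
			by (rule linear_compose[OF linear_wedge_right linear_ext_lin, unfolded o_def])
		show "linear (%x. vec_wedge (T (real_basis a)) (ext_lin T x))"
			by (rule linear_compose[OF linear_ext_lin linear_wedge_right, unfolded o_def])
	qed (rule basis)
	show ?thesis
	proof (rule linear_eq_on_real_basis[of "%v. ext_lin T (vec_wedge v x)"])
		show "linear (%v. ext_lin T (vec_wedge v x))"
			by (rule linear_compose[OF linear_vec_wedge linear_ext_lin, unfolded o_def])
		show "linear (%v. vec_wedge (T v) (ext_lin T x))"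
			by (rule linear_compose[OF T linear_vec_wedge, unfolded o_def])
	qed (simp add: 1)
qed

lemma ext_lin_wedge_list: "linear T ==> ext_lin T (wedge_list ws) = wedge_list (map T ws)"
	by (induction ws) (simp_all add: ext_lin_vec_wedge)

lemma ext_lin_wedge:
	assumes "linear T" shows "ext_lin T (wedge x y) = wedge (ext_lin T x) (ext_lin T y)"
proof -
	have 1: "ext_lin T (wedge (wedge_list xs) y) = wedge (ext_lin T (wedge_list xs)) (ext_lin T y)" for xs
		using assms by (induction xs) (simp_all add: wedge_assoc ext_lin_vec_wedge)
	show ?thesis
	proof (rule linear_eq_on_wedge_list[of "%x. ext_lin T (wedge x y)"])
		show "linear (%x. ext_lin T (wedge x y))"
			by (rule linear_compose[OF linear_wedge_left linear_ext_lin, unfolded o_def])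
		show "linear (%x. wedge (ext_lin T x) (ext_lin T y))"
			by (rule linear_compose[OF linear_ext_lin linear_wedge_left, unfolded o_def])
	qed (rule 1)
qed

lemma linear_matrix_vector: "linear ((*v) (g :: complex ^ 'n ^ 'm::finite))"
	by (rule linearI) (simp_all add: matrix_vector_mult_def vec_eq_iff sum.distrib algebra_simps scaleR_sum_right)

lemma ext_map_eq: "ext_map g = ext_lin ((*v) g)"
	unfolding ext_map_def
proof (rule the_equality)
	show "linear (ext_lin ((*v) g)) & (ALL ws. ext_lin ((*v) g) (wedge_list ws) = wedge_list (map ((*v) g) ws))"
		by (simp add: linear_ext_lin ext_lin_wedge_list linear_matrix_vector)
	show "T = ext_lin ((*v) g)" if "linear T & (ALL ws. T (wedge_list ws) = wedge_list (map ((*v) g) ws))" for T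
		by (rule ext, rule linear_eq_on_wedge_list)
			(use that in \<open>simp_all add: linear_ext_lin ext_lin_wedge_list linear_matrix_vector\<close>)
qed

lemma contraction_ext_lin:
	assumes T: "orthogonal_transformation T"
	shows "contraction (T w) (ext_lin T y) = ext_lin T (contraction w y)"
proof (rule linear_eq_on_wedge_list[of "%y. contraction (T w) (ext_lin T y)"])
	have lT: "linear T" using T by (rule orthogonal_transformation_linear)
	show "contraction (T w) (ext_lin T (wedge_list ws)) = ext_lin T (contraction w (wedge_list ws))" for ws
		using T by (induction ws)
			(simp_all add: ext_lin_one ext_lin_vec_wedge[OF lT] contraction_vec_wedge linear_diff[OF linear_ext_lin]
				linear_scale[OF linear_ext_lin] orthogonal_transformation_def linear_0[OF linear_ext_lin])
qed (rule linear_compose[OF linear_ext_lin linear_contraction, unfolded o_def],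
		 rule linear_compose[OF linear_contraction linear_ext_lin, unfolded o_def])

text \<open>Contraction commutes with \<open>ext_lin T\<close> for orthogonal \<open>T\<close>.
  Moving the factors of a wedge product across one by one reduces the inner product to the component
  along \<open>axis {} 1\<close>, which \<open>ext_lin T\<close> leaves alone.\<close>

lemma orthogonal_ext_lin:
	assumes T: "orthogonal_transformation T"
	shows "orthogonal_transformation (ext_lin T)"
proof -
	have lT: "linear T" using T by (rule orthogonal_transformation_linear)
	have one: "axis {} 1 \<bullet> vec_wedge v x = 0" for v :: "complex ^ 'a" and x
		by (subst inner_commute) (simp add: inner_contraction)
	have "axis {} 1 \<bullet> ext_lin T y = axis {} 1 \<bullet> y" for y
	proof (rule linear_eq_on_wedge_list)
		show "axis {} 1 \<bullet> ext_lin T (wedge_list ws) = axis {} 1 \<bullet> wedge_list ws" for ws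
			by (cases ws) (simp_all add: ext_lin_vec_wedge[OF lT] one)
	qed (rule linear_compose[OF linear_ext_lin bounded_linear.linear[OF bounded_linear_inner_right], unfolded o_def],
			rule bounded_linear.linear[OF bounded_linear_inner_right])
	hence "ext_lin T (wedge_list ws) \<bullet> ext_lin T y = wedge_list ws \<bullet> y" for ws y
		by (induction ws arbitrary: y)
			(simp_all add: ext_lin_vec_wedge[OF lT] inner_contraction contraction_ext_lin[OF T])
	moreover have "linear (%x. ext_lin T x \<bullet> ext_lin T y)" for y
		by (rule linear_compose[OF linear_ext_lin bounded_linear.linear[OF bounded_linear_inner_left], unfolded o_def])
	moreover have "linear (%x. x \<bullet> y)" for y :: "'a ext"
		by (rule bounded_linear.linear[OF bounded_linear_inner_left])
	ultimately have "ext_lin T x \<bullet> ext_lin T y = x \<bullet> y" for x y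
		using linear_eq_on_wedge_list[of "%x. ext_lin T x \<bullet> ext_lin T y" "%x. x \<bullet> y" x] by blast
	thus ?thesis by (simp add: orthogonal_transformation_def linear_ext_lin)
qed

lemma bounded_bilinear_wedge: "bounded_bilinear wedge"
	using bilinear_wedge by (simp add: bilinear_conv_bounded_bilinear)

lemma continuous_on_wedge [continuous_intros]:
	"continuous_on S f ==> continuous_on S g ==> continuous_on S (%x. wedge (f x) (g x))"
	by (rule bounded_bilinear.continuous_on[OF bounded_bilinear_wedge])

lemma continuous_on_ext_vec [continuous_intros]:
	"continuous_on S f ==> continuous_on S (%x. ext_vec (f x))"
	by (rule bounded_linear.continuous_on[OF linear_conv_bounded_linear[THEN iffD1, OF linear_ext_vec]])

lemma measurable_wedge [measurable]:
	"f : borel_measurable M ==> g : borel_measurable M ==> (%x. wedge (f x) (g x)) : borel_measurable M"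
	by (rule borel_measurable_continuous_Pair) (auto intro!: continuous_intros)

lemma measurable_ext_vec [measurable]: "ext_vec : borel_measurable borel"
	by (rule linear_borel[OF linear_ext_vec])

section \<open>Simple vectors\<close>

lemma wedge_list_span_zero: "v : span (set ws) ==> vec_wedge v (wedge_list ws) = 0"
	by (rule linear_eq_0_on_span[OF linear_vec_wedge, of "set ws"]) (auto simp: vec_wedge_mem)

lemma wedge_list_move:
	"wedge_list (a @ x # b) = wedge_list (x # a @ b) \<or> wedge_list (a @ x # b) = - wedge_list (x # a @ b)"
proof (induction a)
	case (Cons y a)
	thus ?case
	proof
		assume "wedge_list (a @ x # b) = wedge_list (x # a @ b)"
		thus ?thesis by (simp add: vec_wedge_anticommute[of y x])
	next
		assume "wedge_list (a @ x # b) = - wedge_list (x # a @ b)"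
		thus ?thesis by (simp add: vec_wedge_anticommute[of y x] wedge_linear_simps)
	qed
qed simp

text \<open>The sign is left undetermined because zonoids only see |<u, xi>|.\<close>

lemma wedge_list_perm:
	"mset xs = mset ys ==> wedge_list xs = wedge_list ys \<or> wedge_list xs = - wedge_list ys"
proof (induction xs arbitrary: ys)
	case (Cons x xs)
	hence "x : set ys" by (metis list.set_intros(1) mset_eq_setD)
	then obtain a b where ys: "ys = a @ x # b" by (meson split_list)
	hence "mset xs = mset (a @ b)" using Cons.prems by simp
	from Cons.IH[OF this] wedge_list_move[of a x b] show ?case
		by (auto simp: ys wedge_linear_simps)
qed simp

lemma wedge_list_not_distinct: "\<not> distinct ws ==> wedge_list ws = 0"
	by (induction ws) (auto simp: vec_wedge_mem wedge_linear_simps)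

text \<open>The sign of graded commutativity is invisible in K(xi), and so the algebra of zonoids of
  simple vectors is commutative (\<open>grass_gen_commute\<close>).\<close>

lemma wedge_commute_simple:
	assumes "simple_vector d x" "simple_vector e y"
	shows "wedge x y = wedge y x \<or> wedge x y = - wedge y x"
proof -
	obtain xs ys where "x = wedge_list xs" "y = wedge_list ys" using assms by (auto simp: simple_vector_def)
	thus ?thesis using wedge_list_perm[of "xs @ ys" "ys @ xs"] by (simp add: wedge_list_append)
qed

lemma simple_vector_wedge:
	"simple_vector d x ==> simple_vector e y ==> simple_vector (d + e) (wedge x y)"
	unfolding simple_vector_def by (metis length_append wedge_list_append)

text \<open>In degree 0 only the scalar 1 counts as simple, so there must be a factor that can
  absorb \<open>c\<close>.\<close>

lemma simple_vector_scaleR: "0 < d ==> simple_vector d x ==> simple_vector d (c *\<^sub>R x)"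
proof -
	assume d: "0 < d" and "simple_vector d x"
	then obtain ws where ws: "length ws = d" "x = wedge_list ws" by (auto simp: simple_vector_def)
	then obtain v vs where "ws = v # vs" using d by (cases ws) auto
	thus "simple_vector d (c *\<^sub>R x)"
		unfolding simple_vector_def using ws
		by (intro exI[of _ "c *\<^sub>R v # vs"]) (simp add: linear_scale[OF linear_ext_vec] wedge_linear_simps)
qed

lemma wedge_list_in_span:
	assumes "set ws \<subseteq> span B"
	shows "wedge_list ws : span {wedge_list us | us. set us \<subseteq> B & length us = length ws}"
	using assms
proof (induction ws)
	case Nil
	thus ?case by (intro span_base) auto
next
	case (Cons w ws)
	let ?P = "%n. span {wedge_list us | us. set us \<subseteq> B & length us = n}"
	have 1: "vec_wedge b x : ?P (Suc (length ws))" if "b : B" "x : ?P (length ws)" for b x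
		using that(2)
	proof (induction rule: span_induct_alt)
		case base
		thus ?case by (simp add: wedge_linear_simps span_zero)
	next
		case (step c x y)
		then obtain us where us: "x = wedge_list us" "set us \<subseteq> B" "length us = length ws" by blast
		hence "vec_wedge b x : ?P (Suc (length ws))"
			using that(1) by (intro span_base CollectI exI[of _ "b # us"]) auto
		thus ?case using step by (simp add: wedge_linear_simps span_add span_scale)
	qed
	have "w : span B" "set ws \<subseteq> span B" using Cons.prems by auto
	from this(1) have "vec_wedge w (wedge_list ws) : ?P (Suc (length ws))"
	proof (induction rule: span_induct_alt)
		case base
		thus ?case by (simp add: linear_0[OF linear_vec_wedge] span_zero)
	next
		case (step c x y)
		thus ?case
			using 1[OF _ Cons.IH[OF \<open>set ws \<subseteq> span B\<close>]]
			by (simp add: linear_add[OF linear_vec_wedge] linear_scale[OF linear_vec_wedge] span_add span_scale)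
	qed
	thus ?case by simp
qed

text \<open>The top exterior power of a space spanned by \<open>length vs\<close> vectors is at most
  a line. Hence the spanning list chosen in \<open>conormal_unit\<close> matters only up to a
  scalar.\<close>

lemma wedge_list_multiple:
	assumes "set ws \<subseteq> span (set vs)" "length ws = length vs"
	obtains c where "wedge_list ws = c *\<^sub>R wedge_list vs"
proof -
	have "wedge_list us : span {wedge_list vs}" if "set us \<subseteq> set vs" "length us = length vs" for us
	proof (cases "distinct us")
		case True
		have "card (set vs) <= length vs" by (rule card_length)
		hence "set us = set vs" using True that by (metis card_seteq distinct_card List.finite_set)
		moreover have "distinct vs" using True that calculation by (metis card_distinct distinct_card)
		ultimately have "mset us = mset vs" using True by (simp add: set_eq_iff_mset_eq_distinct)
		from wedge_list_perm[OF this] show ?thesis using span_neg[OF span_base[of "wedge_list vs" "{wedge_list vs}"]]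
			by (auto intro: span_base)
	next
		case False
		thus ?thesis by (simp add: wedge_list_not_distinct span_zero)
	qed
	hence "{wedge_list us | us. set us \<subseteq> set vs & length us = length ws} \<subseteq> span {wedge_list vs}"
		using assms(2) by auto
	hence "wedge_list ws : span {wedge_list vs}"
		using wedge_list_in_span[OF assms(1)] by (metis (no_types, lifting) span_mono span_span subsetD)
	thus ?thesis using that by (auto simp: span_singleton)
qed

section \<open>Dual and orthonormal lists\<close>

definition biorthogonal :: "('a::real_inner) list => 'a list => bool"
	where "biorthogonal ws vs \<longleftrightarrow> length ws = length vs &
		(ALL i<length ws. ALL j<length vs. ws ! i \<bullet> vs ! j = (if i = j then 1 else 0))"

lemma biorthogonal_Cons:
	"biorthogonal (w # ws) (v # vs) \<longleftrightarrow> biorthogonal ws vs & w \<bullet> v = 1 &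
		(ALL u:set vs. w \<bullet> u = 0) & (ALL u:set ws. u \<bullet> v = 0)"
	unfolding biorthogonal_def all_set_conv_all_nth length_Cons All_less_Suc2 by auto

lemma contraction_orthogonal: "(!!u. u : set ws ==> v \<bullet> u = 0) ==> contraction v (wedge_list ws) = 0"
	by (induction ws) (auto simp: contraction_vec_wedge wedge_linear_simps)

text \<open>Each vector of the first list pairs only with its partner in the second, so contraction
  peels off the pairs one at a time.\<close>

lemma inner_wedge_list_biorthogonal:
	"biorthogonal ws vs ==> wedge_list ws \<bullet> wedge_list vs = 1"
proof (induction ws arbitrary: vs)
	case Nil
	thus ?case by (auto simp: biorthogonal_def inner_axis)
next
	case (Cons w ws)
	then obtain v us where vs: "vs = v # us" by (cases vs) (auto simp: biorthogonal_def)
	hence "biorthogonal ws us" "w \<bullet> v = 1" "ALL u:set us. w \<bullet> u = 0"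
		using Cons.prems by (auto simp: biorthogonal_Cons)
	thus ?case
		using Cons.IH by (simp add: vs inner_contraction contraction_vec_wedge contraction_orthogonal wedge_linear_simps)
qed

text \<open>Pairing a linear relation with \<open>vs ! i\<close> isolates one coefficient. The lists
  to come are gradients of equations: independent but not orthonormal, with a dual list supplied by
  surjectivity of the differential.\<close>

lemma biorthogonal_distinct_independent:
	fixes ws :: "'a::euclidean_space list"
	assumes "biorthogonal ws vs"
	shows "distinct ws" "independent (set ws)" "dim (span (set ws)) = length ws"
proof -
	have d: "ws ! i \<bullet> vs ! j = (if i = j then 1 else 0)" if "i < length ws" "j < length ws" for i j
		using assms that by (auto simp: biorthogonal_def)
	show dis: "distinct ws" unfolding distinct_conv_nth using d by (metis zero_neq_one)
	show ind: "independent (set ws)"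
	proof
		assume "dependent (set ws)"
		then obtain u v where uv: "v : set ws" "u v ~= 0" "(SUM w:set ws. u w *\<^sub>R w) = 0"
			by (auto simp: dependent_finite)
		obtain i where i: "i < length ws" "v = ws ! i" using uv(1) by (metis in_set_conv_nth)
		have "0 = (SUM w:set ws. u w *\<^sub>R w) \<bullet> vs ! i" using uv(3) by simp
		also have "... = (SUM w:set ws. if w = v then u v else 0)"
			unfolding inner_sum_left
		proof (intro sum.cong refl)
			fix w assume "w : set ws"
			then obtain k where "k < length ws" "w = ws ! k" by (metis in_set_conv_nth)
			thus "u w *\<^sub>R w \<bullet> vs ! i = (if w = v then u v else 0)"
				using d[of k i] i dis by (auto simp: nth_eq_iff_index_eq)
		qed
		also have "... = u v" using uv(1) by simp
		finally show False using uv(2) by simp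
	qed
	show "dim (span (set ws)) = length ws" using ind dis by (simp add: dim_eq_card_independent distinct_card)
qed

definition orthonormal_list :: "('a::real_inner) list => bool"
	where "orthonormal_list fs \<longleftrightarrow> distinct fs & (ALL f:set fs. ALL g:set fs. f \<bullet> g = (if f = g then 1 else 0))"

lemma orthonormal_list_Nil [simp]: "orthonormal_list []"
	by (simp add: orthonormal_list_def)

lemma orthonormal_list_Cons:
	"orthonormal_list (f # fs) \<longleftrightarrow> orthonormal_list fs & norm f = 1 & (ALL g:set fs. f \<bullet> g = 0)"
	unfolding orthonormal_list_def by (auto simp: norm_eq_1 inner_commute)

lemma orthonormal_list_biorthogonal: "orthonormal_list fs ==> biorthogonal fs fs"
	by (induction fs) (auto simp: orthonormal_list_Cons biorthogonal_Cons norm_eq_1 inner_commute, simp add: biorthogonal_def)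

lemma norm_wedge_list_orthonormal: "orthonormal_list fs ==> norm (wedge_list fs) = 1"
	by (simp add: norm_eq_1 inner_wedge_list_biorthogonal orthonormal_list_biorthogonal)

lemma orthonormal_list_projection:
	assumes "orthonormal_list fs" "g : set fs"
	shows "(w - (SUM f:set fs. (w \<bullet> f) *\<^sub>R f)) \<bullet> g = 0"
proof -
	have "(SUM f:set fs. (w \<bullet> f) *\<^sub>R f) \<bullet> g = (SUM f:set fs. if f = g then w \<bullet> g else 0)"
		unfolding inner_sum_left using assms by (intro sum.cong) (auto simp: orthonormal_list_def)
	thus ?thesis using assms(2) by (simp add: inner_diff_left)
qed

text \<open>Gram-Schmidt: removing from \<open>w\<close> its projection to the span of the later
  vectors leaves the wedge product unchanged.\<close>

lemma wedge_list_orthonormal_form: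
	"wedge_list ws = 0 \<or> (EX c fs. orthonormal_list fs & length fs = length ws & wedge_list ws = c *\<^sub>R wedge_list fs)"
proof (induction ws)
	case Nil
	thus ?case by (intro disjI2 exI[of _ 1] exI[of _ "[]"]) simp
next
	case (Cons w ws)
	show ?case
	proof (cases "wedge_list ws = 0")
		case True
		thus ?thesis by (simp add: wedge_linear_simps)
	next
		case False
		with Cons obtain c fs where fs: "orthonormal_list fs" "length fs = length ws" "wedge_list ws = c *\<^sub>R wedge_list fs" by blast
		define p where "p = (SUM f:set fs. (w \<bullet> f) *\<^sub>R f)"
		have "p : span (set fs)" unfolding p_def by (intro span_sum span_scale span_base)
		hence "vec_wedge p (wedge_list fs) = 0" by (rule wedge_list_span_zero)
		moreover have "vec_wedge w (wedge_list fs) = vec_wedge p (wedge_list fs) + vec_wedge (w - p) (wedge_list fs)"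
			by (simp flip: linear_add[OF linear_vec_wedge])
		ultimately have eq: "wedge_list (w # ws) = c *\<^sub>R vec_wedge (w - p) (wedge_list fs)"
			by (simp add: fs(3) wedge_linear_simps)
		show ?thesis
		proof (cases "w - p = 0")
			case True
			thus ?thesis unfolding eq by (simp only: True linear_0[OF linear_vec_wedge]) simp
		next
			case ne: False
			let ?f = "(1 / norm (w - p)) *\<^sub>R (w - p)"
			have on: "orthonormal_list (?f # fs)"
				using ne fs(1) orthonormal_list_projection[OF fs(1), of _ w, folded p_def] by (simp add: orthonormal_list_Cons)
			have "vec_wedge (w - p) (wedge_list fs) = norm (w - p) *\<^sub>R wedge_list (?f # fs)"
				using ne by (simp add: linear_scale[OF linear_vec_wedge])
			hence "wedge_list (w # ws) = (c * norm (w - p)) *\<^sub>R wedge_list (?f # fs)" unfolding eq by simp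
			moreover have "length (?f # fs) = length (w # ws)" using fs(2) by simp
			ultimately show ?thesis using on by blast
		qed
	qed
qed

text \<open>Once the tails are matched by \<open>T\<close>, one reflection moves \<open>T e\<close>
  to \<open>f\<close>. It fixes the tail, whose vectors are orthogonal to both.\<close>

lemma orthonormal_list_transitive:
	fixes es fs :: "'a::euclidean_space list"
	assumes "orthonormal_list es" "orthonormal_list fs" "length es = length fs"
	obtains T where "orthogonal_transformation T" "map T es = fs"
proof -
	have "EX T. orthogonal_transformation T & map T es = fs"
		using assms(3,1,2)
	proof (induction es fs rule: list_induct2)
		case Nil
		thus ?case by (intro exI[of _ "%x. x"]) simp
	next
		case (Cons e es f fs)
		then obtain T where T: "orthogonal_transformation T" "map T es = fs" by (auto simp: orthonormal_list_Cons)
		have "norm (T e) = norm f" using Cons.prems T(1) by (simp add: orthonormal_list_Cons orthogonal_transformation_norm)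
		then obtain R where R: "orthogonal_transformation R" "R (T e) = f" "!!z. z \<bullet> T e = z \<bullet> f ==> R z = z"
			by (rule orthogonal_transformation_maps) blast
		have "R z = z" if "z : set fs" for z
		proof (rule R(3))
			have "z : T ` set es" using that T(2) by (metis set_map)
			then obtain y where y: "y : set es" "z = T y" by blast
			have "z \<bullet> T e = y \<bullet> e" using T(1) y(2) by (simp add: orthogonal_transformation_def)
			also have "... = z \<bullet> f" using Cons.prems y(1) that by (simp add: orthonormal_list_Cons inner_commute[of _ e] inner_commute[of _ f])
			finally show "z \<bullet> T e = z \<bullet> f" .
		qed
		hence "map (R o T) (e # es) = f # fs" using T(2) R(2) by (auto simp: map_idI simp flip: map_map)
		moreover have "orthogonal_transformation (R o T)" by (rule orthogonal_transformation_compose[OF R(1) T(1)])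
		ultimately show ?case by (intro exI[of _ "R o T"] conjI)
	qed
	with that show ?thesis by blast
qed

section \<open>Interior products and measurability of simplicity\<close>

lemma wedge_list_shear:
	"vec_wedge v (wedge_list (map (%u. u - c u *\<^sub>R v) ws)) = vec_wedge v (wedge_list ws)"
proof (induction ws)
	case (Cons u ws)
	let ?X = "wedge_list (map (%u. u - c u *\<^sub>R v) ws)"
	have "vec_wedge v (vec_wedge (u - c u *\<^sub>R v) ?X) = vec_wedge v (vec_wedge u ?X)"
		by (simp add: linear_diff[OF linear_vec_wedge] linear_scale[OF linear_vec_wedge] wedge_linear_simps)
	thus ?case by (simp add: vec_wedge_anticommute[of v u] Cons wedge_linear_simps)
qed simp

text \<open>Contraction preserves simplicity. At the first factor \<open>v\<close> not orthogonal to
  \<open>w\<close>, subtracting multiples of \<open>v\<close> from the later factors makes them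
  orthogonal to \<open>w\<close> without changing the product, and the contraction then deletes
  \<open>v\<close> up to a scalar.\<close>

lemma contraction_wedge_list:
	assumes "ws ~= []"
	obtains us c where "length us = length ws - 1" "contraction w (wedge_list ws) = c *\<^sub>R wedge_list us"
proof -
	have "EX us c. length us = length ws - 1 & contraction w (wedge_list ws) = c *\<^sub>R wedge_list us"
		using assms
	proof (induction ws)
		case (Cons v ws)
		show ?case
		proof (cases "w \<bullet> v = 0")
			case True
			show ?thesis
			proof (cases "ws = []")
				case True
				thus ?thesis using contraction_vec_wedge[of w v "axis {} 1"]
					by (intro exI[of _ "[]"] exI[of _ "w \<bullet> v"]) (simp add: wedge_linear_simps)
			next
				case False
				then obtain us c where "length us = length ws - 1" "contraction w (wedge_list ws) = c *\<^sub>R wedge_list us"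
					using Cons.IH by blast
				thus ?thesis using True False
					by (intro exI[of _ "v # us"] exI[of _ "- c"]) (simp add: contraction_vec_wedge wedge_linear_simps)
			qed
		next
			case False
			let ?ws = "map (%u. u - ((w \<bullet> u) / (w \<bullet> v)) *\<^sub>R v) ws"
			have "contraction w (wedge_list ?ws) = 0"
				using False by (intro contraction_orthogonal) (auto simp: inner_diff_right)
			hence "contraction w (wedge_list (v # ws)) = (w \<bullet> v) *\<^sub>R wedge_list ?ws"
				using contraction_vec_wedge[of w v "wedge_list ?ws"] by (simp add: wedge_list_shear wedge_linear_simps)
			thus ?thesis by (intro exI[of _ ?ws] exI[of _ "w \<bullet> v"]) simp
		qed
	qed simp
	with that show ?thesis by blast
qed

text \<open>The adjoint of left multiplication by \<open>x\<close>. It will move a factor of a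
  product of zonoids to the other side of the pairing.\<close>

definition interior_mult :: "'n::finite ext => 'n ext => 'n ext"
	where "interior_mult x = adjoint (wedge x)"

lemma inner_interior: "wedge x y \<bullet> z = y \<bullet> interior_mult x z"
	unfolding interior_mult_def by (rule adjoint_works[OF linear_wedge_right, symmetric])

lemma interior_eqI: "(!!y. wedge x y \<bullet> z = y \<bullet> w) ==> interior_mult x z = w"
	by (rule vector_eq_ldot[THEN iffD1]) (simp flip: inner_interior)

lemma bilinear_interior: "bilinear interior_mult"
	unfolding bilinear_def
	by (auto intro!: linearI interior_eqI simp: wedge_linear_simps inner_add_left inner_add_right inner_interior)

lemma bounded_bilinear_interior: "bounded_bilinear interior_mult"
	using bilinear_interior by (simp add: bilinear_conv_bounded_bilinear)

lemma measurable_interior [measurable]: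
	"f : borel_measurable M ==> g : borel_measurable M ==> (%x. interior_mult (f x) (g x)) : borel_measurable M"
	by (rule borel_measurable_continuous_Pair)
		(auto intro!: bounded_bilinear.continuous_on[OF bounded_bilinear_interior] continuous_intros)

text \<open>Iterated contraction. Simplicity of the result is what keeps the test zonoid in
  \<open>null_deg_wedge\<close> a Grassmann zonoid.\<close>

lemma interior_wedge_list:
	assumes "length vs <= length ws"
	obtains us c where "length us = length ws - length vs" "interior_mult (wedge_list vs) (wedge_list ws) = c *\<^sub>R wedge_list us"
proof -
	have "EX us c. length us = length ws - length vs & interior_mult (wedge_list vs) (wedge_list ws) = c *\<^sub>R wedge_list us"
		using assms
	proof (induction vs arbitrary: ws)
		case Nil
		show ?case by (intro exI[of _ ws] exI[of _ 1]) (auto intro!: interior_eqI)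
	next
		case (Cons v vs)
		hence "ws ~= []" by auto
		then obtain us c where us: "length us = length ws - 1" "contraction v (wedge_list ws) = c *\<^sub>R wedge_list us"
			by (rule contraction_wedge_list)
		then obtain ts d where ts: "length ts = length us - length vs" "interior_mult (wedge_list vs) (wedge_list us) = d *\<^sub>R wedge_list ts"
			using Cons.IH[of us] Cons.prems by fastforce
		have "interior_mult (wedge_list (v # vs)) (wedge_list ws) = (c * d) *\<^sub>R wedge_list ts"
			by (rule interior_eqI, simp only: wedge_list_Cons wedge_assoc inner_contraction us(2))
				(simp add: inner_interior ts(2))
		thus ?case using us ts by (intro exI[of _ ts] exI[of _ "c * d"]) auto
	qed
	with that show ?thesis by blast
qed

text \<open>Compact sets that exhaust the simple vectors as the radius grows over the naturals; they
  show that simplicity is a Borel condition.\<close>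

primrec simple_ball :: "nat => real => 'n::finite ext set"
	where "simple_ball 0 R = {axis {} 1}"
	| "simple_ball (Suc d) R = (%(v, x). vec_wedge v x) ` (cball 0 R \<times> simple_ball d R)"

lemma compact_simple_ball: "compact (simple_ball d R)"
	by (induction d) (auto intro!: compact_continuous_image compact_Times continuous_intros simp: split_beta)

lemma simple_vector_iff_simple_ball: "simple_vector d x \<longleftrightarrow> (EX k::nat. x : simple_ball d (real k))"
proof
	assume "simple_vector d x"
	then obtain ws where ws: "length ws = d" "x = wedge_list ws" by (auto simp: simple_vector_def)
	obtain k :: nat where k: "(\<Sum>w\<leftarrow>ws. norm w) <= real k" using real_arch_simple by blast
	have "norm w <= real k" if "w : set ws" for w
	proof -
		have "norm w <= (\<Sum>w\<leftarrow>ws. norm w)" using that by (intro member_le_sum_list) auto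
		with k show ?thesis by simp
	qed
	hence "wedge_list ws : simple_ball (length ws) (real k)"
		by (induction ws) force+
	thus "EX k::nat. x : simple_ball d (real k)" using ws by blast
next
	assume "EX k::nat. x : simple_ball d (real k)"
	then obtain k where "x : simple_ball d (real k)" by blast
	thus "simple_vector d x"
	proof (induction d arbitrary: x)
		case 0
		thus ?case by (auto simp: simple_vector_def)
	next
		case (Suc d)
		then obtain v y where "x = vec_wedge v y" "y : simple_ball d (real k)" by auto
		moreover from Suc.IH[OF this(2)] obtain ws where "length ws = d" "y = wedge_list ws"
			by (auto simp: simple_vector_def)
		ultimately show ?case unfolding simple_vector_def by (intro exI[of _ "v # ws"]) simp
	qed
qed

lemma borel_simple_vector [measurable]: "{x :: 'n::finite ext. simple_vector d x} : sets borel"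
proof -
	have "{x :: 'n ext. simple_vector d x} = (\<Union>k::nat. simple_ball d (real k))"
		by (auto simp: simple_vector_iff_simple_ball)
	moreover have "(\<Union>k::nat. simple_ball d (real k) :: 'n ext set) : sets borel"
		by (intro sets.countable_UN) (auto intro!: borel_closed compact_imp_closed compact_simple_ball)
	ultimately show ?thesis by simp
qed

section \<open>The algebra of Grassmann zonoids\<close>

text \<open>The maps picked by SOME are prescribed on these zonoids, so identities between them are
  proved on this span, which contains all Grassmann zonoids.\<close>

abbreviation law_span :: "'a::euclidean_space vzonoid set"
	where "law_span \<equiv> span {vz mu (%x. x) | mu. integrable_law mu}"

lemma wedge_norm_bound: obtains C where "0 < C" "!!x y :: 'n::finite ext. norm (wedge x y) <= C * norm x * norm y"
	using bounded_bilinear.pos_bounded[OF bounded_bilinear_wedge] by (metis mult.commute mult.assoc)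

lemma integrable_pair_bilinear:
	fixes f :: "'a::euclidean_space => 'b::euclidean_space => 'c::euclidean_space"
	assumes f: "bounded_bilinear f" and M: "prob_space M" "integrable M xi" and N: "prob_space N" "integrable N ze"
	shows "integrable (M \<Otimes>\<^sub>M N) (%(a, b). f (xi a) (ze b))"
proof -
	obtain C where C: "!!x y. norm (f x y) <= norm x * norm y * C"
		using bounded_bilinear.pos_bounded[OF f] by blast
	have [measurable]: "xi : borel_measurable M" "ze : borel_measurable N" using M N by auto
	have "continuous_on UNIV (%x. f (fst x) (snd x))"
		by (intro bounded_bilinear.continuous_on[OF f] continuous_intros)
	hence [measurable]: "(%x. f (fst x) (snd x)) : borel_measurable borel" by (rule borel_measurable_continuous_onI)
	have "(%x. f (fst (xi (fst x), ze (snd x))) (snd (xi (fst x), ze (snd x)))) : borel_measurable (M \<Otimes>\<^sub>M N)"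
		by measurable
	thus ?thesis
		by (intro integrable_pair_bound[where a="%a. C * norm (xi a)" and b="%b. norm (ze b)"])
			(use M N C in \<open>auto simp: split_beta mult_ac\<close>)
qed

text \<open>The two orders of integration. In each, the inner integral is twice the support function
  of one factor at a vector determined by the other, so the product respects linear relations in
  both factors.\<close>

lemma vz_wedge_law_support:
	fixes mu nu :: "'n::finite ext measure"
	assumes mu: "integrable_law mu" and nu: "integrable_law nu"
	shows "vz_support (vz (mu \<Otimes>\<^sub>M nu) (%(x, y). wedge x y)) u = 1/2 * (LINT y|nu. \<integral>x. abs (adjoint (%x. wedge x y) u \<bullet> x) \<partial>mu)"
		"vz_support (vz (mu \<Otimes>\<^sub>M nu) (%(x, y). wedge x y)) u = 1/2 * (LINT x|mu. \<integral>y. abs (interior_mult x u \<bullet> y) \<partial>nu)"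
		"integrable nu (%y. \<integral>x. abs (adjoint (%x. wedge x y) u \<bullet> x) \<partial>mu)"
		"integrable mu (%x. \<integral>y. abs (interior_mult x u \<bullet> y) \<partial>nu)"
proof -
	obtain C where C: "0 < C" "!!x y :: 'n ext. norm (wedge x y) <= C * norm x * norm y" by (rule wedge_norm_bound) blast
	have i: "integrable (mu \<Otimes>\<^sub>M nu) (%(x, y). wedge x y)"
		using integrable_pair_bilinear[OF bounded_bilinear_wedge integrable_law_prob[OF mu] integrable_law_integrable[OF mu]
			integrable_law_prob[OF nu] integrable_law_integrable[OF nu]] by simp
	have "\<bar>u \<bullet> wedge x y\<bar> <= norm u * C * norm x * norm y" for x y
	proof -
		have "\<bar>u \<bullet> wedge x y\<bar> <= norm u * norm (wedge x y)" by (rule Cauchy_Schwarz_ineq2)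
		also have "... <= norm u * (C * norm x * norm y)" using C by (intro mult_left_mono) auto
		finally show ?thesis by (simp add: mult_ac)
	qed
	hence bnd: "norm (case (x, y) of (x, y) => \<bar>u \<bullet> wedge x y\<bar>) <= norm u * C * norm x * norm y" for x y by simp
	have m: "(%(x, y). abs (u \<bullet> wedge x y)) : borel_measurable (borel \<Otimes>\<^sub>M borel)" by measurable
	have s: "vz_support (vz (mu \<Otimes>\<^sub>M nu) (%(x, y). wedge x y)) u = 1/2 * (LINT z|(mu \<Otimes>\<^sub>M nu). (case z of (x, y) => \<bar>u \<bullet> wedge x y\<bar>))"
		by (simp add: vz_support_vz[OF i] split_beta)
	have e1: "adjoint (%x. wedge x y) u \<bullet> x = u \<bullet> wedge x y" for x y :: "'n ext"
		by (simp add: inner_commute adjoint_works[OF linear_wedge_left])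
	have e2: "interior_mult x u \<bullet> y = u \<bullet> wedge x y" for x y :: "'n ext"
		by (metis inner_commute inner_interior)
	note F = integral_law_pair[OF mu nu m bnd]
	show "vz_support (vz (mu \<Otimes>\<^sub>M nu) (%(x, y). wedge x y)) u = 1/2 * (LINT y|nu. \<integral>x. abs (adjoint (%x. wedge x y) u \<bullet> x) \<partial>mu)"
		"vz_support (vz (mu \<Otimes>\<^sub>M nu) (%(x, y). wedge x y)) u = 1/2 * (LINT x|mu. \<integral>y. abs (interior_mult x u \<bullet> y) \<partial>nu)"
		"integrable nu (%y. \<integral>x. abs (adjoint (%x. wedge x y) u \<bullet> x) \<partial>mu)"
		"integrable mu (%x. \<integral>y. abs (interior_mult x u \<bullet> y) \<partial>nu)"
		unfolding s e1 e2 using F(1,2) F(3,4) by simp_all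
qed

lemma vz_wedge_exists:
	"EX f. bilinear f & (ALL mu nu. integrable_law mu --> integrable_law nu -->
			f (vz mu (%x. x)) (vz nu (%y. y)) = vz (mu \<Otimes>\<^sub>M nu) (%(x, y). wedge x (y :: 'n::finite ext)))"
proof -
	let ?T = "%mu nu. vz (mu \<Otimes>\<^sub>M nu) (%(x, y). wedge x (y :: 'n ext))"
	have c1: "(SUM mu:t. c mu *\<^sub>R ?T mu nu) = 0"
		if t: "t \<subseteq> {mu. integrable_law mu}" "nu : {mu. integrable_law mu}"
			"(SUM mu:t. c mu *\<^sub>R vz mu (%x. x)) = 0" for t c nu
	proof (rule vz_support_eqI)
		fix u
		have "vz_support (SUM mu:t. c mu *\<^sub>R ?T mu nu) u =
				(SUM mu:t. 1/2 * (LINT y|nu. c mu * (LINT x|mu. \<bar>adjoint (%x. wedge x y) u \<bullet> x\<bar>)))"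
			unfolding vz_support_sum vz_support_scaleR using t by (intro sum.cong) (auto simp: vz_wedge_law_support(1))
		also have "... = 1/2 * (LINT y|nu. (SUM mu:t. c mu * (LINT x|mu. abs (adjoint (%x. wedge x y) u \<bullet> x))))"
			unfolding sum_distrib_left[symmetric] using t
			by (intro arg_cong2[of _ _ _ _ "(*)"] refl Bochner_Integration.integral_sum[symmetric] integrable_mult_right
					vz_wedge_law_support(3)) auto
		also have "... = 0" using integrable_law_relation[OF t(1,3)] by simp
		finally show "vz_support (SUM mu:t. c mu *\<^sub>R ?T mu nu) u = vz_support 0 u" by simp
	qed
	have c2: "(SUM mu:t. c mu *\<^sub>R ?T nu mu) = 0"
		if t: "t \<subseteq> {mu. integrable_law mu}" "nu : {mu. integrable_law mu}"
			"(SUM mu:t. c mu *\<^sub>R vz mu (%x. x)) = 0" for t c nu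
	proof (rule vz_support_eqI)
		fix u
		have "vz_support (SUM mu:t. c mu *\<^sub>R ?T nu mu) u =
				(SUM mu:t. 1/2 * (LINT x|nu. c mu * (LINT y|mu. \<bar>interior_mult x u \<bullet> y\<bar>)))"
			unfolding vz_support_sum vz_support_scaleR using t by (intro sum.cong) (auto simp: vz_wedge_law_support(2))
		also have "... = 1/2 * (LINT x|nu. (SUM mu:t. c mu * (LINT y|mu. abs (interior_mult x u \<bullet> y))))"
			unfolding sum_distrib_left[symmetric] using t
			by (intro arg_cong2[of _ _ _ _ "(*)"] refl Bochner_Integration.integral_sum[symmetric] integrable_mult_right
					vz_wedge_law_support(4)) auto
		also have "... = 0" using integrable_law_relation[OF t(1,3)] by simp
		finally show "vz_support (SUM mu:t. c mu *\<^sub>R ?T nu mu) u = vz_support 0 u" by simp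
	qed
	obtain f where "bilinear f" "!!mu nu. mu : {mu. integrable_law mu} ==> nu : {mu. integrable_law mu} ==>
			f (vz mu (%x. x)) (vz nu (%x. x)) = ?T mu nu"
		using bilinear_extension[of "{mu. integrable_law mu}" "%mu. vz mu (%x. x)" ?T] c1 c2 by blast
	thus ?thesis by blast
qed

lemma bilinear_vz_wedge: "bilinear vz_wedge"
	and vz_wedge_law: "integrable_law mu ==> integrable_law nu ==>
		vz_wedge (vz mu (%x. x)) (vz nu (%y. y)) = vz (mu \<Otimes>\<^sub>M nu) (%(x, y). wedge x y)"
	using someI_ex[OF vz_wedge_exists] unfolding vz_wedge_def[symmetric] by blast+

lemma vz_wedge_vz:
	fixes xi :: "'w => 'n::finite ext"
	assumes M: "prob_space M" "integrable M xi" and N: "prob_space N" "integrable N ze"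
	shows "vz_wedge (vz M xi) (vz N ze) = vz (M \<Otimes>\<^sub>M N) (%(a, b). wedge (xi a) (ze b))"
proof -
	have m[measurable]: "xi : borel_measurable M" "ze : borel_measurable N" using M N by auto
	interpret N': prob_space "distr N borel ze" by (rule prob_space.prob_space_distr[OF N(1) m(2)])
	have "vz_wedge (vz M xi) (vz N ze) = vz (distr M borel xi \<Otimes>\<^sub>M distr N borel ze) (%(x, y). wedge x y)"
		using vz_wedge_law[OF integrable_law_distr[OF M] integrable_law_distr[OF N]] by (simp add: vz_distr)
	also have "distr M borel xi \<Otimes>\<^sub>M distr N borel ze = distr (M \<Otimes>\<^sub>M N) (borel \<Otimes>\<^sub>M borel) (%(x, y). (xi x, ze y))"
		by (rule pair_measure_distr[OF m N'.sigma_finite_measure_axioms])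
	also have "vz ... (%(x, y). wedge x y) = vz (M \<Otimes>\<^sub>M N) (%(a, b). wedge (xi a) (ze b))"
		by (rule vz_eqI) (simp add: integral_distr split_beta)
	finally show ?thesis .
qed

lemma span_bilinear_closed:
	assumes f: "bilinear f" and "!!a b. a : S ==> b : T ==> f a b : span R" and "A : span S" "B : span T"
	shows "f A B : span R"
proof -
	have 1: "f a B : span R" if "a : S" for a
		using assms(4)
	proof (induction rule: span_induct_alt)
		case (step c x y)
		thus ?case by (simp add: bilinear_radd[OF f] bilinear_rmul[OF f] span_add span_scale assms(2) that)
	qed (simp add: bilinear_rzero[OF f] span_zero)
	show ?thesis
		using assms(3)
	proof (induction rule: span_induct_alt)
		case (step c x y)
		thus ?case by (simp add: bilinear_ladd[OF f] bilinear_lmul[OF f] span_add span_scale 1)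
	qed (simp add: bilinear_lzero[OF f] span_zero)
qed

lemma bilinear_eq_on_span:
	assumes "bilinear f" "bilinear g" "!!a b. a : S ==> b : T ==> f a b = g a b" "A : span S" "B : span T"
	shows "f A B = g A B"
proof -
	have "f a B = g a B" if "a : S" for a
		using linear_eq_on_span[of "f a" "g a" T B] assms that unfolding bilinear_def by blast
	thus ?thesis
		using linear_eq_on_span[of "%A. f A B" "%A. g A B" S A] assms unfolding bilinear_def by blast
qed

section \<open>The ring of Grassmann zonoids\<close>

abbreviation grass_gen :: "nat => 'n::finite ext vzonoid set"
	where "grass_gen d \<equiv> {vz mu (%x. x) | mu. integrable_law mu & (AE x in mu. simple_vector d x)}"

lemma vz_mem_grass_gen:
	assumes "prob_space M" "integrable M xi" "AE om in M. simple_vector d (xi om)"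
	shows "vz M xi : grass_gen d"
proof -
	have m: "xi : borel_measurable M" using assms by auto
	have "AE x in distr M borel xi. simple_vector d x"
		using assms(3) m by (subst AE_distr_iff) (auto simp: borel_simple_vector)
	thus ?thesis using vz_distr[OF m] integrable_law_distr[OF assms(1,2)] by (smt (verit) mem_Collect_eq)
qed

lemma integrable_law_return: "integrable_law (return borel (x :: 'a::euclidean_space))"
proof -
	have "integrable (return borel x) (%x. x)"
		by (rule finite_measure.integrable_const_bound[where B="norm x"])
			(auto intro!: prob_space.finite_measure prob_space_return simp: AE_return)
	thus ?thesis by (simp add: integrable_law_def prob_space_return)
qed

definition unit_zonoid :: "'n::finite ext vzonoid"
	where "unit_zonoid = vz (return borel (axis {} 1)) (%x. x)"

lemma vz_support_unit_zonoid: "vz_support unit_zonoid u = 1/2 * abs (u $ {})"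
	by (simp add: unit_zonoid_def integrable_law_support integrable_law_return integral_return inner_axis)

lemma unit_zonoid_grass_gen: "unit_zonoid : grass_gen 0"
	unfolding unit_zonoid_def
	by (rule CollectI, rule exI[of _ "return borel (axis {} 1)"])
		(auto simp: AE_return simple_vector_def borel_simple_vector integrable_law_return)

text \<open>For \<open>d > 0\<close> the scalar is absorbed by a factor. In degree 0 the vector is a
  random scalar, and its zonoid is the mean absolute value times the unit.\<close>

lemma vz_mem_grass_deg:
	assumes "prob_space M" "integrable M xi" "AE om in M. EX c us. length us = d & xi om = c *\<^sub>R wedge_list us"
	shows "vz M xi : grass_deg d"
proof (cases "d = 0")
	case True
	have ae: "AE om in M. xi om = (xi om $ {}) *\<^sub>R axis {} 1"
		using assms(3) by eventually_elim (auto simp: axis_def True)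
	have m: "xi : borel_measurable M" using assms by auto
	have m2: "(%om. xi om $ {}) : borel_measurable M"
		using borel_measurable_inner[OF m borel_measurable_const[of "axis {} 1"]] by (simp add: inner_axis)
	have eq: "vz M xi = (LINT om|M. abs (xi om $ {})) *\<^sub>R unit_zonoid"
	proof (rule vz_support_eqI)
		fix u
		have "(LINT om|M. abs (u \<bullet> xi om)) = (LINT om|M. abs (xi om $ {}) * abs (u $ {}))"
		proof (rule integral_cong_AE)
			show "AE x in M. abs (u \<bullet> xi x) = abs (xi x $ {}) * abs (u $ {})"
				using ae
			proof eventually_elim
				case (elim x)
				hence "u \<bullet> xi x = u \<bullet> ((xi x $ {}) *\<^sub>R axis {} 1)" by simp
				also have "... = (xi x $ {}) * (u $ {})" by (simp add: inner_axis)
				finally show ?case by (simp add: abs_mult)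
			qed
		qed (use m m2 in \<open>auto intro!: borel_measurable_abs borel_measurable_times borel_measurable_inner\<close>)
		thus "vz_support (vz M xi) u = vz_support ((LINT om|M. abs (xi om $ {})) *\<^sub>R unit_zonoid) u"
			by (simp add: vz_support_vz[OF assms(2)] vz_support_unit_zonoid)
	qed
	show ?thesis
		unfolding eq True grass_deg_def by (rule span_scale[OF span_base[OF unit_zonoid_grass_gen]])
next
	case False
	have "AE om in M. simple_vector d (xi om)"
		using assms(3)
	proof eventually_elim
		case (elim om)
		then obtain c us where "length us = d" "xi om = c *\<^sub>R wedge_list us" by blast
		moreover from this have "simple_vector d (wedge_list us)" by (auto simp: simple_vector_def)
		ultimately show ?case using False by (auto intro: simple_vector_scaleR)
	qed
	thus ?thesis unfolding grass_deg_def by (intro span_base vz_mem_grass_gen assms)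
qed

lemma AE_law_pair:
	assumes "integrable_law mu" "integrable_law nu" "AE x in mu. P x" "AE y in nu. Q y"
	shows "AE z in mu \<Otimes>\<^sub>M nu. P (fst z) & Q (snd z)"
proof -
	interpret M: prob_space mu by (rule integrable_law_prob[OF assms(1)])
	interpret N: prob_space nu by (rule integrable_law_prob[OF assms(2)])
	obtain A where A: "{x : space mu. \<not> P x} \<subseteq> A" "A : null_sets mu" using assms(3) by (auto elim!: AE_E)
	obtain B where B: "{x : space nu. \<not> Q x} \<subseteq> B" "B : null_sets nu" using assms(4) by (auto elim!: AE_E)
	have "A \<times> space nu : null_sets (mu \<Otimes>\<^sub>M nu)" "space mu \<times> B : null_sets (mu \<Otimes>\<^sub>M nu)"
		using A B by (auto simp: null_sets_def N.emeasure_pair_measure_Times)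
	hence "A \<times> space nu Un space mu \<times> B : null_sets (mu \<Otimes>\<^sub>M nu)" by (rule null_sets.Un)
	thus ?thesis
		by (rule AE_I') (use A B in \<open>auto simp: space_pair_measure\<close>)
qed

lemma grass_gen_wedge:
	assumes "A : grass_gen d" "B : grass_gen e" shows "vz_wedge A B : grass_gen (d + e)"
proof -
	obtain mu nu where mu: "integrable_law mu" "AE x in mu. simple_vector d x" "A = vz mu (%x. x)"
		and nu: "integrable_law nu" "AE x in nu. simple_vector e x" "B = vz nu (%x. x)" using assms by auto
	interpret M: prob_space mu by (rule integrable_law_prob[OF mu(1)])
	interpret N: prob_space nu by (rule integrable_law_prob[OF nu(1)])
	interpret P: pair_prob_space mu nu ..
	have "AE z in mu \<Otimes>\<^sub>M nu. simple_vector d (fst z) & simple_vector e (snd z)"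
		by (rule AE_law_pair) (use mu nu in auto)
	hence "AE z in mu \<Otimes>\<^sub>M nu. simple_vector (d + e) (case z of (x, y) => wedge x y)"
		by eventually_elim (auto simp: split_beta intro: simple_vector_wedge)
	moreover have "integrable (mu \<Otimes>\<^sub>M nu) (%(x, y). wedge x y)"
		using integrable_pair_bilinear[OF bounded_bilinear_wedge integrable_law_prob[OF mu(1)] integrable_law_integrable[OF mu(1)]
			integrable_law_prob[OF nu(1)] integrable_law_integrable[OF nu(1)]] by simp
	ultimately show ?thesis
		unfolding mu(3) nu(3) vz_wedge_law[OF mu(1) nu(1)] by (intro vz_mem_grass_gen P.prob_space_axioms) auto
qed

lemma grass_deg_wedge:
	"A : grass_deg d ==> B : grass_deg e ==> vz_wedge A B : grass_deg (d + e)"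
	unfolding grass_deg_def by (erule (1) span_bilinear_closed[OF bilinear_vz_wedge, rotated])
		(intro span_base grass_gen_wedge)

abbreviation grass_carrier :: "'n::finite ext vzonoid set"
	where "grass_carrier \<equiv> span (\<Union>d. grass_gen d)"

lemma span_UN_grass_deg: "span (\<Union>d. grass_deg d) = grass_carrier"
proof (rule antisym)
	have "grass_deg d \<subseteq> grass_carrier" for d :: nat unfolding grass_deg_def by (rule span_mono) blast
	thus "span (\<Union>d. grass_deg d) \<subseteq> grass_carrier" by (intro span_minimal UN_least subspace_span)
	show "grass_carrier \<subseteq> span (\<Union>d. grass_deg d)"
		unfolding grass_deg_def by (intro span_mono UN_mono order_refl span_superset)
qed

lemma grass_carrier_wedge: "A : grass_carrier ==> B : grass_carrier ==> vz_wedge A B : grass_carrier"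
proof (erule (1) span_bilinear_closed[OF bilinear_vz_wedge, rotated])
	fix a b :: "'a ext vzonoid" assume "a : (\<Union>d. grass_gen d)" "b : (\<Union>d. grass_gen d)"
	then obtain d e where "a : grass_gen d" "b : grass_gen e" by (elim UN_E)
	hence "vz_wedge a b : grass_gen (d + e)" by (rule grass_gen_wedge)
	thus "vz_wedge a b : grass_carrier" by (intro span_base UN_I UNIV_I)
qed

text \<open>Exchanging the factors changes the vector almost surely by at most a sign, which the
  absolute value removes.\<close>

lemma grass_gen_commute:
	fixes A B :: "'n::finite ext vzonoid"
	assumes "A : grass_gen d" "B : grass_gen e" shows "vz_wedge A B = vz_wedge B A"
proof -
	obtain mu nu where mu: "integrable_law mu" "AE x in mu. simple_vector d x" "A = vz mu (%x. x)"
		and nu: "integrable_law nu" "AE x in nu. simple_vector e x" "B = vz nu (%x. x)" using assms by auto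
	interpret M: prob_space mu by (rule integrable_law_prob[OF mu(1)])
	interpret N: prob_space nu by (rule integrable_law_prob[OF nu(1)])
	interpret P: pair_prob_space mu nu ..
	show ?thesis
		unfolding mu(3) nu(3) vz_wedge_law[OF mu(1) nu(1)] vz_wedge_law[OF nu(1) mu(1)]
	proof (rule vz_eqI)
		fix u :: "'n ext"
		have b: "(%(x, y). abs (u \<bullet> wedge y x)) : borel_measurable (borel \<Otimes>\<^sub>M borel)"
			"(%(x, y). abs (u \<bullet> wedge x y)) : borel_measurable (borel \<Otimes>\<^sub>M borel)" by measurable
		have eq: "\<bar>u \<bullet> (case z of (x, y) => wedge x y)\<bar> = (case z of (x, y) => \<bar>u \<bullet> wedge x y\<bar>)" for z
			by (cases z) simp
		note m = measurable_law_pair[OF mu(1) nu(1) b(1)] measurable_law_pair[OF mu(1) nu(1) b(2)]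
		have "(LINT z|(nu \<Otimes>\<^sub>M mu). abs (u \<bullet> (case z of (x, y) => wedge x y))) = (LINT z|(mu \<Otimes>\<^sub>M nu). (case z of (x, y) => \<bar>u \<bullet> wedge y x\<bar>))"
			unfolding eq using P.integral_product_swap[OF m(1)] by simp
		also have "... = (LINT z|(mu \<Otimes>\<^sub>M nu). (case z of (x, y) => \<bar>u \<bullet> wedge x y\<bar>))"
		proof (rule integral_cong_AE[OF m])
			show "AE z in mu \<Otimes>\<^sub>M nu. (case z of (x, y) => \<bar>u \<bullet> wedge y x\<bar>) = (case z of (x, y) => \<bar>u \<bullet> wedge x y\<bar>)"
				using AE_law_pair[OF mu(1) nu(1) mu(2) nu(2)]
			proof eventually_elim
				case (elim z)
				thus ?case using wedge_commute_simple[of d "fst z" e "snd z"] by (auto simp: split_beta)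
			qed
		qed
		finally show "(LINT z|(mu \<Otimes>\<^sub>M nu). \<bar>u \<bullet> (case z of (x, y) => wedge x y)\<bar>) =
				(LINT z|(nu \<Otimes>\<^sub>M mu). \<bar>u \<bullet> (case z of (x, y) => wedge x y)\<bar>)"
			unfolding eq by simp
	qed
qed

lemma grass_carrier_commute: "A : grass_carrier ==> B : grass_carrier ==> vz_wedge A B = vz_wedge B A"
proof -
	have "bilinear (%A B. vz_wedge B A)" using bilinear_vz_wedge unfolding bilinear_def by blast
	thus "A : grass_carrier ==> B : grass_carrier ==> vz_wedge A B = vz_wedge B A"
	proof (rule bilinear_eq_on_span[OF bilinear_vz_wedge])
		fix a b :: "'a ext vzonoid" assume "a : (\<Union>d. grass_gen d)" "b : (\<Union>d. grass_gen d)"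
		then obtain d e where "a : grass_gen d" "b : grass_gen e" by (elim UN_E)
		thus "vz_wedge a b = vz_wedge b a" by (rule grass_gen_commute)
	qed
qed

text \<open>Both sides integrate the absolute inner product of \<open>u\<close> with the triple
  product over the three laws. Passing to nonnegative integrals makes Tonelli applicable at each
  stage.\<close>

lemma law_wedge_assoc:
	assumes "integrable_law mu" "integrable_law nu" "integrable_law rho"
	shows "vz_wedge (vz_wedge (vz mu (%x. x)) (vz nu (%x. x))) (vz rho (%x. x)) =
		vz_wedge (vz mu (%x. x)) (vz_wedge (vz nu (%x. x)) (vz rho (%x :: 'n::finite ext. x)))"
proof -
	interpret M: prob_space mu by (rule integrable_law_prob[OF assms(1)])
	interpret N: prob_space nu by (rule integrable_law_prob[OF assms(2)])
	interpret R: prob_space rho by (rule integrable_law_prob[OF assms(3)])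
	interpret MN: pair_prob_space mu nu ..
	interpret NR: pair_prob_space nu rho ..
	interpret MN_R: pair_prob_space "mu \<Otimes>\<^sub>M nu" rho ..
	interpret M_NR: pair_prob_space mu "nu \<Otimes>\<^sub>M rho" ..
	note int = integrable_law_integrable[OF assms(1)] integrable_law_integrable[OF assms(2)] integrable_law_integrable[OF assms(3)]
	have i1: "integrable (mu \<Otimes>\<^sub>M nu) (%(x, y). wedge x y)"
		using integrable_pair_bilinear[OF bounded_bilinear_wedge M.prob_space_axioms int(1) N.prob_space_axioms int(2)] by simp
	have i2: "integrable (nu \<Otimes>\<^sub>M rho) (%(x, y). wedge x y)"
		using integrable_pair_bilinear[OF bounded_bilinear_wedge N.prob_space_axioms int(2) R.prob_space_axioms int(3)] by simp
	have i3: "integrable ((mu \<Otimes>\<^sub>M nu) \<Otimes>\<^sub>M rho) (%(a, z). wedge (case a of (x, y) => wedge x y) z)"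
		by (rule integrable_pair_bilinear[OF bounded_bilinear_wedge MN.prob_space_axioms i1 R.prob_space_axioms int(3)])
	have i4: "integrable (mu \<Otimes>\<^sub>M (nu \<Otimes>\<^sub>M rho)) (%(x, a). wedge x (case a of (x, y) => wedge x y))"
		by (rule integrable_pair_bilinear[OF bounded_bilinear_wedge M.prob_space_axioms int(1) NR.prob_space_axioms i2])
	have "vz ((mu \<Otimes>\<^sub>M nu) \<Otimes>\<^sub>M rho) (%(a, z). wedge (case a of (x, y) => wedge x y) z) =
			vz (mu \<Otimes>\<^sub>M (nu \<Otimes>\<^sub>M rho)) (%(x, a). wedge x (case a of (x, y) => wedge x y))"
	proof (rule vz_eqI)
		fix u :: "'n ext"
		have j3: "integrable ((mu \<Otimes>\<^sub>M nu) \<Otimes>\<^sub>M rho) (%w. abs (u \<bullet> (case w of (a, z) => wedge (case a of (x, y) => wedge x y) z)))"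
			by (rule integrable_abs_inner[OF i3])
		have j4: "integrable (mu \<Otimes>\<^sub>M (nu \<Otimes>\<^sub>M rho)) (%w. abs (u \<bullet> (case w of (x, a) => wedge x (case a of (x, y) => wedge x y))))"
			by (rule integrable_abs_inner[OF i4])
		have [measurable_cong]: "sets mu = sets borel" "sets nu = sets borel" "sets rho = sets borel"
			using assms by (auto simp: integrable_law_def)
		have "ennreal (LINT w|((mu \<Otimes>\<^sub>M nu) \<Otimes>\<^sub>M rho). \<bar>u \<bullet> (case w of (a, z) => wedge (case a of (x, y) => wedge x y) z)\<bar>) =
				(\<integral>\<^sup>+w. ennreal \<bar>u \<bullet> (case w of (a, z) => wedge (case a of (x, y) => wedge x y) z)\<bar> \<partial>((mu \<Otimes>\<^sub>M nu) \<Otimes>\<^sub>M rho))"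
			using nn_integral_eq_integral[OF j3] by simp
		also have "... = (\<integral>\<^sup>+a. \<integral>\<^sup>+z. ennreal \<bar>u \<bullet> wedge (case a of (x, y) => wedge x y) z\<bar> \<partial>rho \<partial>(mu \<Otimes>\<^sub>M nu))"
			by (subst R.nn_integral_fst[symmetric]) (auto simp: split_beta)
		also have "... = (\<integral>\<^sup>+x. \<integral>\<^sup>+y. \<integral>\<^sup>+z. ennreal \<bar>u \<bullet> wedge (wedge x y) z\<bar> \<partial>rho \<partial>nu \<partial>mu)"
			by (subst N.nn_integral_fst[symmetric]) (auto simp: split_beta)
		also have "... = (\<integral>\<^sup>+x. \<integral>\<^sup>+a. ennreal \<bar>u \<bullet> wedge x (case a of (x, y) => wedge x y)\<bar> \<partial>(nu \<Otimes>\<^sub>M rho) \<partial>mu)"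
			by (subst R.nn_integral_fst[symmetric]) (auto simp: split_beta wedge_assoc)
		also have "... = (\<integral>\<^sup>+w. ennreal \<bar>u \<bullet> (case w of (x, a) => wedge x (case a of (x, y) => wedge x y))\<bar> \<partial>(mu \<Otimes>\<^sub>M (nu \<Otimes>\<^sub>M rho)))"
			by (subst NR.nn_integral_fst[symmetric]) (auto simp: split_beta)
		also have "... = ennreal (LINT w|(mu \<Otimes>\<^sub>M (nu \<Otimes>\<^sub>M rho)). abs (u \<bullet> (case w of (x, a) => wedge x (case a of (x, y) => wedge x y))))"
			using nn_integral_eq_integral[OF j4] by simp
		finally show "(LINT w|((mu \<Otimes>\<^sub>M nu) \<Otimes>\<^sub>M rho). \<bar>u \<bullet> (case w of (a, z) => wedge (case a of (x, y) => wedge x y) z)\<bar>) =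
				(LINT w|(mu \<Otimes>\<^sub>M (nu \<Otimes>\<^sub>M rho)). \<bar>u \<bullet> (case w of (x, a) => wedge x (case a of (x, y) => wedge x y))\<bar>)"
			by (subst (asm) ennreal_inj) auto
	qed
	thus ?thesis
		unfolding vz_wedge_law[OF assms(1,2)] vz_wedge_law[OF assms(2,3)]
			vz_wedge_vz[OF MN.prob_space_axioms i1 R.prob_space_axioms int(3)]
			vz_wedge_vz[OF M.prob_space_axioms int(1) NR.prob_space_axioms i2] .
qed

lemma law_span_wedge_assoc:
	assumes "A : law_span" "B : law_span" "C : law_span"
	shows "vz_wedge (vz_wedge A B) C = vz_wedge A (vz_wedge B (C :: 'n::finite ext vzonoid))"
proof -
	have l: "linear (vz_wedge x)" "linear (%x. vz_wedge x y)" for x y :: "'n ext vzonoid"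
		using bilinear_vz_wedge unfolding bilinear_def by blast+
	let ?L = "{vz mu (%x :: 'n ext. x) | mu. integrable_law mu}"
	have 1: "vz_wedge (vz_wedge a b) C = vz_wedge a (vz_wedge b C)" if "a : ?L" "b : ?L" for a b
		using that law_wedge_assoc
		by (intro linear_eq_on_span[OF l(1) linear_compose[OF l(1) l(1), unfolded o_def] _ assms(3)]) auto
	have 2: "vz_wedge (vz_wedge a B) C = vz_wedge a (vz_wedge B C)" if "a : ?L" for a
		by (rule linear_eq_on_span[OF linear_compose[OF l(1) l(2), unfolded o_def] linear_compose[OF l(2) l(1), unfolded o_def] _ assms(2)])
			(use that 1 in blast)
	show ?thesis
		by (rule linear_eq_on_span[OF linear_compose[OF l(2) l(2), unfolded o_def] l(2) _ assms(1)]) (use 2 in blast)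
qed

lemma law_span_wedge_unit:
	assumes "A : law_span"
	shows "vz_wedge unit_zonoid A = (A :: 'n::finite ext vzonoid)"
proof -
	have "vz_wedge unit_zonoid (vz mu (%x. x)) = vz mu (%x. x :: 'n ext)" if mu: "integrable_law mu" for mu
	proof (rule vz_support_eqI)
		have e: "interior_mult (axis {} 1) u = u" for u :: "'n ext" by (rule interior_eqI) simp
		fix u
		have m: "(%x. \<integral>y. abs (interior_mult x u \<bullet> y) \<partial>mu) : borel_measurable borel"
			using borel_measurable_integrable[OF vz_wedge_law_support(4)[OF integrable_law_return mu]] by (simp cong: measurable_cong_sets)
		show "vz_support (vz_wedge unit_zonoid (vz mu (%x. x))) u = vz_support (vz mu (%x. x)) u"
			unfolding unit_zonoid_def vz_wedge_law[OF integrable_law_return mu] vz_wedge_law_support(2)[OF integrable_law_return mu]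
			by (simp add: integral_return[OF _ m] e integrable_law_support[OF mu])
	qed
	thus ?thesis
		using bilinear_vz_wedge unfolding bilinear_def
		by (intro linear_eq_on_span[OF _ linear_ident _ assms, of "vz_wedge unit_zonoid"]) auto
qed

lemma grass_gen_law: "grass_gen d \<subseteq> {vz mu (%x. x) | mu. integrable_law mu}"
	by blast

lemma grass_deg_law_span: "grass_deg d \<subseteq> law_span"
	unfolding grass_deg_def by (rule span_mono[OF grass_gen_law])

lemma grass_carrier_law_span: "grass_carrier \<subseteq> law_span"
	by (rule span_mono) blast

lemma grass_deg_carrier: "grass_deg d \<subseteq> grass_carrier"
	unfolding grass_deg_def by (rule span_mono) blast

lemma unit_zonoid_carrier: "unit_zonoid : grass_carrier"
	using unit_zonoid_grass_gen by (intro span_base) blast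

lemma grass_algebra_simps [simp]:
	"carrier grass_algebra = grass_carrier" "mult grass_algebra = vz_wedge" "one grass_algebra = unit_zonoid"
	"zero grass_algebra = 0" "add grass_algebra = (+)"
	by (simp_all add: grass_algebra_def span_UN_grass_deg unit_zonoid_def)

lemma ring_grass_algebra: "ring (grass_algebra :: 'n::finite ext vzonoid ring)"
proof (rule ringI)
	show "abelian_group (grass_algebra :: 'n ext vzonoid ring)"
	proof (rule abelian_groupI)
		fix x :: "'n ext vzonoid" assume "x : carrier grass_algebra"
		thus "EX y:carrier grass_algebra. y \<oplus>\<^bsub>grass_algebra\<^esub> x = \<zero>\<^bsub>grass_algebra\<^esub>"
			by (intro bexI[of _ "- x"]) (simp_all add: span_neg)
	qed (simp_all add: span_add span_zero add.assoc add.commute)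
	show "monoid (grass_algebra :: 'n ext vzonoid ring)"
	proof (rule monoidI)
		show "x \<otimes>\<^bsub>grass_algebra\<^esub> y \<otimes>\<^bsub>grass_algebra\<^esub> z = x \<otimes>\<^bsub>grass_algebra\<^esub> (y \<otimes>\<^bsub>grass_algebra\<^esub> z)"
			if "x : carrier grass_algebra" "y : carrier grass_algebra" "z : carrier grass_algebra"
			for x y z :: "'n ext vzonoid"
			using that grass_carrier_law_span by (simp only: grass_algebra_simps) (blast intro: law_span_wedge_assoc)
		show "\<one>\<^bsub>grass_algebra\<^esub> \<otimes>\<^bsub>grass_algebra\<^esub> x = x" if "x : carrier grass_algebra" for x :: "'n ext vzonoid"
			using that grass_carrier_law_span by (simp only: grass_algebra_simps) (blast intro: law_span_wedge_unit)
		thus "x \<otimes>\<^bsub>grass_algebra\<^esub> \<one>\<^bsub>grass_algebra\<^esub> = x" if "x : carrier grass_algebra" for x :: "'n ext vzonoid"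
			using that grass_carrier_commute[OF _ unit_zonoid_carrier, of x] by (simp only: grass_algebra_simps)
	qed (simp_all only: grass_algebra_simps grass_carrier_wedge unit_zonoid_carrier)
qed (simp_all add: bilinear_ladd[OF bilinear_vz_wedge] bilinear_radd[OF bilinear_vz_wedge])

section \<open>The ideal of null classes\<close>

lemma law_span_support_bound:
	fixes A :: "'a::euclidean_space vzonoid"
	assumes "A : law_span"
	shows "vz_support A : borel_measurable borel & (EX C. ALL v. abs (vz_support A v) <= C * norm v)"
	using assms
proof (induction rule: span_induct_alt)
	case base
	have "vz_support 0 = (%v :: 'a. 0)" by (rule ext) simp
	thus ?case by (auto intro: exI[of _ 0])
next
	case (step c x y)
	then obtain mu where mu: "integrable_law mu" "x = vz mu (%x. x)" by blast
	interpret M: prob_space mu by (rule integrable_law_prob[OF mu(1)])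
	have [measurable_cong]: "sets mu = sets borel" by (rule integrable_law_sets[OF mu(1)])
	obtain C where C: "!!v. abs (vz_support y v) <= C * norm v" using step by blast
	have int: "integrable mu (%x. x)" by (rule integrable_law_integrable[OF mu(1)])
	have hx: "vz_support x = (%v. 1/2 * (LINT x|mu. abs (v \<bullet> x)))"
		unfolding mu(2) by (rule ext) (rule integrable_law_support[OF mu(1)])
	have "(%v. \<integral>x. abs (v \<bullet> x) \<partial>mu) : borel_measurable borel"
		by (rule M.borel_measurable_lebesgue_integral) measurable
	hence "vz_support x : borel_measurable borel" unfolding hx by measurable
	moreover have "vz_support (c *\<^sub>R x + y) = (%v. c * vz_support x v + vz_support y v)" by (rule ext) simp
	ultimately have "vz_support (c *\<^sub>R x + y) : borel_measurable borel" using step by auto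
	moreover have "\<bar>vz_support (c *\<^sub>R x + y) v\<bar> <= (abs (c) * (LINT x|mu. norm x) + C) * norm v" for v
	proof -
		have "(LINT x|mu. abs (v \<bullet> x)) <= (LINT x|mu. norm v * norm x)"
			using int by (intro integral_mono integrable_abs_inner) (auto simp: Cauchy_Schwarz_ineq2)
		hence "\<bar>vz_support x v\<bar> <= (LINT x|mu. norm x) * norm v"
			by (simp add: hx mult.commute)
				(smt (verit) integral_nonneg_AE AE_I2 abs_ge_zero)
		hence "\<bar>c\<bar> * abs (vz_support x v) <= abs (c) * ((LINT x|mu. norm x) * norm v)" by (intro mult_left_mono) auto
		moreover have "\<bar>vz_support (c *\<^sub>R x + y) v\<bar> <= abs (c) * abs (vz_support x v) + abs (vz_support y v)"
			by (simp add: abs_mult[symmetric])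
		ultimately show ?thesis using C[of v] by (simp add: algebra_simps)
	qed
	ultimately show ?case by blast
qed

lemma vz_support_wedge_law:
	assumes L: "integrable_law mu" and A: "A : law_span"
	shows "vz_support (vz_wedge (vz mu (%x. x)) A) z = (LINT l|mu. vz_support A (interior_mult l z)) &
		integrable mu (%l. vz_support A (interior_mult l z))"
	using A
proof (induction rule: span_induct_alt)
	case base
	thus ?case by (simp add: bilinear_rzero[OF bilinear_vz_wedge])
next
	case (step c x y)
	then obtain nu where nu: "integrable_law nu" "x = vz nu (%x. x)" by blast
	have "vz_support (vz_wedge (vz mu (%x. x)) x) z = (LINT l|mu. vz_support x (interior_mult l z))"
		"integrable mu (%l. vz_support x (interior_mult l z))"
		unfolding nu(2) vz_wedge_law[OF L nu(1)] using vz_wedge_law_support(2,4)[OF L nu(1)]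
		by (simp_all add: integrable_law_support[OF nu(1)])
	thus ?case
		using step by (simp add: bilinear_radd[OF bilinear_vz_wedge] bilinear_rmul[OF bilinear_vz_wedge])
qed

text \<open>Multiplication by K(mu) has the interior product as adjoint: both sides are twice the
  mean of the support function of \<open>A\<close> at \<open>interior_mult l z\<close>.\<close>

lemma vz_pairing_wedge:
	fixes A :: "'n::finite ext vzonoid"
	assumes L: "integrable_law mu" and Z: "integrable_law nu" and A: "A : law_span"
		and w: "vz_wedge (vz mu (%x. x)) A : law_span"
	shows "vz_pairing (vz_wedge (vz mu (%x. x)) A) (vz nu (%x. x)) =
		vz_pairing A (vz (mu \<Otimes>\<^sub>M nu) (%(l, z). interior_mult l z))"
proof -
	interpret M: prob_space mu by (rule integrable_law_prob[OF L])
	interpret N: prob_space nu by (rule integrable_law_prob[OF Z])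
	interpret P: pair_prob_space mu nu ..
	have [measurable_cong]: "sets mu = sets borel" "sets nu = sets borel"
		using L Z by (auto simp: integrable_law_def)
	obtain C where C: "!!v. abs (vz_support A v) <= C * norm v" and mA[measurable]: "vz_support A : borel_measurable borel"
		using law_span_support_bound[OF A] by blast
	have i: "integrable (mu \<Otimes>\<^sub>M nu) (%(l, z). interior_mult l z)"
		using integrable_pair_bilinear[OF bounded_bilinear_interior M.prob_space_axioms integrable_law_integrable[OF L]
			N.prob_space_axioms integrable_law_integrable[OF Z]] by simp
	hence m: "(%(l, z). interior_mult l z) : borel_measurable (mu \<Otimes>\<^sub>M nu)" by auto
	have mm: "(%(l, z). vz_support A (interior_mult l z)) : borel_measurable (mu \<Otimes>\<^sub>M nu)" by measurable
	have ii: "integrable (mu \<Otimes>\<^sub>M nu) (%(l, z). vz_support A (interior_mult l z))"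
	proof (rule Bochner_Integration.integrable_bound[OF integrable_mult_right[OF integrable_norm[OF i], of C] mm], rule AE_I2)
		show "norm (case x of (l, z) => vz_support A (interior_mult l z)) <= norm (C * norm (case x of (l, z) => interior_mult l z))" for x
			using C[of "interior_mult (fst x) (snd x)"] by (simp add: split_beta)
	qed
	have "vz_pairing (vz_wedge (vz mu (%x. x)) A) (vz nu (%x. x)) = 2 * (LINT z|nu. \<integral>l. vz_support A (interior_mult l z) \<partial>mu)"
		using vz_pairing_span_support[OF w Z] vz_support_wedge_law[OF L A] by simp
	also have "(LINT z|nu. \<integral>l. vz_support A (interior_mult l z) \<partial>mu) = (LINT x|(mu \<Otimes>\<^sub>M nu). (case x of (l, z) => vz_support A (interior_mult l z)))"
		by (rule P.integral_snd[OF ii])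
	also have "... = (LINT x|(distr (mu \<Otimes>\<^sub>M nu) borel (%(l, z). interior_mult l z)). vz_support A x)"
		unfolding integral_distr[OF m mA] by (rule Bochner_Integration.integral_cong) auto
	also have "2 * ... = vz_pairing A (vz (mu \<Otimes>\<^sub>M nu) (%(l, z). interior_mult l z))"
		using vz_pairing_span_support[OF A integrable_law_distr[OF P.prob_space_axioms i]] vz_distr[OF m] by simp
	finally show ?thesis .
qed

text \<open>By adjointness, testing the product against a Grassmann zonoid of degree
  \<open>e + d\<close> amounts to testing \<open>A\<close> against one of degree
  \<open>d\<close>.\<close>

lemma null_deg_wedge:
	fixes A :: "'n::finite ext vzonoid"
	assumes L: "L : grass_gen e" and A: "A : null_deg d"
	shows "vz_wedge L A : null_deg (e + d)"
proof -
	have Ad: "A : grass_deg d" and A0: "!!M. M : grass_deg d ==> vz_pairing A M = 0"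
		using A by (auto simp: null_deg_def)
	obtain mu where mu: "integrable_law mu" "AE x in mu. simple_vector e x" "L = vz mu (%x. x)" using L by auto
	have Ld: "L : grass_deg e" unfolding grass_deg_def by (rule span_base[OF L])
	have w: "vz_wedge L A : grass_deg (e + d)" by (rule grass_deg_wedge[OF Ld Ad])
	have 0: "vz_pairing (vz_wedge L A) Z = 0" if Z: "Z : grass_gen (e + d)" for Z
	proof -
		obtain nu where nu: "integrable_law nu" "AE x in nu. simple_vector (e + d) x" "Z = vz nu (%x. x)" using Z by auto
		interpret M: prob_space mu by (rule integrable_law_prob[OF mu(1)])
		interpret N: prob_space nu by (rule integrable_law_prob[OF nu(1)])
		interpret P: pair_prob_space mu nu ..
		have "vz_pairing (vz_wedge L A) Z = vz_pairing A (vz (mu \<Otimes>\<^sub>M nu) (%(l, z). interior_mult l z))"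
			unfolding mu(3) nu(3) using w Ad grass_deg_law_span
			by (intro vz_pairing_wedge mu(1) nu(1)) (auto simp: mu(3))
		moreover have "vz (mu \<Otimes>\<^sub>M nu) (%(l, z). interior_mult l z) : grass_deg d"
		proof (rule vz_mem_grass_deg[OF P.prob_space_axioms])
			show "integrable (mu \<Otimes>\<^sub>M nu) (%(l, z). interior_mult l z)"
				using integrable_pair_bilinear[OF bounded_bilinear_interior M.prob_space_axioms integrable_law_integrable[OF mu(1)]
					N.prob_space_axioms integrable_law_integrable[OF nu(1)]] by simp
			show "AE x in mu \<Otimes>\<^sub>M nu. EX c us. length us = d & (case x of (l, z) => interior_mult l z) = c *\<^sub>R wedge_list us"
				using AE_law_pair[OF mu(1) nu(1) mu(2) nu(2)]
			proof eventually_elim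
				case (elim x)
				then obtain vs ws where vs: "length vs = e" "fst x = wedge_list vs" and ws: "length ws = e + d" "snd x = wedge_list ws"
					by (auto simp: simple_vector_def)
				have "length vs <= length ws" using vs ws by simp
				then obtain us c where "length us = length ws - length vs" "interior_mult (wedge_list vs) (wedge_list ws) = c *\<^sub>R wedge_list us"
					by (rule interior_wedge_list)
				thus ?case using vs ws by (intro exI[of _ c] exI[of _ us]) (simp add: split_beta)
			qed
		qed
		ultimately show ?thesis using A0 by simp
	qed
	have "vz_pairing (vz_wedge L A) Z = 0" if "Z : grass_deg (e + d)" for Z
	proof -
		have "linear (vz_pairing (vz_wedge L A))" using bilinear_vz_pairing unfolding bilinear_def by blast
		thus ?thesis using linear_eq_0_on_span[of "vz_pairing (vz_wedge L A)" "grass_gen (e + d)" Z] 0 that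
			unfolding grass_deg_def by blast
	qed
	with w show ?thesis by (simp add: null_deg_def)
qed

lemma null_ideal_carrier: "null_ideal \<subseteq> grass_carrier"
	unfolding null_ideal_def span_UN_grass_deg[symmetric] by (rule span_mono) (auto simp: null_deg_def)

lemma null_ideal_wedge:
	assumes "L : grass_carrier" "A : null_ideal"
	shows "vz_wedge L A : null_ideal" "vz_wedge A L : null_ideal"
proof -
	show 1: "vz_wedge L A : null_ideal"
		unfolding null_ideal_def
	proof (rule span_bilinear_closed[OF bilinear_vz_wedge _ assms(1)])
		show "A : span (\<Union>d. null_deg d)" using assms(2) by (simp add: null_ideal_def)
		fix a b :: "'a ext vzonoid" assume "a : (\<Union>d. grass_gen d)" "b : (\<Union>d. null_deg d)"
		then obtain d e where "a : grass_gen d" "b : null_deg e" by (elim UN_E)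
		hence "vz_wedge a b : null_deg (d + e)" by (rule null_deg_wedge)
		thus "vz_wedge a b : span (\<Union>d. null_deg d)" by (intro span_base UN_I UNIV_I)
	qed
	show "vz_wedge A L : null_ideal"
		using 1 grass_carrier_commute[OF assms(1), of A] assms(2) null_ideal_carrier by auto
qed

lemma ideal_null_ideal: "ideal null_ideal (grass_algebra :: 'n::finite ext vzonoid ring)"
proof (rule idealI[OF ring_grass_algebra])
	interpret ring "grass_algebra :: 'n ext vzonoid ring" by (rule ring_grass_algebra)
	show "subgroup null_ideal (add_monoid (grass_algebra :: 'n ext vzonoid ring))"
	proof (rule subgroup.intro)
		show "inv\<^bsub>add_monoid grass_algebra\<^esub> x : null_ideal" if x: "x : null_ideal" for x :: "'n ext vzonoid"
		proof -
			have xc: "x : grass_carrier" using x null_ideal_carrier by blast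
			have "\<ominus>\<^bsub>grass_algebra\<^esub> x = - x"
				by (rule minus_equality) (use xc in \<open>simp_all add: span_neg\<close>)
			moreover have "- x : null_ideal" using x unfolding null_ideal_def by (rule span_neg)
			ultimately show ?thesis by (simp add: a_inv_def)
		qed
	qed (use null_ideal_carrier in \<open>auto simp: null_ideal_def span_add span_zero\<close>)
qed (simp_all add: null_ideal_wedge)

section \<open>Classes and the action of orthogonal maps\<close>

lemma Q_class_eq: "Q_class A = (%h. h + A) ` null_ideal"
	by (auto simp: Q_class_def a_r_coset_def')

lemma Q_class_cong: "A - B : null_ideal ==> Q_class A = Q_class B"
proof -
	have *: "Q_class A \<subseteq> Q_class B" if "A - B : null_ideal" for A B :: "'a ext vzonoid"
	proof
		fix x assume "x : Q_class A"
		then obtain h where h: "h : null_ideal" "x = h + A" by (auto simp: Q_class_eq)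
		have "h + (A - B) : null_ideal" using h that unfolding null_ideal_def by (intro span_add)
		thus "x : Q_class B" unfolding Q_class_eq h by (intro image_eqI[of _ _ "h + (A - B)"]) auto
	qed
	assume "A - B : null_ideal"
	moreover from this have "B - A : null_ideal" using span_neg[of "A - B"] unfolding null_ideal_def by fastforce
	ultimately show ?thesis using * by blast
qed

lemma Q_class_self: "A : Q_class A"
	unfolding Q_class_eq by (intro image_eqI[of _ _ 0]) (auto simp: null_ideal_def span_zero)

text \<open>\<open>Q_scale\<close> is a union over all representatives of the class; they all yield
  the same coset, as the ideal is closed under scaling.\<close>

lemma Q_scale_class: "Q_scale r (Q_class A) = Q_class (r *\<^sub>R A)"
proof -
	have "Q_class (r *\<^sub>R B) = Q_class (r *\<^sub>R A)" if B: "B : Q_class A" for B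
	proof (rule Q_class_cong)
		obtain h where "h : null_ideal" "B = h + A" using B unfolding Q_class_eq by blast
		thus "r *\<^sub>R B - r *\<^sub>R A : null_ideal" by (simp add: null_ideal_def span_scale algebra_simps)
	qed
	thus ?thesis unfolding Q_scale_def using Q_class_self[of A] by blast
qed

lemma Q_class_mult:
	assumes "A : grass_carrier" "B : grass_carrier"
	shows "Q_class A \<otimes>\<^bsub>Q_algebra\<^esub> Q_class B = Q_class (vz_wedge A B)"
	using ideal.rcoset_mult_add[OF ideal_null_ideal, of A B] assms
	by (simp add: Q_algebra_def FactRing_def Q_class_def)

lemma Q_class_one: "\<one>\<^bsub>Q_algebra\<^esub> = Q_class unit_zonoid"
	by (simp add: Q_algebra_def FactRing_def Q_class_def)

lemma Q_class_carrier: "A : grass_carrier ==> Q_class A : carrier Q_algebra"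
	by (auto simp: Q_algebra_def FactRing_def Q_class_def A_RCOSETS_def')

lemma vz_map_pairing:
	fixes T :: "'a::euclidean_space => 'a"
	assumes T: "orthogonal_transformation T" and A: "A : law_span" and B: "B : law_span"
	shows "vz_pairing (vz_map T A) (vz_map T B) = vz_pairing A B"
proof -
	have lT: "linear T" using T by (rule orthogonal_transformation_linear)
	have lm: "linear (vz_map T)" by (rule linear_vz_map[OF lT])
	have b: "bilinear (%A B. vz_pairing (vz_map T A) (vz_map T B))"
		using bilinear_vz_pairing unfolding bilinear_def
		by (auto intro: linear_compose[OF lm, unfolded o_def])
	show ?thesis
	proof (rule bilinear_eq_on_span[OF b bilinear_vz_pairing _ A B])
		fix a b assume "a : {vz mu (%x :: 'a. x) | mu. integrable_law mu}" "b : {vz mu (%x :: 'a. x) | mu. integrable_law mu}"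
		then obtain mu nu where mu: "integrable_law mu" "a = vz mu (%x. x)" and nu: "integrable_law nu" "b = vz nu (%x. x)" by blast
		have mT: "T : borel_measurable mu" "T : borel_measurable nu"
			using linear_borel[OF lT] integrable_law_sets[OF mu(1)] integrable_law_sets[OF nu(1)]
			by (simp_all cong: measurable_cong_sets)
		have iT: "integrable mu T" "integrable nu T"
			using integrable_bounded_linear[OF linear_conv_bounded_linear[THEN iffD1, OF lT]]
				integrable_law_integrable[OF mu(1)] integrable_law_integrable[OF nu(1)] by fastforce+
		have laws: "integrable_law (distr mu borel T)" "integrable_law (distr nu borel T)"
			by (auto intro!: integrable_law_distr iT integrable_law_prob mu nu)
		have e: "vz_map T a = vz (distr mu borel T) (%x. x)" "vz_map T b = vz (distr nu borel T) (%x. x)"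
			unfolding mu(2) nu(2) using mT
			by (simp_all add: vz_distr vz_map_vz[OF lT integrable_law_integrable[OF mu(1)]] vz_map_vz[OF lT integrable_law_integrable[OF nu(1)]])
		have F: "(LINT z|(mu \<Otimes>\<^sub>M nu). (case z of (x, y) => \<bar>x \<bullet> (y :: 'a)\<bar>)) = (LINT x|mu. \<integral>y. abs (x \<bullet> y) \<partial>nu)"
			"integrable mu (%x. \<integral>y. abs (x \<bullet> y) \<partial>nu)"
			if l: "integrable_law mu" "integrable_law nu" for mu nu :: "'a measure"
			using integral_law_pair(1,3)[OF l, of "%(x, y). abs (x \<bullet> y)" 1] by (auto simp: Cauchy_Schwarz_ineq2)
		have mi: "(%x. \<integral>y. abs (x \<bullet> y) \<partial>distr nu borel T) : borel_measurable borel"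
			using borel_measurable_integrable[OF F(2)[OF laws]] by simp
		have "vz_pairing (vz_map T a) (vz_map T b) = (LINT x|distr mu borel T. \<integral>y. abs (x \<bullet> y) \<partial>distr nu borel T)"
			unfolding e vz_pairing_law[OF laws] by (rule F(1)[OF laws])
		also have "... = (LINT x|mu. \<integral>y. abs (T x \<bullet> T y) \<partial>nu)"
			unfolding integral_distr[OF mT(1) mi] using mT(2) by (simp add: integral_distr)
		also have "... = (LINT x|mu. \<integral>y. abs (x \<bullet> y) \<partial>nu)" using T by (simp add: orthogonal_transformation_def)
		also have "... = vz_pairing a b"
			unfolding mu(2) nu(2) vz_pairing_law[OF mu(1) nu(1)] by (rule F(1)[OF mu(1) nu(1), symmetric])
		finally show "vz_pairing (vz_map T a) (vz_map T b) = vz_pairing a b" .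
	qed
qed

lemma vz_map_compose:
	fixes A :: "'a::euclidean_space vzonoid" and S :: "'a => 'b::euclidean_space" and T :: "'b => 'c::euclidean_space"
	assumes "linear S" "linear T" shows "vz_map T (vz_map S A) = vz_map (%x. T (S x)) A"
proof (rule vz_support_eqI)
	have l: "linear (%x. T (S x))" using linear_compose[OF assms] by (simp add: o_def)
	fix u
	have "adjoint (%x. T (S x)) u = adjoint S (adjoint T u)"
		by (rule vector_eq_ldot[THEN iffD1]) (simp add: adjoint_works[OF l] adjoint_works[OF assms(1)] adjoint_works[OF assms(2)])
	thus "vz_support (vz_map T (vz_map S A)) u = vz_support (vz_map (%x. T (S x)) A) u"
		by (simp add: vz_support_vz_map l assms)
qed

lemma vz_map_ident: "vz_map (%x. x) A = (A :: 'a::euclidean_space vzonoid)"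
proof (rule vz_support_eqI)
	have "adjoint (%x. x) u = (u :: 'a)" for u
		by (rule vector_eq_ldot[THEN iffD1]) (simp add: adjoint_works[OF linear_ident])
	thus "vz_support (vz_map (%x. x) A) u = vz_support A u" for u by (simp add: vz_support_vz_map linear_ident)
qed

lemma ext_lin_compose:
	"linear S ==> linear T ==> ext_lin T (ext_lin S x) = ext_lin (%x. T (S x)) x"
	by (rule linear_eq_on_wedge_list[of "%x. ext_lin T (ext_lin S x)"])
		(simp_all add: ext_lin_wedge_list linear_ext_lin linear_compose[OF linear_ext_lin linear_ext_lin, unfolded o_def]
			linear_compose[unfolded o_def, of S T] o_def)

lemma ext_lin_ident: "ext_lin (%x. x) x = x"
	by (rule linear_eq_on_wedge_list) (simp_all add: linear_ext_lin linear_ident ext_lin_wedge_list)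

lemma ext_lin_simple: "linear T ==> simple_vector d x ==> simple_vector d (ext_lin T x)"
	by (auto simp: simple_vector_def ext_lin_wedge_list) (metis length_map)

lemma vz_map_grass_deg:
	assumes T: "linear T" and A: "A : grass_deg d"
	shows "vz_map (ext_lin T) A : grass_deg d"
proof -
	have 1: "vz_map (ext_lin T) a : grass_gen d" if a: "a : grass_gen d" for a
	proof -
		obtain mu where mu: "integrable_law mu" "AE x in mu. simple_vector d x" "a = vz mu (%x. x)" using a by auto
		have "integrable mu (ext_lin T)"
			using integrable_bounded_linear[OF linear_conv_bounded_linear[THEN iffD1, OF linear_ext_lin] integrable_law_integrable[OF mu(1)]] .
		moreover have "AE x in mu. simple_vector d (ext_lin T x)"
			using mu(2) by eventually_elim (rule ext_lin_simple[OF T])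
		ultimately show ?thesis
			unfolding mu(3) vz_map_vz[OF linear_ext_lin integrable_law_integrable[OF mu(1)]]
			by (intro vz_mem_grass_gen integrable_law_prob[OF mu(1)])
	qed
	have "vz_map (ext_lin T) ` span (grass_gen d) = span (vz_map (ext_lin T) ` grass_gen d)"
		by (rule linear_span_image[OF linear_vz_map[OF linear_ext_lin], symmetric])
	also have "... \<subseteq> span (grass_gen d)" using 1 by (intro span_mono) blast
	finally show ?thesis using A unfolding grass_deg_def by blast
qed

text \<open>Orthogonal maps preserve the pairing and the degree, and every test zonoid is the image
  of one under the inverse map.\<close>

lemma vz_map_null_ideal:
	fixes T :: "complex ^ 'n::finite => complex ^ 'n"
	assumes T: "orthogonal_transformation T" and A: "A : null_ideal"
	shows "vz_map (ext_lin T) A : null_ideal"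
proof -
	have lT: "linear T" using T by (rule orthogonal_transformation_linear)
	define S where "S = inv_into UNIV T"
	have S: "orthogonal_transformation S" unfolding S_def by (rule orthogonal_transformation_inv[OF T])
	have lS: "linear S" using S by (rule orthogonal_transformation_linear)
	have TS: "T (S x) = x" for x
		unfolding S_def using orthogonal_transformation_surj[OF T] by (simp add: surj_f_inv_f)
	have TS': "vz_map (ext_lin T) (vz_map (ext_lin S) B) = B" for B :: "'n ext vzonoid"
		by (simp add: vz_map_compose linear_ext_lin ext_lin_compose lS lT TS ext_lin_ident vz_map_ident)
	have 1: "vz_map (ext_lin T) a : null_deg d" if a: "a : null_deg d" for a d
		unfolding null_deg_def
	proof (intro CollectI conjI ballI)
		have ad: "a : grass_deg d" using a by (simp add: null_deg_def)
		show "vz_map (ext_lin T) a : grass_deg d" by (rule vz_map_grass_deg[OF lT ad])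
		fix L :: "'n ext vzonoid" assume L: "L : grass_deg d"
		have L': "vz_map (ext_lin S) L : grass_deg d" by (rule vz_map_grass_deg[OF lS L])
		have "vz_pairing (vz_map (ext_lin T) a) (vz_map (ext_lin T) (vz_map (ext_lin S) L)) = vz_pairing a (vz_map (ext_lin S) L)"
			using ad L' grass_deg_law_span by (intro vz_map_pairing orthogonal_ext_lin[OF T]) auto
		thus "vz_pairing (vz_map (ext_lin T) a) L = 0" using a L' by (simp add: TS' null_deg_def)
	qed
	have "vz_map (ext_lin T) ` null_ideal = span (vz_map (ext_lin T) ` (\<Union>d. null_deg d))"
		unfolding null_ideal_def by (rule linear_span_image[OF linear_vz_map[OF linear_ext_lin], symmetric])
	also have "... \<subseteq> null_ideal" unfolding null_ideal_def using 1 by (intro span_mono) blast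
	finally show ?thesis using A by blast
qed

lemma vz_map_Q_class:
	fixes T :: "complex ^ 'n::finite => complex ^ 'n"
	assumes T: "orthogonal_transformation T"
	shows "vz_map (ext_lin T) ` Q_class A = Q_class (vz_map (ext_lin T) A)"
proof -
	have lT: "linear T" using T by (rule orthogonal_transformation_linear)
	have lm: "linear (vz_map (ext_lin T))" by (rule linear_vz_map[OF linear_ext_lin])
	define S where "S = inv_into UNIV T"
	have S: "orthogonal_transformation S" unfolding S_def by (rule orthogonal_transformation_inv[OF T])
	have lS: "linear S" using S by (rule orthogonal_transformation_linear)
	have TS: "T (S x) = x" for x
		unfolding S_def using orthogonal_transformation_surj[OF T] by (simp add: surj_f_inv_f)
	have TS': "vz_map (ext_lin T) (vz_map (ext_lin S) B) = B" for B :: "'n ext vzonoid"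
		by (simp add: vz_map_compose linear_ext_lin ext_lin_compose lS lT TS ext_lin_ident vz_map_ident)
	have "vz_map (ext_lin T) ` null_ideal = null_ideal"
	proof
		show "vz_map (ext_lin T) ` null_ideal \<subseteq> null_ideal" using vz_map_null_ideal[OF T] by blast
		show "null_ideal \<subseteq> vz_map (ext_lin T) ` null_ideal"
			using vz_map_null_ideal[OF S] TS' by (metis image_eqI subsetI)
	qed
	thus ?thesis unfolding Q_class_eq image_image linear_add[OF lm] by (metis (no_types, lifting) image_cong image_image)
qed

section \<open>The length on the quotient\<close>

primrec wedge_law :: "(complex ^ 'n::finite) measure => nat => 'n ext measure"
	where "wedge_law ga 0 = return borel (axis {} 1)"
	| "wedge_law ga (Suc d) = distr (ga \<Otimes>\<^sub>M wedge_law ga d) borel (%(w, x). vec_wedge w x)"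

lemma bounded_bilinear_vec_wedge: "bounded_bilinear (%w x. vec_wedge w x)"
	using bounded_bilinear.comp[OF bounded_bilinear_wedge linear_conv_bounded_linear[THEN iffD1, OF linear_ext_vec] bounded_linear_ident] .

lemma integrable_law_wedge_law:
	assumes "integrable_law ga" shows "integrable_law (wedge_law ga d)"
proof (induction d)
	case (Suc d)
	interpret M: prob_space ga by (rule integrable_law_prob[OF assms])
	interpret N: prob_space "wedge_law ga d" by (rule integrable_law_prob[OF Suc])
	interpret P: pair_prob_space ga "wedge_law ga d" ..
	have "integrable (ga \<Otimes>\<^sub>M wedge_law ga d) (%(w, x). vec_wedge w x)"
		using integrable_pair_bilinear[OF bounded_bilinear_vec_wedge M.prob_space_axioms integrable_law_integrable[OF assms]
			N.prob_space_axioms integrable_law_integrable[OF Suc]] by simp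
	thus ?case by (simp add: integrable_law_distr P.prob_space_axioms)
qed (simp add: integrable_law_return)

lemma measurable_vec_wedge_law:
	assumes "integrable_law ga"
	shows "(%(w, x). vec_wedge w x) : borel_measurable (ga \<Otimes>\<^sub>M wedge_law ga d)"
proof -
	have "(%(w, x). vec_wedge w x) : borel_measurable (borel \<Otimes>\<^sub>M borel)" by measurable
	thus ?thesis by (rule measurable_law_pair[OF assms integrable_law_wedge_law[OF assms]])
qed

lemma AE_wedge_law_simple:
	fixes ga :: "(complex ^ 'n::finite) measure"
	assumes "integrable_law ga" shows "AE x in wedge_law ga d. simple_vector d x"
proof (induction d)
	case 0
	have "AE x in return borel (axis {} 1 :: 'n ext). simple_vector 0 x"
		by (auto simp: AE_return simple_vector_def borel_simple_vector)
	thus ?case unfolding wedge_law.simps(1) .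
next
	case (Suc d)
	have t: "AE x in ga. True" by simp
	have "AE z in ga \<Otimes>\<^sub>M wedge_law ga d. simple_vector (Suc d) (case z of (w, x) => vec_wedge w x)"
		using AE_law_pair[OF assms integrable_law_wedge_law[OF assms] t Suc]
	proof eventually_elim
		case (elim z)
		then obtain ws where "length ws = d" "snd z = wedge_list ws" by (auto simp: simple_vector_def)
		thus ?case by (auto simp: split_beta simple_vector_def intro!: exI[of _ "fst z # ws"])
	qed
	thus ?case
		unfolding wedge_law.simps(2)
		by (subst AE_distr_iff[OF measurable_vec_wedge_law[OF assms]]) (simp_all add: borel_simple_vector)
qed

lemma integral_wedge_law_Suc:
	assumes ga: "integrable_law ga"
	shows "(LINT z|wedge_law ga (Suc d). abs (u \<bullet> z)) = (LINT w|ga. \<integral>x. abs (contraction w u \<bullet> x) \<partial>wedge_law ga d)"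
		"integrable ga (%w. \<integral>x. abs (contraction w u \<bullet> x) \<partial>wedge_law ga d)"
proof -
	obtain C where C: "!!w x. norm (vec_wedge w x) <= norm w * norm (x :: 'a ext) * C"
		using bounded_bilinear.pos_bounded[OF bounded_bilinear_vec_wedge] by blast
	have e: "\<bar>contraction w u \<bullet> x\<bar> = abs (u \<bullet> vec_wedge w x)" for w x
		by (metis inner_commute inner_contraction)
	have "\<bar>u \<bullet> vec_wedge w x\<bar> <= norm u * C * norm w * norm x" for w x
	proof -
		have "\<bar>u \<bullet> vec_wedge w x\<bar> <= norm u * (norm w * norm x * C)"
			by (rule order_trans[OF Cauchy_Schwarz_ineq2 mult_left_mono[OF C norm_ge_zero]])
		thus ?thesis by (simp only: mult_ac)
	qed
	hence bnd: "norm (case (w, x) of (w, x) => \<bar>u \<bullet> vec_wedge w x\<bar>) <= norm u * C * norm w * norm x" for w x by simp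
	have m: "(%(w, x). abs (u \<bullet> vec_wedge w x)) : borel_measurable (borel \<Otimes>\<^sub>M borel)" by measurable
	note F = integral_law_pair[OF ga integrable_law_wedge_law[OF ga] m bnd]
	have "(LINT z|wedge_law ga (Suc d). abs (u \<bullet> z)) = (LINT z|(ga \<Otimes>\<^sub>M wedge_law ga d). (case z of (w, x) => \<bar>u \<bullet> vec_wedge w x\<bar>))"
		using measurable_vec_wedge_law[OF ga, of d] by (simp add: integral_distr split_beta)
	thus "(LINT z|wedge_law ga (Suc d). abs (u \<bullet> z)) = (LINT w|ga. \<integral>x. abs (contraction w u \<bullet> x) \<partial>wedge_law ga d)"
		using F(1) by (simp add: e)
	show "integrable ga (%w. \<integral>x. abs (contraction w u \<bullet> x) \<partial>wedge_law ga d)" using F(3) by (simp add: e)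
qed

text \<open>In the first factor \<open>T\<close> is absorbed by the invariance of \<open>ga\<close>;
  contraction commutes with \<open>ext_lin T\<close>, so the induction hypothesis takes care of the
  other factors.\<close>

lemma wedge_law_invariant:
	fixes ga :: "(complex ^ 'n::finite) measure"
	assumes ga: "isotropic_law ga" and T: "orthogonal_transformation T"
	shows "(LINT z|wedge_law ga d. abs (ext_lin T u \<bullet> z)) = (LINT z|wedge_law ga d. abs (u \<bullet> z))"
proof (induction d arbitrary: u)
	case 0
	have "ext_lin T u \<bullet> axis {} 1 = u \<bullet> axis {} 1" for u
		using orthogonal_ext_lin[OF T] ext_lin_one[of T] unfolding orthogonal_transformation_def by metis
	thus ?case by (simp add: integral_return)
next
	case (Suc d)
	have law: "integrable_law ga" and inv: "distr ga borel T = ga" using ga T by (auto simp: isotropic_law_def)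
	have lT: "linear T" using T by (rule orthogonal_transformation_linear)
	have mT: "T : borel_measurable ga"
		using linear_borel[OF lT] integrable_law_sets[OF law] by (simp cong: measurable_cong_sets)
	let ?f = "%u w. \<integral>x. abs (contraction w u \<bullet> x) \<partial>wedge_law ga d"
	have m: "?f u : borel_measurable borel" for u
		using borel_measurable_integrable[OF integral_wedge_law_Suc(2)[OF law]] integrable_law_sets[OF law]
		by (simp cong: measurable_cong_sets)
	have "(LINT z|wedge_law ga (Suc d). abs (ext_lin T u \<bullet> z)) = (LINT w|ga. ?f (ext_lin T u) w)"
		by (rule integral_wedge_law_Suc(1)[OF law])
	also have "... = (LINT w|distr ga borel T. ?f (ext_lin T u) w)" by (simp add: inv)
	also have "... = (LINT w|ga. ?f (ext_lin T u) (T w))" by (rule integral_distr[OF mT m])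
	also have "... = (LINT w|ga. ?f u w)" by (simp add: contraction_ext_lin[OF T] Suc)
	also have "... = (LINT z|wedge_law ga (Suc d). abs (u \<bullet> z))" by (rule integral_wedge_law_Suc(1)[OF law, symmetric])
	finally show ?case .
qed

lemma wedge_law_norm_aux:
	assumes ga: "isotropic_law ga" and es: "orthonormal_list es" and fs: "orthonormal_list fs" "length fs = length es"
	shows "(LINT z|wedge_law ga d. abs ((c *\<^sub>R wedge_list fs) \<bullet> z)) = (LINT z|wedge_law ga d. abs (wedge_list es \<bullet> z)) * abs (c)"
proof -
	obtain T where T: "orthogonal_transformation T" "map T es = fs"
		using orthonormal_list_transitive[OF es fs(1)] fs(2) by metis
	have "wedge_list fs = ext_lin T (wedge_list es)"
		using T by (simp add: ext_lin_wedge_list orthogonal_transformation_linear)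
	thus ?thesis using wedge_law_invariant[OF ga T(1)] by (simp add: abs_mult mult.commute)
qed

text \<open>Contracting \<open>wedge_list (e # es)\<close> with a random \<open>w\<close> leaves a
  multiple of a simple vector, of norm at least |<e, w>|. Its mean is the previous constant times
  that norm, so the new constant is at least the previous one times the mean of |<e, w>|.\<close>

lemma wedge_law_pos:
	fixes es :: "(complex ^ 'n::finite) list"
	assumes ga: "isotropic_law ga" and es: "orthonormal_list es"
	shows "0 < (LINT z|wedge_law ga (length es). abs (wedge_list es \<bullet> z))"
	using es
proof (induction es)
	case Nil
	thus ?case by (simp add: integral_return inner_axis)
next
	case (Cons e es)
	have law: "integrable_law ga" using ga by (simp add: isotropic_law_def)
	have es: "orthonormal_list es" "norm e = 1" "!!f. f : set es ==> e \<bullet> f = 0" using Cons.prems by (auto simp: orthonormal_list_Cons)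
	let ?ka = "\<integral>z. abs (wedge_list es \<bullet> z) \<partial>wedge_law ga (length es)"
	have pos: "0 < ?ka" by (rule Cons.IH[OF es(1)])
	let ?f = "%w. \<integral>x. abs (contraction w (wedge_list (e # es)) \<bullet> x) \<partial>wedge_law ga (length es)"
	have lower: "?ka * abs (e \<bullet> w) <= ?f w" for w
	proof -
		let ?v = "contraction w (wedge_list (e # es))"
		obtain us c where us: "length us = length es" "?v = c *\<^sub>R wedge_list us"
			using contraction_wedge_list[of "e # es" w] by auto
		\<comment> \<open>The contraction has component \<open>e \<bullet> w\<close> along the unit vector
		  \<open>wedge_list es\<close>.\<close>
		have n: "\<bar>e \<bullet> w\<bar> <= norm ?v"
		proof -
			have "wedge_list es \<bullet> ?v = vec_wedge w (wedge_list es) \<bullet> vec_wedge e (wedge_list es)"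
				by (simp add: inner_contraction)
			also have "... = contraction e (vec_wedge w (wedge_list es)) \<bullet> wedge_list es"
				by (metis inner_commute inner_contraction)
			also have "... = e \<bullet> w"
				using es norm_wedge_list_orthonormal[OF es(1)]
				by (simp add: contraction_vec_wedge contraction_orthogonal wedge_linear_simps norm_eq_1)
			finally have "\<bar>e \<bullet> w\<bar> = abs (wedge_list es \<bullet> ?v)" by simp
			also have "... <= norm (wedge_list es) * norm ?v" by (rule Cauchy_Schwarz_ineq2)
			finally show ?thesis by (simp add: norm_wedge_list_orthonormal[OF es(1)])
		qed
		have "?f w = ?ka * norm ?v"
		proof (cases "wedge_list us = 0")
			case True
			hence v0: "?v = 0" using us(2) by simp
			show ?thesis unfolding v0 by simp
		next
			case False
			then obtain b fs where fs: "orthonormal_list fs" "length fs = length us" "wedge_list us = b *\<^sub>R wedge_list fs"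
				using wedge_list_orthonormal_form[of us] by blast
			have v: "?v = (c * b) *\<^sub>R wedge_list fs" using us(2) fs(3) by simp
			have "norm ?v = abs (c * b)" unfolding v by (simp add: norm_wedge_list_orthonormal[OF fs(1)])
			thus ?thesis unfolding v using wedge_law_norm_aux[OF ga es(1) fs(1), where c="c * b" and d="length es"] fs(2) us(1) by simp
		qed
		thus ?thesis using n pos by (simp add: mult_left_mono)
	qed
	have "e ~= 0" using es(2) by auto
	hence "0 < ?ka * (LINT w|ga. abs (e \<bullet> w))" using pos ga by (simp add: isotropic_law_def)
	also have "... = (LINT w|ga. ?ka * abs (e \<bullet> w))" by simp
	also have "... <= (LINT w|ga. ?f w)"
		by (rule integral_mono[OF _ integral_wedge_law_Suc(2)[OF law] lower])
			(intro integrable_mult_right integrable_abs_inner integrable_law_integrable[OF law])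
	also have "... = (LINT z|wedge_law ga (length (e # es)). abs (wedge_list (e # es) \<bullet> z))"
		using integral_wedge_law_Suc(1)[OF law, where u="wedge_list (e # es)" and d="length es"] by simp
	finally show ?case .
qed

text \<open>\<open>wedge_law ga d\<close> is the law of a product of \<open>d\<close> independent
  vectors, so it is carried by simple vectors and its zonoid lies in \<open>grass_deg d\<close>.
  Since orthogonal maps act transitively on orthonormal lists of length \<open>d\<close>, pairing
  with it measures the norm of simple vectors.\<close>

lemma wedge_law_norm:
	fixes ga :: "(complex ^ 'n::finite) measure"
	assumes ga: "isotropic_law ga"
	obtains ka where "0 < ka" "!!x. simple_vector d x ==> (LINT z|wedge_law ga d. abs (x \<bullet> z)) = ka * norm x"
proof (cases "EX es :: (complex ^ 'n) list. orthonormal_list es & length es = d")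
	case True
	then obtain es :: "(complex ^ 'n) list" where es: "orthonormal_list es" "length es = d" by blast
	show ?thesis
	proof (rule that)
		show "0 < (LINT z|wedge_law ga d. abs (wedge_list es \<bullet> z))" using wedge_law_pos[OF ga es(1)] es(2) by simp
		fix x :: "'n ext" assume "simple_vector d x"
		then obtain ws where ws: "length ws = d" "x = wedge_list ws" by (auto simp: simple_vector_def)
		show "(LINT z|wedge_law ga d. abs (x \<bullet> z)) = (LINT z|wedge_law ga d. abs (wedge_list es \<bullet> z)) * norm x"
		proof (cases "x = 0")
			case False
			then obtain c fs where fs: "orthonormal_list fs" "length fs = d" "x = c *\<^sub>R wedge_list fs"
				using wedge_list_orthonormal_form[of ws] ws by auto
			thus ?thesis
				using wedge_law_norm_aux[OF ga es(1) fs(1), where c=c and d=d] es(2) by (simp add: norm_wedge_list_orthonormal)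
		qed simp
	qed
next
	case False
	have zero: "x = 0" if "simple_vector d x" for x :: "'n ext"
	proof -
		obtain ws where "length ws = d" "x = wedge_list ws" using \<open>simple_vector d x\<close> by (auto simp: simple_vector_def)
		thus ?thesis using wedge_list_orthonormal_form[of ws] False by auto
	qed
	have "(LINT z|wedge_law ga d. abs (x \<bullet> z)) = 1 * norm x" if "simple_vector d x" for x
		unfolding zero[OF that] by simp
	\<comment> \<open>There is no orthonormal list of this length, so all simple vectors of the degree
	  vanish and any positive constant serves.\<close>
	thus ?thesis using that[of 1] by simp
qed

text \<open>On \<open>grass_deg d\<close> a positive multiple of the length is the pairing with one
  element of \<open>grass_deg d\<close>, and a null element pairs with that to zero.\<close>

lemma vz_length_null_deg:
	fixes A :: "'n::finite ext vzonoid"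
	assumes A: "A : null_deg d" shows "vz_length A = 0"
proof -
	obtain ga :: "(complex ^ 'n) measure" where ga: "isotropic_law ga" using isotropic_law_exists by blast
	have law: "integrable_law ga" using ga by (simp add: isotropic_law_def)
	obtain ka where ka: "0 < ka" "!!x. simple_vector d x ==> (LINT z|wedge_law ga d. abs (x \<bullet> z)) = ka * norm x"
		using wedge_law_norm[OF ga] by blast
	let ?W = "wedge_law ga d"
	have lW: "integrable_law ?W" by (rule integrable_law_wedge_law[OF law])
	have W: "vz ?W (%x. x) : grass_deg d"
		unfolding grass_deg_def using lW AE_wedge_law_simple[OF law, of d] by (intro span_base) blast
	have "ka * vz_length B = vz_pairing B (vz ?W (%x. x))" if "B : grass_deg d" for B
		using that unfolding grass_deg_def
	proof (induction rule: span_induct_alt)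
		case base
		thus ?case by (simp add: linear_0[OF linear_vz_length] bilinear_lzero[OF bilinear_vz_pairing])
	next
		case (step c x y)
		then obtain mu where mu: "integrable_law mu" "AE z in mu. simple_vector d z" "x = vz mu (%x. x)" by auto
		have F: "(LINT z|(mu \<Otimes>\<^sub>M ?W). (case z of (x, y) => \<bar>x \<bullet> (y :: 'n ext)\<bar>)) = (LINT x|mu. \<integral>y. abs (x \<bullet> y) \<partial>?W)"
			"integrable mu (%x. \<integral>y. abs (x \<bullet> y) \<partial>?W)"
			using integral_law_pair(1,3)[OF mu(1) lW, of "%(x, y). abs (x \<bullet> y)" 1] by (auto simp: Cauchy_Schwarz_ineq2)
		have "vz_pairing x (vz ?W (%x. x)) = (LINT x|mu. \<integral>y. abs (x \<bullet> y) \<partial>?W)"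
			unfolding mu(3) vz_pairing_law[OF mu(1) lW] by (rule F(1))
		also have "... = (LINT x|mu. ka * norm x)"
		proof (rule integral_cong_AE)
			show "AE x in mu. (LINT y|?W. abs (x \<bullet> y)) = ka * norm x" using mu(2) by eventually_elim (rule ka(2))
		qed (use F(2) integrable_law_integrable[OF mu(1)] in auto)
		also have "... = ka * vz_length x" by (simp add: mu(3) vz_length_law[OF mu(1)])
		finally show ?case using step
			by (simp add: linear_add[OF linear_vz_length] linear_scale[OF linear_vz_length]
				bilinear_ladd[OF bilinear_vz_pairing] bilinear_lmul[OF bilinear_vz_pairing] algebra_simps)
	qed
	from this[of A] show ?thesis using A W ka(1) by (simp add: null_deg_def)
qed

lemma vz_length_null_ideal: "A : null_ideal ==> vz_length A = 0"
	unfolding null_ideal_def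
	by (rule linear_eq_0_on_span[OF linear_vz_length, of "\<Union>d. null_deg d"]) (auto simp: vz_length_null_deg)

text \<open>\<open>Q_length\<close> is a definite description over the whole coset; it is meaningful
  because null elements have length zero.\<close>

lemma Q_length_class: "Q_length (Q_class A) = vz_length A"
	unfolding Q_length_def
proof (rule the_equality)
	show "ALL B:Q_class A. vz_length B = vz_length A"
		by (auto simp: Q_class_eq linear_add[OF linear_vz_length] vz_length_null_ideal)
	show "r = vz_length A" if "ALL B:Q_class A. vz_length B = r" for r
		using bspec[OF that Q_class_self[of A]] by simp
qed

section \<open>Unitary frames\<close>

definition herm :: "complex ^ 'm => complex ^ 'm::finite => complex"
	where "herm x y = (SUM i:UNIV. x $ i * cnj (y $ i))"

lemma herm_simps:
	"herm (x + y) z = herm x z + herm y z" "herm x (y + z) = herm x y + herm x z"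
	"herm (x - y) z = herm x z - herm y z" "herm x (y - z) = herm x y - herm x z"
	"herm (c *s x) z = c * herm x z" "herm x (c *s z) = cnj c * herm x z"
	"herm 0 z = 0" "herm x 0 = 0"
	by (simp_all add: herm_def algebra_simps sum.distrib sum_distrib_left sum_subtractf)

lemma herm_sum_left: "herm (SUM a:A. f a) z = (SUM a:A. herm (f a) z)"
	by (induction A rule: infinite_finite_induct) (simp_all add: herm_simps)

lemma herm_cnj: "herm y x = cnj (herm x y)"
	by (simp add: herm_def mult.commute)

lemma herm_zero_commute: "herm x y = 0 \<longleftrightarrow> herm y x = 0"
	by (metis herm_cnj complex_cnj_zero)

lemma Re_herm: "Re (herm x y) = x \<bullet> y"
	by (simp add: herm_def inner_vec_def inner_complex_def)

lemma herm_self: "herm x x = complex_of_real ((norm x)\<^sup>2)"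
	by (simp add: complex_eq_iff Re_herm power2_norm_eq_inner) (simp add: herm_def)

lemma scaleR_eq_vector_scale: "r *\<^sub>R (x :: complex ^ 'm) = complex_of_real r *s x"
	unfolding vec_eq_iff vector_scaleR_component vector_smult_component by (simp add: scaleR_conv_of_real)

lemma vector_scale_decomp: "c *s (x :: complex ^ 'm) = Re c *\<^sub>R x + Im c *\<^sub>R (\<i> *s x)"
	by (simp add: vec_eq_iff complex_eq_iff)

lemma norm_vector_scale: "norm (c *s (x :: complex ^ 'm::finite)) = cmod c * norm x"
proof -
	have "complex_of_real ((norm (c *s x))\<^sup>2) = complex_of_real ((cmod c * norm x)\<^sup>2)"
		unfolding herm_self[symmetric] herm_simps power_mult_distrib of_real_mult complex_norm_square
		by (simp add: herm_self)
	hence "(norm (c *s x))\<^sup>2 = (cmod c * norm x)\<^sup>2" by (simp only: of_real_eq_iff)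
	thus ?thesis by (simp add: power2_eq_iff_nonneg)
qed

definition unitary_list :: "(complex ^ 'm::finite) list => bool"
	where "unitary_list us \<longleftrightarrow> distinct us & (ALL f:set us. ALL g:set us. herm f g = (if f = g then 1 else 0))"

lemma herm_self_1: "herm f f = 1 \<longleftrightarrow> norm f = 1"
proof -
	have "herm f f = 1 \<longleftrightarrow> complex_of_real ((norm f)\<^sup>2) = complex_of_real 1" by (simp only: herm_self of_real_1)
	also have "... \<longleftrightarrow> (norm f)\<^sup>2 = 1" by (simp only: of_real_eq_iff)
	also have "... \<longleftrightarrow> norm f = 1" by (simp add: power2_eq_1_iff) (metis norm_ge_zero not_one_le_zero neg_0_le_iff_le)
	finally show ?thesis .
qed

lemma unitary_list_Nil [simp]: "unitary_list []"
	by (simp add: unitary_list_def)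

lemma unitary_list_Cons:
	"unitary_list (f # fs) \<longleftrightarrow> unitary_list fs & norm f = 1 & (ALL g:set fs. herm f g = 0)"
	unfolding unitary_list_def using herm_self_1[of f] herm_zero_commute[of f] by auto

text \<open>A real list for a complex span. For a unitary list its wedge product is the unit simple
  vector of that span, each complex line entering through the pair u, i u.\<close>

definition complexify :: "(complex ^ 'm) list => (complex ^ 'm) list"
	where "complexify us = concat (map (%u. [u, \<i> *s u]) us)"

lemma complexify_simps [simp]:
	"complexify [] = []" "complexify (u # us) = u # \<i> *s u # complexify us"
	"complexify (us @ vs) = complexify us @ complexify vs"
	by (simp_all add: complexify_def)

lemma length_complexify [simp]: "length (complexify us) = 2 * length us"
	by (induction us) simp_all

lemma set_complexify: "set (complexify us) = set us Un (%u. \<i> *s u) ` set us"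
	by (induction us) auto

lemma map_complexify: "map ((*v) g) (complexify us) = complexify (map ((*v) (g :: complex ^ 'm ^ 'm::finite)) us)"
	by (induction us) (simp_all add: matrix_vector_mult_def vec_eq_iff vector_scalar_mult_def sum_distrib_left mult_ac)

lemma unitary_list_complexify: "unitary_list us ==> orthonormal_list (complexify us)"
proof (induction us)
	case (Cons u us)
	have "norm (\<i> *s u) = 1" using Cons.prems by (simp add: norm_vector_scale unitary_list_Cons)
	moreover have "u \<bullet> (\<i> *s u) = 0" by (simp add: Re_herm[symmetric] herm_simps herm_self)
	moreover have "u \<bullet> g = 0" "(\<i> *s u) \<bullet> g = 0" if "g : set (complexify us)" for g
		using that Cons.prems by (auto simp: set_complexify unitary_list_Cons Re_herm[symmetric] herm_simps)
	ultimately show ?case using Cons by (simp add: unitary_list_Cons orthonormal_list_Cons)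
qed simp

definition complex_subspace :: "(complex ^ 'm::finite) set => bool"
	where "complex_subspace W \<longleftrightarrow> subspace W & (ALL w:W. \<i> *s w : W)"

lemma complex_subspace_scale: "complex_subspace W ==> w : W ==> c *s w : W"
	unfolding vector_scale_decomp[of c] complex_subspace_def by (auto intro: subspace_add subspace_scale)

lemma linear_vector_scale: "linear ((*s) c :: complex ^ 'm::finite => _)"
	by (rule linearI) (simp_all add: vec_eq_iff algebra_simps)

lemma complex_subspace_span: "complex_subspace (span (set (complexify us)))"
	unfolding complex_subspace_def
proof (intro conjI ballI subspace_span)
	fix w assume "w : span (set (complexify us))"
	hence "\<i> *s w : (*s) \<i> ` span (set (complexify us))" by blast
	also have "... = span ((*s) \<i> ` set (complexify us))" by (rule linear_span_image[OF linear_vector_scale, symmetric])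
	also have "... \<subseteq> span (set (complexify us))"
	proof (intro span_minimal subspace_span subsetI)
		fix x assume "x : (*s) \<i> ` set (complexify us)"
		then consider u where "u : set us" "x = \<i> *s u" | u where "u : set us" "x = \<i> *s (\<i> *s u)"
			by (auto simp: set_complexify)
		thus "x : span (set (complexify us))"
		proof cases
			case 1
			thus ?thesis by (intro span_base) (auto simp: set_complexify)
		next
			case 2
			hence "x = - u" by (simp add: vec_eq_iff)
			moreover have "u : span (set (complexify us))" using 2 by (intro span_base) (auto simp: set_complexify)
			ultimately show ?thesis by (simp add: span_neg)
		qed
	qed
	finally show "\<i> *s w : span (set (complexify us))" .
qed

text \<open>Hermitian Gram-Schmidt: a unit vector is split off together with its complex line, and
  the Hermitian complement in \<open>W\<close> has smaller real dimension.\<close>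

lemma complex_subspace_frame:
	assumes "complex_subspace W"
	obtains us where "unitary_list us" "span (set (complexify us)) = W"
proof -
	have "EX us. unitary_list us & span (set (complexify us)) = W"
		using assms
	proof (induction "dim W" arbitrary: W rule: less_induct)
		case less
		have sW: "subspace W" using less.prems by (simp add: complex_subspace_def)
		show ?case
		proof (cases "W \<subseteq> {0}")
			case True
			hence "W = {0}" using subspace_0[OF sW] by blast
			thus ?thesis by (intro exI[of _ "[]"]) simp
		next
			case False
			then obtain w where w: "w : W" "w ~= 0" by blast
			define u where "u = (1 / norm w) *\<^sub>R w"
			have u: "u : W" "norm u = 1" using w sW by (auto simp: u_def subspace_scale)
			define W' where "W' = {x : W. herm x u = 0}"
			have sW': "complex_subspace W'"
				using less.prems unfolding complex_subspace_def W'_def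
				by (auto simp: herm_simps scaleR_eq_vector_scale subspace_def)
			have "u ~: W'" using u(2) herm_self_1[of u] by (simp add: W'_def)
			hence "W' \<subset> W" using u(1) by (auto simp: W'_def)
			moreover have "span W' = W'" "span W = W" using sW sW' unfolding complex_subspace_def span_eq_iff by blast+
			ultimately have "dim W' < dim W" using dim_psubset[of W' W] by metis
			then obtain us where us: "unitary_list us" "span (set (complexify us)) = W'" using less.hyps sW' by blast
			have sub: "set us \<subseteq> W'" using us(2) span_superset[of "set (complexify us)"] by (auto simp: set_complexify)
			have "unitary_list (u # us)"
				using us(1) u(2) sub herm_zero_commute[of _ u] by (auto simp: unitary_list_Cons W'_def)
			moreover have "span (set (complexify (u # us))) = W"
			proof
				have iu: "\<i> *s u : W" using less.prems u(1) by (rule complex_subspace_scale)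
				have "set (complexify us) \<subseteq> W'" using us(2) span_superset by blast
				thus "span (set (complexify (u # us))) \<subseteq> W"
					using u(1) iu sW by (intro span_minimal) (auto simp: W'_def)
				show "W \<subseteq> span (set (complexify (u # us)))"
				proof
					fix x assume x: "x : W"
					have "x - herm x u *s u : W'"
						unfolding W'_def using x u herm_self_1[of u] complex_subspace_scale[OF less.prems u(1)] sW
						by (simp add: subspace_diff herm_simps)
					hence "x - herm x u *s u : span (set (complexify (u # us)))"
						using us(2) span_mono[of "set (complexify us)" "set (complexify (u # us))"] by auto
					moreover have "herm x u *s u : span (set (complexify (u # us)))"
						by (rule complex_subspace_scale[OF complex_subspace_span]) (intro span_base, simp)
					ultimately show "x : span (set (complexify (u # us)))" by (metis diff_add_cancel span_add)
				qed
			qed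
			ultimately show ?thesis by blast
		qed
	qed
	with that show ?thesis by blast
qed

lemma unitary_list_append:
	"unitary_list (us @ vs) \<longleftrightarrow> unitary_list us & unitary_list vs & (ALL u:set us. ALL v:set vs. herm u v = 0)"
	by (induction us) (auto simp: unitary_list_Cons)

lemma unitary_list_dim: "unitary_list us ==> dim (span (set (complexify us))) = 2 * length us"
	using biorthogonal_distinct_independent(3)[OF orthonormal_list_biorthogonal[OF unitary_list_complexify]] by simp

lemma unitary_list_proj:
	assumes "unitary_list us" "u : set us"
	shows "herm (x - (SUM v:set us. herm x v *s v)) u = 0"
proof -
	have "herm (SUM v:set us. herm x v *s v) u = (SUM v:set us. if v = u then herm x u else 0)"
		unfolding herm_sum_left using assms by (intro sum.cong) (auto simp: herm_simps unitary_list_def)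
	thus ?thesis using assms(2) by (simp add: herm_simps)
qed

lemma unitary_list_complete:
	fixes us :: "(complex ^ 'm::finite) list"
	assumes us: "unitary_list us"
	obtains vs where "unitary_list (us @ vs)" "span (set (complexify (us @ vs))) = UNIV" "length us + length vs = CARD('m)"
proof -
	define W where "W = {x. ALL u:set us. herm x u = 0}"
	have "complex_subspace W"
		unfolding complex_subspace_def W_def by (auto simp: herm_simps scaleR_eq_vector_scale subspace_def)
	then obtain vs where vs: "unitary_list vs" "span (set (complexify vs)) = W" by (rule complex_subspace_frame)
	have "set vs \<subseteq> W" using vs(2) span_superset[of "set (complexify vs)"] by (auto simp: set_complexify)
	hence on: "unitary_list (us @ vs)" using us vs(1) herm_zero_commute by (auto simp: unitary_list_append W_def)
	have sp: "span (set (complexify (us @ vs))) = UNIV"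
	proof (intro equalityI subset_UNIV subsetI)
		fix x
		let ?p = "SUM v:set us. herm x v *s v"
		have "x - ?p : W" unfolding W_def using unitary_list_proj[OF us] by blast
		hence "x - ?p : span (set (complexify (us @ vs)))"
			using vs(2) span_mono[of "set (complexify vs)" "set (complexify (us @ vs))"] by auto
		moreover have "?p : span (set (complexify (us @ vs)))"
			by (intro span_sum complex_subspace_scale[OF complex_subspace_span] span_base) (auto simp: set_complexify)
		ultimately show "x : span (set (complexify (us @ vs)))" by (metis diff_add_cancel span_add)
	qed
	have "2 * length (us @ vs) = dim (UNIV :: (complex ^ 'm) set)" using unitary_list_dim[OF on] unfolding sp by simp
	hence "length us + length vs = CARD('m)" by simp
	with on sp show ?thesis by (rule that)
qed

lemma unitary_list_expand:
	assumes "unitary_list us" "span (set (complexify us)) = UNIV"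
	shows "x = (SUM v:set us. herm x v *s v)"
proof -
	let ?y = "x - (SUM v:set us. herm x v *s v)"
	have 0: "herm ?y u = 0" if "u : set us" for u by (rule unitary_list_proj[OF assms(1) that])
	have "?y \<bullet> z = 0" if "z : span (set (complexify us))" for z
		using that
	proof (induction rule: span_induct_alt)
		case (step c a b)
		hence "?y \<bullet> a = 0" using 0 by (auto simp: set_complexify Re_herm[symmetric] herm_simps simp del: inner_diff_left)
		thus ?case using step by (simp add: inner_add_right)
	qed simp
	hence "?y \<bullet> ?y = 0" using assms(2) by blast
	thus ?thesis by simp
qed

section \<open>The unitary group and its action on frames\<close>

lemma herm_adj: "herm (g *v x) y = herm x (adj g *v y)"
proof -
	have "herm (g *v x) y = (SUM i:UNIV. SUM j:UNIV. g $ i $ j * x $ j * cnj (y $ i))"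
		by (simp add: herm_def matrix_vector_mult_def sum_distrib_right)
	also have "... = (SUM j:UNIV. SUM i:UNIV. g $ i $ j * x $ j * cnj (y $ i))" by (rule sum.swap)
	also have "... = herm x (adj g *v y)"
		by (simp add: herm_def matrix_vector_mult_def adj_def sum_distrib_left mult_ac)
	finally show ?thesis .
qed

lemma adj_adj [simp]: "adj (adj g) = g"
	by (simp add: adj_def vec_eq_iff)

lemma adj_mult: "adj (g ** h) = adj h ** adj g"
	by (simp add: adj_def vec_eq_iff matrix_matrix_mult_def mult.commute)

lemma adj_one [simp]: "adj (mat 1) = mat 1"
	by (auto simp: adj_def vec_eq_iff mat_def)

lemma unitary_group_iff: "g : unitary_group \<longleftrightarrow> g ** adj g = mat 1 & adj g ** g = mat 1"
	by (simp add: unitary_group_def)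

lemma unitary_group_mult: "g : unitary_group ==> h : unitary_group ==> g ** h : unitary_group"
	unfolding unitary_group_iff adj_mult by (metis matrix_mul_assoc matrix_mul_lid)

lemma unitary_group_adj: "g : unitary_group ==> adj g : unitary_group"
	by (simp add: unitary_group_iff)

lemma unitary_group_one: "mat 1 : unitary_group"
	by (simp add: unitary_group_iff)

lemma unitary_group_inverse [simp]:
	assumes "g : unitary_group"
	shows "g *v (adj g *v x) = x" "adj g *v (g *v x) = x"
	using assms by (simp_all add: matrix_vector_mul_assoc unitary_group_iff)

lemma herm_unitary: "g : unitary_group ==> herm (g *v x) (g *v y) = herm x y"
	by (simp add: herm_adj)

lemma orthogonal_unitary: "g : unitary_group ==> orthogonal_transformation ((*v) g)"
	by (simp add: orthogonal_transformation_def linear_matrix_vector Re_herm[symmetric] herm_unitary)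

lemma unitary_groupI:
	fixes g :: "complex ^ 'm ^ 'm::finite"
	assumes "!!x y. herm (g *v x) (g *v y) = herm x y"
	shows "g : unitary_group"
proof -
	have "(adj g ** g) $ i $ j = (mat 1 :: complex ^ 'm ^ 'm) $ i $ j" for i j
	proof -
		have e: "(g *v axis j 1) $ k = g $ k $ j" for k j
			by (simp add: matrix_vector_mult_def axis_def if_distrib cong: if_cong)
		have "(adj g ** g) $ i $ j = herm (g *v axis j 1) (g *v axis i 1)"
			unfolding herm_def e by (simp add: matrix_matrix_mult_def adj_def mult.commute)
		also have "... = herm (axis j 1) (axis i 1 :: complex ^ 'm)" by (rule assms)
		also have "... = (SUM k:UNIV. if k = j then (if i = j then 1 else 0) else 0)"
			unfolding herm_def by (intro sum.cong refl) (auto simp: axis_def)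
		also have "... = (mat 1 :: complex ^ 'm ^ 'm) $ i $ j" by (simp add: mat_def)
		finally show ?thesis .
	qed
	hence "adj g ** g = mat 1" by (simp add: vec_eq_iff)
	thus ?thesis by (simp add: unitary_group_iff matrix_left_right_inverse)
qed

text \<open>Both lists are completed to unitary bases, and \<open>g\<close> is the sum of the rank
  one maps that send each vector \<open>u\<close> of the first basis to its partner
  \<open>f u\<close>.\<close>

lemma unitary_transitive:
	fixes us vs :: "(complex ^ 'm::finite) list"
	assumes us: "unitary_list us" and vs: "unitary_list vs" and l: "length us = length vs"
	obtains g where "g : unitary_group" "map ((*v) g) us = vs"
proof -
	obtain us' where us': "unitary_list (us @ us')" "span (set (complexify (us @ us'))) = UNIV" "length us + length us' = CARD('m)"
		by (rule unitary_list_complete[OF us])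
	obtain vs' where vs': "unitary_list (vs @ vs')" "span (set (complexify (vs @ vs'))) = UNIV" "length vs + length vs' = CARD('m)"
		by (rule unitary_list_complete[OF vs])
	define a b where "a = us @ us'" and "b = vs @ vs'"
	have la: "length a = CARD('m)" "length b = CARD('m)" using us' vs' by (auto simp: a_def b_def)
	have da: "distinct a" "distinct b" using us' vs' by (auto simp: a_def b_def unitary_list_def)
	define f where "f = the o map_of (zip a b)"
	have f: "f (a ! k) = b ! k" if "k < CARD('m)" for k
		using that da la by (simp add: f_def map_of_zip_nth)
	have bij: "bij_betw f (set a) (set b)"
	proof -
		have "map f a = b" using f la by (intro nth_equalityI) auto
		hence "f ` set a = set b" by (metis set_map)
		moreover have "inj_on f (set a)"
			using da calculation la by (intro eq_card_imp_inj_on) (simp_all add: distinct_card)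
		ultimately show ?thesis by (simp add: bij_betw_def)
	qed
	have ha: "herm u v = (if u = v then 1 else 0)" if "u : set a" "v : set a" for u v
		using us'(1) that unfolding a_def unitary_list_def by blast
	have hb: "herm u v = (if u = v then 1 else 0)" if "u : set b" "v : set b" for u v
		using vs'(1) that unfolding b_def unitary_list_def by blast
	define g :: "complex ^ 'm ^ 'm" where "g = (\<chi> i j. SUM u:set a. f u $ i * cnj (u $ j))"
	have g: "g *v x = (SUM u:set a. herm x u *s f u)" for x
	proof (rule vec_eq_iff[THEN iffD2, rule_format])
		fix i
		have "(g *v x) $ i = (SUM j:UNIV. SUM u:set a. f u $ i * cnj (u $ j) * x $ j)"
			by (simp add: g_def matrix_vector_mult_def sum_distrib_right)
		also have "... = (SUM u:set a. SUM j:UNIV. f u $ i * cnj (u $ j) * x $ j)" by (rule sum.swap)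
		also have "... = (SUM u:set a. herm x u *s f u) $ i"
			by (simp add: herm_def sum_distrib_right sum_distrib_left mult_ac)
		finally show "(g *v x) $ i = (SUM u:set a. herm x u *s f u) $ i" .
	qed
	have gf: "herm (g *v x) (f u) = herm x u" if "u : set a" for x u
	proof -
		have "herm (g *v x) (f u) = (SUM v:set a. herm x v * herm (f v) (f u))" by (simp add: g herm_sum_left herm_simps)
		also have "... = (SUM v:set a. if v = u then herm x u else 0)"
		proof (intro sum.cong refl)
			fix v assume v: "v : set a"
			have "f v : set b" "f u : set b" "f v = f u \<longleftrightarrow> v = u"
				using bij v that by (auto simp: bij_betw_def inj_on_eq_iff)
			thus "herm x v * herm (f v) (f u) = (if v = u then herm x u else 0)" using hb[of "f v" "f u"] by simp
		qed
		finally show ?thesis using that by simp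
	qed
	have "herm (g *v x) (g *v y) = herm x y" for x y
	proof -
		have "herm (g *v x) (g *v y) = cnj (SUM u:set a. herm y u * herm (f u) (g *v x))"
			by (subst herm_cnj) (simp add: g[of y] herm_sum_left herm_simps)
		also have "... = cnj (SUM u:set a. herm y u * herm u x)"
			using gf by (simp add: herm_cnj[of _ "g *v x"] herm_cnj[of _ x] cong: sum.cong)
		also have "(SUM u:set a. herm y u * herm u x) = herm (SUM u:set a. herm y u *s u) x"
			by (simp add: herm_sum_left herm_simps)
		also have "... = herm y x" using unitary_list_expand[OF us'(1,2), of y] by (simp add: a_def)
		finally show ?thesis by (simp add: herm_cnj[of x y])
	qed
	hence "g : unitary_group" by (rule unitary_groupI)
	moreover have "map ((*v) g) us = vs"
	proof (rule nth_equalityI)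
		show "length (map ((*v) g) us) = length vs" using l by simp
		fix k assume "k < length (map ((*v) g) us)"
		hence k: "k < length us" "k < CARD('m)" using us'(3) by auto
		have ak: "a ! k : set a" using k la by simp
		have "g *v (a ! k) = (SUM u:set a. if u = a ! k then f u else 0)"
			unfolding g using ha ak by (intro sum.cong refl) auto
		hence "g *v (a ! k) = b ! k" using ak f[OF k(2)] by simp
		thus "map ((*v) g) us ! k = vs ! k" using k l by (simp add: a_def b_def nth_append)
	qed
	ultimately show ?thesis by (rule that)
qed

definition matrix_group :: "(complex ^ 'm ^ 'm::finite) set => bool"
	where "matrix_group G \<longleftrightarrow> G \<subseteq> unitary_group & mat 1 : G & (ALL g:G. ALL h:G. g ** h : G) & (ALL g:G. adj g : G)"

lemma matrix_group_unitary: "matrix_group unitary_group"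
	by (simp add: matrix_group_def unitary_group_mult unitary_group_adj unitary_group_one)

lemma bilinear_matrix_mult: "bilinear ((**) :: complex ^ 'm ^ 'm => complex ^ 'm ^ 'm => complex ^ 'm ^ 'm::finite)"
	unfolding bilinear_def
	by (auto intro!: linearI simp: matrix_matrix_mult_def vec_eq_iff sum.distrib algebra_simps scaleR_sum_right)

lemma continuous_on_matrix_mult [continuous_intros]:
	fixes f g :: "'a::topological_space => complex ^ 'm ^ 'm::finite"
	shows "continuous_on S f ==> continuous_on S g ==> continuous_on S (%x. f x ** g x)"
	by (rule bounded_bilinear.continuous_on[OF bilinear_conv_bounded_bilinear[THEN iffD1, OF bilinear_matrix_mult]])

lemma bilinear_matrix_vector_mult: "bilinear ((*v) :: complex ^ 'm ^ 'm => complex ^ 'm => complex ^ 'm::finite)"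
	unfolding bilinear_def
	by (auto intro!: linearI simp: matrix_vector_mult_def vec_eq_iff sum.distrib algebra_simps scaleR_sum_right)

lemma continuous_on_matrix_vector_mult [continuous_intros]:
	fixes f :: "'a::topological_space => complex ^ 'm ^ 'm::finite"
	shows "continuous_on S f ==> continuous_on S g ==> continuous_on S (%x. f x *v g x)"
	by (rule bounded_bilinear.continuous_on[OF bilinear_conv_bounded_bilinear[THEN iffD1, OF bilinear_matrix_vector_mult]])

lemma linear_adj: "linear (adj :: complex ^ 'm ^ 'm => complex ^ 'm ^ 'm::finite)"
	by (rule linearI) (simp_all add: adj_def vec_eq_iff)

lemma continuous_on_adj [continuous_intros]:
	"continuous_on S f ==> continuous_on S (%x. adj (f x))"
	by (rule bounded_linear.continuous_on[OF linear_conv_bounded_linear[THEN iffD1, OF linear_adj]])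

lemma measurable_matrix_mult [measurable]:
	fixes f g :: "'a => complex ^ 'm ^ 'm::finite"
	shows "f : borel_measurable M ==> g : borel_measurable M ==> (%x. f x ** g x) : borel_measurable M"
	by (rule borel_measurable_continuous_Pair) (auto intro!: continuous_intros)

lemma measurable_matrix_vector_mult [measurable]:
	fixes f :: "'a => complex ^ 'm ^ 'm::finite"
	shows "f : borel_measurable M ==> g : borel_measurable M ==> (%x. f x *v g x) : borel_measurable M"
	by (rule borel_measurable_continuous_Pair) (auto intro!: continuous_intros)

lemma measurable_adj [measurable]: "adj : borel_measurable borel"
	by (rule linear_borel[OF linear_adj])

section \<open>Uniform distributions on matrix groups\<close>

lemma haar_prob_space: "haar_prob G mu ==> space mu = G"
	using sets_eq_imp_space_eq[of mu "restrict_space borel G"] by (simp add: haar_prob_def space_restrict_space)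

lemma haar_measurable:
	"haar_prob G mu ==> f : measurable borel N ==> f : measurable mu N"
	by (subst measurable_cong_sets[of mu "restrict_space borel G" N N])
		(auto simp: haar_prob_def intro: measurable_restrict_space1)

lemma haar_measurable_id: "haar_prob G mu ==> (%x. x) : borel_measurable mu"
	by (rule haar_measurable) auto

lemma haar_left_invariant:
	fixes f :: "complex ^ 'm ^ 'm::finite => ennreal"
	assumes G: "matrix_group G" and mu: "haar_prob G mu" and f: "f : borel_measurable borel" and g: "g : G"
	shows "(\<integral>\<^sup>+h. f (g ** h) \<partial>mu) = (\<integral>\<^sup>+h. f h \<partial>mu)"
proof -
	have "(%h. g ** h) : measurable mu (restrict_space borel G)"
		using G g haar_prob_space[OF mu]
		by (intro measurable_restrict_space2) (auto simp: matrix_group_def intro!: measurable_matrix_mult haar_measurable_id[OF mu])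
	hence m: "(%h. g ** h) : measurable mu mu"
		using mu by (simp add: haar_prob_def cong: measurable_cong_sets)
	have "(\<integral>\<^sup>+h. f h \<partial>mu) = (\<integral>\<^sup>+h. f h \<partial>distr mu mu (%h. g ** h))" using mu g by (simp add: haar_prob_def)
	also have "... = (\<integral>\<^sup>+h. f (g ** h) \<partial>mu)" by (rule nn_integral_distr[OF m]) (simp add: haar_measurable[OF mu f])
	finally show ?thesis by simp
qed

text \<open>\<open>haar_prob\<close> asks for left invariance only. Integrate
  \<open>f (adj h ** g)\<close> over both variables: left invariance in \<open>g\<close> gives one
  side, and since the argument is the adjoint of \<open>adj g ** h\<close>, left invariance in
  \<open>h\<close> gives the other. Uniqueness and right invariance are consequences.\<close>

lemma haar_adjoint:
	fixes f :: "complex ^ 'm ^ 'm::finite => ennreal"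
	assumes G: "matrix_group G" and mu: "haar_prob G mu" and nu: "haar_prob G nu" and f: "f : borel_measurable borel"
	shows "(\<integral>\<^sup>+h. f h \<partial>mu) = (\<integral>\<^sup>+h. f (adj h) \<partial>nu)"
proof -
	interpret M: prob_space mu using mu by (simp add: haar_prob_def)
	interpret N: prob_space nu using nu by (simp add: haar_prob_def)
	interpret P: pair_sigma_finite nu mu ..
	have idm: "(%x. x) : borel_measurable mu" "(%x. x) : borel_measurable nu"
		using mu nu haar_measurable_id by auto
	have fa: "(%h. f (adj h)) : borel_measurable borel" using f by measurable
	have m: "(%(h, g). f (adj h ** g)) : borel_measurable (nu \<Otimes>\<^sub>M mu)"
	proof -
		have "(%x. adj (fst x) ** snd x) : borel_measurable (nu \<Otimes>\<^sub>M mu)"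
			using measurable_compose[OF measurable_fst idm(2)] measurable_compose[OF measurable_snd idm(1)]
			by (intro measurable_matrix_mult measurable_compose[OF _ measurable_adj])
		from measurable_compose[OF this f] show ?thesis by (simp add: split_beta)
	qed
	have "(\<integral>\<^sup>+h. \<integral>\<^sup>+g. f (adj h ** g) \<partial>mu \<partial>nu) = (\<integral>\<^sup>+h. (\<integral>\<^sup>+g. f g \<partial>mu) \<partial>nu)"
		using G by (intro nn_integral_cong haar_left_invariant[OF G mu f]) (auto simp: haar_prob_space[OF nu] matrix_group_def)
	also have "... = (\<integral>\<^sup>+g. f g \<partial>mu)" by (simp add: N.emeasure_space_1)
	finally have 1: "(\<integral>\<^sup>+h. \<integral>\<^sup>+g. f (adj h ** g) \<partial>mu \<partial>nu) = (\<integral>\<^sup>+g. f g \<partial>mu)" .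
	have "(\<integral>\<^sup>+g. \<integral>\<^sup>+h. f (adj h ** g) \<partial>nu \<partial>mu) = (\<integral>\<^sup>+g. \<integral>\<^sup>+h. f (adj (adj g ** h)) \<partial>nu \<partial>mu)"
		by (simp add: adj_mult)
	also have "... = (\<integral>\<^sup>+g. (\<integral>\<^sup>+h. f (adj h) \<partial>nu) \<partial>mu)"
		using G by (intro nn_integral_cong haar_left_invariant[OF G nu fa]) (auto simp: haar_prob_space[OF mu] matrix_group_def)
	also have "... = (\<integral>\<^sup>+h. f (adj h) \<partial>nu)" by (simp add: M.emeasure_space_1)
	finally have 2: "(\<integral>\<^sup>+g. \<integral>\<^sup>+h. f (adj h ** g) \<partial>nu \<partial>mu) = (\<integral>\<^sup>+h. f (adj h) \<partial>nu)" .
	show ?thesis using 1 2 P.Fubini'[OF m] by simp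
qed

lemma haar_unique:
	fixes f :: "complex ^ 'm ^ 'm::finite => ennreal"
	assumes "matrix_group G" "haar_prob G mu" "haar_prob G nu" "f : borel_measurable borel"
	shows "(\<integral>\<^sup>+h. f h \<partial>mu) = (\<integral>\<^sup>+h. f h \<partial>nu)"
	using haar_adjoint[OF assms(1,2,3,4)] haar_adjoint[OF assms(1,3,3,4)] by simp

lemma haar_right_invariant:
	fixes f :: "complex ^ 'm ^ 'm::finite => ennreal"
	assumes G: "matrix_group G" and mu: "haar_prob G mu" and f: "f : borel_measurable borel" and g: "g : G"
	shows "(\<integral>\<^sup>+h. f (h ** g) \<partial>mu) = (\<integral>\<^sup>+h. f h \<partial>mu)"
proof -
	have m: "(%h. f (h ** g)) : borel_measurable borel" "(%h. f (adj h)) : borel_measurable borel" using f by measurable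
	have "(\<integral>\<^sup>+h. f (h ** g) \<partial>mu) = (\<integral>\<^sup>+h. f (adj (adj g ** h)) \<partial>mu)"
		using haar_adjoint[OF G mu mu m(1)] by (simp add: adj_mult)
	also have "... = (\<integral>\<^sup>+h. f (adj h) \<partial>mu)"
		using G g by (intro haar_left_invariant[OF G mu m(2)]) (auto simp: matrix_group_def)
	finally show ?thesis using haar_adjoint[OF G mu mu f] by simp
qed

lemma haar_integrals:
	fixes f :: "complex ^ 'm ^ 'm::finite => real"
	assumes G: "matrix_group G" and mu: "haar_prob G mu" and f: "f : borel_measurable borel" "!!x. 0 <= f x"
	shows "g : G ==> (LINT h|mu. f (g ** h)) = (LINT h|mu. f h)" "g : G ==> (LINT h|mu. f (h ** g)) = (LINT h|mu. f h)"
		"haar_prob G nu ==> (LINT h|mu. f h) = (LINT h|nu. f h)"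
proof -
	have e: "(LINT h|nu. k h) = enn2real (\<integral>\<^sup>+h. ennreal (k h) \<partial>nu)"
		if "haar_prob G nu" "k : borel_measurable borel" "!!x. 0 <= k x" for k nu
		using that by (intro integral_eq_nn_integral) (auto intro: haar_measurable[OF that(1)])
	have m: "(%h. ennreal (f h)) : borel_measurable borel" "(%h. f (g ** h)) : borel_measurable borel"
		"(%h. f (h ** g)) : borel_measurable borel" using f by measurable
	show "g : G ==> (LINT h|mu. f (g ** h)) = (LINT h|mu. f h)"
		using haar_left_invariant[OF G mu m(1)] by (simp add: e[OF mu m(2)] e[OF mu] f)
	show "g : G ==> (LINT h|mu. f (h ** g)) = (LINT h|mu. f h)"
		using haar_right_invariant[OF G mu m(1)] by (simp add: e[OF mu m(3)] e[OF mu] f)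
	show "haar_prob G nu ==> (LINT h|mu. f h) = (LINT h|nu. f h)"
		using haar_unique[OF G mu _ m(1)] by (simp add: e[OF mu] e f)
qed

section \<open>Zonoids of rotated complex frames\<close>

lemma measurable_wedge_list:
	"(!!w. w : set ws ==> f w : borel_measurable M) ==> (%x. wedge_list (map (%w. f w x) ws)) : borel_measurable M"
	by (induction ws) (auto intro!: measurable_wedge measurable_compose[OF _ measurable_ext_vec])

lemma ext_map_wedge_list: "ext_map g (wedge_list ws) = wedge_list (map ((*v) g) ws)"
	by (simp add: ext_map_eq ext_lin_wedge_list linear_matrix_vector)

lemma measurable_ext_map_wedge_list [measurable]: "(%g. ext_map g (wedge_list ws)) : borel_measurable borel"
	unfolding ext_map_wedge_list by (rule measurable_wedge_list) measurable

lemma measurable_ext_map [measurable]: "(%g. ext_map g x) : borel_measurable borel"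
proof -
	have "(%g. ext_map g x) = (%g. SUM S:UNIV. x $ S *\<^sub>R wedge_list (map (%b. g *v real_basis b) (basis_list S)))"
		by (rule ext) (simp add: ext_map_eq ext_lin_def)
	also have "... : borel_measurable borel"
		by (intro borel_measurable_sum borel_measurable_scaleR borel_measurable_const measurable_wedge_list) measurable
	finally show ?thesis .
qed

lemma ext_map_orthogonal: "g : unitary_group ==> orthogonal_transformation (ext_map g)"
	unfolding ext_map_eq by (intro orthogonal_ext_lin orthogonal_unitary)

lemma norm_ext_map: "g : unitary_group ==> norm (ext_map g x) = norm x"
	by (rule orthogonal_transformation_norm[OF ext_map_orthogonal])

lemma ext_map_mult: "ext_map (g ** h) x = ext_map g (ext_map h x)"
	by (simp add: ext_map_eq ext_lin_compose linear_matrix_vector matrix_vector_mul_assoc)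

lemma integrable_ext_map:
	assumes mu: "haar_prob unitary_group mu"
	shows "integrable mu (%g. ext_map g x)"
proof -
	interpret M: prob_space mu using mu by (simp add: haar_prob_def)
	show ?thesis
	proof (rule M.integrable_const_bound[where B="norm x"])
		show "AE g in mu. norm (ext_map g x) <= norm x"
			by (intro AE_I2) (auto simp: haar_prob_space[OF mu] norm_ext_map)
	qed (rule haar_measurable[OF mu measurable_ext_map])
qed

text \<open>The zonoid of a uniformly rotated complex subspace. For unitary \<open>us\<close> it
  depends on the length of the list only, by \<open>frame_integral\<close>.\<close>

definition frame_zonoid :: "(complex ^ 'n ^ 'n) measure => (complex ^ 'n) list => 'n::finite ext vzonoid"
	where "frame_zonoid mu us = vz mu (%g. ext_map g (wedge_list (complexify us)))"

lemma haar_ext_map_right: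
	assumes mu: "haar_prob unitary_group mu" and g: "g : unitary_group"
	shows "(LINT h|mu. abs (u \<bullet> ext_map h (ext_map g x))) = (LINT h|mu. abs (u \<bullet> ext_map h x))"
proof -
	have "(%h. abs (u \<bullet> ext_map h x)) : borel_measurable borel" by measurable
	from haar_integrals(2)[OF matrix_group_unitary mu this _ g] show ?thesis by (simp add: ext_map_mult)
qed

lemma frame_integral:
	assumes mu: "haar_prob unitary_group mu" and us: "unitary_list us" and vs: "unitary_list vs" and l: "length us = length vs"
	shows "(LINT h|mu. abs (u \<bullet> ext_map h (wedge_list (complexify us)))) = (LINT h|mu. abs (u \<bullet> ext_map h (wedge_list (complexify vs))))"
proof -
	obtain g where g: "g : unitary_group" "map ((*v) g) us = vs" by (rule unitary_transitive[OF us vs l])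
	have "wedge_list (complexify vs) = ext_map g (wedge_list (complexify us))"
		by (simp add: ext_map_wedge_list map_complexify g(2))
	thus ?thesis using haar_ext_map_right[OF mu g(1)] by simp
qed

lemma vz_support_frame_zonoid:
	"haar_prob unitary_group mu ==>
		vz_support (frame_zonoid mu us) u = 1/2 * (LINT h|mu. \<bar>u \<bullet> ext_map h (wedge_list (complexify us))\<bar>)"
	unfolding frame_zonoid_def by (rule vz_support_vz[OF integrable_ext_map])

lemma frame_zonoid_grass_deg:
	assumes mu: "haar_prob unitary_group mu"
	shows "frame_zonoid mu us : grass_deg (2 * length us)"
proof -
	have "AE h in mu. simple_vector (2 * length us) (ext_map h (wedge_list (complexify us)))"
		by (intro AE_I2) (auto simp: ext_map_wedge_list simple_vector_def intro!: exI[of _ "map ((*v) _) (complexify us)"])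
	thus ?thesis
		unfolding frame_zonoid_def grass_deg_def using mu
		by (intro span_base vz_mem_grass_gen integrable_ext_map) (auto simp: haar_prob_def)
qed

lemma vz_length_frame_zonoid:
	assumes mu: "haar_prob unitary_group mu" and us: "unitary_list us"
	shows "vz_length (frame_zonoid mu us) = 1"
proof -
	interpret M: prob_space mu using mu by (simp add: haar_prob_def)
	let ?x = "wedge_list (complexify us)"
	have m: "(%g. ext_map g ?x) : borel_measurable mu" by (rule haar_measurable[OF mu measurable_ext_map])
	have "vz_length (frame_zonoid mu us) = (LINT x|distr mu borel (%g. ext_map g ?x). norm x)"
		unfolding frame_zonoid_def vz_distr[OF m, symmetric]
		by (rule vz_length_law[OF integrable_law_distr[OF M.prob_space_axioms integrable_ext_map[OF mu]]])
	also have "... = (LINT g|mu. norm (ext_map g ?x))" by (rule integral_distr[OF m]) simp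
	also have "... = (LINT g|mu. 1)"
		using norm_wedge_list_orthonormal[OF unitary_list_complexify[OF us]]
		by (intro Bochner_Integration.integral_cong) (auto simp: haar_prob_space[OF mu] norm_ext_map)
	finally show ?thesis by (simp add: M.prob_space)
qed

lemma frame_zonoid_Nil: "haar_prob unitary_group mu ==> frame_zonoid mu [] = unit_zonoid"
proof (rule vz_support_eqI)
	fix u assume mu: "haar_prob unitary_group mu"
	interpret M: prob_space mu using mu by (simp add: haar_prob_def)
	show "vz_support (frame_zonoid mu []) u = vz_support unit_zonoid u"
		by (simp add: vz_support_frame_zonoid[OF mu] vz_support_unit_zonoid ext_map_eq M.prob_space inner_axis)
qed

text \<open>Left invariance of the uniform distribution. This is what places the class of a
  hyperplane among the invariants.\<close>

lemma vz_map_frame_zonoid: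
	assumes mu: "haar_prob unitary_group mu" and g: "g : unitary_group"
	shows "vz_map (ext_map g) (frame_zonoid mu us) = frame_zonoid mu us"
proof -
	let ?x = "wedge_list (complexify us)"
	have lin: "linear (ext_map g)" by (simp add: ext_map_eq linear_ext_lin)
	have "vz_map (ext_map g) (frame_zonoid mu us) = vz mu (%h. ext_map (g ** h) ?x)"
		unfolding frame_zonoid_def ext_map_mult by (rule vz_map_vz[OF lin integrable_ext_map[OF mu]])
	also have "... = frame_zonoid mu us"
		unfolding frame_zonoid_def
	proof (rule vz_eqI)
		fix u
		have "(%h. abs (u \<bullet> ext_map h ?x)) : borel_measurable borel" by measurable
		from haar_integrals(1)[OF matrix_group_unitary mu this _ g]
		show "(LINT h|mu. abs (u \<bullet> ext_map (g ** h) ?x)) = (LINT h|mu. abs (u \<bullet> ext_map h ?x))" by simp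
	qed
	finally show ?thesis .
qed

lemma unitary_list_parseval:
	assumes "unitary_list us"
	shows "(norm (x - (SUM u:set us. herm x u *s u)))\<^sup>2 = (norm x)\<^sup>2 - (SUM u:set us. (cmod (herm x u))\<^sup>2)"
proof -
	let ?p = "SUM u:set us. herm x u *s u"
	have p0: "herm (x - ?p) ?p = 0"
	proof -
		have "herm ?p (x - ?p) = 0"
			unfolding herm_sum_left herm_simps(5)
		proof (intro sum.neutral ballI)
			fix u assume "u : set us"
			hence "herm u (x - ?p) = 0" using unitary_list_proj[OF assms, of u x] by (simp only: herm_zero_commute[of u])
			thus "herm x u * herm u (x - ?p) = 0" by simp
		qed
		thus ?thesis by (simp only: herm_zero_commute[of "x - ?p"])
	qed
	have "herm (x - ?p) (x - ?p) = herm (x - ?p) x"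
		using p0 herm_simps(4)[of "x - ?p" x ?p] by simp
	also have "... = herm x x - (SUM u:set us. herm x u * cnj (herm x u))"
	proof -
		have "(SUM u:set us. herm x u * herm u x) = (SUM u:set us. herm x u * cnj (herm x u))"
			by (rule sum.cong[OF refl]) (metis herm_cnj)
		thus ?thesis unfolding herm_simps(3) herm_sum_left herm_simps(5) by simp
	qed
	finally have "complex_of_real ((norm (x - ?p))\<^sup>2) = complex_of_real ((norm x)\<^sup>2 - (SUM u:set us. (cmod (herm x u))\<^sup>2))"
		unfolding herm_self of_real_diff of_real_sum complex_norm_square by simp
	thus ?thesis by (simp only: of_real_eq_iff)
qed

lemma wedge_list_append_span_zero:
	"p : span (set (a @ b)) ==> wedge_list (a @ p # b) = 0"
	using wedge_list_move[of a p b] wedge_list_span_zero[of p "a @ b"] by auto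

text \<open>Only the part \<open>v - p\<close> orthogonal to the complex span of \<open>us\<close>
  survives. It enters once through \<open>v\<close> and once through \<open>\<i> *s v\<close>, so
  the scalar is its squared norm.\<close>

lemma wedge_complex_line:
	fixes us vs :: "(complex ^ 'n::finite) list"
	assumes us: "unitary_list us" and vs: "unitary_list vs" "length vs = Suc (length us)" and v: "norm v = 1"
	obtains ws where "unitary_list ws" "length ws = Suc (length us)"
		"wedge (wedge_list (complexify us)) (wedge_list (complexify [v])) =
			(1 - (SUM u:set us. (cmod (herm v u))\<^sup>2)) *\<^sub>R wedge_list (complexify ws)"
proof -
	define p where "p = (SUM u:set us. herm v u *s u)"
	define r where "r = norm (v - p)"
	let ?x = "wedge_list (complexify us)"
	have r: "r\<^sup>2 = 1 - (SUM u:set us. (cmod (herm v u))\<^sup>2)"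
		using unitary_list_parseval[OF us, of v] v by (simp add: r_def p_def)
	have pS: "p : span (set (complexify us))"
		unfolding p_def by (intro span_sum complex_subspace_scale[OF complex_subspace_span] span_base) (auto simp: set_complexify)
	have ipS: "\<i> *s p : span (set (complexify us))" by (rule complex_subspace_scale[OF complex_subspace_span pS])
	have e: "wedge ?x (wedge_list [a, b]) = wedge_list (complexify us @ [a, b])" for a b
		by (simp add: wedge_list_append)
	have add: "wedge ?x (wedge_list [a + a', b]) = wedge ?x (wedge_list [a, b]) + wedge ?x (wedge_list [a', b])"
		"wedge ?x (wedge_list [b, a + a']) = wedge ?x (wedge_list [b, a]) + wedge ?x (wedge_list [b, a'])" for a a' b
		by (simp_all add: linear_add[OF linear_ext_vec] wedge_linear_simps)
	have scale: "wedge ?x (wedge_list [t *\<^sub>R a, t *\<^sub>R b]) = (t * t) *\<^sub>R wedge ?x (wedge_list [a, b])" for t a b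
		by (simp add: linear_scale[OF linear_ext_vec] wedge_linear_simps)
	have z1: "wedge ?x (wedge_list [p, b]) = 0" for b
		unfolding e by (rule wedge_list_append_span_zero) (use pS span_mono[of "set (complexify us)" "set (complexify us @ [b])"] in auto)
	have z2: "wedge ?x (wedge_list [a, \<i> *s p]) = 0" for a
	proof -
		have "\<i> *s p : span (set ((complexify us @ [a]) @ []))"
			using ipS span_mono[of "set (complexify us)" "set ((complexify us @ [a]) @ [])"] by auto
		from wedge_list_append_span_zero[OF this] show ?thesis unfolding e by simp
	qed
	have iv: "\<i> *s v = \<i> *s (v - p) + \<i> *s p" by (simp add: vec_eq_iff algebra_simps)
	have "wedge ?x (wedge_list [v, \<i> *s v]) = wedge ?x (wedge_list [(v - p) + p, \<i> *s v])" by simp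
	also have "... = wedge ?x (wedge_list [v - p, \<i> *s v])" unfolding add z1 by simp
	also have "... = wedge ?x (wedge_list [v - p, \<i> *s (v - p)])" unfolding iv add z2 by simp
	finally have main: "wedge ?x (wedge_list (complexify [v])) = wedge ?x (wedge_list [v - p, \<i> *s (v - p)])" by simp
	show ?thesis
	proof (cases "r = 0")
		case True
		hence "v - p = 0" by (simp add: r_def)
		hence "wedge ?x (wedge_list (complexify [v])) = 0"
			unfolding main by (simp only: wedge_list_Cons linear_0[OF linear_ext_vec] wedge_linear_simps)
		moreover have "1 - (SUM u:set us. (cmod (herm v u))\<^sup>2) = 0" using r True by simp
		\<comment> \<open>The coefficient is zero, so any unitary list of the right length serves.\<close>
		ultimately show ?thesis using that[OF vs] by simp
	next
		case False
		define f where "f = (1 / r) *\<^sub>R (v - p)"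
		have vf: "v - p = r *\<^sub>R f" "\<i> *s (v - p) = r *\<^sub>R (\<i> *s f)"
			using False by (simp_all add: f_def vec_eq_iff right_diff_distrib)
		have "norm f = 1" using False by (simp add: f_def r_def)
		moreover have "herm u f = 0" if "u : set us" for u
			unfolding herm_zero_commute[of u] f_def scaleR_eq_vector_scale herm_simps(5)
				unitary_list_proj[OF us that, of v, folded p_def] by simp
		ultimately have "unitary_list (us @ [f])" using us by (simp add: unitary_list_append unitary_list_Cons)
		moreover have "wedge ?x (wedge_list (complexify [v])) = r\<^sup>2 *\<^sub>R wedge_list (complexify (us @ [f]))"
			unfolding main vf(2) unfolding vf(1) scale by (simp add: wedge_list_append power2_eq_square)
		ultimately show ?thesis using that[of "us @ [f]"] r by simp
	qed
qed

text \<open>By left invariance the mean is the same for all unit vectors \<open>u\<close>. Over a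
  unitary basis the squares add up to the squared norm of \<open>h *v e\<close>, which is 1.\<close>

lemma haar_herm_average:
	fixes e u :: "complex ^ 'n::finite"
	assumes mu: "haar_prob unitary_group mu" and e: "norm e = 1" and u: "norm u = 1"
	shows "(LINT h|mu. (cmod (herm (h *v e) u))\<^sup>2) = 1 / CARD('n)" "integrable mu (%h. (cmod (herm (h *v e) u))\<^sup>2)"
proof -
	interpret M: prob_space mu using mu by (simp add: haar_prob_def)
	have cont: "continuous_on UNIV (%h. (cmod (herm (h *v e) v))\<^sup>2)" for v :: "complex ^ 'n"
		unfolding herm_def by (intro continuous_intros)
	have m: "(%h. (cmod (herm (h *v e) v))\<^sup>2) : borel_measurable borel" for v :: "complex ^ 'n"
		by (rule borel_measurable_continuous_onI[OF cont])
	have le: "(cmod (herm x v))\<^sup>2 <= 1" if "norm x = 1" "norm v = 1" for x v :: "complex ^ 'n"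
	proof -
		have "unitary_list [v]" using that by (simp add: unitary_list_Cons)
		from unitary_list_parseval[OF this, of x] that show ?thesis by simp (smt (verit) zero_le_power2)
	qed
	have norm_he: "norm (h *v e) = 1" if "h : unitary_group" for h
		using orthogonal_transformation_norm[OF orthogonal_unitary[OF that]] e by simp
	have i: "integrable mu (%h. (cmod (herm (h *v e) v))\<^sup>2)" if "norm v = 1" for v
		using that le norm_he haar_prob_space[OF mu]
		by (intro M.integrable_const_bound[where B=1] haar_measurable[OF mu m] AE_I2) auto
	thus "integrable mu (%h. (cmod (herm (h *v e) u))\<^sup>2)" using u by blast
	have eq: "(LINT h|mu. (cmod (herm (h *v e) v))\<^sup>2) = (LINT h|mu. (cmod (herm (h *v e) u))\<^sup>2)" if "norm v = 1" for v
	proof -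
		have "unitary_list [u]" "unitary_list [v]" using u that by (auto simp: unitary_list_Cons)
		then obtain g where g: "g : unitary_group" "map ((*v) g) [u] = [v]" using unitary_transitive by (metis length_Cons)
		have "(LINT h|mu. (cmod (herm (h *v e) v))\<^sup>2) = (LINT h|mu. (cmod (herm ((g ** h) *v e) v))\<^sup>2)"
			using haar_integrals(1)[OF matrix_group_unitary mu m[of v] _ g(1)] by simp
		also have "... = (LINT h|mu. (cmod (herm (h *v e) u))\<^sup>2)"
		proof -
			have "herm ((g ** h) *v e) v = herm (h *v e) u" for h
				using herm_unitary[OF g(1), of "h *v e" u] g(2) by (simp add: matrix_vector_mul_assoc)
			thus ?thesis by simp
		qed
		finally show ?thesis .
	qed
	obtain b :: "(complex ^ 'n) list" where b: "unitary_list b" "span (set (complexify b)) = UNIV" "length b = CARD('n)"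
		using unitary_list_complete[of "[] :: (complex ^ 'n) list"] by auto
	have db: "card (set b) = CARD('n)" using b by (metis distinct_card unitary_list_def)
	have nb: "norm v = 1" if "v : set b" for v using b(1) that herm_self_1[of v] by (simp add: unitary_list_def)
	have "(SUM v:set b. (cmod (herm x v))\<^sup>2) = (norm x)\<^sup>2" for x
		using unitary_list_parseval[OF b(1), of x] unitary_list_expand[OF b(1,2), of x] by simp
	hence "(LINT h|mu. (SUM v:set b. (cmod (herm (h *v e) v))\<^sup>2)) = (LINT h|mu. 1)"
		using norm_he by (intro Bochner_Integration.integral_cong) (auto simp: haar_prob_space[OF mu])
	also have "... = 1" by (simp add: M.prob_space)
	also have "(LINT h|mu. (SUM v:set b. (cmod (herm (h *v e) v))\<^sup>2)) = (SUM v:set b. \<integral>h. (cmod (herm (h *v e) v))\<^sup>2 \<partial>mu)"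
		by (rule Bochner_Integration.integral_sum) (use i nb in blast)
	also have "... = CARD('n) * (LINT h|mu. (cmod (herm (h *v e) u))\<^sup>2)"
		using eq nb db by simp
	finally show "(LINT h|mu. (cmod (herm (h *v e) u))\<^sup>2) = 1 / CARD('n)" by (simp add: field_simps)
qed

text \<open>The factors are rotated independently, by \<open>g\<close> and \<open>h\<close>.
  Replacing \<open>h\<close> by \<open>g ** h\<close> brings the common rotation \<open>g\<close> in
  front of the product, and \<open>wedge_complex_line\<close> leaves a scalar depending on
  \<open>h\<close> times a frame rotated by \<open>g\<close>, so that the two means
  separate.\<close>

lemma frame_zonoid_wedge:
	fixes us vs :: "(complex ^ 'n::finite) list"
	assumes mu: "haar_prob unitary_group mu" and us: "unitary_list us"
		and vs: "unitary_list vs" "length vs = Suc (length us)" and e: "norm e = 1"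
	shows "vz_wedge (frame_zonoid mu us) (frame_zonoid mu [e]) = (1 - length us / CARD('n)) *\<^sub>R frame_zonoid mu vs"
proof (rule vz_support_eqI)
	fix u
	interpret M: prob_space mu using mu by (simp add: haar_prob_def)
	interpret P: pair_prob_space mu mu ..
	let ?x = "wedge_list (complexify us)" and ?y = "wedge_list (complexify [e])"
	have pair_m: "(%z. f (fst z) (snd z)) : borel_measurable (mu \<Otimes>\<^sub>M mu)"
		if "(%z. f (fst z) (snd z)) : borel_measurable (borel \<Otimes>\<^sub>M borel)" for f :: "complex ^ 'n ^ 'n => complex ^ 'n ^ 'n => real"
	proof -
		have "(%z. (fst z, snd z)) : measurable (mu \<Otimes>\<^sub>M mu) (borel \<Otimes>\<^sub>M borel)"
			using haar_measurable_id[OF mu]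
			by (intro measurable_Pair measurable_compose[OF measurable_fst] measurable_compose[OF measurable_snd]) auto
		from measurable_compose[OF this that] show ?thesis by simp
	qed
	have i0: "integrable (mu \<Otimes>\<^sub>M mu) (%(g, h). wedge (ext_map g ?x) (ext_map h ?y))"
		by (rule integrable_pair_bilinear[OF bounded_bilinear_wedge M.prob_space_axioms integrable_ext_map[OF mu]
			M.prob_space_axioms integrable_ext_map[OF mu]])
	hence i1: "integrable (mu \<Otimes>\<^sub>M mu) (%z. abs (u \<bullet> (case z of (g, h) => wedge (ext_map g ?x) (ext_map h ?y))))"
		by (rule integrable_abs_inner)
	define F where "F g h = abs (u \<bullet> wedge (ext_map g ?x) (ext_map (g ** h) ?y))" for g h
	have i2: "integrable (mu \<Otimes>\<^sub>M mu) (%(g, h). F g h)"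
	proof -
		obtain C where C: "0 < C" "!!x y :: 'n ext. norm (wedge x y) <= C * norm x * norm y" by (rule wedge_norm_bound) blast
		have m: "(%z. F (fst z) (snd z)) : borel_measurable (mu \<Otimes>\<^sub>M mu)"
			unfolding F_def by (rule pair_m) measurable
		have "F g h <= norm u * (C * norm ?x * norm ?y)" if "g : unitary_group" "h : unitary_group" for g h
		proof -
			have "F g h <= norm u * norm (wedge (ext_map g ?x) (ext_map (g ** h) ?y))"
				unfolding F_def by (rule Cauchy_Schwarz_ineq2)
			also have "... <= norm u * (C * norm (ext_map g ?x) * norm (ext_map (g ** h) ?y))"
				by (intro mult_left_mono C) auto
			finally show ?thesis using that by (simp add: norm_ext_map unitary_group_mult)
		qed
		thus ?thesis
			using m by (intro P.integrable_const_bound[where B="norm u * (C * norm ?x * norm ?y)"] AE_I2)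
				(auto simp: space_pair_measure haar_prob_space[OF mu] split_beta F_def)
	qed
	have s1: "vz_support (vz_wedge (frame_zonoid mu us) (frame_zonoid mu [e])) u =
			1/2 * (LINT z|(mu \<Otimes>\<^sub>M mu). \<bar>u \<bullet> (case z of (g, h) => wedge (ext_map g ?x) (ext_map h ?y))\<bar>)"
		unfolding frame_zonoid_def vz_wedge_vz[OF M.prob_space_axioms integrable_ext_map[OF mu] M.prob_space_axioms integrable_ext_map[OF mu]]
		by (rule vz_support_vz[OF i0])
	have "(LINT z|(mu \<Otimes>\<^sub>M mu). \<bar>u \<bullet> (case z of (g, h) => wedge (ext_map g ?x) (ext_map h ?y))\<bar>) =
			(LINT g|mu. \<integral>h. \<bar>u \<bullet> wedge (ext_map g ?x) (ext_map h ?y)\<bar> \<partial>mu)"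
		using P.integral_fst'[OF i1] by simp
	also have "... = (LINT g|mu. \<integral>h. F g h \<partial>mu)"
	proof (rule Bochner_Integration.integral_cong[OF refl])
		fix g assume "g : space mu"
		hence g: "g : unitary_group" by (simp add: haar_prob_space[OF mu])
		have "(%h. abs (u \<bullet> wedge (ext_map g ?x) (ext_map h ?y))) : borel_measurable borel" by measurable
		from haar_integrals(1)[OF matrix_group_unitary mu this _ g]
		show "(LINT h|mu. abs (u \<bullet> wedge (ext_map g ?x) (ext_map h ?y))) = (LINT h|mu. F g h)" by (simp add: F_def)
	qed
	also have "... = (LINT h|mu. \<integral>g. F g h \<partial>mu)"
		using P.Fubini_integral[OF i2] by simp
	also have "... = (LINT h|mu. (1 - (SUM v:set us. (cmod (herm (h *v e) v))\<^sup>2)) * (LINT g|mu. abs (u \<bullet> ext_map g (wedge_list (complexify vs)))))"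
	proof (rule Bochner_Integration.integral_cong[OF refl])
		fix h assume "h : space mu"
		hence h: "h : unitary_group" by (simp add: haar_prob_space[OF mu])
		have n: "norm (h *v e) = 1" using orthogonal_transformation_norm[OF orthogonal_unitary[OF h]] e by simp
		obtain ws where ws: "unitary_list ws" "length ws = Suc (length us)"
			"wedge ?x (wedge_list (complexify [h *v e])) =
				(1 - (SUM v:set us. (cmod (herm (h *v e) v))\<^sup>2)) *\<^sub>R wedge_list (complexify ws)"
			by (rule wedge_complex_line[OF us vs n])
		have lin: "linear (ext_map g)" for g :: "complex ^ 'n ^ 'n" by (simp add: ext_map_eq linear_ext_lin)
		have "ext_map h ?y = wedge_list (complexify [h *v e])"
			unfolding ext_map_wedge_list map_complexify by simp
		hence hy: "wedge ?x (ext_map h ?y) = (1 - (SUM v:set us. (cmod (herm (h *v e) v))\<^sup>2)) *\<^sub>R wedge_list (complexify ws)"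
			using ws(3) by simp
		have gw: "wedge (ext_map g ?x) (ext_map (g ** h) ?y) = ext_map g (wedge ?x (ext_map h ?y))" for g
			unfolding ext_map_mult by (simp only: ext_map_eq[of g] ext_lin_wedge[OF linear_matrix_vector])
		have "wedge (ext_map g ?x) (ext_map (g ** h) ?y) =
				(1 - (SUM v:set us. (cmod (herm (h *v e) v))\<^sup>2)) *\<^sub>R ext_map g (wedge_list (complexify ws))" for g
			unfolding gw hy by (rule linear_scale[OF lin])
		hence F: "F g h = abs (1 - (SUM v:set us. (cmod (herm (h *v e) v))\<^sup>2)) * abs (u \<bullet> ext_map g (wedge_list (complexify ws)))" for g
			by (simp add: F_def abs_mult)
		have "0 <= 1 - (SUM v:set us. (cmod (herm (h *v e) v))\<^sup>2)"
			using zero_le_power2[of "norm (h *v e - (SUM u:set us. herm (h *v e) u *s u))"]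
			unfolding unitary_list_parseval[OF us] n by simp
		thus "(LINT g|mu. F g h) = (1 - (SUM v:set us. (cmod (herm (h *v e) v))\<^sup>2)) * (LINT g|mu. abs (u \<bullet> ext_map g (wedge_list (complexify vs))))"
			using frame_integral[OF mu ws(1) vs(1)] ws(2) vs(2) by (simp add: F)
	qed
	also have "... = (LINT h|mu. (1 - (SUM v:set us. (cmod (herm (h *v e) v))\<^sup>2))) * (LINT g|mu. abs (u \<bullet> ext_map g (wedge_list (complexify vs))))"
		by simp
	also have "(LINT h|mu. (1 - (SUM v:set us. (cmod (herm (h *v e) v))\<^sup>2))) = 1 - length us / CARD('n)"
	proof -
		have nv: "norm v = 1" if "v : set us" for v using us that herm_self_1[of v] by (simp add: unitary_list_def)
		have "(LINT h|mu. (1 - (SUM v:set us. (cmod (herm (h *v e) v))\<^sup>2))) = 1 - (SUM v:set us. (LINT h|mu. (cmod (herm (h *v e) v))\<^sup>2))"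
			using haar_herm_average(2)[OF mu e] nv by (simp add: M.prob_space)
		also have "(SUM v:set us. (LINT h|mu. (cmod (herm (h *v e) v))\<^sup>2)) = card (set us) * (1 / CARD('n))"
			using haar_herm_average(1)[OF mu e] nv by simp
		also have "card (set us) = length us" using us by (simp add: unitary_list_def distinct_card)
		finally show ?thesis by simp
	qed
	finally show "vz_support (vz_wedge (frame_zonoid mu us) (frame_zonoid mu [e])) u =
			vz_support ((1 - length us / CARD('n)) *\<^sub>R frame_zonoid mu vs) u"
		by (simp add: s1 vz_support_frame_zonoid[OF mu])
qed

lemma unitary_list_exists:
	assumes "j <= CARD('n::finite)"
	obtains us :: "(complex ^ 'n) list" where "unitary_list us" "length us = j"
proof -
	obtain b :: "(complex ^ 'n) list" where b: "unitary_list b" "length b = CARD('n)"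
		using unitary_list_complete[of "[] :: (complex ^ 'n) list"] by auto
	have "unitary_list (take j b @ drop j b)" using b(1) by simp
	hence "unitary_list (take j b)" unfolding unitary_list_append by blast
	thus ?thesis using that[of "take j b"] b(2) assms by simp
qed

text \<open>The step from \<open>j\<close> to \<open>Suc j\<close> contributes the factor 1 - j/n,
  and the product of these factors is the quotient of factorials over the power of n.\<close>

lemma frame_zonoid_power:
	fixes us :: "(complex ^ 'n::finite) list"
	assumes mu: "haar_prob unitary_group mu" and e: "norm e = 1"
		and us: "unitary_list us" "length us = j" "j <= CARD('n)"
	shows "Q_class (c *\<^sub>R frame_zonoid mu [e]) [^]\<^bsub>Q_algebra\<^esub> j =
		Q_class ((c ^ j * (fact CARD('n) / (fact (CARD('n) - j) * real CARD('n) ^ j))) *\<^sub>R frame_zonoid mu us)"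
	using us
proof (induction j arbitrary: us)
	case 0
	thus ?case by (simp add: frame_zonoid_Nil[OF mu] Q_class_one)
next
	case (Suc j)
	obtain vs :: "(complex ^ 'n) list" where vs: "unitary_list vs" "length vs = j"
		using unitary_list_exists[where 'n='n, of j] Suc.prems by auto
	let ?n = "CARD('n)"
	let ?a = "c ^ j * (fact ?n / (fact (?n - j) * real ?n ^ j))"
	have car: "r *\<^sub>R frame_zonoid mu ws : grass_carrier" for r and ws :: "(complex ^ 'n) list"
		using frame_zonoid_grass_deg[OF mu] grass_deg_carrier by (intro span_scale) blast
	have "Q_class (c *\<^sub>R frame_zonoid mu [e]) [^]\<^bsub>Q_algebra\<^esub> Suc j =
			Q_class (?a *\<^sub>R frame_zonoid mu vs) \<otimes>\<^bsub>Q_algebra\<^esub> Q_class (c *\<^sub>R frame_zonoid mu [e])"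
		using Suc.IH[OF vs] Suc.prems(3) by simp
	also have "... = Q_class (vz_wedge (?a *\<^sub>R frame_zonoid mu vs) (c *\<^sub>R frame_zonoid mu [e]))"
		by (rule Q_class_mult[OF car car])
	also have "vz_wedge (?a *\<^sub>R frame_zonoid mu vs) (c *\<^sub>R frame_zonoid mu [e]) =
			(?a * c * (1 - real j / real ?n)) *\<^sub>R frame_zonoid mu us"
		using frame_zonoid_wedge[OF mu vs(1) Suc.prems(1) _ e] vs(2) Suc.prems(2)
		by (simp add: bilinear_lmul[OF bilinear_vz_wedge] bilinear_rmul[OF bilinear_vz_wedge] mult_ac)
	also have "?a * c * (1 - real j / real ?n) = c ^ Suc j * (fact ?n / (fact (?n - Suc j) * real ?n ^ Suc j))"
	proof -
		have "?n - j = Suc (?n - Suc j)" using Suc.prems by simp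
		hence f: "fact (?n - j) = real (?n - j) * fact (?n - Suc j)" by (metis fact_Suc of_nat_mult)
		have d: "real (?n - j) = real ?n - real j" "real ?n - real j ~= 0" using Suc.prems by auto
		show ?thesis unfolding f d(1) using d(2) by (simp add: field_simps)
	qed
	finally show ?case .
qed

lemma P_zonoid_frame: "P_zonoid mu k = frame_zonoid mu [axis k 1]"
	by (simp add: P_zonoid_def frame_zonoid_def)

section \<open>Projective space\<close>

lemma sum_option: "(SUM i:(UNIV :: 'n::finite option set). f i) = f None + (SUM k:UNIV. f (Some k))"
	unfolding UNIV_option_conv by (simp add: sum.reindex)

definition emb :: "complex => complex ^ 'n => complex ^ ('n::finite option)"
	where "emb c w = (\<chi> i. case i of None => c | Some k => w $ k)"

definition tail :: "complex ^ ('n::finite option) => complex ^ 'n"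
	where "tail z = (\<chi> k. z $ Some k)"

lemma emb_nth [simp]: "emb c w $ None = c" "emb c w $ Some k = w $ k"
	by (simp_all add: emb_def)

lemma tail_nth [simp]: "tail z $ k = z $ Some k"
	by (simp add: tail_def)

lemma tail_emb [simp]: "tail (emb c w) = w"
	by (simp add: vec_eq_iff)

lemma emb_tail [simp]: "emb (z $ None) (tail z) = z"
	by (simp add: vec_eq_iff split_option_all)

lemma vec_option_eq_iff: "(x :: 'a ^ ('n::finite option)) = y \<longleftrightarrow> x $ None = y $ None & (ALL k. x $ Some k = y $ Some k)"
	by (simp add: vec_eq_iff split_option_all)

lemma emb_simps:
	"emb (c + d) (v + w) = emb c v + emb d w" "emb (a * c) (a *s w) = a *s emb c w"
	"emb (r *\<^sub>R c) (r *\<^sub>R w) = r *\<^sub>R emb c w"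
	by (simp_all add: vec_option_eq_iff)

lemma emb_eq: "emb c w = c *s axis None 1 + emb 0 w"
	by (simp add: vec_option_eq_iff axis_def)

lemma emb_zero: "emb 1 0 = axis None 1"
	by (simp add: vec_option_eq_iff axis_def)

lemma linear_emb0: "linear (emb 0)"
	by (rule linearI) (simp_all add: vec_option_eq_iff)

lemma linear_tail: "linear tail"
	by (rule linearI) (simp_all add: vec_eq_iff)

lemma norm_emb: "(norm (emb c w))\<^sup>2 = (cmod c)\<^sup>2 + (norm w)\<^sup>2"
	by (simp add: power2_norm_eq_inner inner_vec_def sum_option)

lemma has_derivative_emb1:
	fixes w :: "complex ^ 'n::finite"
	shows "(emb 1 has_derivative emb 0) (at w within S)"
proof -
	have "((%w :: complex ^ 'n. axis None 1 + emb 0 w) has_derivative emb 0) (at w within S)"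
		by (auto intro!: derivative_eq_intros linear_imp_has_derivative linear_emb0)
	moreover have "(%w :: complex ^ 'n. axis None 1 + emb 0 w) = emb 1" by (rule ext) (simp add: emb_eq[of 1])
	ultimately show ?thesis by simp
qed

lemma bounded_bilinear_cscale: "bounded_bilinear (%(c :: complex) (v :: complex ^ 'n::finite). c *s v)"
	unfolding bilinear_conv_bounded_bilinear[symmetric] bilinear_def
	by (auto intro!: linearI simp: vec_eq_iff algebra_simps)

definition outer :: "complex ^ 'm => complex ^ 'm => complex ^ 'm ^ 'm::finite"
	where "outer z z' = (\<chi> i j. z $ i * cnj (z' $ j))"

lemma bounded_bilinear_outer: "bounded_bilinear outer"
	unfolding bilinear_conv_bounded_bilinear[symmetric] bilinear_def
	by (auto intro!: linearI simp: vec_eq_iff outer_def algebra_simps)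

lemma outer_nth [simp]: "outer z z' $ i $ j = z $ i * cnj (z' $ j)"
	by (simp add: outer_def)

lemma pt_nth: "pt z $ i $ j = z $ i * cnj (z $ j) / complex_of_real ((norm z)\<^sup>2)"
	by (simp add: pt_def)

lemma pt_outer: "pt z = (1 / (norm z)\<^sup>2) *\<^sub>R outer z z"
	unfolding vec_eq_iff vector_scaleR_component pt_nth outer_nth by (simp add: scaleR_conv_of_real divide_simps)

lemma pt_scale: "c ~= 0 ==> pt (c *s z) = pt z"
proof -
	assume c: "c ~= 0"
	have e: "c * a * (cnj c * b) = complex_of_real ((cmod c)\<^sup>2) * (a * b)" for a b
		by (simp only: complex_norm_square mult_ac)
	show ?thesis
		unfolding vec_eq_iff pt_nth norm_vector_scale power_mult_distrib of_real_mult vector_smult_component complex_cnj_mult e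
		using c by simp
qed

lemma bounded_linear_act: "bounded_linear (act g)"
proof -
	have "linear (act g)"
		unfolding act_def
		by (rule linearI) (simp_all add: matrix_add_ldistrib bilinear_ladd[OF bilinear_matrix_mult]
				bilinear_radd[OF bilinear_matrix_mult] bilinear_lmul[OF bilinear_matrix_mult] bilinear_rmul[OF bilinear_matrix_mult])
	thus ?thesis by (simp add: linear_conv_bounded_linear)
qed

lemma linear_act: "linear (act g)"
	by (rule bounded_linear.linear[OF bounded_linear_act])

lemma act_mult: "act (g ** h) y = act g (act h y)"
	by (simp add: act_def adj_mult matrix_mul_assoc)

lemma act_one [simp]: "act (mat 1) y = y"
	by (simp add: act_def)

lemma act_adj [simp]:
	assumes "g : unitary_group" shows "act (adj g) (act g y) = y" "act g (act (adj g) y) = y"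
	using assms by (simp_all add: unitary_group_iff flip: act_mult)

lemma matrix_outer: "act g (outer z z') = outer (g *v z) (g *v z')"
proof -
	have "act g (outer z z') $ i $ j = outer (g *v z) (g *v z') $ i $ j" for i j
		by (simp add: act_def matrix_matrix_mult_def matrix_vector_mult_def adj_def sum_distrib_right sum_distrib_left mult_ac)
	thus ?thesis by (simp add: vec_eq_iff)
qed

lemma norm_unitary: "g : unitary_group ==> norm (g *v z) = norm z"
	by (rule orthogonal_transformation_norm[OF orthogonal_unitary])

lemma act_pt: "g : unitary_group ==> act g (pt z) = pt (g *v z)"
	by (simp add: pt_outer linear_scale[OF linear_act] matrix_outer norm_unitary)

lemma inner_mat_adj: "adj X \<bullet> adj Z = X \<bullet> (Z :: complex ^ 'm ^ 'm::finite)"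
	unfolding inner_vec_def adj_def by (simp add: inner_complex_def) (rule sum.swap)

lemma inner_mat_left:
	fixes X Z :: "complex ^ 'm ^ 'm::finite"
	assumes "g : unitary_group" shows "(g ** X) \<bullet> (g ** Z) = X \<bullet> Z"
proof -
	have e: "X \<bullet> Z = (SUM j:UNIV. column j X \<bullet> column j Z)" for X Z :: "complex ^ 'm ^ 'm::finite"
		unfolding inner_vec_def column_def by (simp add: inner_complex_def) (rule sum.swap)
	have c: "column j (g ** X) = g *v column j X" for j and X :: "complex ^ 'm ^ 'm"
		by (simp add: vec_eq_iff column_def matrix_matrix_mult_def matrix_vector_mult_def)
	have "(g *v x) \<bullet> (g *v y) = x \<bullet> y" for x y
		using orthogonal_unitary[OF assms] by (simp add: orthogonal_transformation_def)
	thus ?thesis unfolding e c by simp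
qed

lemma inner_act: "g : unitary_group ==> act g X \<bullet> act g Z = X \<bullet> Z"
proof -
	assume g: "g : unitary_group"
	have "act g X \<bullet> act g Z = adj (act g X) \<bullet> adj (act g Z)" by (simp add: inner_mat_adj)
	also have "... = (g ** (adj X ** adj g)) \<bullet> (g ** (adj Z ** adj g))"
		by (simp add: act_def adj_mult matrix_mul_assoc)
	also have "... = adj (g ** X) \<bullet> adj (g ** Z)" by (simp add: inner_mat_left[OF g] adj_mult)
	finally show ?thesis by (simp add: inner_mat_adj inner_mat_left[OF g])
qed

lemma fs_metric_act: "g : unitary_group ==> fs_metric (act g X) (act g Z) = fs_metric X Z"
	by (simp add: fs_metric_def inner_act)

lemma horizontal_nth [simp]:
	"horizontal w $ None $ None = 0" "horizontal w $ Some i $ None = w $ i"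
	"horizontal w $ None $ Some i = cnj (w $ i)" "horizontal w $ Some i $ Some k = 0"
	by (simp_all add: horizontal_def)

lemma horizontal_outer: "horizontal w = outer (emb 0 w) (axis None 1) + outer (axis None 1) (emb 0 w)"
	by (simp add: vec_option_eq_iff axis_def)

lemma linear_horizontal: "linear horizontal"
	by (rule linearI) (simp_all add: vec_option_eq_iff)

lemma fs_metric_horizontal: "fs_metric (horizontal v) (horizontal w) = v \<bullet> w"
	unfolding fs_metric_def inner_vec_def by (simp add: sum_option inner_complex_def sum.distrib)

lemma inj_horizontal: "horizontal v = horizontal w \<longleftrightarrow> v = w"
	by (auto simp: vec_option_eq_iff vec_eq_iff)

lemma pt_in_CP: "z ~= 0 ==> pt z : CP"
	by (auto simp: CP_def)

lemma CP_E:
	assumes "y : CP" obtains z where "z ~= 0" "y = pt z"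
	using assms by (auto simp: CP_def)

lemma emb1_nonzero [simp]: "emb 1 w ~= 0"
	by (auto simp: vec_option_eq_iff)

text \<open>The inverse of w |-> [1 : w] on homogeneous vectors. \<open>coord\<close> is the same
  map read off the first column of a projection matrix.\<close>

definition slope :: "complex ^ ('n::finite option) => complex ^ 'n"
	where "slope z = inverse (z $ None) *s tail z"

definition coord :: "'n::finite hmat => complex ^ 'n"
	where "coord y = inverse (y $ None $ None) *s (\<chi> k. y $ Some k $ None)"

lemma slope_emb [simp]: "slope (emb 1 w) = w"
	by (simp add: slope_def vec_eq_iff)

lemma emb_slope: "z $ None ~= 0 ==> emb 1 (slope z) = inverse (z $ None) *s z"
	by (simp add: vec_option_eq_iff slope_def)

lemma pt_emb_slope: "z $ None ~= 0 ==> pt (emb 1 (slope z)) = pt z"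
	by (simp add: emb_slope pt_scale)

lemma coord_pt: "z $ None ~= 0 ==> coord (pt z) = slope z"
proof -
	assume z: "z $ None ~= 0"
	hence "z ~= 0" by auto
	thus ?thesis using z by (simp add: coord_def slope_def vec_eq_iff pt_nth field_simps)
qed

lemma pt_None_None: "z ~= 0 ==> pt z $ None $ None = 0 \<longleftrightarrow> z $ None = 0"
	by (simp add: pt_nth)

lemma pt_emb_coord: "y : CP ==> y $ None $ None ~= 0 ==> pt (emb 1 (coord y)) = y"
	by (metis CP_E coord_pt pt_None_None pt_emb_slope)

lemma base_pt_nth: "base_pt $ i $ j = (if i = None & j = None then 1 else 0)"
	unfolding base_pt_def emb_zero[symmetric] pt_nth norm_emb by (cases i; cases j) simp_all

lemma base_pt_emb: "base_pt = pt (emb 1 0)"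
	by (simp add: base_pt_def emb_zero)

lemma coord_base_pt: "coord base_pt = 0"
	by (simp add: base_pt_emb coord_pt)

lemma bounded_linear_entry: "bounded_linear (%y :: complex ^ 'm ^ 'k. y $ i $ j)"
	by (rule bounded_linear_compose[OF bounded_linear_vec_nth bounded_linear_vec_nth])

lemma bounded_linear_first_column: "bounded_linear (%y :: 'n::finite hmat. \<chi> k. y $ Some k $ None)"
proof -
	have "linear (%y :: 'n hmat. \<chi> k. y $ Some k $ None)" by (rule linearI) (simp_all add: vec_eq_iff)
	thus ?thesis by (simp add: linear_conv_bounded_linear)
qed

lemma has_derivative_coord:
	"(coord has_derivative (%X. \<chi> k. X $ Some k $ None)) (at (base_pt :: 'n::finite hmat))"
proof -
	have e: "((%y :: 'n hmat. y $ None $ None) has_derivative (%X. X $ None $ None)) (at base_pt)"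
		by (rule bounded_linear.has_derivative[OF bounded_linear_entry has_derivative_ident])
	have i: "((%y :: 'n hmat. inverse (y $ None $ None)) has_derivative (%X. - (inverse 1 * X $ None $ None * inverse 1))) (at base_pt)"
		by (rule has_derivative_eq_rhs[OF Deriv.has_derivative_inverse[OF _ e]]) (simp_all add: base_pt_nth)
	have t: "((%y :: 'n hmat. (\<chi> k. y $ Some k $ None) :: complex ^ 'n) has_derivative (%X. \<chi> k. X $ Some k $ None)) (at base_pt)"
		by (rule bounded_linear.has_derivative[OF bounded_linear_first_column has_derivative_ident])
	show ?thesis
		unfolding coord_def
		by (rule has_derivative_eq_rhs[OF bounded_bilinear.FDERIV[OF bounded_bilinear_cscale i t]])
			(simp add: fun_eq_iff base_pt_nth vec_eq_iff)
qed

text \<open>The normalizing factor 1/(1 + |w|^2) is stationary at 0, so the derivative comes from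
  the outer product alone.\<close>

lemma has_derivative_pt_emb: "((%w. pt (emb 1 w)) has_derivative horizontal) (at (0 :: complex ^ 'n::finite))"
proof -
	have n: "(norm (emb 1 w))\<^sup>2 = 1 + w \<bullet> w" for w :: "complex ^ 'n"
		unfolding norm_emb power2_norm_eq_inner[of w] by simp
	have r: "((%w :: complex ^ 'n. 1 / (1 + w \<bullet> w)) has_derivative (%v. 0)) (at 0)"
		by (auto intro!: derivative_eq_intros)
	have p: "((%w :: complex ^ 'n. outer (emb 1 w) (emb 1 w)) has_derivative (%v. outer (emb 1 0) (emb 0 v) + outer (emb 0 v) (emb 1 0))) (at 0)"
		by (rule bounded_bilinear.FDERIV[OF bounded_bilinear_outer has_derivative_emb1 has_derivative_emb1])
	show ?thesis
		unfolding pt_outer n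
		by (rule has_derivative_eq_rhs[OF has_derivative_scaleR[OF r p]])
			(simp add: fun_eq_iff horizontal_outer emb_zero add.commute)
qed

section \<open>Tangent spaces from local equations\<close>

lemma tangent_space_mono: "Y \<subseteq> Z ==> tangent_space Y y \<subseteq> tangent_space Z y"
	unfolding tangent_space_def by blast

lemma tangent_space_act:
	assumes g: "g : unitary_group"
	shows "tangent_space (act g ` Y) (act g y) = act g ` tangent_space Y y"
proof -
	have sub: "act g ` tangent_space Y y \<subseteq> tangent_space (act g ` Y) (act g y)" for g Y and y :: "'a hmat"
		unfolding tangent_space_def
	proof clarsimp
		fix c X assume c: "ALL t. c t : Y" "y = c 0" "(c has_vector_derivative X) (at 0)"
		show "EX c'. c' 0 = act g (c 0) & (ALL t. c' t : act g ` Y) & (c' has_vector_derivative act g X) (at 0)"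
			using c by (intro exI[of _ "%t. act g (c t)"]) (auto intro: bounded_linear.has_vector_derivative[OF bounded_linear_act])
	qed
	have "tangent_space (act g ` Y) (act g y) \<subseteq> act g ` tangent_space Y y"
	proof
		fix X assume "X : tangent_space (act g ` Y) (act g y)"
		hence "act (adj g) X : tangent_space (act (adj g) ` act g ` Y) (act (adj g) (act g y))"
			using sub by blast
		hence "act (adj g) X : tangent_space Y y" using g by (simp add: image_image)
		hence "act g (act (adj g) X) : act g ` tangent_space Y y" by blast
		thus "X : act g ` tangent_space Y y" using g by simp
	qed
	with sub show ?thesis by blast
qed

text \<open>A form of the implicit function theorem for equations differentiable at one point: a
  zero near \<open>t *\<^sub>R w\<close> is found by Brouwer's theorem in the complex span of the
  dual vectors \<open>v k\<close>, where the linear part of the equations is the identity.\<close>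

lemma zero_set_approximation:
	fixes f :: "nat => complex ^ 'n::finite => complex"
	assumes U: "open U" "0 : U" and cont: "!!k. k < j ==> continuous_on U (f k)"
		and der: "!!k. k < j ==> (f k has_derivative D k) (at 0)"
		and lin: "!!k c v. k < j ==> D k (c *s v) = c * D k v"
		and dual: "!!k l. k < j ==> l < j ==> D k (v l) = (if k = l then 1 else 0)"
		and f0: "!!k. k < j ==> f k 0 = 0" and w: "!!k. k < j ==> D k w = 0" and e: "0 < eps"
	shows "EX de>0. ALL t. abs (t) < de --> (EX q:U. (ALL k<j. f k q = 0) & norm (q - t *\<^sub>R w) <= eps * abs (t))"
proof -
	define V where "V = (\<Sum>k<j. norm (v k))"
	\<comment> \<open>The relative error allowed in the linearization: summed against the norms of the
	  \<open>v k\<close> it stays below \<open>eps * \<bar>t\<bar>\<close>. The 1 in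
	  \<open>V + 1\<close> covers \<open>V = 0\<close>.\<close>
	define eta where "eta = eps / ((V + 1) * (norm w + eps))"
	have V0: "0 <= V" by (simp add: V_def sum_nonneg)
	have eta: "0 < eta" using e V0 by (auto simp: eta_def intro!: divide_pos_pos mult_pos_pos add_nonneg_pos)
	have linD: "linear (D k)" if "k < j" for k using der[OF that] by (rule has_derivative_linear)
	have "ALL k. EX rho>0. k < j --> (ALL x. norm x < rho --> norm (f k x - D k x) <= eta * norm x)"
	proof
		fix k
		show "EX rho>0. k < j --> (ALL x. norm x < rho --> norm (f k x - D k x) <= eta * norm x)"
		proof (cases "k < j")
			case True
			from der[OF True] eta obtain rho where "rho > 0" "!!x. norm (x - 0) < rho ==> norm (f k x - f k 0 - D k (x - 0)) <= eta * norm (x - 0)"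
				unfolding has_derivative_at_alt by blast
			thus ?thesis using f0[OF True] by auto
		qed (auto intro: exI[of _ 1])
	qed
	then obtain rho where rho: "!!k. 0 < rho k" "!!k x. k < j ==> norm x < rho k ==> norm (f k x - D k x) <= eta * norm x"
		by metis
	obtain r0 where r0: "0 < r0" "ball 0 r0 \<subseteq> U" using U openE by blast
	define R where "R = Min (insert r0 (rho ` {..<j}))"
	have R: "0 < R" "R <= r0" "!!k. k < j ==> R <= rho k" using r0 rho(1) by (auto simp: R_def)
	define de where "de = R / (norm w + eps)"
	have we: "0 < norm w + eps" using e by (simp add: add_nonneg_pos)
	have de: "0 < de" using R we by (simp add: de_def)
	have "EX q:U. (ALL k<j. f k q = 0) & norm (q - t *\<^sub>R w) <= eps * abs (t)" if t: "\<bar>t\<bar> < de" for t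
	proof -
		define S where "S = span (set (complexify (map v [0..<j])))"
		have cS: "complex_subspace S" unfolding S_def by (rule complex_subspace_span)
		hence sS: "subspace S" by (simp add: complex_subspace_def)
		have vS: "v k : S" if "k < j" for k unfolding S_def using that by (intro span_base) (auto simp: set_complexify)
		have combS: "(\<Sum>k<j. c k *s v k) : S" for c using sS cS vS by (intro subspace_sum complex_subspace_scale) auto
		\<comment> \<open>The projection to \<open>S\<close> along the common kernel of the
		  \<open>D k\<close>.\<close>
		define P where "P x = (\<Sum>k<j. D k x *s v k)" for x
		have linP: "linear P"
			unfolding P_def
		proof (rule linear_compose_sum, rule ballI)
			fix k assume "k : {..<j}"
			hence "linear (D k)" by (auto intro: linD)
			thus "linear (%x. D k x *s v k)"
				by (auto intro!: linearI simp: linear_add linear_scale vec_eq_iff algebra_simps)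
		qed
		have Pv: "P (v l) = v l" if "l < j" for l
		proof -
			have "P (v l) = (\<Sum>k<j. if k = l then v l else 0)"
				unfolding P_def using dual that by (intro sum.cong) auto
			thus ?thesis using that by simp
		qed
		have Piv: "P (\<i> *s v l) = \<i> *s v l" if "l < j" for l
		proof -
			have "P (\<i> *s v l) = (\<Sum>k<j. if k = l then \<i> *s v l else 0)"
				unfolding P_def using dual lin that by (intro sum.cong) auto
			thus ?thesis using that by simp
		qed
		have PS: "P s = s" if "s : S" for s
			by (rule linear_eq_on_span[OF linP linear_ident _ that[unfolded S_def]])
				(use Pv Piv in \<open>auto simp: set_complexify\<close>)
		have Pw: "P w = 0" using w by (simp add: P_def)
		define K where "K = S Int cball 0 (eps * abs (t))"
		\<comment> \<open>At a fixed point all equations vanish, because the \<open>v k\<close> are dual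
		  to the differentials. As \<open>P\<close> is the identity on \<open>S\<close>, the linear part
		  cancels and \<open>Psi s\<close> consists of linearization errors, which keeps it in
		  \<open>K\<close>.\<close>
		define Psi where "Psi s = s - (\<Sum>k<j. f k (t *\<^sub>R w + s) *s v k)" for s
		have small: "norm (t *\<^sub>R w + s) <= abs (t) * (norm w + eps)" "norm (t *\<^sub>R w + s) < R" if "s : K" for s
		proof -
			have "norm (t *\<^sub>R w + s) <= abs (t) * norm w + norm s" using norm_triangle_ineq[of "t *\<^sub>R w" s] by simp
			also have "... <= abs (t) * norm w + eps * abs (t)" using that by (simp add: K_def)
			finally show 1: "norm (t *\<^sub>R w + s) <= abs (t) * (norm w + eps)" by (simp add: algebra_simps)
			have "\<bar>t\<bar> * (norm w + eps) < de * (norm w + eps)" using t we by (intro mult_strict_right_mono)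
			also have "... = R" using we by (simp add: de_def)
			finally show "norm (t *\<^sub>R w + s) < R" using 1 by simp
		qed
		have inU: "t *\<^sub>R w + s : U" if "s : K" for s using small(2)[OF that] R(2) r0(2) by (auto simp: subset_iff)
		have "EX s:K. Psi s = s"
		proof -
			have "compact K" unfolding K_def by (intro closed_Int_compact closed_subspace sS) auto
			moreover have "convex K" unfolding K_def by (rule convex_Int[OF subspace_imp_convex[OF sS] convex_cball])
			moreover have "K ~= {}" using subspace_0[OF sS] e by (auto simp: K_def)
			moreover have "continuous_on K Psi"
				unfolding Psi_def
			proof (intro continuous_intros continuous_on_sum)
				fix k assume "k : {..<j}"
				hence "continuous_on K (%s. f k (t *\<^sub>R w + s))"
					using inU by (intro continuous_on_compose2[OF cont[of k]] continuous_intros) auto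
				thus "continuous_on K (%s. f k (t *\<^sub>R w + s) *s v k)"
					by (intro bounded_bilinear.continuous_on[OF bounded_bilinear_cscale] continuous_intros)
			qed
			moreover have "Psi : K \<rightarrow> K"
			proof
				fix s assume s: "s : K"
				have sS': "s : S" using s by (simp add: K_def)
				have "P (t *\<^sub>R w + s) = s" using PS[OF sS'] Pw by (simp add: linear_add[OF linP] linear_scale[OF linP])
				hence "Psi s = - (\<Sum>k<j. (f k (t *\<^sub>R w + s) - D k (t *\<^sub>R w + s)) *s v k)"
					by (simp add: Psi_def P_def bounded_bilinear.diff_left[OF bounded_bilinear_cscale] sum_subtractf)
				hence "norm (Psi s) <= (\<Sum>k<j. norm ((f k (t *\<^sub>R w + s) - D k (t *\<^sub>R w + s)) *s v k))"
					by (simp add: norm_sum)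
				also have "... <= (\<Sum>k<j. eta * (abs (t) * (norm w + eps)) * norm (v k))"
				proof (intro sum_mono)
					fix k assume k: "k : {..<j}"
					have "norm (t *\<^sub>R w + s) < rho k" using small(2)[OF s] R(3)[of k] k by simp
					hence "cmod (f k (t *\<^sub>R w + s) - D k (t *\<^sub>R w + s)) <= eta * norm (t *\<^sub>R w + s)" using rho(2) k by auto
					also have "... <= eta * (abs (t) * (norm w + eps))" using small(1)[OF s] eta by (intro mult_left_mono) auto
					finally show "norm ((f k (t *\<^sub>R w + s) - D k (t *\<^sub>R w + s)) *s v k) <= eta * (abs (t) * (norm w + eps)) * norm (v k)"
						unfolding norm_vector_scale by (intro mult_right_mono) auto
				qed
				also have "... = eps * abs (t) * (V / (V + 1))"
				proof -
					have "eta * (norm w + eps) = eps / (V + 1)"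
						unfolding eta_def times_divide_eq_left
						by (rule nonzero_mult_divide_mult_cancel_right) (use we in simp)
					hence "eta * (abs (t) * (norm w + eps)) * V = abs (t) * (eps / (V + 1)) * V" by (metis mult.left_commute)
					thus ?thesis unfolding sum_distrib_left[symmetric] V_def[symmetric] by simp
				qed
				also have "... <= eps * abs (t) * 1" using e V0 by (intro mult_left_mono) auto
				finally show "Psi s : K"
					unfolding K_def using sS' combS sS by (auto simp: Psi_def intro: subspace_diff)
			qed
			ultimately show ?thesis using brouwer[of K Psi] by metis
		qed
		then obtain s where s: "s : K" "(\<Sum>k<j. f k (t *\<^sub>R w + s) *s v k) = 0" by (auto simp: Psi_def)
		have "f l (t *\<^sub>R w + s) = 0" if l: "l < j" for l
		proof -
			have "0 = D l (\<Sum>k<j. f k (t *\<^sub>R w + s) *s v k)" using s(2) linear_0[OF linD[OF l]] by simp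
			also have "... = (\<Sum>k<j. f k (t *\<^sub>R w + s) * D l (v k))" by (simp add: linear_sum[OF linD[OF l]] lin[OF l])
			also have "... = (\<Sum>k<j. if k = l then f l (t *\<^sub>R w + s) else 0)" using dual l by (intro sum.cong) auto
			finally show ?thesis using l by simp
		qed
		thus ?thesis using inU[OF s(1)] s(1) by (intro bexI[of _ "t *\<^sub>R w + s"]) (auto simp: K_def)
	qed
	with de show ?thesis by blast
qed

text \<open>Local equations of \<open>Z\<close> in the affine chart centered at the base point. Differentiability
	is only asked for at the center.\<close>

definition local_equations :: "nat => 'n::finite hmat set => (nat => complex ^ 'n => complex) =>
		(nat => complex ^ 'n => complex) => bool"
	where "local_equations j Z f D \<longleftrightarrow> Z \<subseteq> CP & base_pt : Z &
		(EX U. open U & 0 : U & (ALL k<j. continuous_on U (f k)) & (ALL w:U. pt (emb 1 w) : Z \<longleftrightarrow> (ALL k<j. f k w = 0))) &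
		(ALL k<j. (f k has_derivative D k) (at 0)) & (ALL k<j. ALL c v. D k (c *s v) = c * D k v) &
		(ALL c. EX v. ALL k<j. D k v = c k)"

text \<open>A curve in \<open>Z\<close> read in the chart lies in the zero set, so each
  \<open>D k\<close> kills its velocity. Conversely a kernel vector has to be the velocity of a
  curve that stays in \<open>Z\<close> for all times; such a curve is built from almost nearest
  points of the zero set, whose first order behaviour at 0 is given by
  \<open>zero_set_approximation\<close>.\<close>

lemma tangent_space_local_equations:
	fixes Z :: "'n::finite hmat set"
	assumes "local_equations j Z f D"
	shows "tangent_space Z base_pt = horizontal ` {w. ALL k<j. D k w = 0}"
proof -
	have Z: "Z \<subseteq> CP" "base_pt : Z" using assms by (auto simp: local_equations_def)
	have "EX U. open U & 0 : U & (ALL k<j. continuous_on U (f k)) & (ALL w:U. pt (emb 1 w) : Z \<longleftrightarrow> (ALL k<j. f k w = 0))"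
		using assms unfolding local_equations_def by (elim conjE)
	then obtain U where UU: "open U & 0 : U & (ALL k<j. continuous_on U (f k)) & (ALL w:U. pt (emb 1 w) : Z \<longleftrightarrow> (ALL k<j. f k w = 0))"
		by (elim exE)
	hence U: "open U" "0 : U" and cont: "!!k. k < j ==> continuous_on U (f k)"
		and ZU: "!!w. w : U ==> pt (emb 1 w) : Z \<longleftrightarrow> (ALL k<j. f k w = 0)"
		by simp_all
	have der: "(f k has_derivative D k) (at 0)" and lin: "D k (c *s v) = c * D k v" if "k < j" for k c v
		using assms that by (simp_all add: local_equations_def)
	have "ALL l. EX v. ALL k<j. D k v = (if k = l then 1 else 0)"
		using assms by (simp add: local_equations_def)
	then obtain v where v: "!!k l. k < j ==> D k (v l) = (if k = l then 1 else 0)" by metis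
	have f0: "f k 0 = 0" if "k < j" for k using ZU[OF U(2)] Z(2) that by (simp add: base_pt_emb)
	show ?thesis
	proof (intro equalityI subsetI)
		fix X assume "X : tangent_space Z base_pt"
		then obtain c :: "real => 'n hmat" where c: "c 0 = base_pt" "!!t. c t : Z" and cd: "(c has_vector_derivative X) (at 0)"
			by (auto simp: tangent_space_def)
		have cd': "(c has_derivative (%t. t *\<^sub>R X)) (at 0)" using cd by (simp add: has_vector_derivative_def)
		define w :: "complex ^ 'n" where "w = (\<chi> k. X $ Some k $ None)"
		have kd: "((%t. coord (c t)) has_derivative (%t. t *\<^sub>R w)) (at 0)"
		proof -
			have e: "(%t. t *\<^sub>R w) = (%t. \<chi> k. (t *\<^sub>R X) $ Some k $ None)" by (simp add: fun_eq_iff vec_eq_iff w_def)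
			show ?thesis
				unfolding e using has_derivative_compose[OF cd', of coord "%X. \<chi> k. X $ Some k $ None"] has_derivative_coord
				by (simp add: c(1))
		qed
		have cont_c: "isCont c 0" using cd' by (rule has_derivative_continuous)
		have "isCont (%t. coord (c t)) 0" using kd by (rule has_derivative_continuous)
		hence "((%t. coord (c t)) \<longlongrightarrow> 0) (at 0)" by (simp add: isCont_def c(1) coord_base_pt)
		hence ev1: "eventually (%t. coord (c t) : U) (at 0)" using U by (rule topological_tendstoD)
		have "((%t. c t $ None $ None) \<longlongrightarrow> c 0 $ None $ None) (at 0)"
			using cont_c unfolding isCont_def by (intro tendsto_vec_nth)
		hence ev2: "eventually (%t. c t $ None $ None ~= 0) (at 0)"
			by (rule tendsto_imp_eventually_ne) (simp add: c(1) base_pt_nth)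
		have ev: "eventually (%t. pt (emb 1 (coord (c t))) = c t & (ALL k<j. f k (coord (c t)) = 0)) (at 0)"
			using ev1 ev2
		proof eventually_elim
			case (elim t)
			have "c t : CP" using c(2) Z(1) by blast
			hence "pt (emb 1 (coord (c t))) = c t" using elim by (intro pt_emb_coord)
			thus ?case using ZU[OF elim(1)] c(2)[of t] by simp
		qed
		have "((%t. pt (emb 1 (coord (c t)))) has_derivative (%t. horizontal (t *\<^sub>R w))) (at 0)"
			using has_derivative_compose[OF kd, of "%w. pt (emb 1 w)" horizontal] has_derivative_pt_emb
			by (simp add: c(1) coord_base_pt)
		hence "(c has_derivative (%t. horizontal (t *\<^sub>R w))) (at 0)"
			by (rule has_derivative_transform_eventually)
				(use ev in \<open>auto elim: eventually_mono simp: c(1) coord_base_pt base_pt_emb[symmetric]\<close>)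
		from has_derivative_unique[OF this cd'] have "horizontal (1 *\<^sub>R w) = 1 *\<^sub>R X" by metis
		hence X: "X = horizontal w" by simp
		have "D k w = 0" if k: "k < j" for k
		proof -
			have "((%t. f k (coord (c t))) has_derivative (%t. D k (t *\<^sub>R w))) (at 0)"
				using has_derivative_compose[OF kd, of "f k" "D k"] der[OF k] by (simp add: c(1) coord_base_pt)
			moreover have "((%t. f k (coord (c t))) has_derivative (%t. 0)) (at 0)"
				by (rule has_derivative_transform_eventually[OF has_derivative_const[of 0]])
					(use ev k f0 in \<open>auto elim: eventually_mono simp: c(1) coord_base_pt\<close>)
			ultimately have "D k (1 *\<^sub>R w) = 0" by (metis has_derivative_unique)
			thus ?thesis by simp
		qed
		thus "X : horizontal ` {w. ALL k<j. D k w = 0}" using X by blast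
	next
		fix X assume "X : horizontal ` {w. ALL k<j. D k w = 0}"
		then obtain w where X: "X = horizontal w" and w: "!!k. k < j ==> D k w = 0" by blast
		define Q where "Q = {q : U. ALL k<j. f k q = 0}"
		have Q0: "0 : Q" using U(2) f0 by (simp add: Q_def)
		\<comment> \<open>A zero whose distance from \<open>t *\<^sub>R w\<close> exceeds the infimum by
		  at most t^2. The slack is there because the infimum may not be attained, and it is of smaller
		  order than t.\<close>
		have "EX q. q : Q & (t = 0 --> q = 0) & dist (t *\<^sub>R w) q <= infdist (t *\<^sub>R w) Q + t\<^sup>2" for t :: real
		proof (cases "t = 0")
			case True
			thus ?thesis using Q0 by (intro exI[of _ 0]) (simp add: infdist_nonneg)
		next
			case False
			have "infdist (t *\<^sub>R w) Q < infdist (t *\<^sub>R w) Q + t\<^sup>2" using False by simp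
			moreover have "infdist (t *\<^sub>R w) Q = (INF q\<in>Q. dist (t *\<^sub>R w) q)" using Q0 by (auto simp: infdist_def)
			moreover have "bdd_below (dist (t *\<^sub>R w) ` Q)" by (rule bdd_belowI[of _ 0]) auto
			ultimately obtain q where "q : Q" "dist (t *\<^sub>R w) q < infdist (t *\<^sub>R w) Q + t\<^sup>2"
				using cINF_less_iff[of Q "dist (t *\<^sub>R w)"] Q0 by (metis empty_iff)
			thus ?thesis using False by (intro exI[of _ q]) simp
		qed
		then obtain q where q: "!!t :: real. q t : Q" "q 0 = 0" "!!t. dist (t *\<^sub>R w) (q t) <= infdist (t *\<^sub>R w) Q + t\<^sup>2"
			by metis
		have "(q has_derivative (%t. t *\<^sub>R w)) (at 0)"
			unfolding has_derivative_at_alt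
		proof (intro conjI allI impI)
			show "bounded_linear (%t. t *\<^sub>R w)" by (rule bounded_linear_scaleR_left)
			fix e :: real assume e: "0 < e"
			have "EX de>0. ALL t. abs (t) < de --> (EX q:U. (ALL k<j. f k q = 0) & norm (q - t *\<^sub>R w) <= e / 2 * abs (t))"
				by (rule zero_set_approximation[OF U, where D=D and v=v]) (use cont der lin v f0 w e in auto)
			then obtain de where de: "0 < de" "!!t. abs (t) < de ==> EX q:U. (ALL k<j. f k q = 0) & norm (q - t *\<^sub>R w) <= e / 2 * abs (t)"
				by blast
			have "norm (q t - t *\<^sub>R w) <= e * abs (t)" if t: "\<bar>t\<bar> < min de (e / 2)" for t
			proof -
				obtain p where p: "p : Q" "norm (p - t *\<^sub>R w) <= e / 2 * abs (t)" using de(2)[of t] t by (auto simp: Q_def)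
				have "infdist (t *\<^sub>R w) Q <= e / 2 * abs (t)"
					using infdist_le[OF p(1), of "t *\<^sub>R w"] p(2) by (simp add: dist_norm norm_minus_commute)
				moreover have "t\<^sup>2 <= e / 2 * abs (t)"
					using mult_right_mono[of "\<bar>t\<bar>" "e / 2" "\<bar>t\<bar>"] t by (simp add: power2_eq_square abs_mult_self_eq flip: abs_mult)
				ultimately show ?thesis using q(3)[of t] by (simp add: dist_norm norm_minus_commute)
			qed
			thus "EX d>0. ALL y. norm (y - 0) < d --> norm (q y - q 0 - (y - 0) *\<^sub>R w) <= e * norm (y - 0)"
				using de(1) e by (intro exI[of _ "min de (e / 2)"]) (auto simp: q(2))
		qed
		hence "((%t. pt (emb 1 (q t))) has_derivative (%t. horizontal (t *\<^sub>R w))) (at 0)"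
			using has_derivative_compose[of q "%t. t *\<^sub>R w" 0 UNIV "%w. pt (emb 1 w)" horizontal] has_derivative_pt_emb
			by (simp add: q(2))
		hence "((%t. pt (emb 1 (q t))) has_vector_derivative X) (at 0)"
			by (simp add: has_vector_derivative_def X linear_scale[OF linear_horizontal])
		moreover have "pt (emb 1 (q t)) : Z" for t using q(1)[of t] ZU[of "q t"] by (simp add: Q_def)
		ultimately show "X : tangent_space Z base_pt"
			unfolding tangent_space_def by (intro CollectI exI[of _ "%t. pt (emb 1 (q t))"]) (auto simp: q(2) base_pt_emb)
	qed
qed

text \<open>The case of no equations.\<close>

lemma tangent_space_CP: "tangent_space CP (base_pt :: 'n::finite hmat) = range horizontal"
proof -
	have "local_equations 0 (CP :: 'n hmat set) (%_ _. 0) (%_ _. 0)"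
		by (auto simp: local_equations_def base_pt_emb intro!: pt_in_CP exI[of _ UNIV])
	from tangent_space_local_equations[OF this] show ?thesis by simp
qed

section \<open>Conormal spaces from local equations\<close>

lemma conormal_base_iff:
	fixes Z :: "'n::finite hmat set"
	assumes "Z \<subseteq> CP"
	shows "w : conormal_base Z \<longleftrightarrow> (ALL x. horizontal x : tangent_space Z base_pt --> w \<bullet> x = 0)"
proof -
	have sub: "tangent_space Z base_pt \<subseteq> range horizontal"
		using tangent_space_mono[OF assms] tangent_space_CP by blast
	have "linear (fs_metric (horizontal w))"
		by (rule linearI) (simp_all add: fs_metric_def inner_add_right add_divide_distrib)
	hence cov: "covector w : cotangent_space base_pt" by (auto simp: covector_def cotangent_space_def)
	have val: "covector w (horizontal x) = w \<bullet> x" for x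
		by (simp add: covector_def tangent_space_CP fs_metric_horizontal)
	have "(ALL X:tangent_space Z base_pt. covector w X = 0) \<longleftrightarrow> (ALL x. horizontal x : tangent_space Z base_pt --> w \<bullet> x = 0)"
	proof (intro iffI allI impI ballI)
		fix X assume *: "ALL x. horizontal x : tangent_space Z base_pt --> w \<bullet> x = 0" and X: "X : tangent_space Z base_pt"
		then obtain x where "X = horizontal x" using sub by blast
		thus "covector w X = 0" using * X val by simp
	qed (use val in auto)
	thus ?thesis using cov by (simp add: conormal_base_def conormal_space_def)
qed

text \<open>The Hermitian gradient; the conjugate compensates that \<open>herm\<close> is conjugate
  linear in its second argument.\<close>

definition gradient :: "(complex ^ 'n => complex) => complex ^ 'n::finite"
	where "gradient D = (\<chi> i. cnj (D (axis i 1)))"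

lemma herm_gradient:
	assumes "linear D" "!!c v. D (c *s v) = c * D v"
	shows "D x = herm x (gradient D)"
proof -
	have "x = (SUM i:UNIV. x $ i *s axis i 1)"
		by (simp add: vec_eq_iff axis_def if_distrib cong: if_cong)
	hence "D x = D (SUM i:UNIV. x $ i *s axis i 1)" by simp
	also have "... = herm x (gradient D)" by (simp add: linear_sum[OF assms(1)] assms(2) herm_def gradient_def)
	finally show ?thesis .
qed

text \<open>Since \<open>D k\<close> is complex linear, its real and imaginary parts are the inner
  products with the gradient and with i times the gradient. So the conormal space is the complex
  span of the gradients, and vectors on which the differentials take the values 0 and 1 form a dual
  list, which gives the dimension.\<close>

lemma conormal_base_local_equations:
	fixes Z :: "'n::finite hmat set"
	assumes L: "local_equations j Z f D"
	defines "as \<equiv> map (%k. gradient (D k)) [0..<j]"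
	shows "conormal_base Z = span (set (complexify as))" "wedge_list (complexify as) ~= 0"
		"dim (conormal_base Z) = 2 * j" "{x. horizontal x : tangent_space Z base_pt} = {x. ALL w:conormal_base Z. w \<bullet> x = 0}"
proof -
	have Z: "Z \<subseteq> CP" using L by (simp add: local_equations_def)
	have linD: "linear (D k)" if "k < j" for k using has_derivative_linear[of "f k" "D k" "at 0"] L that by (simp add: local_equations_def)
	have scD: "D k (c *s v) = c * D k v" if "k < j" for k c v using L that by (simp add: local_equations_def)
	have D: "D k x = herm x (gradient (D k))" if "k < j" for k x by (rule herm_gradient[OF linD[OF that] scD[OF that]])
	have ker: "{x. horizontal x : tangent_space Z base_pt} = {x. ALL k<j. D k x = 0}"
		unfolding tangent_space_local_equations[OF L] by (auto simp: inj_horizontal image_iff)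
	have ker': "(ALL k<j. D k x = 0) \<longleftrightarrow> (ALL a:set (complexify as). a \<bullet> x = 0)" for x
	proof -
		have "D k x = 0 \<longleftrightarrow> gradient (D k) \<bullet> x = 0 & (\<i> *s gradient (D k)) \<bullet> x = 0" if "k < j" for k
		proof -
			define a where "a = gradient (D k)"
			have "D k x = herm x a" unfolding a_def by (rule D[OF that])
			moreover have "Re (herm x a) = a \<bullet> x" by (simp add: Re_herm inner_commute)
			moreover have "Im (herm x a) = (\<i> *s a) \<bullet> x"
				by (subst herm_cnj) (simp add: Re_herm[symmetric] herm_simps)
			ultimately show ?thesis unfolding a_def[symmetric] by (simp add: complex_eq_iff)
		qed
		thus ?thesis unfolding as_def by (auto simp: set_complexify)
	qed
	have orth: "(ALL a:set (complexify as). a \<bullet> x = 0) \<longleftrightarrow> (ALL a:span (set (complexify as)). a \<bullet> x = 0)" for x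
	proof
		assume *: "ALL a:set (complexify as). a \<bullet> x = 0"
		show "ALL a:span (set (complexify as)). a \<bullet> x = 0"
		proof
			fix a assume "a : span (set (complexify as))"
			thus "a \<bullet> x = 0"
				by (induction rule: span_induct_alt) (use * in \<open>auto simp: inner_add_left\<close>)
		qed
	qed (auto intro: span_base)
	show cb: "conormal_base Z = span (set (complexify as))"
	proof (intro equalityI subsetI)
		fix w assume "w : conormal_base Z"
		hence w: "w \<bullet> x = 0" if "ALL a:span (set (complexify as)). a \<bullet> x = 0" for x
			using that ker ker' orth by (auto simp: conormal_base_iff[OF Z])
		\<comment> \<open>The component \<open>t\<close> orthogonal to the span is tangent, so
		  \<open>w\<close> is orthogonal to it, which forces \<open>t = 0\<close>.\<close>
		obtain s t where st: "s : span (set (complexify as))" "!!a. a : span (set (complexify as)) ==> orthogonal t a" "w = s + t"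
			using orthogonal_subspace_decomp_exists[of "set (complexify as)" w] by metis
		have "ALL a:span (set (complexify as)). a \<bullet> t = 0" using st(2) by (simp add: orthogonal_def inner_commute)
		hence "w \<bullet> t = 0" "s \<bullet> t = 0" using w st(1) by auto
		hence "t = 0" using st(3) by (simp add: inner_add_left)
		thus "w : span (set (complexify as))" using st by simp
	next
		fix w assume "w : span (set (complexify as))"
		thus "w : conormal_base Z" using ker ker' orth by (auto simp: conormal_base_iff[OF Z])
	qed
	show "{x. horizontal x : tangent_space Z base_pt} = {x. ALL w:conormal_base Z. w \<bullet> x = 0}"
		unfolding cb ker using ker' orth by blast
	have "ALL l. EX v. ALL k<j. D k v = (if k = l then 1 else 0)" using L by (auto simp: local_equations_def)
	then obtain v where v: "!!k l. k < j ==> D k (v l) = (if k = l then 1 else 0)" by metis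
	have bi: "biorthogonal (complexify (map (%k. gradient (D k)) ks)) (complexify (map v ks))"
		if "distinct ks" "set ks \<subseteq> {..<j}" for ks
		using that
	proof (induction ks)
		case Nil
		thus ?case by (simp add: biorthogonal_def)
	next
		case (Cons k ks)
		have h: "herm (gradient (D k)) (v l) = (if k = l then 1 else 0)" if "k < j" for k l
			using D[OF that, of "v l", symmetric] v[OF that] by (subst herm_cnj) simp
		have "gradient (D k) \<bullet> v l = (if k = l then 1 else 0)" "gradient (D k) \<bullet> (\<i> *s v l) = 0"
			"(\<i> *s gradient (D k)) \<bullet> v l = 0" "(\<i> *s gradient (D k)) \<bullet> (\<i> *s v l) = (if k = l then 1 else 0)" if "k < j" for k l
			unfolding Re_herm[symmetric] herm_simps h[OF that] by auto
		thus ?case using Cons by (auto simp: biorthogonal_Cons set_complexify)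
	qed
	have b: "biorthogonal (complexify as) (complexify (map v [0..<j]))"
		unfolding as_def by (rule bi) auto
	show "wedge_list (complexify as) ~= 0" using inner_wedge_list_biorthogonal[OF b] by auto
	show "dim (conormal_base Z) = 2 * j"
		unfolding cb using biorthogonal_distinct_independent(3)[OF b] by (simp add: as_def)
qed

text \<open>Removes the choice: the products of two spanning lists of this length are proportional,
  so any list with nonzero product computes |<u, nu>| after normalization.\<close>

lemma conormal_unit_eq:
	assumes W: "conormal_base Z = span (set ws)" and l: "length ws = d" and nz: "wedge_list ws ~= 0"
	shows "\<bar>u \<bullet> conormal_unit d Z\<bar> = abs (u \<bullet> wedge_list ws) / norm (wedge_list ws)"
proof -
	let ?P = "%nu. norm nu = 1 & (EX ws. length ws = d & span (set ws) = conormal_base Z & nu = wedge_list ws)"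
	have "EX nu. ?P nu"
	proof (cases ws)
		case Nil
		thus ?thesis using W l by (intro exI[of _ "axis {} 1"] conjI exI[of _ "[]"]) (auto simp: norm_axis_1)
	next
		case (Cons v vs)
		\<comment> \<open>Rescaling the first vector by this factor normalizes the product and keeps the
		  span.\<close>
		let ?r = "1 / norm (wedge_list ws)"
		have r: "?r ~= 0" using nz by simp
		have e: "wedge_list (?r *\<^sub>R v # vs) = ?r *\<^sub>R wedge_list ws"
			by (simp add: Cons linear_scale[OF linear_vec_wedge])
		have "span (set (?r *\<^sub>R v # vs)) = span (set ws)"
		proof -
			have "v = (1 / ?r) *\<^sub>R (?r *\<^sub>R v)" using r by simp
			hence "v : span (set (?r *\<^sub>R v # vs))" using span_scale[OF span_base] by (metis list.set_intros(1))
			moreover have "?r *\<^sub>R v : span (set ws)" unfolding Cons by (intro span_scale span_base) simp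
			ultimately show ?thesis unfolding span_eq Cons by (auto intro: span_base)
		qed
		thus ?thesis
			using W l nz Cons e by (intro exI[of _ "?r *\<^sub>R wedge_list ws"] conjI exI[of _ "?r *\<^sub>R v # vs"]) auto
	qed
	hence "?P (conormal_unit d Z)" unfolding conormal_unit_def by (rule someI_ex)
	then obtain vs where vs: "norm (conormal_unit d Z) = 1" "length vs = d" "span (set vs) = conormal_base Z" "conormal_unit d Z = wedge_list vs"
		by blast
	have "set vs \<subseteq> span (set ws)" using vs(3) W span_superset[of "set vs"] by auto
	then obtain c where c: "wedge_list vs = c *\<^sub>R wedge_list ws" using wedge_list_multiple[of vs ws] vs(2) l by metis
	have "\<bar>c\<bar> = 1 / norm (wedge_list ws)" using vs(1,4) c nz by (simp add: field_simps)
	thus ?thesis using vs(4) c by (simp add: abs_mult)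
qed

section \<open>Dependence of the equations on the group element\<close>

lemma has_derivative_difference_quotients:
	fixes h :: "'a::real_normed_vector => 'b::real_normed_vector"
	assumes "(h has_derivative D) (at 0)"
	shows "(%m. real (Suc m) *\<^sub>R (h ((1 / real (Suc m)) *\<^sub>R v) - h 0)) \<longlonglongrightarrow> D v"
proof (rule LIMSEQ_I)
	fix r :: real assume r: "0 < r"
	have lin: "linear D" using assms by (rule has_derivative_linear)
	define e where "e = r / (norm v + 1)"
	have nv: "0 < norm v + 1" using norm_ge_zero[of v] by linarith
	hence e: "0 < e" "e * norm v < r"
		using r by (simp_all add: e_def pos_divide_less_eq)
	obtain d where d: "0 < d" "!!x. norm (x - 0) < d ==> norm (h x - h 0 - D (x - 0)) <= e * norm (x - 0)"
		using assms e(1) unfolding has_derivative_at_alt by blast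
	obtain N where N: "norm v / d < real N" using reals_Archimedean2 by blast
	show "EX N. ALL m>=N. norm (real (Suc m) *\<^sub>R (h ((1 / real (Suc m)) *\<^sub>R v) - h 0) - D v) < r"
	proof (intro exI allI impI)
		fix m assume m: "N <= m"
		let ?s = "real (Suc m)"
		have "norm v / d < ?s" using N m by linarith
		hence "norm ((1 / ?s) *\<^sub>R v) < d" using d(1) by (simp add: field_simps)
		hence "norm (h ((1 / ?s) *\<^sub>R v) - h 0 - (1 / ?s) *\<^sub>R D v) <= e * (norm v / ?s)"
			using d(2)[of "(1 / ?s) *\<^sub>R v"] by (simp add: linear_scale[OF lin])
		hence "?s * norm (h ((1 / ?s) *\<^sub>R v) - h 0 - (1 / ?s) *\<^sub>R D v) <= ?s * (e * (norm v / ?s))"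
			by (intro mult_left_mono) auto
		also have "?s * (e * (norm v / ?s)) = e * norm v" by simp
		also have "?s * norm (h ((1 / ?s) *\<^sub>R v) - h 0 - (1 / ?s) *\<^sub>R D v) =
				norm (?s *\<^sub>R (h ((1 / ?s) *\<^sub>R v) - h 0 - (1 / ?s) *\<^sub>R D v))" by simp
		also have "?s *\<^sub>R (h ((1 / ?s) *\<^sub>R v) - h 0 - (1 / ?s) *\<^sub>R D v) = ?s *\<^sub>R (h ((1 / ?s) *\<^sub>R v) - h 0) - D v"
			by (simp add: scaleR_diff_right)
		finally show "norm (?s *\<^sub>R (h ((1 / ?s) *\<^sub>R v) - h 0) - D v) < r" using e(2) by linarith
	qed
qed

lemma has_derivative_slope:
	assumes z: "z $ None ~= 0"
	shows "(slope has_derivative (%ze. inverse (z $ None) *s tail ze +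
		(- (inverse (z $ None) * ze $ None * inverse (z $ None))) *s tail z)) (at z)"
proof -
	have e: "((%z :: complex ^ ('a option). z $ None) has_derivative (%ze. ze $ None)) (at z)"
		by (rule bounded_linear.has_derivative[OF bounded_linear_vec_nth has_derivative_ident])
	have t: "(tail has_derivative tail) (at z)"
		using linear_tail by (intro bounded_linear_imp_has_derivative) (simp add: linear_conv_bounded_linear)
	show ?thesis
		unfolding slope_def
		by (rule bounded_bilinear.FDERIV[OF bounded_bilinear_cscale Deriv.has_derivative_inverse[OF z e] t])
qed

lemma measurable_cscale:
	"f : borel_measurable M ==> g : borel_measurable M ==> (%x. f x *s (g x :: complex ^ 'n::finite)) : borel_measurable M"
	by (rule borel_measurable_continuous_Pair)
		(auto intro!: bounded_bilinear.continuous_on[OF bounded_bilinear_cscale] continuous_intros)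

lemma measurable_slope: "slope : borel_measurable borel"
proof -
	have "(%z :: complex ^ ('a option). inverse (z $ None)) : borel_measurable borel"
		by (intro borel_measurable_inverse linear_borel bounded_linear.linear[OF bounded_linear_vec_nth])
	from measurable_cscale[OF this linear_borel[OF linear_tail]] show ?thesis by (simp add: slope_def[abs_def])
qed

lemma affine_chart_emb: "affine_chart g w = pt (g *v emb 1 w)"
	by (simp add: affine_chart_def emb_def)

text \<open>Equations near one point of \<open>Y\<close> serve all translates of \<open>Y\<close> by
  group elements near \<open>g0\<close> that pass through the base point. Their differentials there
  are Borel functions of \<open>g\<close>, on which the measurability of the conormal vector
  rests.\<close>

lemma local_equations_submanifold:
	fixes Y :: "'n::finite hmat set"
	assumes Y: "complex_submanifold j Y" and g0: "g0 : unitary_group" and b: "base_pt : act g0 ` Y"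
	obtains V F where "open V" "g0 : V" "!!k v. (%g. F g k v) : borel_measurable borel"
		"!!g. g : V ==> g : unitary_group ==> base_pt : act g ` Y ==> EX f D. local_equations j (act g ` Y) f D & (ALL k<j. D k = F g k)"
proof -
	have YCP: "Y \<subseteq> CP" and sub: "complex_submanifold_affine j {w. affine_chart (adj g0) w : Y}"
		using Y g0 by (auto simp: complex_submanifold_def unitary_group_adj)
	let ?S = "{w. affine_chart (adj g0) w : Y}"
	obtain x0 where x0: "x0 : Y" "base_pt = act g0 x0" using b by blast
	hence "act (adj g0) base_pt : Y" unfolding x0(2) by (simp add: act_adj(1)[OF g0])
	hence "0 : ?S" by (simp add: affine_chart_emb base_pt_emb act_pt unitary_group_adj g0)
	from bspec[OF sub[unfolded complex_submanifold_affine_def] this] obtain U f where Uf: "open U & 0 : U & (ALL k<j. holomorphic_several (f k) U) & ?S Int U = {w : U. ALL k<j. f k w = 0} &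
			(ALL w:U. ALL c :: nat => complex. EX v. ALL k<j. frechet_derivative (f k) (at w) v = c k)"
		by (elim exE)
	hence U: "open U" "0 : U" and hol: "!!k. k < j ==> holomorphic_several (f k) U"
		and SU: "?S Int U = {w : U. ALL k<j. f k w = 0}"
		and surj: "!!w c. w : U ==> EX v. ALL k<j. frechet_derivative (f k) (at w) v = c k"
		by simp_all
	have hd: "(f k has_derivative frechet_derivative (f k) (at w)) (at w)"
		"frechet_derivative (f k) (at w) (c *s v) = c * frechet_derivative (f k) (at w) v" if k: "k < j" and w: "w : U" for k w c v
	proof -
		obtain D where D: "(f k has_derivative D) (at w)" "!!c v. D (c *s v) = c * D v"
			using hol[OF k] w unfolding holomorphic_several_def by blast
		have "frechet_derivative (f k) (at w) = D" using frechet_derivative_at[OF D(1)] by simp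
		thus "(f k has_derivative frechet_derivative (f k) (at w)) (at w)"
			"frechet_derivative (f k) (at w) (c *s v) = c * frechet_derivative (f k) (at w) v" using D by simp_all
	qed
	have contf: "continuous_on U (f k)" if "k < j" for k
		by (rule has_derivative_continuous_on[OF has_derivative_at_withinI[OF hd(1)[OF that]]])
	define C where "C = {z :: complex ^ ('n option). z $ None ~= 0 & slope z : U}"
	have open0: "open {z :: complex ^ ('n option). z $ None ~= 0}"
		by (intro open_Collect_neq continuous_intros)
	have cslope: "continuous_on {z :: complex ^ ('n option). z $ None ~= 0} slope"
		by (rule has_derivative_continuous_on[OF has_derivative_at_withinI[OF has_derivative_slope]]) simp
	have "open ({z :: complex ^ ('n option). z $ None ~= 0} Int slope -` U)"
		by (rule continuous_open_preimage[OF cslope open0 U(1)])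
	moreover have "C = {z :: complex ^ ('n option). z $ None ~= 0} Int slope -` U" by (auto simp: C_def)
	ultimately have openC: "open C" by simp
	\<comment> \<open>Homogeneous coordinates, in the chart belonging to \<open>g0\<close>, of the
	  point with coordinate \<open>w\<close> in the chart belonging to \<open>g\<close>.\<close>
	define A where "A g w = (g0 ** adj g) *v emb 1 w" for g :: "'n hmat" and w
	have contA: "continuous_on UNIV (%g. A g w)" for w
		unfolding A_def by (intro continuous_intros)
	have Ader: "(A g has_derivative (%v. (g0 ** adj g) *v emb 0 v)) (at w)" for g w
		unfolding A_def[abs_def]
		by (rule bounded_linear.has_derivative[OF linear_conv_bounded_linear[THEN iffD1, OF linear_matrix_vector] has_derivative_emb1])
	have contA': "continuous_on UNIV (A g)" for g
		by (rule has_derivative_continuous_on[OF has_derivative_at_withinI[OF Ader]])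
	define V where "V = (%g. A g 0) -` C"
	have openV: "open V" unfolding V_def by (rule open_vimage[OF openC contA])
	have g0V: "g0 : V"
	proof -
		have "A g0 0 = emb 1 0" using g0 by (simp add: A_def unitary_group_iff)
		thus ?thesis using U(2) by (simp add: V_def C_def)
	qed
	\<comment> \<open>Cut off outside \<open>U\<close> to obtain a Borel function on the whole space;
	  on \<open>U\<close> it agrees with \<open>f k\<close>.\<close>
	define fh where "fh k w = indicator U w *\<^sub>R f k w" for k w
	define h where "h g k w = fh k (slope (A g w))" for g k w
	\<comment> \<open>The differential as a limit of difference quotients at step 1/(m+1), so that
	  measurability in \<open>g\<close> passes from \<open>h\<close> to it.\<close>
	define F where "F g k v = (if k < j then lim (%m. real (Suc m) *\<^sub>R (h g k ((1 / real (Suc m)) *\<^sub>R v) - h g k 0)) else 0)" for g k v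
	have mF: "(%g. F g k v) : borel_measurable borel" for k v
	proof (cases "k < j")
		case True
		have "fh k : borel_measurable borel"
			unfolding fh_def[abs_def] using U(1) contf[OF True] by (intro borel_measurable_continuous_on_indicator) auto
		hence "(%g. h g k w) : borel_measurable borel" for w
			unfolding h_def
			by (intro measurable_compose[OF _ \<open>fh k : _\<close>] measurable_compose[OF _ measurable_slope] borel_measurable_continuous_onI contA)
		thus ?thesis unfolding F_def using True
			by (simp del: of_nat_Suc)
	qed (simp add: F_def)
	have loc: "EX f D. local_equations j (act g ` Y) f D & (ALL k<j. D k = F g k)"
		if gV: "g : V" and g: "g : unitary_group" and bg: "base_pt : act g ` Y" for g
	proof -
		define W where "W = A g -` C"
		have W: "open W" "0 : W" unfolding W_def using open_vimage[OF openC contA'] gV by (auto simp: V_def)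
		define z where "z = A g 0"
		have zC: "z $ None ~= 0" "slope z : U" using W(2) by (auto simp: W_def C_def z_def)
		define L where "L v = inverse (z $ None) *s tail ((g0 ** adj g) *v emb 0 v) +
			(- (inverse (z $ None) * ((g0 ** adj g) *v emb 0 v) $ None * inverse (z $ None))) *s tail z" for v
		have Ld: "((%w. slope (A g w)) has_derivative L) (at 0)"
			unfolding L_def[abs_def] z_def by (rule has_derivative_compose[OF Ader has_derivative_slope[OF zC(1)[unfolded z_def]]])
		define D where "D k v = frechet_derivative (f k) (at (slope z)) (L v)" for k v
		have kd: "((%w. f k (slope (A g w))) has_derivative D k) (at 0)" if "k < j" for k
			unfolding D_def[abs_def] using has_derivative_compose[OF Ld, of "f k"] hd(1)[OF that zC(2)] by (simp add: z_def)
		have hW: "h g k w = f k (slope (A g w))" if "w : W" for k w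
			using that by (simp add: h_def fh_def W_def C_def)
		have hder: "(h g k has_derivative D k) (at 0)" if "k < j" for k
			by (rule has_derivative_transform_within_open[OF kd[OF that] W]) (simp add: hW)
		have "D k v = F g k v" if "k < j" for k v
		proof -
			have "(%m. real (Suc m) *\<^sub>R (h g k ((1 / real (Suc m)) *\<^sub>R v) - h g k 0)) \<longlonglongrightarrow> D k v"
				by (rule has_derivative_difference_quotients[OF hder[OF that]])
			thus ?thesis unfolding F_def using that by (simp add: limI del: of_nat_Suc)
		qed
		moreover have "local_equations j (act g ` Y) (h g) D"
			unfolding local_equations_def
		proof (intro conjI allI impI exI[of _ W] ballI)
			show "act g ` Y \<subseteq> CP"
			proof
				fix y assume "y : act g ` Y"
				then obtain x where "x : Y" "y = act g x" by blast
				then obtain v where "v ~= 0" "y = act g (pt v)" using YCP by (metis CP_E subsetD)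
				moreover have "g *v v ~= 0" using \<open>v ~= 0\<close> norm_unitary[OF g, of v] by (metis norm_eq_zero)
				ultimately show "y : CP" by (simp add: act_pt[OF g] pt_in_CP)
			qed
			show "continuous_on W (h g k)" if "k < j" for k
			proof -
				have "continuous_on W (%w. f k (slope (A g w)))"
				proof (rule continuous_on_compose2[OF contf[OF that]])
					show "continuous_on W (%w. slope (A g w))"
					proof (rule continuous_on_compose2[of C slope W "A g"])
						show "continuous_on C slope"
							by (rule continuous_on_subset[OF cslope]) (auto simp: C_def)
					qed (auto intro: continuous_on_subset[OF contA'] simp: W_def)
				qed (auto simp: W_def C_def)
				thus ?thesis by (rule continuous_on_eq) (simp add: hW)
			qed
			show "(pt (emb 1 w) : act g ` Y) = (ALL k<j. h g k w = 0)" if w: "w : W" for w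
			proof -
				have zw: "A g w $ None ~= 0" "slope (A g w) : U" using w by (auto simp: W_def C_def)
				have "A g w = g0 *v (adj g *v emb 1 w)" by (simp add: A_def matrix_vector_mul_assoc)
				hence "adj g *v emb 1 w = adj g0 *v A g w" using g0 by simp
				hence "act (adj g) (pt (emb 1 w)) = act (adj g0) (pt (A g w))"
					using g g0 by (simp add: act_pt unitary_group_adj)
				also have "... = affine_chart (adj g0) (slope (A g w))"
					unfolding affine_chart_emb act_pt[OF unitary_group_adj[OF g0], symmetric] pt_emb_slope[OF zw(1)] ..
				finally have e: "act (adj g) (pt (emb 1 w)) = affine_chart (adj g0) (slope (A g w))" .
				have "pt (emb 1 w) : act g ` Y \<longleftrightarrow> act (adj g) (pt (emb 1 w)) : Y"
					using g by (metis act_adj image_iff)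
				also have "... \<longleftrightarrow> slope (A g w) : ?S Int U" using zw(2) by (simp add: e)
				also have "... \<longleftrightarrow> (ALL k<j. h g k w = 0)" unfolding SU using zw(2) by (simp add: hW[OF w])
				finally show ?thesis .
			qed
			show "(h g k has_derivative D k) (at 0)" if "k < j" for k by (rule hder[OF that])
			show "D k (c *s v) = c * D k v" if "k < j" for k c v
			proof -
				have ec: "(g0 ** adj g) *v emb 0 (c *s v) = c *s ((g0 ** adj g) *v emb 0 v)"
				proof -
					have "emb 0 (c *s v) = c *s emb 0 v" by (simp add: vec_option_eq_iff)
					thus ?thesis by (simp add: matrix_vector_mult_def vec_eq_iff sum_distrib_left mult_ac)
				qed
				have "L (c *s v) = c *s L v"
					unfolding L_def ec by (simp add: vec_eq_iff algebra_simps)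
				thus ?thesis by (simp add: D_def hd(2)[OF that zC(2)])
			qed
			show "EX v. ALL k<j. D k v = c k" for c
			proof -
				obtain u where u: "ALL k<j. frechet_derivative (f k) (at (slope z)) u = c k" using surj[OF zC(2)] by blast
				let ?B = "g0 ** adj g"
				have B: "?B : unitary_group" using g g0 by (intro unitary_group_mult unitary_group_adj)
				\<comment> \<open>The direction to be hit, in homogeneous coordinates. Dropping the first entry
				  of \<open>x\<close> changes the image by a multiple of \<open>z\<close>, a direction that the
				  derivative of \<open>slope\<close> at \<open>z\<close> kills.\<close>
				define ze where "ze = emb 0 (z $ None *s u)"
				define x where "x = adj ?B *v ze"
				have z': "z = ?B *v axis None 1" by (simp add: z_def A_def emb_zero)
				have "emb 0 (tail x) = x - x $ None *s axis None 1" by (simp add: vec_option_eq_iff axis_def)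
				hence "?B *v emb 0 (tail x) = ze - x $ None *s z"
					using B by (simp add: x_def z' linear_diff[OF linear_matrix_vector] matrix_vector_mult_diff_distrib vector_scalar_commute)
				hence "(?B *v emb 0 (tail x)) $ None = - (x $ None * z $ None)"
					"(?B *v emb 0 (tail x)) $ Some i = z $ None * u $ i - x $ None * z $ Some i" for i
					by (simp_all add: ze_def)
				hence "L (tail x) = u"
					unfolding L_def using zC(1) by (simp add: vec_eq_iff field_simps)
				thus ?thesis using u by (intro exI[of _ "tail x"]) (simp add: D_def)
			qed
		qed (use W bg in auto)
		ultimately show ?thesis by (intro exI[of _ "h g"] exI[of _ D]) auto
	qed
	show ?thesis by (rule that[OF openV g0V mF loc])
qed

section \<open>The isotropy representation\<close>

lemma CP_moves:
	assumes "orbit_section tau" "y : CP" shows "tau y : unitary_group" "act (tau y) y = base_pt"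
	using assms by (auto simp: orbit_section_def)

text \<open>A section of \<open>isotropy\<close>: every unitary map of the tangent space is induced
  by an element of the stabilizer.\<close>

definition block :: "complex ^ 'n ^ 'n => 'n::finite hmat"
	where "block g = (\<chi> i k. case (i, k) of (None, None) => 1 | (Some a, Some b) => g $ a $ b | _ => 0)"

text \<open>The action of the stabilizer on tangent vectors at the base point
  (\<open>act_horizontal\<close>). It is the lower block divided by the phase of the corner entry,
  as a line does not see a common phase.\<close>

definition isotropy :: "'n::finite hmat => complex ^ 'n ^ 'n"
	where "isotropy h = (\<chi> i k. cnj (h $ None $ None) * h $ Some i $ Some k)"

lemma stabilizer_emb:
	assumes "h : stabilizer"
	shows "h *v emb c x = emb (h $ None $ None * c) ((\<chi> i k. h $ Some i $ Some k) *v x)" "cmod (h $ None $ None) = 1"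
proof -
	have 0: "h $ None $ Some i = 0" "h $ Some i $ None = 0" for i using assms by (auto simp: stabilizer_def)
	show e: "h *v emb c x = emb (h $ None $ None * c) ((\<chi> i k. h $ Some i $ Some k) *v x)" for c x
		by (simp add: vec_option_eq_iff matrix_vector_mult_def sum_option 0)
	have u: "h : unitary_group" using assms by (simp add: stabilizer_def)
	have "(norm (h *v emb 1 0))\<^sup>2 = 1" unfolding norm_unitary[OF u] norm_emb by simp
	hence "(cmod (h $ None $ None))\<^sup>2 = 1" unfolding e norm_emb by simp
	thus "cmod (h $ None $ None) = 1" by (simp add: power2_eq_1_iff) (metis norm_ge_zero not_one_le_zero neg_0_le_iff_le)
qed

lemma isotropy_vector: "isotropy h *v x = cnj (h $ None $ None) *s ((\<chi> i k. h $ Some i $ Some k) *v x)"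
	by (simp add: isotropy_def matrix_vector_mult_def vec_eq_iff sum_distrib_left mult_ac)

lemma isotropy_unitary:
	assumes h: "h : stabilizer" shows "isotropy h : unitary_group"
proof (rule unitary_groupI)
	fix x y
	let ?B = "\<chi> i k. h $ Some i $ Some k"
	have u: "h : unitary_group" using h by (simp add: stabilizer_def)
	have he: "herm (emb 0 a) (emb 0 b) = herm a b" for a b :: "complex ^ 'a" by (simp add: herm_def sum_option)
	have c: "cnj (h $ None $ None) * h $ None $ None = 1"
		using complex_norm_square[of "h $ None $ None"] stabilizer_emb(2)[OF h] by (simp add: mult.commute)
	have "herm (isotropy h *v x) (isotropy h *v y) = (cnj (h $ None $ None) * h $ None $ None) * herm (?B *v x) (?B *v y)"
		unfolding isotropy_vector herm_simps by simp
	also have "... = herm (h *v emb 0 x) (h *v emb 0 y)" unfolding c stabilizer_emb(1)[OF h] mult_zero_right he by simp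
	also have "... = herm x y" by (simp add: herm_unitary[OF u] he)
	finally show "herm (isotropy h *v x) (isotropy h *v y) = herm x y" .
qed

lemma act_horizontal:
	assumes h: "h : stabilizer" shows "act h (horizontal x) = horizontal (isotropy h *v x)"
proof -
	have e: "h *v axis None 1 = h $ None $ None *s axis None 1"
		using stabilizer_emb(1)[OF h, of 1 0] by (simp add: emb_zero) (simp add: vec_option_eq_iff axis_def)
	have "act h (horizontal x) = outer (emb 0 ((\<chi> i k. h $ Some i $ Some k) *v x)) (h $ None $ None *s axis None 1) +
			outer (h $ None $ None *s axis None 1) (emb 0 ((\<chi> i k. h $ Some i $ Some k) *v x))"
		by (simp add: horizontal_outer linear_add[OF linear_act] matrix_outer e stabilizer_emb(1)[OF h])
	thus ?thesis by (simp add: vec_option_eq_iff isotropy_vector axis_def)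
qed

lemma act_base:
	assumes h: "h : stabilizer" shows "act h base_pt = base_pt"
proof -
	have u: "h : unitary_group" using h by (simp add: stabilizer_def)
	have nz: "h $ None $ None ~= 0" using stabilizer_emb(2)[OF h] by auto
	have "h *v emb 1 0 = h $ None $ None *s emb 1 0"
		unfolding stabilizer_emb(1)[OF h] by (simp add: vec_option_eq_iff)
	hence "pt (h *v emb 1 0) = pt (emb 1 0)" by (simp add: pt_scale[OF nz])
	thus ?thesis by (simp add: base_pt_emb act_pt[OF u])
qed

lemma block_emb: "block g *v emb c x = emb c (g *v x)"
	by (simp add: vec_option_eq_iff matrix_vector_mult_def sum_option block_def)

lemma block_stabilizer:
	assumes g: "g : unitary_group" shows "block g : stabilizer"
proof -
	have he: "herm (emb c a) (emb d b) = c * cnj d + herm a b" for a b :: "complex ^ 'a" and c d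
		by (simp add: herm_def sum_option)
	have "herm (block g *v z) (block g *v z') = herm z z'" for z z'
	proof -
		have z: "z = emb (z $ None) (tail z)" "z' = emb (z' $ None) (tail z')" by (simp_all add: vec_option_eq_iff)
		have "herm (block g *v emb (z $ None) (tail z)) (block g *v emb (z' $ None) (tail z')) =
				herm (emb (z $ None) (tail z)) (emb (z' $ None) (tail z'))"
			by (simp only: block_emb he herm_unitary[OF g])
		thus ?thesis using z by simp
	qed
	hence "block g : unitary_group" by (rule unitary_groupI)
	thus ?thesis by (simp add: stabilizer_def block_def)
qed

lemma stabilizer_mult:
	assumes "g : stabilizer" "h : stabilizer" shows "g ** h : stabilizer"
proof -
	have "g ** h : unitary_group" using assms by (simp add: stabilizer_def unitary_group_mult)
	moreover have "(g ** h) $ None $ Some i = 0 & (g ** h) $ Some i $ None = 0" for i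
		using assms by (simp add: stabilizer_def matrix_matrix_mult_def sum_option)
	ultimately show ?thesis by (simp add: stabilizer_def)
qed

lemma isotropy_block_mult:
	assumes "h : stabilizer" shows "isotropy (block g ** h) = g ** isotropy h"
	using assms by (auto simp: isotropy_def stabilizer_def block_def matrix_matrix_mult_def sum_option vec_eq_iff
			sum_distrib_left mult_ac)

lemma isotropy_block: "isotropy (block g) = g"
	by (simp add: isotropy_def block_def vec_eq_iff)

lemma act_CP_subset:
	assumes g: "g : unitary_group"
	shows "act g ` CP \<subseteq> (CP :: 'n::finite hmat set)"
proof
	fix y assume "y : act g ` (CP :: 'n hmat set)"
	then obtain x where x: "x : (CP :: 'n hmat set)" "y = act g x" by blast
	obtain v where v: "v ~= 0" "x = pt v" using x(1) by (auto simp: CP_def)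
	moreover have "g *v v ~= 0" using v(1) norm_unitary[OF g, of v] by (metis norm_eq_zero)
	ultimately show "y : CP" by (simp add: x(2) act_pt[OF g] pt_in_CP)
qed

text \<open>The stabilizer acts on tangent vectors by its isotropy representation, which is
  orthogonal; so the annihilator is moved by the same map.\<close>

lemma conormal_base_act:
	fixes Z :: "'n::finite hmat set"
	assumes h: "h : stabilizer" and Z: "Z \<subseteq> CP"
	shows "conormal_base (act h ` Z) = (*v) (isotropy h) ` conormal_base Z"
proof -
	have u: "h : unitary_group" using h by (simp add: stabilizer_def)
	have k: "isotropy h : unitary_group" by (rule isotropy_unitary[OF h])
	let ?T = "tangent_space Z base_pt"
	have T: "tangent_space (act h ` Z) base_pt = act h ` ?T"
		using tangent_space_act[OF u, of Z base_pt] by (simp add: act_base[OF h])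
	have sub: "?T \<subseteq> range horizontal" using tangent_space_mono[OF Z] tangent_space_CP by blast
	have "act h ` Z \<subseteq> act h ` CP" using Z by blast
	also have "act h ` (CP :: 'n hmat set) \<subseteq> CP" by (rule act_CP_subset[OF u])
	finally have hZ: "act h ` Z \<subseteq> CP" .
	have hT: "horizontal x : act h ` ?T \<longleftrightarrow> horizontal (adj (isotropy h) *v x) : ?T" for x
	proof
		assume "horizontal x : act h ` ?T"
		then obtain x' where x': "horizontal x' : ?T" "horizontal x = act h (horizontal x')" using sub by blast
		hence "x = isotropy h *v x'" by (simp add: act_horizontal[OF h] inj_horizontal)
		thus "horizontal (adj (isotropy h) *v x) : ?T" using k x' by simp
	next
		assume a: "horizontal (adj (isotropy h) *v x) : ?T"
		have "act h (horizontal (adj (isotropy h) *v x)) = horizontal x" using k by (simp add: act_horizontal[OF h])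
		thus "horizontal x : act h ` ?T" using a by (metis image_eqI)
	qed
	have in': "(adj (isotropy h) *v w) \<bullet> (adj (isotropy h) *v x) = w \<bullet> x" for w x
		using orthogonal_unitary[OF unitary_group_adj[OF k]] by (simp add: orthogonal_transformation_def)
	have iff: "w : conormal_base (act h ` Z) \<longleftrightarrow> adj (isotropy h) *v w : conormal_base Z" for w
	proof
		assume w: "w : conormal_base (act h ` Z)"
		show "adj (isotropy h) *v w : conormal_base Z"
			unfolding conormal_base_iff[OF Z]
		proof (intro allI impI)
			fix x assume x: "horizontal x : ?T"
			have "w \<bullet> (isotropy h *v x) = 0" using w x k unfolding conormal_base_iff[OF hZ] T hT by simp
			thus "(adj (isotropy h) *v w) \<bullet> x = 0" using in'[of w "isotropy h *v x"] k by simp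
		qed
	next
		assume w: "adj (isotropy h) *v w : conormal_base Z"
		show "w : conormal_base (act h ` Z)"
			unfolding conormal_base_iff[OF hZ] T hT
		proof (intro allI impI)
			fix x assume "horizontal (adj (isotropy h) *v x) : ?T"
			thus "w \<bullet> x = 0" using w in'[of w x] unfolding conormal_base_iff[OF Z] by simp
		qed
	qed
	show ?thesis
	proof (intro Set.set_eqI iffI)
		fix w assume "w : conormal_base (act h ` Z)"
		thus "w : (*v) (isotropy h) ` conormal_base Z"
			using k by (intro image_eqI[of w _ "adj (isotropy h) *v w"]) (simp_all add: iff)
	next
		fix w assume "w : (*v) (isotropy h) ` conormal_base Z"
		thus "w : conormal_base (act h ` Z)" using k by (auto simp: iff)
	qed
qed

lemma conormal_frame:
	fixes Y :: "'n::finite hmat set"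
	assumes Y: "complex_submanifold j Y" and g: "g : unitary_group" and b: "base_pt : act g ` Y"
	obtains us where "unitary_list us" "length us = j" "conormal_base (act g ` Y) = span (set (complexify us))"
		"tangent_space (act g ` Y) base_pt = horizontal ` {x. ALL w:conormal_base (act g ` Y). w \<bullet> x = 0}"
		"act g ` Y \<subseteq> CP"
proof -
	obtain V F where V: "open V" "g : V" "!!k v. (%g. F g k v) : borel_measurable borel"
		"!!g. g : V ==> g : unitary_group ==> base_pt : act g ` Y ==> EX f D. local_equations j (act g ` Y) f D & (ALL k<j. D k = F g k)"
		using local_equations_submanifold[OF Y g b] by metis
	obtain f D where L: "local_equations j (act g ` Y) f D" using V(4)[OF V(2) g b] by blast
	let ?W = "conormal_base (act g ` Y)"
	have "complex_subspace ?W" unfolding conormal_base_local_equations(1)[OF L] by (rule complex_subspace_span)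
	then obtain us where us: "unitary_list us" "span (set (complexify us)) = ?W" by (rule complex_subspace_frame)
	have "2 * length us = 2 * j"
		using unitary_list_dim[OF us(1)] us(2) conormal_base_local_equations(3)[OF L] by simp
	moreover have CP: "act g ` Y \<subseteq> CP" using L by (simp add: local_equations_def)
	moreover have "tangent_space (act g ` Y) base_pt = horizontal ` {x. ALL w:?W. w \<bullet> x = 0}"
		using tangent_space_mono[OF CP, of base_pt] unfolding tangent_space_CP conormal_base_local_equations(4)[OF L, symmetric]
		by blast
	ultimately show ?thesis using that[of us] us by simp
qed

text \<open>One unitary frame of the conormal space serves all of the stabilizer: \<open>h\<close>
  merely rotates it by \<open>isotropy h\<close>.\<close>

lemma conormal_unit_act:
	fixes Y :: "'n::finite hmat set"
	assumes CP: "act g ` Y \<subseteq> CP" and us: "unitary_list us" "conormal_base (act g ` Y) = span (set (complexify us))"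
		and h: "h : stabilizer" and j: "length us = j"
	shows "\<bar>u \<bullet> conormal_unit (2 * j) (act (h ** g) ` Y)\<bar> = abs (u \<bullet> ext_map (isotropy h) (wedge_list (complexify us)))"
proof -
	let ?k = "isotropy h"
	let ?ws = "complexify (map ((*v) ?k) us)"
	have ws: "wedge_list ?ws = ext_map ?k (wedge_list (complexify us))"
		by (simp add: ext_map_wedge_list map_complexify)
	have n: "norm (wedge_list ?ws) = 1"
		unfolding ws norm_ext_map[OF isotropy_unitary[OF h]]
		by (rule norm_wedge_list_orthonormal[OF unitary_list_complexify[OF us(1)]])
	have "act (h ** g) ` Y = act h ` act g ` Y" by (simp add: image_image act_mult)
	hence "conormal_base (act (h ** g) ` Y) = (*v) ?k ` span (set (complexify us))"
		using conormal_base_act[OF h CP] us(2) by simp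
	also have "... = span ((*v) ?k ` set (complexify us))" by (rule linear_span_image[OF linear_matrix_vector, symmetric])
	also have "(*v) ?k ` set (complexify us) = set ?ws" unfolding map_complexify[symmetric] by simp
	finally have e: "conormal_base (act (h ** g) ` Y) = span (set ?ws)" .
	have "\<bar>u \<bullet> conormal_unit (2 * j) (act (h ** g) ` Y)\<bar> = abs (u \<bullet> wedge_list ?ws) / norm (wedge_list ?ws)"
		by (rule conormal_unit_eq[OF e]) (use n j in \<open>auto simp: length_complexify\<close>)
	thus ?thesis unfolding n by (simp add: ws)
qed

text \<open>Left translation by \<open>g\<close> on U(n) lifts to left translation by
  \<open>block g\<close> on the stabilizer, so the image measure inherits invariance.\<close>

lemma haar_isotropy:
	fixes eta :: "'n::finite hmat measure"
	assumes eta: "haar_prob stabilizer eta"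
	shows "haar_prob unitary_group (distr eta (restrict_space borel unitary_group) isotropy)"
proof -
	interpret prob_space eta using eta by (simp add: haar_prob_def)
	have sp: "space eta = stabilizer" by (rule haar_prob_space[OF eta])
	have c: "continuous_on UNIV (isotropy :: 'n hmat => _)"
		unfolding isotropy_def by (intro continuous_intros)
	have m: "isotropy : measurable eta (restrict_space borel unitary_group)"
		by (rule measurable_restrict_space2)
			(auto simp: sp isotropy_unitary intro: haar_measurable[OF eta borel_measurable_continuous_onI[OF c]])
	show ?thesis
		unfolding haar_prob_def
	proof (intro conjI ballI)
		show "prob_space (distr eta (restrict_space borel unitary_group) isotropy)" by (rule prob_space_distr[OF m])
		fix g :: "complex ^ 'n ^ 'n" assume g: "g : unitary_group"
		let ?nu = "distr eta (restrict_space borel unitary_group) isotropy"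
		have mg: "(%h. g ** h) : measurable (restrict_space borel unitary_group) ?nu"
			unfolding measurable_distr_eq2
			by (rule measurable_restrict_space2)
				(auto simp: space_restrict_space unitary_group_mult g intro!: measurable_restrict_space1 measurable_matrix_mult)
		have mb: "(%h. block g ** h) : measurable eta eta"
		proof (subst measurable_cong_sets[OF refl, of eta "restrict_space borel stabilizer"])
			show "sets eta = sets (restrict_space borel stabilizer)" using eta by (simp add: haar_prob_def)
			show "(%h. block g ** h) : measurable eta (restrict_space borel stabilizer)"
				by (intro measurable_restrict_space2 Pi_I measurable_matrix_mult borel_measurable_const haar_measurable_id[OF eta])
					(simp add: sp stabilizer_mult[OF block_stabilizer[OF g]])
		qed
		have "distr ?nu ?nu (%h. g ** h) = distr eta ?nu ((%h. g ** h) o isotropy)"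
			by (rule distr_distr[OF mg m])
		also have "... = distr eta ?nu (isotropy o (%h. block g ** h))"
			by (rule distr_cong) (simp_all add: sp isotropy_block_mult)
		also have "... = distr (distr eta eta (%h. block g ** h)) ?nu isotropy"
			using m by (intro distr_distr[symmetric] mb) simp
		also have "distr eta eta (%h. block g ** h) = eta"
			using eta block_stabilizer[OF g] unfolding haar_prob_def by blast
		also have "distr eta ?nu isotropy = ?nu" by (rule distr_cong) simp_all
		finally show "distr ?nu ?nu (%h. g ** h) = ?nu" .
	qed simp
qed

text \<open>Averaging over the stabilizer erases the position of the conormal space, so the value is
  the same at all points of \<open>Y\<close> and for all \<open>Y\<close> of one
  codimension.\<close>

lemma integral_conormal_unit:
	fixes Y :: "'n::finite hmat set" and mu :: "(complex ^ 'n ^ 'n) measure"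
	assumes mu: "haar_prob unitary_group mu" and eta: "haar_prob stabilizer eta"
		and Y: "complex_submanifold j Y" and g: "g : unitary_group" "base_pt : act g ` Y"
		and vs: "unitary_list vs" "length vs = j"
	shows "(LINT h|eta. \<bar>u \<bullet> conormal_unit (2 * j) (act (h ** g) ` Y)\<bar>) =
		(LINT h|mu. \<bar>u \<bullet> ext_map h (wedge_list (complexify vs))\<bar>)"
proof -
	obtain us where us: "unitary_list us" "length us = j" "conormal_base (act g ` Y) = span (set (complexify us))"
		and CP: "act g ` Y \<subseteq> CP"
		by (rule conormal_frame[OF Y g])
	let ?f = "%h. abs (u \<bullet> ext_map h (wedge_list (complexify us)))"
	have f: "?f : borel_measurable borel" by measurable
	have sp: "space eta = stabilizer" by (rule haar_prob_space[OF eta])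
	have c: "continuous_on UNIV (isotropy :: 'n hmat => _)"
		unfolding isotropy_def by (intro continuous_intros)
	have m: "isotropy : measurable eta (restrict_space borel unitary_group)"
		by (rule measurable_restrict_space2)
			(auto simp: sp isotropy_unitary intro: haar_measurable[OF eta borel_measurable_continuous_onI[OF c]])
	have "(LINT h|eta. abs (u \<bullet> conormal_unit (2 * j) (act (h ** g) ` Y))) = (LINT h|eta. ?f (isotropy h))"
		by (rule Bochner_Integration.integral_cong[OF refl])
			(simp add: sp conormal_unit_act[OF CP us(1) us(3) _ us(2)])
	also have "... = (LINT h|distr eta (restrict_space borel unitary_group) isotropy. ?f h)"
		by (rule integral_distr[OF m, symmetric]) (rule measurable_restrict_space1[OF f])
	also have "... = (LINT h|mu. ?f h)"
		by (rule haar_integrals(3)[OF matrix_group_unitary haar_isotropy[OF eta] f _ mu]) simp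
	also have "... = (LINT h|mu. abs (u \<bullet> ext_map h (wedge_list (complexify vs))))"
		by (rule frame_integral[OF mu us(1) vs(1)]) (simp add: us vs)
	finally show ?thesis .
qed

section \<open>The zonoid of a complex submanifold\<close>

lemma measurable_locally:
	fixes f :: "'a::second_countable_topology => 'b::topological_space"
	assumes "!!x. x : X ==> EX V m. open V & x : V & m : borel_measurable borel & (ALL y:V Int X. f y = m y)"
	shows "f : borel_measurable (restrict_space borel X)"
proof -
	let ?F = "{V. open V & (EX m. m : borel_measurable borel & (ALL y:V Int X. f y = m y))}"
	obtain C where C: "C \<subseteq> ?F" "countable C" "\<Union>C = \<Union>?F" by (rule Lindelof[of ?F]) auto
	show ?thesis
	proof (rule measurable_piecewise_restrict[OF C(2)])
		show "space (restrict_space borel X) \<subseteq> \<Union>C"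
			unfolding C(3) space_restrict_space using assms by force
		fix V assume "V : C"
		then obtain m where V: "open V" and m: "m : borel_measurable borel" "ALL y:V Int X. f y = m y" using C(1) by auto
		show "V Int space (restrict_space borel X) : sets (restrict_space borel X)"
			using V by (auto simp: space_restrict_space sets_restrict_space)
		have "m : borel_measurable (restrict_space (restrict_space borel X) V)"
			by (intro measurable_restrict_space1 m)
		moreover have "f x = m x" if "x : space (restrict_space (restrict_space borel X) V)" for x
			using m(2) that by (auto simp: space_restrict_space)
		ultimately show "f : borel_measurable (restrict_space (restrict_space borel X) V)"
			by (simp cong: measurable_cong)
	qed
qed

lemma measurable_wedge_complexify:
	"(!!k. k : set ks ==> a k : borel_measurable M) ==>
		(%x. wedge_list (complexify (map (%k. a k x) ks))) : borel_measurable M"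
	by (induction ks) (auto intro!: measurable_wedge measurable_cscale measurable_compose[OF _ measurable_ext_vec])

lemma measurable_gradient:
	fixes F :: "'a => complex ^ 'n => complex"
	assumes "!!v. (%g. F g v) : borel_measurable M"
	shows "(%g. gradient (F g) :: complex ^ 'n::finite) : borel_measurable M"
proof -
	have "(%g. gradient (F g)) = (%g. SUM i:UNIV. cnj (F g (axis i 1)) *s axis i 1)"
		by (rule ext) (simp add: gradient_def vec_eq_iff axis_def if_distrib cong: if_cong)
	also have "... : borel_measurable M"
		by (intro borel_measurable_sum measurable_cscale borel_measurable_const
				measurable_compose[OF assms linear_borel[OF bounded_linear.linear[OF bounded_linear_cnj]]])
	finally show ?thesis .
qed

text \<open>The unit vector is chosen separately for each \<open>g\<close>, but its absolute inner
  product with \<open>u\<close> agrees near each \<open>g0\<close> with a Borel expression in the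
  gradients.\<close>

lemma measurable_conormal_unit:
	fixes Y :: "'n::finite hmat set"
	assumes Y: "complex_submanifold j Y"
	shows "(%g. \<bar>u \<bullet> conormal_unit (2 * j) (act g ` Y)\<bar>) \<in>
		borel_measurable (restrict_space borel {g : unitary_group. base_pt : act g ` Y})"
proof (rule measurable_locally)
	fix g0 assume "g0 : {g : unitary_group. base_pt : act g ` Y}"
	hence g0: "g0 : unitary_group" "base_pt : act g0 ` Y" by auto
	obtain V F where V: "open V" "g0 : V" "!!k v. (%g. F g k v) : borel_measurable borel"
		"!!g. g : V ==> g : unitary_group ==> base_pt : act g ` Y ==> EX f D. local_equations j (act g ` Y) f D & (ALL k<j. D k = F g k)"
		using local_equations_submanifold[OF Y g0] by metis
	define w where "w g = wedge_list (complexify (map (%k. gradient (F g k)) [0..<j]))" for g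
	have mw: "w : borel_measurable borel"
		unfolding w_def[abs_def] by (intro measurable_wedge_complexify measurable_gradient V(3))
	have "\<bar>u \<bullet> conormal_unit (2 * j) (act g ` Y)\<bar> = abs (u \<bullet> w g) / norm (w g)"
		if g: "g : V" "g : unitary_group" "base_pt : act g ` Y" for g
	proof -
		obtain f D where L: "local_equations j (act g ` Y) f D" and D: "ALL k<j. D k = F g k" using V(4)[OF g] by blast
		have w: "map (%k. gradient (D k)) [0..<j] = map (%k. gradient (F g k)) [0..<j]" using D by simp
		show ?thesis
			unfolding w_def w[symmetric]
			by (rule conormal_unit_eq) (use conormal_base_local_equations(1,2)[OF L] in \<open>simp_all add: length_complexify\<close>)
	qed
	moreover have "(%g. abs (u \<bullet> w g) / norm (w g)) : borel_measurable borel" using mw by measurable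
	ultimately show "EX V m. open V & g0 : V & m : borel_measurable borel &
			(ALL g:V Int {g : unitary_group. base_pt : act g ` Y}. \<bar>u \<bullet> conormal_unit (2 * j) (act g ` Y)\<bar> = m g)"
		using V(1,2) by (intro exI[of _ V] exI[of _ "%g. abs (u \<bullet> w g) / norm (w g)"]) auto
qed

text \<open>The sign drops out under the absolute value, and for each point of \<open>Y\<close> the
  mean over the stabilizer is given by \<open>integral_conormal_unit\<close>. As it does not depend
  on the point, the uniform distribution on \<open>Y\<close> leaves no further trace.\<close>

lemma grass_zonoid_frame:
	fixes Y :: "'n::finite hmat set" and tau :: "'n hmat => 'n hmat" and mu :: "(complex ^ 'n ^ 'n) measure"
	assumes mu: "haar_prob unitary_group mu" and eta: "haar_prob stabilizer eta" and tau: "orbit_section tau"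
		and Y: "complex_submanifold j Y" and vs: "unitary_list vs" "length vs = j"
		and V: "sets (fs_volume (2 * CARD('n) - 2 * j) Y) = sets (restrict_space borel Y)"
	shows "grass_zonoid eta tau (2 * j) Y =
		(vol (2 * CARD('n) - 2 * j) Y / vol (2 * CARD('n)) (CP :: 'n hmat set)) *\<^sub>R frame_zonoid mu vs"
proof (cases "vol (2 * CARD('n) - 2 * j) Y = 0")
	\<comment> \<open>This includes infinite volume, for which \<open>vol\<close> is 0 as well. In the
	  other case the uniform distribution on \<open>Y\<close> is a probability measure.\<close>
	case True
	thus ?thesis by (simp add: grass_zonoid_def)
next
	case False
	let ?V = "fs_volume (2 * CARD('n) - 2 * j) Y"
	let ?X = "{g : unitary_group. base_pt : act g ` Y}"
	let ?U = "uniform_measure ?V Y"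
	let ?E = "uniform_count_measure {-1, 1 :: real}"
	have YCP: "Y \<subseteq> CP" using Y by (simp add: complex_submanifold_def)
	have spV: "space ?V = Y" using sets_eq_imp_space_eq[OF V] by (simp add: space_restrict_space)
	interpret eta: prob_space eta using eta by (simp add: haar_prob_def)
	interpret U: prob_space ?U
		using False by (intro prob_space_uniform_measure) (auto simp: vol_def measure_def)
	interpret E: prob_space ?E by (rule prob_space_uniform_count_measure) auto
	interpret UE: pair_prob_space ?U ?E ..
	interpret P: pair_prob_space eta "?U \<Otimes>\<^sub>M ?E" ..
	have speta: "space eta = stabilizer" by (rule haar_prob_space[OF eta])
	have g: "tau y : unitary_group" "base_pt : act (tau y) ` Y" if "y : Y" for y
		using CP_moves[OF tau, of y] YCP that by (auto intro!: image_eqI[of _ _ y])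
	have "(LINT om|(eta \<Otimes>\<^sub>M (?U \<Otimes>\<^sub>M ?E)). \<bar>u \<bullet> (case om of (h, y, eps) => eps *\<^sub>R conormal_unit (2 * j) (act (h ** tau y) ` Y))\<bar>) =
			(LINT h|mu. \<bar>u \<bullet> ext_map h (wedge_list (complexify vs))\<bar>)" for u
	proof -
		define f where "f = (%(h, p :: 'n hmat \<times> real). abs (u \<bullet> conormal_unit (2 * j) (act (h ** tau (fst p)) ` Y)))"
		have "(%p. tau (fst p)) : borel_measurable (?U \<Otimes>\<^sub>M ?E)"
		proof (rule measurable_compose[OF measurable_fst])
			have "tau : borel_measurable (restrict_space borel Y)"
				by (rule measurable_restrict_mono[OF _ YCP]) (use tau in \<open>simp add: orbit_section_def\<close>)
			thus "tau : borel_measurable ?U" by (simp add: V cong: measurable_cong_sets)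
		qed
		hence m0: "(%(h, p). h ** tau (fst p)) : borel_measurable (eta \<Otimes>\<^sub>M (?U \<Otimes>\<^sub>M ?E))"
			unfolding case_prod_beta
			by (intro measurable_matrix_mult measurable_compose[OF measurable_fst haar_measurable_id[OF eta]]
					measurable_compose[OF measurable_snd])
		have in_X: "h ** tau y : ?X" if "h : stabilizer" "y : Y" for h y
		proof -
			have "base_pt = act (h ** tau y) y"
				using CP_moves[OF tau, of y] YCP that by (auto simp: act_mult act_base)
			thus ?thesis using that g(1)[OF that(2)] by (auto simp: stabilizer_def unitary_group_mult)
		qed
		have "(%(h, p). h ** tau (fst p)) : measurable (eta \<Otimes>\<^sub>M (?U \<Otimes>\<^sub>M ?E)) (restrict_space borel ?X)"
			by (rule measurable_restrict_space2[OF _ m0]) (use in_X in \<open>auto simp: space_pair_measure speta spV\<close>)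
		from measurable_compose[OF this measurable_conormal_unit[OF Y, of u]]
		have mf: "f : borel_measurable (eta \<Otimes>\<^sub>M (?U \<Otimes>\<^sub>M ?E))" by (simp add: f_def case_prod_beta)
		have bound: "\<bar>f (h, p)\<bar> <= norm u" if h: "h : stabilizer" and p: "fst p : Y" for h p
		proof -
			obtain us where us: "unitary_list us" "length us = j" "conormal_base (act (tau (fst p)) ` Y) = span (set (complexify us))"
				and CP: "act (tau (fst p)) ` Y \<subseteq> CP"
				by (rule conormal_frame[OF Y g[OF p]])
			have "\<bar>f (h, p)\<bar> = abs (u \<bullet> ext_map (isotropy h) (wedge_list (complexify us)))"
				by (simp add: f_def conormal_unit_act[OF CP us(1) us(3) h us(2)])
			also have "... <= norm u * norm (ext_map (isotropy h) (wedge_list (complexify us)))" by (rule Cauchy_Schwarz_ineq2)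
			finally show ?thesis
				by (simp add: norm_ext_map[OF isotropy_unitary[OF h]] norm_wedge_list_orthonormal[OF unitary_list_complexify[OF us(1)]])
		qed
		have int: "integrable (eta \<Otimes>\<^sub>M (?U \<Otimes>\<^sub>M ?E)) f"
			by (rule P.integrable_const_bound[OF _ mf, of "norm u"])
				(auto intro!: AE_I2 bound simp: space_pair_measure speta spV)
		have "(LINT om|(eta \<Otimes>\<^sub>M (?U \<Otimes>\<^sub>M ?E)). \<bar>u \<bullet> (case om of (h, y, eps) => eps *\<^sub>R conormal_unit (2 * j) (act (h ** tau y) ` Y))\<bar>) =
				integral\<^sup>L (eta \<Otimes>\<^sub>M (?U \<Otimes>\<^sub>M ?E)) f"
			by (rule Bochner_Integration.integral_cong[OF refl])
				(auto simp: f_def space_pair_measure space_uniform_count_measure abs_mult)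
		also have "... = (LINT p|(?U \<Otimes>\<^sub>M ?E). (LINT h|eta. f (h, p)))"
			by (rule P.integral_snd[symmetric, of "%h p. f (h, p)", simplified]) (rule int)
		also have "... = (LINT p|(?U \<Otimes>\<^sub>M ?E). (LINT h|mu. abs (u \<bullet> ext_map h (wedge_list (complexify vs)))))"
			by (rule Bochner_Integration.integral_cong[OF refl])
				(auto simp: f_def space_pair_measure spV integral_conormal_unit[OF mu eta Y g vs])
		also have "... = (LINT h|mu. abs (u \<bullet> ext_map h (wedge_list (complexify vs))))" by (simp add: UE.prob_space)
		finally show ?thesis .
	qed
	hence "vz (eta \<Otimes>\<^sub>M (?U \<Otimes>\<^sub>M ?E)) (%(h, y, eps). eps *\<^sub>R conormal_unit (2 * j) (act (h ** tau y) ` Y)) = frame_zonoid mu vs"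
		unfolding frame_zonoid_def by (rule vz_eqI)
	thus ?thesis by (simp add: grass_zonoid_def)
qed

section \<open>Cohomogeneity\<close>

lemma conormal_space_act:
	fixes Y :: "'n::finite hmat set"
	assumes g: "g : unitary_group" and Y: "Y \<subseteq> CP" and T: "tangent_space Y (act g y) = act g ` tangent_space Y y"
	shows "cotangent_act g y ` conormal_space Y y = conormal_space Y (act g y)"
proof -
	have sub: "act g ` CP \<subseteq> (CP :: 'n hmat set)" if g: "g : unitary_group" for g
		by (rule act_CP_subset[OF g])
	have "act g ` (CP :: 'n hmat set) = CP"
	proof
		show "(CP :: 'n hmat set) \<subseteq> act g ` CP"
		proof
			fix x :: "'n hmat" assume "x : CP"
			hence "act (adj g) x : CP" using sub[OF unitary_group_adj[OF g]] by blast
			thus "x : act g ` CP" using g by (intro image_eqI[of _ _ "act (adj g) x"]) auto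
		qed
	qed (rule sub[OF g])
	hence TC: "tangent_space CP (act g y) = act g ` tangent_space CP y"
		using tangent_space_act[OF g, of CP y] by simp
	have TY: "tangent_space Y y \<subseteq> tangent_space CP y" by (rule tangent_space_mono[OF Y])
	show ?thesis
	proof (intro Set.set_eqI iffI)
		fix eta assume "eta : cotangent_act g y ` conormal_space Y y"
		then obtain f where f: "linear f" "ALL X:tangent_space Y y. f X = 0"
			"eta = cotangent_act g y (restrict f (tangent_space CP y))"
			using TY by (fastforce simp: conormal_space_def cotangent_space_def)
		have "eta = restrict (f o act (adj g)) (tangent_space CP (act g y))"
			unfolding f(3) cotangent_act_def by (rule restrict_ext) (use g in \<open>auto simp: TC\<close>)
		moreover have "linear (f o act (adj g))" by (intro linear_compose linear_act f(1))
		ultimately show "eta : conormal_space Y (act g y)"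
			using f(2) g TY by (auto simp: conormal_space_def cotangent_space_def T TC)
	next
		fix eta assume "eta : conormal_space Y (act g y)"
		then obtain f where f: "linear f" "ALL X:tangent_space Y y. f (act g X) = 0"
			"eta = restrict f (tangent_space CP (act g y))"
			using TY by (fastforce simp: conormal_space_def cotangent_space_def T TC)
		have "eta = cotangent_act g y (restrict (f o act g) (tangent_space CP y))"
			unfolding f(3) cotangent_act_def by (rule restrict_ext) (use g in \<open>auto simp: TC\<close>)
		moreover have "restrict (f o act g) (tangent_space CP y) : conormal_space Y y"
			using linear_compose[OF linear_act f(1)] f(2) TY by (auto simp: conormal_space_def cotangent_space_def)
		ultimately show "eta : cotangent_act g y ` conormal_space Y y" by blast
	qed
qed

text \<open>Both points are moved to the base point by \<open>tau\<close>, and the unitary map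
  matching the conormal spaces there is lifted to the stabilizer by \<open>block\<close>. It matches
  their orthogonal complements, the tangent spaces, and \<open>conormal_space_act\<close> carries
  this back to the points.\<close>

lemma cohomogeneous_complex_submanifold:
	fixes Y :: "'n::finite hmat set" and tau :: "'n hmat => 'n hmat"
	assumes tau: "orbit_section tau" and Y: "complex_submanifold j Y"
	shows "cohomogeneous Y"
	unfolding cohomogeneous_def
proof (intro ballI)
	fix y1 y2 assume y: "y1 : Y" "y2 : Y"
	have YCP: "Y \<subseteq> CP" using Y by (simp add: complex_submanifold_def)
	have g: "tau y : unitary_group" "act (tau y) y = base_pt" "base_pt : act (tau y) ` Y" if "y : Y" for y
		using CP_moves[OF tau, of y] YCP that by (auto intro!: image_eqI[of _ _ y])
	let ?g1 = "tau y1" and ?g2 = "tau y2"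
	let ?W1 = "conormal_base (act ?g1 ` Y)" and ?W2 = "conormal_base (act ?g2 ` Y)"
	obtain us where us: "unitary_list us" "length us = j" "?W1 = span (set (complexify us))"
		"tangent_space (act ?g1 ` Y) base_pt = horizontal ` {x. ALL w:?W1. w \<bullet> x = 0}"
		by (rule conormal_frame[OF Y g(1,3)[OF y(1)]])
	obtain vs where vs: "unitary_list vs" "length vs = j" "?W2 = span (set (complexify vs))"
		"tangent_space (act ?g2 ` Y) base_pt = horizontal ` {x. ALL w:?W2. w \<bullet> x = 0}"
		by (rule conormal_frame[OF Y g(1,3)[OF y(2)]])
	have "length us = length vs" by (simp add: us vs)
	then obtain A where A: "A : unitary_group" "map ((*v) A) us = vs" by (rule unitary_transitive[OF us(1) vs(1)])
	have W: "?W2 = (*v) A ` ?W1"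
	proof -
		have "(*v) A ` ?W1 = span ((*v) A ` set (complexify us))"
			unfolding us(3) by (rule linear_span_image[OF linear_matrix_vector, symmetric])
		also have "(*v) A ` set (complexify us) = set (complexify vs)" unfolding A(2)[symmetric] map_complexify[symmetric] by simp
		finally show ?thesis by (simp add: vs(3))
	qed
	have Ain: "(A *v w) \<bullet> (A *v x) = w \<bullet> x" for w x
		using orthogonal_unitary[OF A(1)] by (simp add: orthogonal_transformation_def)
	have B: "block A : stabilizer" "block A : unitary_group"
		using block_stabilizer[OF A(1)] by (simp_all add: stabilizer_def)
	have BT: "act (block A) ` tangent_space (act ?g1 ` Y) base_pt = tangent_space (act ?g2 ` Y) base_pt"
	proof -
		have "act (block A) ` tangent_space (act ?g1 ` Y) base_pt = horizontal ` (*v) A ` {x. ALL w:?W1. w \<bullet> x = 0}"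
			unfolding us(4) image_image act_horizontal[OF B(1)] isotropy_block ..
		also have "(*v) A ` {x. ALL w:?W1. w \<bullet> x = 0} = {x. ALL w:?W2. w \<bullet> x = 0}"
		proof (intro Set.set_eqI iffI)
			fix x assume x: "x : {x. ALL w:?W2. w \<bullet> x = 0}"
			have "w \<bullet> (adj A *v x) = 0" if "w : ?W1" for w
				using x that Ain[of w "adj A *v x"] A(1) by (simp add: W)
			thus "x : (*v) A ` {x. ALL w:?W1. w \<bullet> x = 0}"
				using A(1) by (intro image_eqI[of _ _ "adj A *v x"]) auto
		qed (auto simp: W Ain)
		finally show ?thesis by (simp add: vs(4))
	qed
	define h where "h = adj ?g2 ** (block A ** ?g1)"
	have h: "h : unitary_group" unfolding h_def by (intro unitary_group_mult unitary_group_adj g y B)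
	have hact: "act h x = act (adj ?g2) (act (block A) (act ?g1 x))" for x by (simp add: h_def act_mult)
	have hy: "act h y1 = y2"
		using act_adj(1)[OF g(1)[OF y(2)], of y2] by (simp add: hact g(2)[OF y(1)] g(2)[OF y(2)] act_base[OF B(1)])
	have "act h ` tangent_space Y y1 = act (adj ?g2) ` act (block A) ` act ?g1 ` tangent_space Y y1"
		by (simp add: hact image_image)
	also have "act ?g1 ` tangent_space Y y1 = tangent_space (act ?g1 ` Y) base_pt"
		using tangent_space_act[OF g(1)[OF y(1)], of Y y1] by (simp add: g(2)[OF y(1)])
	also have "act (block A) ` ... = act ?g2 ` tangent_space Y y2"
		unfolding BT using tangent_space_act[OF g(1)[OF y(2)], of Y y2] by (simp add: g(2)[OF y(2)])
	also have "act (adj ?g2) ` ... = tangent_space Y y2" using g(1)[OF y(2)] by (simp add: image_image)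
	finally have "tangent_space Y (act h y1) = act h ` tangent_space Y y1" by (simp add: hy)
	from conormal_space_act[OF h YCP this]
	show "EX g:unitary_group. act g y1 = y2 & cotangent_act g y1 ` conormal_space Y y1 = conormal_space Y y2"
		using h hy by auto
qed

section \<open>Volume of projective subspaces\<close>

definition coord_proj :: "'a::euclidean_space set => 'a => 'a"
	where "coord_proj B x = (SUM b:B. (x \<bullet> b) *\<^sub>R b)"

lemma linear_coord_proj: "linear (coord_proj B)"
	unfolding coord_proj_def[abs_def] by (intro linear_compose_sum ballI linear_scaleR_left bounded_linear.linear[OF bounded_linear_inner_left_comp] bounded_linear_ident linearI)
		(simp_all add: inner_add_left scaleR_add_left)

lemma coord_proj_inner:
	assumes "B \<subseteq> Basis" "b : Basis" shows "coord_proj B x \<bullet> b = (if b : B then x \<bullet> b else 0)"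
proof -
	have f: "finite B" using assms(1) finite_Basis finite_subset by blast
	have "coord_proj B x \<bullet> b = (SUM c:B. if c = b then x \<bullet> b else 0)"
		unfolding coord_proj_def inner_sum_left
		by (rule sum.cong) (use assms in \<open>auto simp: inner_Basis\<close>)
	thus ?thesis using f by simp
qed

lemma coord_proj_span [simp]: "coord_proj B x : span B"
	unfolding coord_proj_def by (intro span_sum span_mul span_base)

lemma span_Basis_iff:
	assumes "B \<subseteq> (Basis :: 'a::euclidean_space set)" shows "x : span B \<longleftrightarrow> (ALL b:Basis - B. x \<bullet> b = 0)"
proof
	assume "x : span B"
	thus "ALL b:Basis - B. x \<bullet> b = 0"
	proof (induction rule: span_induct_alt)
		case (step c u y)
		thus ?case using assms by (auto simp: inner_add_left inner_not_same_Basis subset_iff) (metis inner_not_same_Basis)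
	qed simp
next
	assume "ALL b:Basis - B. x \<bullet> b = 0"
	hence "coord_proj B x \<bullet> b = x \<bullet> b" if "b : Basis" for b using that by (simp add: coord_proj_inner[OF assms])
	hence "coord_proj B x = x" by (rule euclidean_eqI)
	thus "x : span B" by (metis coord_proj_span)
qed

lemma coord_proj_id:
	assumes "B \<subseteq> Basis" "x : span B" shows "coord_proj B x = x"
	by (rule euclidean_eqI) (use assms span_Basis_iff[OF assms(1), of x] in \<open>auto simp: coord_proj_inner[OF assms(1)]\<close>)

definition unit_cube :: "'a::euclidean_space set => 'a set"
	where "unit_cube C = {x. ALL b:C. x \<bullet> b : {0..1}}"

lemma borel_unit_cube [measurable]:
	assumes "C \<subseteq> Basis" shows "unit_cube C : sets borel"
proof -
	have "closed (\<Inter>b\<in>C. {x :: 'a. 0 <= x \<bullet> b} Int {x. x \<bullet> b <= 1})"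
		by (intro closed_INT ballI closed_Int closed_Collect_le continuous_intros)
	moreover have "unit_cube C = (\<Inter>b\<in>C. {x :: 'a. 0 <= x \<bullet> b} Int {x. x \<bullet> b <= 1})"
		by (auto simp: unit_cube_def)
	ultimately show ?thesis by simp
qed

text \<open>Filling up with a unit cube in the remaining coordinates turns integrals over a coordinate
	subspace into integrals over the whole space.\<close>

lemma nn_integral_lborel_on:
	fixes B :: "'a::euclidean_space set"
	assumes B: "B \<subseteq> Basis" and f: "f : borel_measurable borel"
	shows "(\<integral>\<^sup>+x. f x \<partial>lborel_on B) =
		(\<integral>\<^sup>+x. f (coord_proj B x) * indicator (unit_cube (Basis - B)) x \<partial>lborel)"
proof -
	let ?C = "Basis - B"
	have fin: "finite B" "finite ?C" using B finite_Basis finite_subset by blast+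
	interpret product_sigma_finite "%_ :: 'a. lborel :: real measure" ..
	have mS: "(%h. SUM b:D. h b *\<^sub>R b) : borel_measurable (\<Pi>\<^sub>M b\<in>E. lborel)"
		if "D \<subseteq> E" for D E :: "'a set"
		using that by (intro borel_measurable_sum borel_measurable_scaleR) (auto intro: measurable_component_singleton)
	have mc: "(%x. f (coord_proj B x) * indicator (unit_cube ?C) x) : borel_measurable borel"
		using borel_unit_cube[of ?C] measurable_compose[OF linear_borel[OF linear_coord_proj] f] by measurable
	have sB: "(SUM b:D. h b *\<^sub>R b) \<bullet> c = (if c : D then h c else 0)" if "D \<subseteq> Basis" "c : Basis" for h c and D :: "'a set"
	proof -
		have "finite D" using that finite_Basis finite_subset by blast
		moreover have "(SUM b:D. h b *\<^sub>R b) \<bullet> c = (SUM b:D. if b = c then h c else 0)"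
			unfolding inner_sum_left by (rule sum.cong) (use that in \<open>auto simp: inner_Basis\<close>)
		ultimately show ?thesis by simp
	qed
	have cube: "emeasure (\<Pi>\<^sub>M b\<in>?C. lborel) (\<Pi>\<^sub>E b\<in>?C. {0..1::real}) = 1"
		by (subst emeasure_PiM[OF fin(2)]) auto
	let ?F = "%h. f (SUM b:B. h b *\<^sub>R b) * indicator (unit_cube ?C) (SUM b:Basis. h b *\<^sub>R b)"
	have mF: "?F : borel_measurable (\<Pi>\<^sub>M b\<in>B Un ?C. lborel)"
	proof -
		have "(%h. SUM b:B. h b *\<^sub>R b) : borel_measurable (\<Pi>\<^sub>M b\<in>B Un ?C. lborel)"
			"(%h. SUM b:Basis. h b *\<^sub>R b) : borel_measurable (\<Pi>\<^sub>M b\<in>B Un ?C. lborel)"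
			using B by (intro mS; auto)+
		thus ?thesis using f borel_unit_cube[of ?C] by measurable
	qed
	have "(\<integral>\<^sup>+x. f (coord_proj B x) * indicator (unit_cube ?C) x \<partial>lborel) = (\<integral>\<^sup>+h. ?F h \<partial>(\<Pi>\<^sub>M b\<in>Basis. lborel))"
	proof -
		have "coord_proj B (SUM b:Basis. h b *\<^sub>R b) = (SUM b:B. h b *\<^sub>R b)" for h
			unfolding coord_proj_def by (rule sum.cong) (use B sB in auto)
		thus ?thesis
			by (subst lborel_eq, subst nn_integral_distr[OF mS]) (use mc in auto)
	qed
	also have "... = (\<integral>\<^sup>+h. ?F h \<partial>(\<Pi>\<^sub>M b\<in>B Un ?C. lborel))" using B by (simp add: Un_absorb1)
	also have "... = (\<integral>\<^sup>+x. (\<integral>\<^sup>+y. ?F (merge B ?C (x, y)) \<partial>(\<Pi>\<^sub>M b\<in>?C. lborel)) \<partial>(\<Pi>\<^sub>M b\<in>B. lborel))"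
		by (rule product_nn_integral_fold[OF _ fin mF]) auto
	also have "... = (\<integral>\<^sup>+x. f (SUM b:B. x b *\<^sub>R b) \<partial>(\<Pi>\<^sub>M b\<in>B. lborel))"
	proof (rule nn_integral_cong)
		fix x :: "'a => real"
		have "(\<integral>\<^sup>+y. ?F (merge B ?C (x, y)) \<partial>(\<Pi>\<^sub>M b\<in>?C. lborel)) =
				(\<integral>\<^sup>+y. f (SUM b:B. x b *\<^sub>R b) * indicator (\<Pi>\<^sub>E b\<in>?C. {0..1::real}) y \<partial>(\<Pi>\<^sub>M b\<in>?C. lborel))"
		proof (rule nn_integral_cong)
			fix y assume y: "y : space (\<Pi>\<^sub>M b\<in>?C. (lborel :: real measure))"
			have "(SUM b:B. merge B ?C (x, y) b *\<^sub>R b) = (SUM b:B. x b *\<^sub>R b)"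
				by (rule sum.cong) (auto simp: merge_def)
			moreover have "(SUM b:Basis. merge B ?C (x, y) b *\<^sub>R b) : unit_cube ?C \<longleftrightarrow> y : (\<Pi>\<^sub>E b\<in>?C. {0..1::real})"
				using y sB[of Basis] by (auto simp: unit_cube_def merge_def space_PiM PiE_def)
			ultimately show "?F (merge B ?C (x, y)) = f (SUM b:B. x b *\<^sub>R b) * indicator (\<Pi>\<^sub>E b\<in>?C. {0..1::real}) y"
				by (simp add: indicator_def)
		qed
		also have "... = f (SUM b:B. x b *\<^sub>R b) * emeasure (\<Pi>\<^sub>M b\<in>?C. lborel) (\<Pi>\<^sub>E b\<in>?C. {0..1::real})"
			by (rule nn_integral_cmult_indicator) (use fin in \<open>auto intro!: sets_PiM_I_finite\<close>)
		finally show "(\<integral>\<^sup>+y. ?F (merge B ?C (x, y)) \<partial>(\<Pi>\<^sub>M b\<in>?C. lborel)) = f (SUM b:B. x b *\<^sub>R b)"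
			unfolding cube by simp
	qed
	also have "... = (\<integral>\<^sup>+x. f x \<partial>lborel_on B)"
		unfolding lborel_on_def by (rule nn_integral_distr[symmetric, OF mS]) (use f in auto)
	finally show ?thesis ..
qed

lemma emeasure_lborel_on:
	fixes B :: "'a::euclidean_space set"
	assumes B: "B \<subseteq> Basis" and A: "A : sets borel"
	shows "emeasure (lborel_on B) A = emeasure lborel {x : unit_cube (Basis - B). coord_proj B x : A}"
proof -
	have "emeasure (lborel_on B) A = (\<integral>\<^sup>+x. indicator A x \<partial>lborel_on B)"
		by (rule nn_integral_indicator[symmetric]) (simp add: A lborel_on_def)
	also have "... = (\<integral>\<^sup>+x. indicator {x : unit_cube (Basis - B). coord_proj B x : A} x \<partial>lborel)"
		by (subst nn_integral_lborel_on[OF B]) (use A in \<open>auto intro!: nn_integral_cong simp: indicator_def\<close>)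
	also have "... = emeasure lborel {x : unit_cube (Basis - B). coord_proj B x : A}"
	proof (rule nn_integral_indicator)
		have "unit_cube (Basis - B) Int (coord_proj B -` A Int space borel) : sets borel"
			by (intro sets.Int borel_unit_cube measurable_sets[OF linear_borel[OF linear_coord_proj] A]) auto
		moreover have "unit_cube (Basis - B) Int (coord_proj B -` A Int space borel) =
				{x : unit_cube (Basis - B). coord_proj B x : A}" by auto
		ultimately show "{x : unit_cube (Basis - B). coord_proj B x : A} : sets lborel" by simp
	qed
	finally show ?thesis .
qed

section \<open>Determinants and change of variables\<close>

definition ebasis :: "'a::euclidean_space eidx => 'a"
	where "ebasis = (SOME e. bij_betw e UNIV Basis)"

lemma ebasis: "bij_betw ebasis (UNIV :: 'a eidx set) (Basis :: 'a::euclidean_space set)"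
proof -
	have "EX e :: 'a eidx => 'a. bij_betw e UNIV Basis"
		by (rule finite_same_card_bij) (simp_all add: card_eidx)
	thus ?thesis unfolding ebasis_def by (rule someI_ex)
qed

lemma ebasis_Basis [simp]: "ebasis i : Basis"
	using ebasis bij_betwE by blast

lemma ebasis_eq_iff [simp]: "ebasis i = ebasis j \<longleftrightarrow> i = j"
	using ebasis by (auto simp: bij_betw_def inj_on_def)

lemma inj_ebasis: "inj ebasis"
	by (rule injI) simp

lemma Basis_ebasis: "b : Basis ==> EX i. b = ebasis i"
	using ebasis by (auto simp: bij_betw_def)

definition of_eidx :: "real ^ 'a eidx => 'a::euclidean_space"
	where "of_eidx x = (SUM i:UNIV. x $ i *\<^sub>R ebasis i)"

definition to_eidx :: "'a::euclidean_space => real ^ 'a eidx"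
	where "to_eidx y = (\<chi> i. y \<bullet> ebasis i)"

lemma linear_of_eidx: "linear of_eidx" and linear_to_eidx: "linear to_eidx"
	by (auto intro!: linearI simp: of_eidx_def to_eidx_def vec_eq_iff inner_add_left scaleR_add_left sum.distrib scaleR_sum_right)

lemma of_eidx_inner: "of_eidx x \<bullet> ebasis i = x $ i"
proof -
	have "of_eidx x \<bullet> ebasis i = (SUM j:UNIV. if j = i then x $ i else 0)"
		unfolding of_eidx_def inner_sum_left by (rule sum.cong) (auto simp: inner_Basis)
	thus ?thesis by simp
qed

lemma to_of_eidx [simp]: "to_eidx (of_eidx x) = x"
	by (simp add: to_eidx_def of_eidx_inner)

lemma of_to_eidx [simp]: "of_eidx (to_eidx y) = y"
proof (rule euclidean_eqI)
	fix b :: 'a assume "b : Basis"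
	then obtain k where k: "b = ebasis k" using Basis_ebasis by blast
	show "of_eidx (to_eidx y) \<bullet> b = y \<bullet> b" unfolding k of_eidx_inner by (simp add: to_eidx_def)
qed

lemma of_eidx_axis [simp]: "of_eidx (axis i 1) = ebasis i"
proof (rule euclidean_eqI)
	fix b :: 'a assume "b : Basis"
	then obtain k where "b = ebasis k" using Basis_ebasis by blast
	thus "of_eidx (axis i 1) \<bullet> b = ebasis i \<bullet> b" by (simp add: of_eidx_inner axis_def inner_Basis)
qed

lemma prod_ebasis: "(PROD b:Basis. f b) = (PROD i:UNIV. f (ebasis i))"
	by (rule prod.reindex_bij_betw[OF ebasis, symmetric])

lemma distr_of_eidx: "distr lborel borel of_eidx = (lborel :: 'a::euclidean_space measure)"
proof (rule lborel_eqI[symmetric])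
	fix l u :: 'a assume lu: "!!b. b : Basis ==> l \<bullet> b <= u \<bullet> b"
	have "of_eidx -` box l u = box (to_eidx l) (to_eidx u)"
	proof -
		have 1: "(ALL b:(Basis :: 'a set). P b) \<longleftrightarrow> (ALL i. P (ebasis i))" for P
			using ebasis_Basis Basis_ebasis by metis
		have 2: "(ALL b:(Basis :: (real ^ 'a eidx) set). P b) \<longleftrightarrow> (ALL i. P (axis i 1))" for P
			by (auto simp: Basis_vec_def)
		have "x : of_eidx -` box l u \<longleftrightarrow> x : box (to_eidx l) (to_eidx u)" for x
			by (simp add: mem_box 1 2 of_eidx_inner inner_axis to_eidx_def)
		thus ?thesis by blast
	qed
	hence "emeasure (distr lborel borel of_eidx) (box l u) = emeasure lborel (box (to_eidx l) (to_eidx u))"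
		by (subst emeasure_distr) (auto simp: linear_borel[OF linear_of_eidx])
	also have "... = (PROD b:Basis. (to_eidx u - to_eidx l) \<bullet> b)"
		by (rule emeasure_lborel_box) (auto simp: Basis_vec_def inner_axis to_eidx_def lu)
	also have "(PROD b:Basis. (to_eidx u - to_eidx l) \<bullet> b) = (PROD i:UNIV. (u - l) \<bullet> ebasis i)"
	proof -
		have B: "(Basis :: (real ^ 'a eidx) set) = (%i. axis i 1) ` UNIV" by (auto simp: Basis_vec_def)
		have i: "inj (%i :: 'a eidx. axis i (1 :: real))" by (rule injI) (simp add: axis_eq_axis)
		have "(PROD b:Basis. (to_eidx u - to_eidx l) \<bullet> b) = (PROD i:UNIV. (to_eidx u - to_eidx l) \<bullet> axis i 1)"
			unfolding B by (subst prod.reindex[OF i]) (simp add: o_def)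
		thus ?thesis by (simp add: inner_axis to_eidx_def inner_diff_left)
	qed
	finally show "emeasure (distr lborel borel of_eidx) (box l u) = (PROD b:Basis. (u - l) \<bullet> b)"
		by (simp add: prod_ebasis)
qed simp

definition edet :: "('a::euclidean_space => 'a) => real"
	where "edet T = det (matrix (to_eidx o T o of_eidx))"

lemma edet_compose:
	assumes "linear S" "linear T" shows "edet (S o T) = edet S * edet T"
proof -
	have e: "to_eidx o (S o T) o of_eidx = (to_eidx o S o of_eidx) o (to_eidx o T o of_eidx)" by (simp add: fun_eq_iff)
	show ?thesis unfolding edet_def e
		by (subst matrix_compose) (auto simp: det_mul intro!: linear_compose linear_of_eidx linear_to_eidx assms)
qed

lemma edet_id: "edet id = 1"
proof -
	have "to_eidx o id o of_eidx = (id :: real ^ 'a eidx => _)" by (simp add: fun_eq_iff)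
	thus ?thesis by (simp add: edet_def matrix_id_mat_1)
qed

lemma edet_gram:
	fixes T :: "'a::euclidean_space => 'a"
	shows
	"det (\<chi> i j. T (ebasis i) \<bullet> T (ebasis j)) = (edet T)\<^sup>2"
proof -
	let ?M = "matrix (to_eidx o T o of_eidx)"
	have M: "?M $ k $ i = T (ebasis i) \<bullet> ebasis k" for k i by (simp add: matrix_def to_eidx_def)
	have "(SUM k:UNIV. (x \<bullet> ebasis k) * (y \<bullet> ebasis k)) = x \<bullet> y" for x y :: 'a
		unfolding euclidean_inner[of x y] by (rule sum.reindex_bij_betw[OF ebasis])
	hence "(\<chi> i j. T (ebasis i) \<bullet> T (ebasis j)) = transpose ?M ** ?M"
		by (simp add: vec_eq_iff matrix_matrix_mult_def transpose_def M)
	thus ?thesis by (simp add: det_mul det_transpose edet_def power2_eq_square)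
qed

text \<open>The change of variables for injective differentiable maps, moved to coordinates: the
  integral is the measure of the image, which is finite because \<open>V\<close> contains
  it.\<close>

lemma change_of_variables_le:
	fixes f :: "'a::euclidean_space => 'a"
	assumes S: "S : sets borel" and der: "!!x. x : S ==> (f has_derivative f' x) (at x within S)"
		and inj: "inj_on f S" and V: "V : sets borel" "f ` S \<subseteq> V" "emeasure lborel V < \<infinity>"
		and d: "!!x. x : S ==> d x = abs (edet (f' x))" and m: "(%x. ennreal (d x) * indicator S x) : borel_measurable borel"
	shows "(\<integral>\<^sup>+x. ennreal (d x) * indicator S x \<partial>lborel) <= emeasure lborel V"
proof -
	let ?S = "of_eidx -` S" and ?V = "of_eidx -` V"
	let ?F = "to_eidx o f o of_eidx"
	have mJ: "of_eidx : borel_measurable (borel :: (real ^ 'a eidx) measure)" by (rule linear_borel[OF linear_of_eidx])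
	have S': "?S : sets borel" "?V : sets borel" using measurable_sets[OF mJ S] measurable_sets[OF mJ V(1)] by simp_all
	have bl: "bounded_linear (of_eidx :: real ^ 'a eidx => 'a)" "bounded_linear (to_eidx :: 'a => _)"
		using linear_of_eidx linear_to_eidx by (simp_all add: linear_conv_bounded_linear)
	have der': "(?F has_derivative (to_eidx o f' (of_eidx x) o of_eidx)) (at x within ?S)" if "x : ?S" for x
	proof -
		have a: "(of_eidx has_derivative of_eidx) (at x within ?S)" by (rule bounded_linear_imp_has_derivative[OF bl(1)])
		have "(f has_derivative f' (of_eidx x)) (at (of_eidx x) within of_eidx ` ?S)"
			using that by (intro has_derivative_subset[OF der]) auto
		from bounded_linear.has_derivative[OF bl(2) has_derivative_in_compose[OF a this]] show ?thesis by (simp add: o_def)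
	qed
	have inj': "inj_on ?F ?S"
		using inj unfolding inj_on_def by (metis comp_apply of_to_eidx to_of_eidx vimageE)
	have FV: "?F ` ?S \<subseteq> ?V" using V(2) by auto
	have Vm: "emeasure lborel ?V = emeasure lborel V"
		using emeasure_distr[of of_eidx lborel borel V] mJ V(1) by (simp add: distr_of_eidx)
	have "?F ` ?S : sets lebesgue"
		using S' der' by (intro differentiable_image_in_sets_lebesgue)
			(auto simp: differentiable_on_def differentiable_def intro: sets_completionI_sets)
	moreover have "?V : fmeasurable lebesgue"
		using S' V(3) Vm by (auto intro!: fmeasurableI sets_completionI_sets simp: emeasure_completion)
	ultimately have lm: "?F ` ?S : lmeasurable" using FV by (metis fmeasurableI2)
	have hi: "((%x. abs (edet (f' (of_eidx x)))) has_integral measure lebesgue (?F ` ?S)) ?S"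
		using has_measure_differentiable_image[OF _ der' inj', of "measure lebesgue (?F ` ?S)"] lm S'
		by (simp add: edet_def sets_completionI_sets)
	have "(\<integral>\<^sup>+x. ennreal (d x) * indicator S x \<partial>lborel) = (\<integral>\<^sup>+x. ennreal (d (of_eidx x)) * indicator S (of_eidx x) \<partial>lborel)"
		by (subst distr_of_eidx[symmetric], subst nn_integral_distr) (use mJ m in auto)
	also have "... = (\<integral>\<^sup>+x. ennreal \<bar>edet (f' (of_eidx x))\<bar> * indicator ?S x \<partial>lborel)"
		by (rule nn_integral_cong) (simp add: indicator_def d)
	also have "... = ennreal (measure lebesgue (?F ` ?S))"
		by (rule nn_integral_has_integral_lebesgue'[OF _ hi]) simp
	also have "... = emeasure lebesgue (?F ` ?S)" using lm by (simp add: emeasure_eq_measure2)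
	also have "... <= emeasure lebesgue ?V" by (rule emeasure_mono[OF FV]) (use S' in \<open>auto intro: sets_completionI_sets\<close>)
	also have "... = emeasure lborel V" using S' Vm by (simp add: emeasure_completion)
	finally show ?thesis .
qed

text \<open>\<open>gram_det\<close> sums over permutations of a set of vectors. Padding by an
  identity block turns it into a determinant over an index type; permutations that move an index
  outside \<open>B\<close> contribute zero.\<close>

lemma gram_det_padded:
	fixes B :: "(complex ^ 'n::finite) set" and T :: "complex ^ 'n => 'n hmat"
	assumes B: "B \<subseteq> Basis"
	shows "gram_det B T = det (\<chi> i j :: (complex ^ 'n) eidx.
		if ebasis i : B & ebasis j : B then fs_metric (T (ebasis i)) (T (ebasis j)) else if i = j then 1 else 0)"
		(is "_ = det ?M")
proof -
	let ?I = "{i :: (complex ^ 'n) eidx. ebasis i : B}"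
	let ?k = "inv_into UNIV (ebasis :: (complex ^ 'n) eidx => complex ^ 'n)"
	have k: "?k (ebasis i) = i" for i by (rule inv_into_f_f) (auto simp: inj_on_def)
	have ek: "ebasis (?k b) = b" if "b : Basis" for b
		using Basis_ebasis[OF that] k by metis
	have kinj: "?k a = ?k b \<longleftrightarrow> a = b" if "a : Basis" "b : Basis" for a b using ek that by metis
	have fin: "finite B" using B finite_Basis finite_subset by blast
	have bij: "bij_betw ?k B ?I"
		by (rule bij_betwI[of _ _ _ ebasis]) (use B ek k in auto)
	\<comment> \<open>A permutation of \<open>B\<close> transported to indices. That the sign is kept
	  is checked one transposition at a time.\<close>
	let ?c = "%p. ?k o p o ebasis"
	have inB: "p b : Basis" if "p permutes B" "b : Basis" for p b
		using permutes_in_image[OF that(1), of b] permutes_not_in[OF that(1), of b] B that(2) by (metis subsetD)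
	have c_eq: "?c p = (%x. if x : ?I then ?k (p (inv_into B ?k x)) else x)" if p: "p permutes B" for p
	proof
		fix x
		have "inv_into B ?k x = ebasis x" if "x : ?I"
			using that bij B by (intro inv_into_f_eq) (auto simp: bij_betw_def inj_ebasis)
		thus "?c p x = (if x : ?I then ?k (p (inv_into B ?k x)) else x)"
			using permutes_not_in[OF p] k by auto
	qed
	have cbij: "bij_betw ?c {p. p permutes B} {p. p permutes ?I}"
		by (rule bij_betw_cong[THEN iffD1, OF _ bij_betw_permutations[OF bij]]) (simp add: c_eq)
	have sgn: "sign (?c p) = sign p" if p: "p permutes B" for p
		using p fin
	proof (induction rule: permutes_induct)
		case id
		have "?c id = id" by (rule ext) (simp add: k)
		thus ?case by simp
	next
		case (swap a b p)
		have ab: "a : Basis" "b : Basis" using swap B by auto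
		have e: "?c (Transposition.transpose a b o p) = Transposition.transpose (?k a) (?k b) o ?c p"
		proof
			fix i
			have "p (ebasis i) : Basis" using inB[OF \<open>p permutes B\<close>] by simp
			thus "?c (Transposition.transpose a b o p) i = (Transposition.transpose (?k a) (?k b) o ?c p) i"
				using ab by (simp add: Transposition.transpose_def kinj)
		qed
		have "permutation (?c p)"
			using bij_betwE[OF cbij] \<open>p permutes B\<close> by (auto intro!: permutes_imp_permutation[of ?I])
		from sign_compose[OF permutation_swap_id this]
		have s1: "sign (?c (Transposition.transpose a b o p)) = sign (Transposition.transpose (?k a) (?k b)) * sign (?c p)"
			unfolding e .
		have "permutation p" using \<open>p permutes B\<close> fin by (rule permutes_imp_permutation[rotated])
		from sign_compose[OF permutation_swap_id this]
		show ?case unfolding s1 using swap.IH ab by (simp only: sign_swap_id kinj)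
	qed
	have van: "(PROD i:UNIV. ?M $ i $ p i) = 0" if np: "\<not> p permutes ?I" and pu: "p permutes UNIV" for p
	proof -
		obtain i where i: "i ~: ?I" "p i ~= i"
			using permutes_superset[OF pu, of ?I] np by blast
		have "?M $ i $ p i = 0" using i by auto
		thus ?thesis by (meson UNIV_I finite prod_zero)
	qed
	have "det ?M = (\<Sum>p | p permutes ?I. of_int (sign p) * (PROD i:UNIV. ?M $ i $ p i))"
		unfolding det_def
	proof (rule sum.mono_neutral_right)
		show "{p. p permutes ?I} \<subseteq> {p. p permutes UNIV}" using permutes_subset by blast
	qed (use van in \<open>auto simp: finite_permutations\<close>)
	also have "... = (\<Sum>p | p permutes B. of_int (sign (?c p)) * (PROD i:UNIV. ?M $ i $ ?c p i))"
		by (rule sum.reindex_bij_betw[OF cbij, symmetric])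
	also have "... = (\<Sum>p | p permutes B. of_int (sign p) * (PROD b:B. fs_metric (T b) (T (p b))))"
	proof (rule sum.cong[OF refl])
		fix p assume "p : {p. p permutes B}"
		hence p: "p permutes B" by simp
		have "(PROD i:UNIV. ?M $ i $ ?c p i) = (PROD b:Basis. ?M $ ?k b $ ?c p (?k b))"
			unfolding prod_ebasis k ..
		also have "... = (PROD b:B. ?M $ ?k b $ ?c p (?k b))"
			by (rule prod.mono_neutral_right) (use B in \<open>auto simp: ek k permutes_not_in[OF p]\<close>)
		also have "... = (PROD b:B. fs_metric (T b) (T (p b)))"
			by (rule prod.cong[OF refl]) (use B permutes_in_image[OF p] in \<open>auto simp: ek inB[OF p] subset_iff\<close>)
		finally show "of_int (sign (?c p)) * (PROD i:UNIV. ?M $ i $ ?c p i) = of_int (sign p) * (PROD b:B. fs_metric (T b) (T (p b)))"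
			by (simp add: sgn[OF p])
	qed
	finally show ?thesis by (simp add: gram_det_def)
qed

section \<open>Darboux coordinates on projective subspaces\<close>

definition cbasis :: "'n set => (complex ^ 'n::finite) set"
	where "cbasis S = (%i. axis i 1) ` S Un (%i. axis i \<i>) ` S"

lemma cbasis_Basis: "cbasis S \<subseteq> Basis"
	by (auto simp: cbasis_def Basis_vec_def Basis_complex_def)

lemma card_cbasis: "card (cbasis S) = 2 * card S"
proof -
	have "card (cbasis S) = card ((%i. axis i (1::complex)) ` S) + card ((%i. axis i \<i>) ` S)"
		unfolding cbasis_def by (rule card_Un_disjoint) (auto simp: axis_eq_axis)
	thus ?thesis by (simp add: card_image inj_on_def axis_eq_axis)
qed

lemma span_cbasis: "w : span (cbasis S) \<longleftrightarrow> (ALL i. i ~: S --> w $ i = 0)"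
proof -
	have "w : span (cbasis S) \<longleftrightarrow> (ALL i. i ~: S --> w \<bullet> axis i 1 = 0 & w \<bullet> axis i \<i> = 0)"
		unfolding span_Basis_iff[OF cbasis_Basis]
		by (auto simp: cbasis_def Basis_vec_def Basis_complex_def axis_eq_axis)
	also have "... \<longleftrightarrow> (ALL i. i ~: S --> w $ i = 0)"
		by (simp add: inner_axis inner_complex_def complex_eq_iff)
	finally show ?thesis .
qed

definition height :: "complex ^ 'n::finite => real"
	where "height w = sqrt (1 - (norm w)\<^sup>2)"

definition lift :: "complex ^ 'n => complex ^ ('n::finite option)"
	where "lift w = emb (complex_of_real (height w)) w"

definition lift_deriv :: "complex ^ 'n => complex ^ 'n => complex ^ ('n::finite option)"
	where "lift_deriv w v = emb (complex_of_real (- (w \<bullet> v) / height w)) v"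

text \<open>Darboux coordinates: the first coordinate of the unit vector representing the line is positive,
	and the remaining ones are the coordinates. In them the Riemannian volume is Lebesgue measure.\<close>

definition ball_chart :: "'n hmat => complex ^ 'n => 'n::finite hmat"
	where "ball_chart g w = act g (outer (lift w) (lift w))"

definition ball_chart_deriv :: "'n hmat => complex ^ 'n => complex ^ 'n => 'n::finite hmat"
	where "ball_chart_deriv g w v = act g (outer (lift w) (lift_deriv w v) + outer (lift_deriv w v) (lift w))"

text \<open>The inverse of \<open>ball_chart\<close>: for a unit vector z representing the line, the
  corner entry is |z_0|^2, so dividing the first column by its root gives the other coordinates of
  the representative with positive first one. The cut to \<open>S\<close> puts the values into the
  span of \<open>cbasis S\<close> for every matrix \<open>y\<close>.\<close>

definition ball_coord :: "'n set => 'n hmat => 'n hmat => complex ^ 'n::finite"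
	where "ball_coord S g y = inverse (sqrt (Re (act (adj g) y $ None $ None))) *\<^sub>R
		(\<chi> i. if i : S then act (adj g) y $ Some i $ None else 0)"

text \<open>A square root of the metric in the Darboux chart (\<open>fs_metric_ball_chart\<close>).
  With s = \<open>height w\<close> it multiplies \<open>w\<close> by 1/s and
  \<open>\<i> *s w\<close> by s and fixes their orthogonal complement; in this form nothing is
  divided by the norm of \<open>w\<close>, which may be 0.\<close>

definition stretch :: "complex ^ 'n => complex ^ 'n => complex ^ 'n::finite"
	where "stretch w v = v + ((w \<bullet> v) / (height w * (1 + height w))) *\<^sub>R w - (((\<i> *s w) \<bullet> v) / (1 + height w)) *\<^sub>R (\<i> *s w)"

lemma height:
	assumes "norm w < 1"
	shows "0 < height w" "(height w)\<^sup>2 = 1 - (norm w)\<^sup>2" "norm (lift w) = 1"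
proof -
	have "(norm w)\<^sup>2 < 1" using assms by (simp add: abs_square_less_1)
	thus h: "0 < height w" "(height w)\<^sup>2 = 1 - (norm w)\<^sup>2" by (simp_all add: height_def)
	have "(norm (lift w))\<^sup>2 = 1" unfolding lift_def norm_emb using h by simp
	thus "norm (lift w) = 1" by (simp add: power2_eq_1_iff) (smt (verit) norm_ge_zero)
qed

lemma ball_chart_pt: "norm w < 1 ==> ball_chart g w = act g (pt (lift w))"
	by (simp add: ball_chart_def pt_outer height)

lemma has_derivative_lift:
	fixes w :: "complex ^ 'n::finite"
	assumes w: "norm w < 1" shows "(lift has_derivative lift_deriv w) (at w)"
proof -
	have p: "0 < 1 - w \<bullet> w" using height(1)[OF w] by (simp add: height_def power2_norm_eq_inner)
	have h: "(height has_derivative (%v. - (w \<bullet> v) / height w)) (at w)"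
		unfolding height_def[abs_def] power2_norm_eq_inner
		by (rule derivative_eq_intros refl p | simp)+ (auto simp: fun_eq_iff inner_commute field_simps)
	have "((%w. height w *\<^sub>R axis None 1 + emb 0 w) has_derivative (%v. (- (w \<bullet> v) / height w) *\<^sub>R axis None 1 + emb 0 v)) (at w)"
		by (intro has_derivative_add has_derivative_scaleR_left h linear_imp_has_derivative linear_emb0)
	moreover have "height w *\<^sub>R axis None 1 + emb 0 w = lift w" for w :: "complex ^ 'n"
		unfolding vec_option_eq_iff lift_def by (simp add: axis_def scaleR_conv_of_real[where 'a=complex])
	moreover have "(- (w \<bullet> v) / height w) *\<^sub>R axis None 1 + emb 0 v = lift_deriv w v" for v
		unfolding vec_option_eq_iff lift_deriv_def by (simp add: axis_def scaleR_conv_of_real[where 'a=complex])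
	ultimately show ?thesis by simp
qed

lemma has_derivative_ball_chart:
	assumes w: "norm w < 1" shows "(ball_chart g has_derivative ball_chart_deriv g w) (at w)"
	unfolding ball_chart_def[abs_def] ball_chart_deriv_def[abs_def]
	by (rule bounded_linear.has_derivative[OF bounded_linear_act
				bounded_bilinear.FDERIV[OF bounded_bilinear_outer has_derivative_lift[OF w] has_derivative_lift[OF w]]])

lemma inner_outer: "outer a b \<bullet> outer c d = Re (herm a c * cnj (herm b d))"
proof -
	have "herm a c * cnj (herm b d) = (SUM i:UNIV. SUM j:UNIV. (a $ i * cnj (c $ i)) * (cnj (b $ j) * d $ j))"
		by (simp add: herm_def sum_product)
	also have "Re ... = outer a b \<bullet> outer c d"
		unfolding Re_sum inner_vec_def
		by (intro sum.cong refl) (simp add: inner_complex_def algebra_simps)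
	finally show ?thesis ..
qed

lemma times_i_inner:
	fixes w v :: "complex ^ 'n::finite"
	shows "w \<bullet> (\<i> *s v) = - ((\<i> *s w) \<bullet> v)" "(\<i> *s w) \<bullet> (\<i> *s v) = w \<bullet> v" "(\<i> *s w) \<bullet> w = 0" "w \<bullet> (\<i> *s w) = 0"
	by (simp_all add: Re_herm[symmetric] herm_simps herm_self)

text \<open>The derivative of \<open>lift\<close> is not horizontal: along \<open>lift w\<close> it
  has the component i <i w, v>. Taking the vertical part away from the Euclidean metric of
  \<open>lift_deriv\<close> leaves a a'/s^2 + <v, v'> - b b', and the coefficients of
  \<open>stretch\<close> reproduce exactly this.\<close>

lemma fs_metric_ball_chart:
	fixes w :: "complex ^ 'n::finite"
	assumes g: "g : unitary_group" and w: "norm w < 1"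
	shows "fs_metric (ball_chart_deriv g w v) (ball_chart_deriv g w v') = stretch w v \<bullet> stretch w v'"
proof -
	let ?s = "height w"
	note h = height[OF w]
	define a a' b b' where ab: "a = w \<bullet> v" "a' = w \<bullet> v'" "b = (\<i> *s w) \<bullet> v" "b' = (\<i> *s w) \<bullet> v'"
	have he: "herm (emb c x) (emb d y) = c * cnj d + herm x y" for x y :: "complex ^ 'n" and c d
		by (simp add: herm_def sum_option)
	have hz: "herm (lift_deriv w u) (lift w) = \<i> * complex_of_real ((\<i> *s w) \<bullet> u)" for u
	proof -
		have "Im (herm u w) = (\<i> *s w) \<bullet> u" by (simp add: Re_herm[symmetric] herm_simps herm_cnj[of w u])
		moreover have "Re (herm u w) = w \<bullet> u" by (simp add: Re_herm inner_commute)
		ultimately show ?thesis using h(1) by (simp add: complex_eq_iff lift_deriv_def lift_def he)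
	qed
	have hz': "herm (lift w) (lift_deriv w u) = - (\<i> * complex_of_real ((\<i> *s w) \<bullet> u))" for u
		by (subst herm_cnj) (simp add: hz)
	have h1: "herm (lift w) (lift w) = 1" by (simp add: herm_self h)
	have hd: "Re (herm (lift_deriv w v) (lift_deriv w v')) = a * a' / ?s\<^sup>2 + v \<bullet> v'"
		by (simp add: lift_deriv_def he Re_herm ab power2_eq_square)
	have "fs_metric (ball_chart_deriv g w v) (ball_chart_deriv g w v') = a * a' / ?s\<^sup>2 + v \<bullet> v' - b * b'"
		unfolding ball_chart_deriv_def fs_metric_act[OF g]
		by (simp add: fs_metric_def inner_add_left inner_add_right inner_outer hz hz' h1 hd ab)
	also have "... = stretch w v \<bullet> stretch w v'"
	proof -
		define al be where albe: "al = 1 / (?s * (1 + ?s))" "be = 1 / (1 + ?s)"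
		have ww: "w \<bullet> w = 1 - ?s\<^sup>2" using h(2) by (simp add: power2_norm_eq_inner)
		have st: "stretch w v = v + (al * a) *\<^sub>R w - (be * b) *\<^sub>R (\<i> *s w)" "stretch w v' = v' + (al * a') *\<^sub>R w - (be * b') *\<^sub>R (\<i> *s w)"
			by (simp_all add: stretch_def albe ab)
		have cm: "v \<bullet> w = a" "v \<bullet> (\<i> *s w) = b" by (simp_all add: ab inner_commute)
		have "stretch w v \<bullet> stretch w v' = v \<bullet> v' + a * a' * (2 * al + al * al * (1 - ?s\<^sup>2)) - b * b' * (2 * be - be * be * (1 - ?s\<^sup>2))"
			unfolding st by (simp add: inner_add_left inner_add_right inner_diff_left inner_diff_right ww times_i_inner(2,3,4) cm
					ab(2)[symmetric] ab(4)[symmetric] algebra_simps)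
		moreover have "2 * al + al * al * (1 - ?s\<^sup>2) = 1 / ?s\<^sup>2"
		proof -
			have "(1 - ?s\<^sup>2) = (1 - ?s) * (1 + ?s)" by (simp add: power2_eq_square algebra_simps)
			thus ?thesis using h(1) by (simp add: albe divide_simps power2_eq_square)
		qed
		moreover have "2 * be - be * be * (1 - ?s\<^sup>2) = 1"
		proof -
			have "(1 - ?s\<^sup>2) = (1 - ?s) * (1 + ?s)" by (simp add: power2_eq_square algebra_simps)
			thus ?thesis using h(1) by (simp add: albe divide_simps) (simp add: algebra_simps)
		qed
		ultimately show ?thesis by simp
	qed
	finally show ?thesis .
qed

lemma linear_stretch: "linear (stretch w)"
	by (rule linearI) (simp_all add: stretch_def inner_add_right add_divide_distrib scaleR_add_left scaleR_diff_right scaleR_add_right)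

lemma linear_times_i: "linear (%v :: complex ^ 'n::finite. \<i> *s v)"
	by (rule linearI) (simp_all add: vec_eq_iff algebra_simps)

text \<open>The stretch is symmetric and symplectic, hence \<open>R J R = J\<close>.\<close>

lemma stretch_symplectic:
	fixes w :: "complex ^ 'n::finite"
	assumes w: "norm w < 1" shows "stretch w (\<i> *s stretch w v) = \<i> *s v"
proof -
	let ?s = "height w"
	note h = height[OF w]
	define a b where ab: "a = w \<bullet> v" "b = (\<i> *s w) \<bullet> v"
	define al be where albe: "al = 1 / (?s * (1 + ?s))" "be = 1 / (1 + ?s)"
	have ww: "w \<bullet> w = 1 - ?s\<^sup>2" using h(2) by (simp add: power2_norm_eq_inner)
	have st: "stretch w u = u + (al * (w \<bullet> u)) *\<^sub>R w - (be * ((\<i> *s w) \<bullet> u)) *\<^sub>R (\<i> *s w)" for u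
		by (simp add: stretch_def albe)
	define u where "u = \<i> *s stretch w v"
	have ii: "\<i> *s (\<i> *s w) = - w" by (simp add: vec_eq_iff)
	have u: "u = \<i> *s v + (al * a) *\<^sub>R (\<i> *s w) + (be * b) *\<^sub>R w"
		unfolding u_def st by (simp add: linear_add[OF linear_times_i] linear_diff[OF linear_times_i] linear_scale[OF linear_times_i] ii ab)
	have wu: "w \<bullet> u = - b + be * b * (1 - ?s\<^sup>2)" "(\<i> *s w) \<bullet> u = a + al * a * (1 - ?s\<^sup>2)"
		unfolding u by (simp_all add: inner_add_right times_i_inner(2,3,4) times_i_inner(1)[of w v] ww ab)
	have c: "be - al + al * be * (1 - ?s\<^sup>2) = 0"
	proof -
		have "(1 - ?s\<^sup>2) = (1 - ?s) * (1 + ?s)" by (simp add: power2_eq_square algebra_simps)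
		thus ?thesis using h(1) by (simp add: albe divide_simps)
	qed
	have "stretch w u = \<i> *s v + (b * (be - al + al * be * (1 - ?s\<^sup>2))) *\<^sub>R w - (a * (be - al + al * be * (1 - ?s\<^sup>2))) *\<^sub>R (\<i> *s w)"
		unfolding st[of u] wu unfolding u by (simp add: algebra_simps)
	thus ?thesis by (simp add: c u_def)
qed

text \<open>Determinants in R J R = J; J is multiplication by i, which is invertible because its
  square is -1.\<close>

lemma edet_stretch:
	fixes w :: "complex ^ 'n::finite"
	assumes w: "norm w < 1" shows "(edet (stretch w))\<^sup>2 = 1"
proof -
	let ?J = "%v :: complex ^ 'n. \<i> *s v"
	have "(%v. - v) o ?J o ?J = (id :: complex ^ 'n => _)" by (simp add: fun_eq_iff vec_eq_iff)
	moreover have "linear (%v :: complex ^ 'n. - v)" by (rule linearI) simp_all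
	ultimately have "edet (%v :: complex ^ 'n. - v) * edet ?J * edet ?J = 1"
		using edet_id linear_times_i by (metis edet_compose linear_compose)
	hence J: "edet ?J ~= 0" by auto
	have "stretch w o (?J o stretch w) = ?J" by (simp add: fun_eq_iff stretch_symplectic[OF w])
	hence "edet (stretch w) * (edet ?J * edet (stretch w)) = edet ?J"
		using linear_stretch linear_times_i by (metis edet_compose linear_compose)
	thus ?thesis using J by (simp add: power2_eq_square algebra_simps)
qed

lemma stretch_orthogonal:
	assumes w: "w : span (cbasis S)" and v: "v : Basis - cbasis S" shows "stretch w v = v"
proof -
	have "w \<bullet> v = 0" using w v span_Basis_iff[OF cbasis_Basis] by blast
	moreover have "\<i> *s w : span (cbasis S)" using w by (simp add: span_cbasis)
	hence "(\<i> *s w) \<bullet> v = 0" using v span_Basis_iff[OF cbasis_Basis] by blast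
	ultimately show ?thesis by (simp add: stretch_def)
qed

lemma stretch_span:
	assumes w: "w : span (cbasis S)" and v: "v : span (cbasis S)" shows "stretch w v : span (cbasis S)"
proof -
	have "\<i> *s w : span (cbasis S)" using w by (simp add: span_cbasis)
	thus ?thesis unfolding stretch_def using w v by (intro span_diff span_add span_mul)
qed

lemma stretch_eq_0:
	assumes "norm w < 1" "stretch w v = 0" shows "v = 0"
proof -
	have "\<i> *s v = 0" using stretch_symplectic[OF assms(1), of v] assms(2)
		by (simp add: linear_0[OF linear_stretch])
	thus ?thesis by (simp add: vec_eq_iff)
qed

text \<open>A projective subspace of complex dimension \<open>card S\<close> in normal form: the
  image under \<open>g\<close> of the coordinate subspace belonging to \<open>None\<close> and
  \<open>S\<close>, for which the Darboux chart is at hand.\<close>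

definition proj_frame :: "'n hmat => 'n set => 'n::finite hmat set => bool"
	where "proj_frame g S X \<longleftrightarrow> g : unitary_group & X = (%z. pt (g *v z)) ` {z. z ~= 0 & (ALL i. i ~: S --> z $ Some i = 0)}"

lemma ball_coord_span [simp]: "ball_coord S g y : span (cbasis S)"
	by (simp add: span_cbasis ball_coord_def)

lemma ball_coord_chart:
	assumes g: "g : unitary_group" and w: "norm w < 1" "w : span (cbasis S)"
	shows "ball_coord S g (ball_chart g w) = w"
proof -
	have e: "act (adj g) (ball_chart g w) = outer (lift w) (lift w)" using g by (simp add: ball_chart_def)
	have "Re (outer (lift w) (lift w) $ None $ None) = (height w)\<^sup>2" by (simp add: lift_def power2_eq_square)
	hence "sqrt (Re (outer (lift w) (lift w) $ None $ None)) = height w" using height(1)[OF w(1)] by simp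
	thus ?thesis
		using height(1)[OF w(1)] w(2) unfolding ball_coord_def e
		by (simp add: vec_eq_iff span_cbasis lift_def scaleR_conv_of_real[where 'a=complex])
qed

lemma ball_chart_in:
	assumes X: "proj_frame g S X" and w: "norm w < 1" "w : span (cbasis S)"
	shows "ball_chart g w : X"
proof -
	have g: "g : unitary_group" using X by (simp add: proj_frame_def)
	have "lift w ~= 0" using height(3)[OF w(1)] by auto
	moreover have "ALL i. i ~: S --> lift w $ Some i = 0" using w(2) by (simp add: lift_def span_cbasis)
	moreover have "ball_chart g w = pt (g *v lift w)" by (simp add: ball_chart_pt[OF w(1)] act_pt[OF g])
	ultimately show ?thesis using X unfolding proj_frame_def by blast
qed

lemma proj_frame_entry:
	assumes X: "proj_frame g S X" and y: "y : X" and nz: "act (adj g) y $ None $ None ~= 0"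
	shows "0 < Re (act (adj g) y $ None $ None)"
proof -
	have g: "g : unitary_group" using X by (simp add: proj_frame_def)
	obtain z where z: "z ~= 0" "y = pt (g *v z)" using X y unfolding proj_frame_def by blast
	hence e: "act (adj g) y = pt z" using g by (simp add: act_pt[OF g, symmetric])
	have r: "pt z $ None $ None = complex_of_real ((cmod (z $ None))\<^sup>2 / (norm z)\<^sup>2)"
		by (simp add: pt_nth complex_norm_square del: of_real_power)
	thus ?thesis using nz z(1) unfolding e r by simp
qed

lemma ball_chart_coord:
	assumes X: "proj_frame g S X" and y: "y : X" and nz: "act (adj g) y $ None $ None ~= 0"
	shows "norm (ball_coord S g y) < 1" "ball_chart g (ball_coord S g y) = y"
proof -
	have g: "g : unitary_group" using X by (simp add: proj_frame_def)
	obtain z where z: "z ~= 0" "ALL i. i ~: S --> z $ Some i = 0" "y = pt (g *v z)"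
		using X y unfolding proj_frame_def by blast
	hence e: "act (adj g) y = pt z" using g by (simp add: act_pt[OF g, symmetric])
	let ?r = "cmod (z $ None)" and ?R = "norm z"
	have R: "0 < ?R" using z(1) by simp
	have r0: "pt z $ None $ None = complex_of_real (?r\<^sup>2 / ?R\<^sup>2)"
		by (simp add: pt_nth complex_norm_square del: of_real_power)
	have r: "0 < ?r" using nz unfolding e r0 by auto
	have sq: "sqrt (Re (pt z $ None $ None)) = ?r / ?R" unfolding r0 using r R by (simp add: real_sqrt_divide)
	\<comment> \<open>The scalar that turns \<open>z\<close> into a unit vector with positive first
	  coordinate.\<close>
	define c where "c = cnj (z $ None) / complex_of_real (?r * ?R)"
	have cc: "c * z $ None = complex_of_real (?r / ?R)"
	proof -
		have "cnj (z $ None) * z $ None = complex_of_real (?r * ?r)"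
			using complex_norm_square[of "z $ None"] by (simp add: power2_eq_square mult.commute)
		thus ?thesis using r R by (simp add: c_def)
	qed
	have nc: "cmod c = 1 / ?R" using r R by (simp add: c_def norm_divide norm_mult)
	have k: "ball_coord S g y = c *s tail z"
	proof -
		have "ball_coord S g y $ i = c * z $ Some i" for i
		proof (cases "i : S")
			case True
			hence "ball_coord S g y $ i = complex_of_real (?R / ?r) * (z $ Some i * cnj (z $ None) / complex_of_real (?R\<^sup>2))"
				unfolding ball_coord_def e sq by (simp add: pt_nth scaleR_conv_of_real[where 'a=complex])
			also have "... = c * z $ Some i" using r R by (simp add: c_def power2_eq_square divide_simps)
			finally show ?thesis .
		qed (use z(2) in \<open>simp add: ball_coord_def\<close>)
		thus ?thesis by (simp add: vec_eq_iff)
	qed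
	have "emb (z $ None) (tail z) = z" by (simp add: vec_option_eq_iff)
	hence Rr: "?R\<^sup>2 = ?r\<^sup>2 + (norm (tail z))\<^sup>2" using norm_emb[of "z $ None" "tail z"] by simp
	have nk: "(norm (ball_coord S g y))\<^sup>2 = 1 - (?r / ?R)\<^sup>2"
	proof -
		have "(norm (ball_coord S g y))\<^sup>2 = (norm (tail z))\<^sup>2 / ?R\<^sup>2"
			by (simp add: k norm_vector_scale nc power_divide)
		also have "(norm (tail z))\<^sup>2 = ?R\<^sup>2 - ?r\<^sup>2" using Rr by simp
		finally show ?thesis using R by (simp add: diff_divide_distrib power_divide)
	qed
	hence "(norm (ball_coord S g y))\<^sup>2 < 1" using r R by simp
	thus n1: "norm (ball_coord S g y) < 1" by (simp add: abs_square_less_1)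
	have "height (ball_coord S g y) = ?r / ?R" unfolding height_def nk using r R by simp
	hence "lift (ball_coord S g y) = c *s z"
		unfolding lift_def k by (simp add: vec_option_eq_iff cc)
	moreover have "c ~= 0" using nc R by auto
	ultimately have "pt (lift (ball_coord S g y)) = pt z" by (simp add: pt_scale)
	thus "ball_chart g (ball_coord S g y) = y" unfolding ball_chart_pt[OF n1] by (simp add: act_pt[OF g] z(3))
qed

lemma linear_ball_coord_numerator: "linear (%y :: 'n::finite hmat. \<chi> i. if i : S then act (adj g) y $ Some i $ None else 0)"
	by (rule linearI) (simp_all add: vec_eq_iff linear_add[OF linear_act] linear_scale[OF linear_act])

text \<open>The derivative is left implicit. Composing with \<open>ball_chart\<close> later relates
  it to the derivative of the parametrization through the chain rule.\<close>

lemma ball_coord_has_derivative: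
	fixes y :: "'n::finite hmat"
	assumes y: "0 < Re (act (adj g) y $ None $ None)"
	obtains K where "(ball_coord S g has_derivative K) (at y)"
proof -
	let ?r = "%y :: 'n hmat. Re (act (adj g) y $ None $ None)"
	have r: "bounded_linear ?r"
		by (rule bounded_linear_compose[OF bounded_linear_Re bounded_linear_compose[OF bounded_linear_entry bounded_linear_act]])
	have "((%y. sqrt (?r y)) has_derivative (%v. ?r v * inverse (sqrt (?r y)) / 2)) (at y)"
		by (rule has_derivative_real_sqrt[OF y bounded_linear_imp_has_derivative[OF r], THEN has_derivative_eq_rhs]) (simp add: fun_eq_iff divide_simps)
	hence "((%y. inverse (sqrt (?r y))) has_derivative (%v. - (inverse (sqrt (?r y)) * (?r v * inverse (sqrt (?r y)) / 2) * inverse (sqrt (?r y))))) (at y)"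
		by (intro Deriv.has_derivative_inverse) (use y in auto)
	from has_derivative_scaleR[OF this linear_imp_has_derivative[OF linear_ball_coord_numerator[of S g]]]
	show ?thesis using that by (simp add: ball_coord_def[abs_def])
qed

section \<open>Comparison of a parametrization with the Darboux chart\<close>

lemma borel_restrict:
	assumes "O' : sets borel" "continuous_on O' f" "A : sets borel"
	shows "{x : O'. f x : A} : sets borel"
proof -
	have "f : borel_measurable (restrict_space borel O')" by (rule borel_measurable_continuous_on_restrict[OF assms(2)])
	from measurable_sets[OF this assms(3)] have "f -` A Int O' : sets (restrict_space borel O')"
		by (simp add: space_restrict_space)
	hence "f -` A Int O' : sets borel" using assms(1) by (simp add: sets_restrict_space_iff)
	moreover have "f -` A Int O' = {x : O'. f x : A}" by auto
	ultimately show ?thesis by simp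
qed

lemma borel_chart_domain:
	fixes S :: "'n::finite set"
	assumes A: "A : sets borel"
	shows "{w : span (cbasis S). norm w < 1 & ball_chart g w : A} : sets borel"
proof -
	have "closed (span (cbasis S))" by simp
	hence "span (cbasis S) Int ball 0 1 : sets borel" by (intro sets.Int borel_closed borel_open) auto
	moreover have "continuous_on (span (cbasis S) Int ball 0 1) (ball_chart g)"
		by (rule has_derivative_continuous_on[OF has_derivative_at_withinI[OF has_derivative_ball_chart]]) auto
	ultimately have "{w : span (cbasis S) Int ball 0 1. ball_chart g w : A} : sets borel" by (rule borel_restrict[OF _ _ A])
	moreover have "{w : span (cbasis S) Int ball 0 1. ball_chart g w : A} = {w : span (cbasis S). norm w < 1 & ball_chart g w : A}"
		by auto
	ultimately show ?thesis by simp
qed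

lemma local_param_measure:
	fixes X :: "'n::finite hmat set"
	assumes lp: "local_param m X B U psi D" and A: "A : sets borel"
	defines "d \<equiv> %x. sqrt (gram_det B (D x))"
	shows "emeasure (distr (density (restrict_space (lborel_on B) U) (%x. ennreal (d x))) (restrict_space borel X) psi) (A Int X) =
			(\<integral>\<^sup>+x. ennreal (d x) * indicator {x : U. psi x : A} x \<partial>lborel_on B)"
		"(%x. ennreal (d x) * indicator {x : U. psi x : A} x) : borel_measurable borel" "U : sets borel"
		"continuous_on U psi"
proof -
	have B: "B \<subseteq> Basis" and U: "openin (top_of_set (span B)) U" and XU: "psi ` U \<subseteq> X"
		and der: "!!x. x : U ==> (psi has_derivative D x) (at x within U)" and cD: "!!b. b : B ==> continuous_on U (%x. D x b)"
		using lp unfolding local_param_def by blast+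
	obtain O' where O': "open O'" "U = O' Int span B" using U by (auto simp: openin_open Int_commute)
	have "closed (span B)" by simp
	thus UB: "U : sets borel" unfolding O'(2) using O'(1) by (intro sets.Int borel_open borel_closed)
	show c: "continuous_on U psi" by (rule has_derivative_continuous_on[OF der])
	have sl: "sets (lborel_on B) = sets borel" "space (lborel_on B) = UNIV" by (simp_all add: lborel_on_def)
	have UA: "{x : U. psi x : A} : sets borel" by (rule borel_restrict[OF UB c A])
	have cd: "continuous_on U d"
		unfolding d_def gram_det_def fs_metric_def
		by (intro continuous_intros cD) (auto simp: permutes_in_image cD)
	have md: "(%x. indicator U x *\<^sub>R d x) : borel_measurable borel"
		by (rule borel_measurable_continuous_on_indicator[OF UB cd])
	have "(%x. ennreal (indicator U x *\<^sub>R d x) * indicator {x : U. psi x : A} x) : borel_measurable borel"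
		using md UA by measurable
	also have "(%x. ennreal (indicator U x *\<^sub>R d x) * indicator {x : U. psi x : A} x) = (%x. ennreal (d x) * indicator {x : U. psi x : A} x)"
		by (rule ext) (auto simp: indicator_def)
	finally show m: "(%x. ennreal (d x) * indicator {x : U. psi x : A} x) : borel_measurable borel" .
	have mr: "d : borel_measurable (restrict_space (lborel_on B) U)"
		using borel_measurable_continuous_on_restrict[OF cd] sl by (simp cong: measurable_cong_sets add: sets_restrict_space)
	have mpsi: "psi : measurable (density (restrict_space (lborel_on B) U) (%x. ennreal (d x))) (restrict_space borel X)"
	proof -
		have "psi : borel_measurable (restrict_space (lborel_on B) U)"
			using borel_measurable_continuous_on_restrict[OF c] sl by (simp cong: measurable_cong_sets add: sets_restrict_space)
		hence "psi : measurable (restrict_space (lborel_on B) U) (restrict_space borel X)"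
			by (rule measurable_restrict_space2[rotated]) (use XU sl in \<open>auto simp: space_restrict_space\<close>)
		thus ?thesis by simp
	qed
	have AX: "A Int X : sets (restrict_space borel X)" using A by (auto simp: sets_restrict_space)
	have pre: "psi -` (A Int X) Int space (density (restrict_space (lborel_on B) U) (%x. ennreal (d x))) = {x : U. psi x : A}"
		using XU sl by (auto simp: space_restrict_space)
	have UA': "{x : U. psi x : A} : sets (restrict_space (lborel_on B) U)"
		using UA UB sl by (subst sets_restrict_space_iff) auto
	have "emeasure (distr (density (restrict_space (lborel_on B) U) (%x. ennreal (d x))) (restrict_space borel X) psi) (A Int X) =
			(\<integral>\<^sup>+x. ennreal (d x) * indicator {x : U. psi x : A} x \<partial>restrict_space (lborel_on B) U)"
		unfolding emeasure_distr[OF mpsi AX] pre by (rule emeasure_density) (use mr UA' in auto)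
	also have "... = (\<integral>\<^sup>+x. ennreal (d x) * indicator {x : U. psi x : A} x * indicator U x \<partial>lborel_on B)"
		by (rule nn_integral_restrict_space) (use UB sl in auto)
	also have "... = (\<integral>\<^sup>+x. ennreal (d x) * indicator {x : U. psi x : A} x \<partial>lborel_on B)"
		by (rule nn_integral_cong) (auto simp: indicator_def)
	finally show "emeasure (distr (density (restrict_space (lborel_on B) U) (%x. ennreal (d x))) (restrict_space borel X) psi) (A Int X) =
			(\<integral>\<^sup>+x. ennreal (d x) * indicator {x : U. psi x : A} x \<partial>lborel_on B)" .
qed

text \<open>Matches the coordinates outside \<open>B\<close> with those outside
  \<open>cbasis S\<close>. \<open>L\<close> carries the padding coordinates of the one domain to
  those of the other, so that a map between coordinate subspaces can be completed to the whole
  space.\<close>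

lemma basis_shift:
	fixes C C' :: "'a::euclidean_space set"
	assumes C: "C \<subseteq> Basis" "C' \<subseteq> Basis" "card C = card C'"
	obtains per L where "bij_betw per C C'" "linear L" "!!b. b : C ==> L b = per b" "!!b. b : Basis - C ==> L b = 0"
		"!!x b. b : C ==> L x \<bullet> per b = x \<bullet> b" "!!x b. b : Basis - C' ==> L x \<bullet> b = 0"
proof -
	have fin: "finite C" "finite C'" using C finite_Basis finite_subset by blast+
	obtain per where per: "bij_betw per C C'" using finite_same_card_bij[OF fin C(3)] by blast
	define L where "L x = (SUM b:C. (x \<bullet> b) *\<^sub>R per b)" for x
	have piC: "per b : C'" if "b : C" for b using bij_betwE[OF per] that by blast
	have lin: "linear L"
		by (rule linearI) (simp_all add: L_def inner_add_left scaleR_add_left sum.distrib scaleR_sum_right)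
	have Lb: "L b = (if b : C then per b else 0)" if "b : Basis" for b
	proof -
		have "L b = (SUM c:C. if c = b then per b else 0)"
			unfolding L_def by (rule sum.cong) (use C(1) that in \<open>auto simp: inner_Basis\<close>)
		thus ?thesis using fin by simp
	qed
	have Lp: "L x \<bullet> per b = x \<bullet> b" if "b : C" for x b
	proof -
		have "L x \<bullet> per b = (SUM c:C. if c = b then x \<bullet> b else 0)"
			unfolding L_def inner_sum_left
		proof (rule sum.cong[OF refl])
			fix c assume c: "c : C"
			have "per c = per b \<longleftrightarrow> c = b" using per c that by (auto simp: bij_betw_def inj_on_def)
			thus "(x \<bullet> c) *\<^sub>R per c \<bullet> per b = (if c = b then x \<bullet> b else 0)"
				using piC[OF c] piC[OF that] C(2) by (auto simp: inner_Basis subset_iff)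
		qed
		thus ?thesis using fin that by simp
	qed
	have L0: "L x \<bullet> b = 0" if "b : Basis - C'" for x b
		unfolding L_def inner_sum_left
	proof (rule sum.neutral, rule ballI)
		fix c assume c: "c : C"
		hence "per c : Basis" "per c ~= b" using piC[OF c] C(2) that by auto
		thus "(x \<bullet> c) *\<^sub>R per c \<bullet> b = 0" using that by (simp add: inner_Basis)
	qed
	show ?thesis by (rule that[OF per lin _ _ Lp L0]) (use C(1) in \<open>auto simp: Lb\<close>)
qed

text \<open>Over \<open>A\<close> the parametrization can be read in the Darboux chart, as a map
  into the span of \<open>cbasis S\<close>. Completed by \<open>L\<close> in the padding directions,
  it becomes an injective map on an open subset of the whole space whose Jacobian is the Riemannian
  density, so the integral of the density is at most the volume of a set containing the
  image.\<close>

lemma local_param_le_chart: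
	fixes X :: "'n::finite hmat set"
	assumes X: "proj_frame g S X" and lp: "local_param (2 * card S) X B U psi D" and A: "A : sets borel"
		and nz: "!!y. y : A ==> act (adj g) y $ None $ None ~= 0"
	shows "emeasure (distr (density (restrict_space (lborel_on B) U) (%x. ennreal (sqrt (gram_det B (D x))))) (restrict_space borel X) psi) (A Int X)
		<= emeasure (lborel_on (cbasis S)) {w : span (cbasis S). norm w < 1 & ball_chart g w : A}"
proof -
	have g: "g : unitary_group" using X by (simp add: proj_frame_def)
	have B: "B \<subseteq> Basis" "card B = 2 * card S" and U: "openin (top_of_set (span B)) U" and XU: "psi ` U \<subseteq> X"
		and injU: "inj_on psi U"
		and der: "!!x. x : U ==> (psi has_derivative D x) (at x within U)"
		using lp unfolding local_param_def by blast+
	let ?B' = "cbasis S" and ?P = "coord_proj B" and ?P' = "coord_proj (cbasis S)"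
	let ?C = "Basis - B" and ?C' = "Basis - cbasis S"
	let ?k = "ball_coord S g" and ?V = "{w : span (cbasis S). norm w < 1 & ball_chart g w : A}"
	have finB: "finite B" "finite ?B'" using B(1) cbasis_Basis finite_Basis finite_subset by blast+
	have cc: "card ?C = card ?C'"
		using B cbasis_Basis[of S] finB by (simp add: card_Diff_subset card_cbasis)
	obtain per L where per: "bij_betw per ?C ?C'" and L: "linear L" "!!b. b : ?C ==> L b = per b"
			"!!b. b : Basis - ?C ==> L b = 0" "!!x b. b : ?C ==> L x \<bullet> per b = x \<bullet> b" "!!x b. b : Basis - ?C' ==> L x \<bullet> b = 0"
		by (rule basis_shift[OF _ _ cc]) auto
	obtain O' where O': "open O'" "U = O' Int span B" using U by (auto simp: openin_open Int_commute)
	have contP: "continuous_on UNIV ?P" using linear_coord_proj by (intro linear_continuous_on) (simp add: linear_conv_bounded_linear)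
	define W where "W = ?P -` O'"
	have W: "open W" unfolding W_def by (rule open_vimage[OF O'(1) contP])
	have WU: "?P x : U \<longleftrightarrow> x : W" for x by (simp add: W_def O'(2))
	define Psi where "Psi x = psi (?P x)" for x
	have dPsi: "(Psi has_derivative (%v. D (?P x) (?P v))) (at x)" if x: "x : W" for x
	proof -
		have a: "(?P has_derivative ?P) (at x within W)" by (rule linear_imp_has_derivative[OF linear_coord_proj])
		have "(psi has_derivative D (?P x)) (at (?P x) within ?P ` W)"
			by (rule has_derivative_subset[OF der]) (use x WU in auto)
		from has_derivative_in_compose[OF a this] show ?thesis
			using at_within_open[OF x W] by (simp add: Psi_def[abs_def])
	qed
	let ?n = "%x. Re (act (adj g) (Psi x) $ None $ None)"
	define Q where "Q = {x : W. 0 < ?n x}"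
	have contPsi: "continuous_on W Psi" by (rule has_derivative_continuous_on[OF has_derivative_at_withinI[OF dPsi]])
	have Qo: "open Q"
	proof -
		have bl: "bounded_linear (%y :: 'n hmat. Re (act (adj g) y $ None $ None))"
			by (rule bounded_linear_compose[OF bounded_linear_Re bounded_linear_compose[OF bounded_linear_entry bounded_linear_act]])
		have "continuous_on W ?n" by (rule bounded_linear.continuous_on[OF bl contPsi])
		hence "open (W Int ?n -` {0<..})" by (rule continuous_open_preimage[OF _ W open_greaterThan])
		moreover have "W Int ?n -` {0<..} = Q" by (auto simp: Q_def)
		ultimately show ?thesis by simp
	qed
	have PX: "Psi x : X" if "x : W" for x using that XU WU by (auto simp: Psi_def)
	have QX: "norm (?k (Psi x)) < 1" "ball_chart g (?k (Psi x)) = Psi x" if "x : Q" for x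
	proof -
		have "Psi x : X" "act (adj g) (Psi x) $ None $ None ~= 0" using PX that by (auto simp: Q_def)
		from ball_chart_coord[OF X this] show "norm (?k (Psi x)) < 1" "ball_chart g (?k (Psi x)) = Psi x" by auto
	qed
	have "EX K. (?k has_derivative K) (at y)" if "0 < Re (act (adj g) y $ None $ None)" for y
		using ball_coord_has_derivative[OF that] by metis
	then obtain K where K: "!!y. 0 < Re (act (adj g) y $ None $ None) ==> (?k has_derivative K y) (at y)" by metis
	define E where "E x v = K (Psi x) (D (?P x) (?P v))" for x v
	have dE: "((%x. ?k (Psi x)) has_derivative E x) (at x)" if "x : Q" for x
		unfolding E_def[abs_def] using that by (intro has_derivative_compose[OF dPsi K]) (auto simp: Q_def)
	have linE: "linear (E x)" if "x : Q" for x by (rule has_derivative_linear[OF dE[OF that]])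
	have Espan: "E x v : span ?B'" if x: "x : Q" for x v
	proof -
		\<comment> \<open>The projection leaves the chart coordinates unchanged, hence also their
		  derivative.\<close>
		have "((%x. ?P' (?k (Psi x))) has_derivative (%v. ?P' (E x v))) (at x)"
			by (rule bounded_linear.has_derivative[OF linear_conv_bounded_linear[THEN iffD1, OF linear_coord_proj] dE[OF x]])
		hence "((%x. ?k (Psi x)) has_derivative (%v. ?P' (E x v))) (at x)"
			by (simp add: coord_proj_id[OF cbasis_Basis])
		from has_derivative_unique[OF this dE[OF x]] have "?P' (E x v) = E x v" by metis
		thus ?thesis by (metis coord_proj_span)
	qed
	\<comment> \<open>The chain rule for \<open>Psi\<close> as the chart composed with its coordinates;
	  it brings the metric of the chart to bear on the implicit derivative \<open>E\<close>.\<close>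
	have TE: "D (?P x) (?P v) = ball_chart_deriv g (?k (Psi x)) (E x v)" if x: "x : Q" for x v
	proof -
		have "((%x. ball_chart g (?k (Psi x))) has_derivative (%v. ball_chart_deriv g (?k (Psi x)) (E x v))) (at x)"
			by (rule has_derivative_compose[OF dE[OF x] has_derivative_ball_chart[OF QX(1)[OF x]]])
		hence "(Psi has_derivative (%v. ball_chart_deriv g (?k (Psi x)) (E x v))) (at x)"
			by (rule has_derivative_transform_within_open[OF _ Qo x]) (simp add: QX)
		moreover have "x : W" using x by (simp add: Q_def)
		ultimately have "(%v. ball_chart_deriv g (?k (Psi x)) (E x v)) = (%v. D (?P x) (?P v))"
			by (rule has_derivative_unique[OF _ dPsi])
		from fun_cong[OF this, of v] show ?thesis by simp
	qed
	\<comment> \<open>Chart coordinates in the span of \<open>cbasis S\<close>, and the padding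
	  coordinates permuted into its complement.\<close>
	define Phi where "Phi x = ?k (Psi x) + L x" for x
	have dPhi: "(Phi has_derivative (%v. E x v + L v)) (at x)" if "x : Q" for x
		unfolding Phi_def[abs_def] by (intro has_derivative_add dE that linear_imp_has_derivative L(1))
	have P'L: "?P' (L x) = 0" for x
		unfolding coord_proj_def using L(5) cbasis_Basis[of S] by (auto intro!: sum.neutral)
	have P'Phi: "?P' (Phi x) = ?k (Psi x)" for x
		by (simp add: Phi_def linear_add[OF linear_coord_proj] P'L coord_proj_id[OF cbasis_Basis])
	have PhiC: "Phi x \<bullet> per b = x \<bullet> b" if b: "b : ?C" for x b
	proof -
		have "per b : ?C'" using bij_betwE[OF per] b by blast
		hence "?k (Psi x) \<bullet> per b = 0" using span_Basis_iff[OF cbasis_Basis, of "?k (Psi x)" S] by auto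
		thus ?thesis by (simp add: Phi_def inner_add_left L(4)[OF b])
	qed
	have injPhi: "inj_on Phi Q"
	proof (rule inj_onI)
		fix x y assume xy: "x : Q" "y : Q" "Phi x = Phi y"
		have "?k (Psi x) = ?k (Psi y)" using P'Phi[of x] P'Phi[of y] xy(3) by simp
		hence "Psi x = Psi y" using QX(2)[OF xy(1)] QX(2)[OF xy(2)] by metis
		hence "psi (?P x) = psi (?P y)" unfolding Psi_def .
		moreover have "?P x : U" "?P y : U" using xy(1,2) unfolding WU by (simp_all add: Q_def)
		ultimately have P: "?P x = ?P y" by (rule inj_onD[OF injU])
		show "x = y"
		proof (rule euclidean_eqI)
			fix b :: "complex ^ 'n" assume b: "b : Basis"
			show "x \<bullet> b = y \<bullet> b"
			proof (cases "b : B")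
				case True
				thus ?thesis using coord_proj_inner[OF B(1) b, of x] coord_proj_inner[OF B(1) b, of y] P by simp
			next
				case False
				thus ?thesis using PhiC[of b x] PhiC[of b y] b xy(3) by simp
			qed
		qed
	qed
	\<comment> \<open>\<open>stretch\<close> turns the metric of the chart into the Euclidean one,
	  fixes the padding directions and has determinant 1 or -1. So the Gram determinant is the square
	  of the Jacobian of \<open>Phi\<close>.\<close>
	have det: "sqrt (gram_det B (D (?P x))) = abs (edet (%v. E x v + L v))" if x: "x : Q" for x
	proof -
		let ?w = "?k (Psi x)"
		let ?R = "stretch ?w"
		have w: "norm ?w < 1" "?w : span ?B'" using QX(1)[OF x] by simp_all
		let ?M = "%v. ?R (E x v + L v)"
		have in1: "?M b = ?R (E x b)" "?R (E x b) : span ?B'" if "b : B" for b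
			using that L(3)[of b] B(1) by (auto intro!: stretch_span Espan[OF x] w)
		have out: "?M b = per b" "per b : ?C'" if b: "b : ?C" for b
		proof -
			show p: "per b : ?C'" using bij_betwE[OF per] b by blast
			have "?P b = 0" by (rule euclidean_eqI) (use b coord_proj_inner[OF B(1)] in \<open>auto simp: inner_Basis\<close>)
			hence "E x b = E x 0" by (simp add: E_def linear_0[OF linear_coord_proj])
			hence "E x b = 0" by (simp add: linear_0[OF linE[OF x]])
			thus "?M b = per b" using L(2)[OF b] stretch_orthogonal[OF w(2) p] by simp
		qed
		have entry: "?M (ebasis i) \<bullet> ?M (ebasis j) =
			(if ebasis i : B & ebasis j : B then fs_metric (D (?P x) (ebasis i)) (D (?P x) (ebasis j)) else if i = j then 1 else 0)" for i j
		proof -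
			consider "ebasis i : B" "ebasis j : B" | "ebasis i : B" "ebasis j : ?C" | "ebasis i : ?C" "ebasis j : B" | "ebasis i : ?C" "ebasis j : ?C"
				by auto
			thus ?thesis
			proof cases
				case 1
				have "D (?P x) b = ball_chart_deriv g ?w (E x b)" if "b : B" for b
					using TE[OF x, of b] coord_proj_id[OF B(1) span_base[OF that]] by simp
				thus ?thesis using 1 by (simp add: in1 fs_metric_ball_chart[OF g w(1)])
			next
				case 2
				hence "?M (ebasis i) \<bullet> ?M (ebasis j) = 0"
					using in1[of "ebasis i"] out[of "ebasis j"] span_Basis_iff[OF cbasis_Basis, of "?R (E x (ebasis i))" S] by auto
				thus ?thesis using 2 by auto
			next
				case 3
				hence "?M (ebasis i) \<bullet> ?M (ebasis j) = 0"
					using in1[of "ebasis j"] out[of "ebasis i"] span_Basis_iff[OF cbasis_Basis, of "?R (E x (ebasis j))" S]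
					by (auto simp: inner_commute)
				thus ?thesis using 3 by auto
			next
				case 4
				have "per (ebasis i) = per (ebasis j) \<longleftrightarrow> i = j"
					using per 4 unfolding bij_betw_def inj_on_def by (metis ebasis_eq_iff)
				thus ?thesis using 4 out[of "ebasis i"] out[of "ebasis j"] by (auto simp: inner_Basis)
			qed
		qed
		have "gram_det B (D (?P x)) = (edet ?M)\<^sup>2"
			unfolding gram_det_padded[OF B(1)] edet_gram[symmetric] entry ..
		also have "edet ?M = edet ?R * edet (%v. E x v + L v)"
			using edet_compose[OF linear_stretch linear_compose_add[OF linE[OF x] L(1)], of ?w] by (simp add: o_def)
		finally have "gram_det B (D (?P x)) = (edet (%v. E x v + L v))\<^sup>2"
			by (simp add: power_mult_distrib edet_stretch[OF w(1)])
		thus ?thesis by simp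
	qed
	let ?d = "%x. sqrt (gram_det B (D x))"
	let ?S = "{x : Q. Psi x : A} Int unit_cube ?C"
	have SB: "?S : sets borel"
	proof (intro sets.Int borel_unit_cube borel_restrict)
		show "Q : sets borel" using Qo by simp
		show "continuous_on Q Psi" by (rule continuous_on_subset[OF contPsi]) (auto simp: Q_def)
	qed (use A in auto)
	have SQ: "{x : Q. Psi x : A} = {x. ?P x : {x : U. psi x : A}}"
		using proj_frame_entry[OF X] nz PX WU by (auto simp: Q_def Psi_def)
	note lm = local_param_measure[OF lp A]
	let ?V' = "{x : unit_cube ?C'. ?P' x : ?V}"
	have VB: "?V : sets borel" by (rule borel_chart_domain[OF A])
	have V'B: "?V' : sets borel"
	proof -
		have "unit_cube ?C' Int (?P' -` ?V Int space borel) : sets borel"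
			by (intro sets.Int borel_unit_cube measurable_sets[OF linear_borel[OF linear_coord_proj] VB]) auto
		moreover have "unit_cube ?C' Int (?P' -` ?V Int space borel) = ?V'" by auto
		ultimately show ?thesis by simp
	qed
	have V': "emeasure (lborel_on ?B') ?V = emeasure lborel ?V'" by (rule emeasure_lborel_on[OF cbasis_Basis VB])
	have img: "Phi ` ?S \<subseteq> ?V'"
	proof
		fix y assume "y : Phi ` ?S"
		then obtain x where x: "x : Q" "Psi x : A" "x : unit_cube ?C" "y = Phi x" by blast
		have "y : unit_cube ?C'"
			unfolding unit_cube_def
		proof (intro CollectI ballI)
			fix c assume "c : ?C'"
			then obtain b where "b : ?C" "c = per b" using per by (auto simp: bij_betw_def)
			thus "y \<bullet> c : {0..1}" using x(3,4) PhiC[of b x] by (auto simp: unit_cube_def)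
		qed
		thus "y : ?V'" using QX[OF x(1)] x(2) by (simp add: x(4) P'Phi)
	qed
	have "(\<integral>\<^sup>+x. ennreal (?d x) * indicator {x : U. psi x : A} x \<partial>lborel_on B) =
			(\<integral>\<^sup>+x. ennreal (?d (?P x)) * indicator {x : U. psi x : A} (?P x) * indicator (unit_cube ?C) x \<partial>lborel)"
		by (rule nn_integral_lborel_on[OF B(1) lm(2)])
	also have e: "(%x. ennreal (?d (?P x)) * indicator {x : U. psi x : A} (?P x) * indicator (unit_cube ?C) x) =
			(%x. ennreal (?d (?P x)) * indicator ?S x)"
		unfolding SQ by (rule ext) (auto simp: indicator_def)
	also have "(\<integral>\<^sup>+x. ennreal (?d (?P x)) * indicator ?S x \<partial>lborel) <= emeasure lborel ?V'"
	proof (cases "emeasure lborel ?V' < \<infinity>")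
		case True
		show ?thesis
		proof (rule change_of_variables_le[OF SB _ _ V'B img True])
			show "(Phi has_derivative (%v. E x v + L v)) (at x within ?S)" if "x : ?S" for x
				using dPhi that by (auto intro: has_derivative_at_withinI)
			show "inj_on Phi ?S" by (rule inj_on_subset[OF injPhi]) auto
			show "?d (?P x) = abs (edet (%v. E x v + L v))" if "x : ?S" for x using det that by auto
			have "(%x. ennreal (?d (?P x)) * indicator {x : U. psi x : A} (?P x) * indicator (unit_cube ?C) x) : borel_measurable borel"
				using measurable_compose[OF linear_borel[OF linear_coord_proj[of B]] lm(2)] borel_unit_cube[of ?C] by measurable
			thus "(%x. ennreal (?d (?P x)) * indicator ?S x) : borel_measurable borel" unfolding e .
		qed
	next
		case False
		hence "\<infinity> <= emeasure lborel ?V'" by (simp only: not_less)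
		thus ?thesis by (rule order_trans[rotated]) simp
	qed
	finally show ?thesis unfolding lm(1) V' .
qed

text \<open>A supremum of measures has the expected sets once the family is nonempty. The empty
  domain counts as a parametrization as soon as there is a coordinate space of dimension
  \<open>m\<close>.\<close>

lemma sets_fs_volume:
	fixes Y :: "'n::finite hmat set"
	assumes "m <= 2 * CARD('n)"
	shows "sets (fs_volume m Y) = sets (restrict_space borel Y)"
proof -
	let ?F = "{distr (density (restrict_space (lborel_on B) U) (%x. ennreal (sqrt (gram_det B (D x))))) (restrict_space borel Y) psi |
		B U psi D. local_param m Y B U psi D}"
	have "m <= card (Basis :: (complex ^ 'n) set)" using assms by simp
	then obtain B :: "(complex ^ 'n) set" where B: "B \<subseteq> Basis" "card B = m" by (rule obtain_subset_with_card_n)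
	have "local_param m Y B {} psi D" for psi D using B by (simp add: local_param_def)
	hence ne: "?F ~= {}" by blast
	have "sets (Sup ?F) = sigma_sets Y (\<Union>x\<in>?F. sets x)"
		by (rule sets_Sup_eq[OF _ ne]) (auto simp: space_restrict_space)
	also have "(\<Union>x\<in>?F. sets x) = sets (restrict_space borel Y)"
	proof -
		have "sets x = sets (restrict_space borel Y)" if "x : ?F" for x using that by auto
		thus ?thesis using ne by auto
	qed
	also have "sigma_sets Y ... = sets (restrict_space borel Y)"
		using sets.sigma_sets_eq[of "restrict_space borel Y"] by (simp add: space_restrict_space)
	finally show ?thesis unfolding fs_volume_def .
qed

section \<open>The volume measure of a projective subspace\<close>

lemma ball_chart_local_param:
	fixes X :: "'n::finite hmat set"
	assumes X: "proj_frame g S X"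
	shows "local_param (2 * card S) X (cbasis S) (ball 0 1 Int span (cbasis S)) (ball_chart g) (ball_chart_deriv g)"
proof -
	have g: "g : unitary_group" using X by (simp add: proj_frame_def)
	let ?U = "ball 0 1 Int span (cbasis S)"
	have inj: "inj_on (ball_chart_deriv g x) (span (cbasis S))" if x: "norm x < 1" for x
	proof -
		have lin: "linear (ball_chart_deriv g x)" by (rule has_derivative_linear[OF has_derivative_ball_chart[OF x]])
		have "v = 0" if "ball_chart_deriv g x v = 0" for v
		proof -
			have "stretch x v \<bullet> stretch x v = 0"
				unfolding fs_metric_ball_chart[OF g x, symmetric] that by (simp add: fs_metric_def)
			thus ?thesis using stretch_eq_0[OF x] by simp
		qed
		thus ?thesis using linear_injective_0[OF lin] by (auto intro: inj_on_subset)
	qed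
	have ch: "continuous_on ?U lift"
		by (rule has_derivative_continuous_on[OF has_derivative_at_withinI[OF has_derivative_lift]]) auto
	have cd: "continuous_on ?U (%x. lift_deriv x b)" for b
	proof -
		have "continuous_on ?U (%x. (- (x \<bullet> b) / height x) *\<^sub>R axis None 1 + emb 0 b)"
			unfolding height_def
			by (intro continuous_intros) (use height(1) in \<open>force simp: height_def\<close>)
		moreover have "(- (x \<bullet> b) / height x) *\<^sub>R axis None 1 + emb 0 b = lift_deriv x b" for x
			unfolding vec_option_eq_iff lift_deriv_def by (simp add: axis_def scaleR_conv_of_real[where 'a=complex])
		ultimately show ?thesis by simp
	qed
	have "continuous_on ?U (%x. ball_chart_deriv g x b)" for b
		unfolding ball_chart_deriv_def
		by (intro bounded_linear.continuous_on[OF bounded_linear_act] continuous_on_add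
				bounded_bilinear.continuous_on[OF bounded_bilinear_outer] ch cd)
	moreover have "inj_on (ball_chart g) ?U"
		by (rule inj_on_inverseI[where g = "ball_coord S g"]) (auto intro!: ball_coord_chart[OF g])
	moreover have "openin (top_of_set (span (cbasis S))) ?U" by (auto simp: openin_open Int_commute)
	ultimately show ?thesis
		unfolding local_param_def using inj
		by (auto simp: cbasis_Basis card_cbasis intro!: ball_chart_in[OF X] has_derivative_at_withinI[OF has_derivative_ball_chart])
qed

text \<open>\<open>stretch w\<close> fixes the basis vectors outside \<open>cbasis S\<close>, so the
  padded Gram matrix is the Gram matrix of \<open>stretch w\<close> on the whole basis, of
  determinant 1.\<close>

lemma gram_det_ball_chart:
	assumes g: "g : unitary_group" and w: "norm w < 1" "w : span (cbasis S)"
	shows "gram_det (cbasis S) (ball_chart_deriv g w) = 1"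
proof -
	have "(if ebasis i : cbasis S & ebasis j : cbasis S then fs_metric (ball_chart_deriv g w (ebasis i)) (ball_chart_deriv g w (ebasis j)) else if i = j then 1 else 0)
			= stretch w (ebasis i) \<bullet> stretch w (ebasis j)" for i j
	proof (cases "ebasis i : cbasis S")
		case i: True
		show ?thesis
		proof (cases "ebasis j : cbasis S")
			case False
			have "stretch w (ebasis i) \<bullet> ebasis j = 0"
				by (rule bspec[OF span_Basis_iff[OF cbasis_Basis, THEN iffD1, OF stretch_span[OF w(2) span_base[OF i]]]]) (simp add: False)
			thus ?thesis using i False stretch_orthogonal[OF w(2), of "ebasis j"] by auto
		qed (simp add: i fs_metric_ball_chart[OF g w(1)])
	next
		case i: False
		have e: "stretch w (ebasis i) = ebasis i" using i stretch_orthogonal[OF w(2), of "ebasis i"] by simp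
		show ?thesis
		proof (cases "ebasis j : cbasis S")
			case True
			have "ebasis i \<bullet> stretch w (ebasis j) = 0"
				by (subst inner_commute, rule bspec[OF span_Basis_iff[OF cbasis_Basis, THEN iffD1, OF stretch_span[OF w(2) span_base[OF True]]]])
					(simp add: i)
			thus ?thesis using i e True by auto
		qed (use i e stretch_orthogonal[OF w(2), of "ebasis j"] in \<open>auto simp: inner_Basis\<close>)
	qed
	thus ?thesis
		unfolding gram_det_padded[OF cbasis_Basis] by (simp add: edet_gram edet_stretch[OF w(1)])
qed

definition chart_measure :: "'n hmat => 'n set => 'n hmat set => 'n::finite hmat measure"
	where "chart_measure g S X = distr (density (restrict_space (lborel_on (cbasis S)) (ball 0 1 Int span (cbasis S)))
		(%x. ennreal (sqrt (gram_det (cbasis S) (ball_chart_deriv g x))))) (restrict_space borel X) (ball_chart g)"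

lemma emeasure_chart_measure:
	assumes X: "proj_frame g S X" and A: "A : sets borel"
	shows "emeasure (chart_measure g S X) (A Int X) =
		emeasure (lborel_on (cbasis S)) {w : span (cbasis S). norm w < 1 & ball_chart g w : A}"
proof -
	have g: "g : unitary_group" using X by (simp add: proj_frame_def)
	let ?V = "{w : span (cbasis S). norm w < 1 & ball_chart g w : A}"
	have V: "{x : ball 0 1 Int span (cbasis S). ball_chart g x : A} = ?V" by auto
	have "emeasure (chart_measure g S X) (A Int X) =
			(\<integral>\<^sup>+x. ennreal (sqrt (gram_det (cbasis S) (ball_chart_deriv g x))) * indicator ?V x \<partial>lborel_on (cbasis S))"
		unfolding chart_measure_def local_param_measure(1)[OF ball_chart_local_param[OF X] A] V ..
	also have "... = (\<integral>\<^sup>+x. indicator ?V x \<partial>lborel_on (cbasis S))"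
		by (rule nn_integral_cong) (auto simp: indicator_def gram_det_ball_chart[OF g])
	also have "... = emeasure (lborel_on (cbasis S)) ?V"
		by (rule nn_integral_indicator) (use borel_chart_domain[OF A] in \<open>simp add: lborel_on_def\<close>)
	finally show ?thesis .
qed

text \<open>Exchanges the coordinates \<open>None\<close> and \<open>Some k\<close>. The charts of
  \<open>g ** swap_mat k\<close> reach points whose coordinate \<open>None\<close> vanishes.\<close>

definition swap_mat :: "'n => 'n::finite hmat"
	where "swap_mat k = (\<chi> i j. if j = Transposition.transpose None (Some k) i then 1 else 0)"

lemma swap_mat_nth: "(swap_mat k *v z) $ i = z $ Transposition.transpose None (Some k) i"
	by (simp add: swap_mat_def matrix_vector_mult_def if_distrib[of "%a. a * _"] cong: if_cong)

lemma swap_mat_unitary: "swap_mat k : unitary_group"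
proof (rule unitary_groupI)
	fix x y
	have "bij (Transposition.transpose None (Some k))" by simp
	from sum.reindex_bij_betw[OF this, of "%i. x $ i * cnj (y $ i)"]
	show "herm (swap_mat k *v x) (swap_mat k *v y) = herm x y" by (simp add: herm_def swap_mat_nth)
qed

lemma swap_mat_swap: "swap_mat k *v (swap_mat k *v z) = z"
	by (simp add: vec_eq_iff swap_mat_nth)

lemma swap_mat_adj: "adj (swap_mat k) *v z = swap_mat k *v z"
	using unitary_group_inverse(2)[OF swap_mat_unitary, of k "swap_mat k *v z"] by (simp add: swap_mat_swap)

lemma proj_frame_swap:
	assumes X: "proj_frame g S X" and k: "k : S" shows "proj_frame (g ** swap_mat k) S X"
proof -
	let ?L = "{z. z ~= 0 & (ALL i. i ~: S --> z $ Some i = 0)}"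
	have g: "g : unitary_group" using X by (simp add: proj_frame_def)
	have sub: "(*v) (swap_mat k) ` ?L \<subseteq> ?L"
	proof clarify
		fix z :: "complex ^ ('a option)" assume z: "z ~= 0" "ALL i. i ~: S --> z $ Some i = 0"
		have "swap_mat k *v z ~= 0" using z(1) norm_unitary[OF swap_mat_unitary, of k z] by (metis norm_eq_zero)
		moreover have "(swap_mat k *v z) $ Some i = 0" if "i ~: S" for i
		proof -
			have "Transposition.transpose None (Some k) (Some i) = Some i"
				using that k by (auto simp: Transposition.transpose_def)
			thus ?thesis using that z(2) by (simp add: swap_mat_nth)
		qed
		ultimately show "swap_mat k *v z ~= 0 & (ALL i. i ~: S --> (swap_mat k *v z) $ Some i = 0)" by blast
	qed
	have "(*v) (swap_mat k) ` ?L = ?L"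
	proof
		show "?L \<subseteq> (*v) (swap_mat k) ` ?L"
		proof
			fix z :: "complex ^ ('a option)" assume "z : ?L"
			hence "swap_mat k *v z : ?L" using sub by blast
			thus "z : (*v) (swap_mat k) ` ?L" by (rule image_eqI[rotated]) (rule swap_mat_swap[symmetric])
		qed
	qed (rule sub)
	moreover have "(%z. pt ((g ** swap_mat k) *v z)) ` ?L = (%z. pt (g *v z)) ` (*v) (swap_mat k) ` ?L"
		by (simp only: image_image matrix_vector_mul_assoc)
	ultimately have "(%z. pt ((g ** swap_mat k) *v z)) ` ?L = (%z. pt (g *v z)) ` ?L" by simp
	thus ?thesis using X by (simp add: proj_frame_def unitary_group_mult swap_mat_unitary)
qed

text \<open>After padding, the set lies in a coordinate hyperplane of the whole space.\<close>

lemma lborel_on_hyperplane: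
	assumes k: "k : S" and V: "V : sets borel" "!!w. w : V ==> w $ k = 0"
	shows "emeasure (lborel_on (cbasis S)) V = 0"
proof -
	let ?b = "axis k 1 :: complex ^ 'a"
	have b: "?b : cbasis S" using k by (simp add: cbasis_def)
	have b': "?b : Basis" using b cbasis_Basis by blast
	let ?H = "{x. x \<bullet> ?b = 0}"
	have "negligible {x. ?b \<bullet> x = 0}"
		by (rule negligible_hyperplane) (use b' nonzero_Basis in blast)
	hence "?H : null_sets lebesgue" by (simp add: negligible_iff_null_sets inner_commute)
	moreover have H: "?H : sets borel" by (intro borel_closed closed_Collect_eq continuous_intros)
	ultimately have z: "emeasure lborel ?H = 0" by (simp add: null_sets_def emeasure_completion)
	have "{x : unit_cube (Basis - cbasis S). coord_proj (cbasis S) x : V} \<subseteq> ?H"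
	proof clarify
		fix x assume "coord_proj (cbasis S) x : V"
		hence "coord_proj (cbasis S) x \<bullet> ?b = 0" using V(2) by (simp add: inner_axis)
		thus "x \<bullet> ?b = 0" using b by (simp add: coord_proj_inner[OF cbasis_Basis b'])
	qed
	hence "emeasure lborel {x : unit_cube (Basis - cbasis S). coord_proj (cbasis S) x : V} <= emeasure lborel ?H"
		by (rule emeasure_mono) (use H in simp)
	thus ?thesis using z by (simp add: emeasure_lborel_on[OF cbasis_Basis V(1)])
qed

lemma borel_entry: "{y :: 'n::finite hmat. act h y $ i $ j ~= 0} : sets borel"
proof -
	have "continuous_on UNIV (%y :: 'n hmat. act h y $ i $ j)"
		by (intro linear_continuous_on bounded_linear_compose[OF bounded_linear_entry bounded_linear_act])
	thus ?thesis by (intro borel_open open_Collect_neq continuous_on_const)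
qed

text \<open>The points missed by the chart of \<open>g\<close> must be null for every
  parametrization. They are covered by the charts of \<open>g ** swap_mat k\<close>, in which they
  lie in the null set \<open>w $ k = 0\<close>, and \<open>local_param_le_chart\<close> for those
  charts bounds their measure by zero.\<close>

lemma local_param_le_chart_measure:
	fixes X :: "'n::finite hmat set"
	assumes X: "proj_frame g S X" and lp: "local_param (2 * card S) X B U psi D" and A: "A : sets borel"
	shows "emeasure (distr (density (restrict_space (lborel_on B) U) (%x. ennreal (sqrt (gram_det B (D x))))) (restrict_space borel X) psi) (A Int X)
		<= emeasure (chart_measure g S X) (A Int X)"
proof -
	let ?mu = "distr (density (restrict_space (lborel_on B) U) (%x. ennreal (sqrt (gram_det B (D x))))) (restrict_space borel X) psi"
	have g: "g : unitary_group" using X by (simp add: proj_frame_def)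
	have setsI: "C Int X : sets (restrict_space borel X)" if "C : sets borel" for C using that by (auto simp: sets_restrict_space)
	let ?H = "{y. act (adj g) y $ None $ None ~= 0}"
	let ?A0 = "A Int ?H" and ?Ak = "%k. (A - ?H) Int {y. act (adj (g ** swap_mat k)) y $ None $ None ~= 0}"
	have A0: "?A0 : sets borel" using A borel_entry by blast
	have Ak: "?Ak k : sets borel" for k using A borel_entry[of "adj g"] borel_entry[of "adj (g ** swap_mat k)"] by blast
	have null: "?Ak k Int X : null_sets ?mu" if k: "k : S" for k
	proof -
		let ?g = "g ** swap_mat k"
		note Xk = proj_frame_swap[OF X k]
		let ?V = "{w : span (cbasis S). norm w < 1 & ball_chart ?g w : ?Ak k}"
		have "w $ k = 0" if w: "w : ?V" for w
		proof -
			have n: "norm w < 1" and e0: "act (adj g) (ball_chart ?g w) $ None $ None = 0" using w by auto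
			have "act (adj g) (ball_chart ?g w) = act (swap_mat k) (pt (lift w))"
				using g by (simp add: ball_chart_pt[OF n] act_mult)
			also have "... = pt (swap_mat k *v lift w)" by (rule act_pt[OF swap_mat_unitary])
			finally have "(swap_mat k *v lift w) $ None * cnj ((swap_mat k *v lift w) $ None) = 0"
				using e0 by (simp add: pt_nth norm_unitary[OF swap_mat_unitary] height(3)[OF n])
			thus ?thesis by (simp add: swap_mat_nth lift_def)
		qed
		hence "emeasure (lborel_on (cbasis S)) ?V = 0"
			by (intro lborel_on_hyperplane[OF k borel_chart_domain[OF Ak]])
		moreover have "emeasure ?mu (?Ak k Int X) <= emeasure (lborel_on (cbasis S)) ?V"
			by (rule local_param_le_chart[OF Xk lp Ak]) auto
		ultimately show ?thesis using setsI[OF Ak] by (auto simp: null_sets_def)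
	qed
	let ?N = "\<Union>k\<in>S. ?Ak k Int X"
	have N: "?N : null_sets ?mu" by (rule null_sets_UN') (use null in auto)
	have "A Int X \<subseteq> (?A0 Int X) Un ?N"
	proof
		fix y assume y: "y : A Int X"
		then obtain z where z: "z ~= 0" "ALL i. i ~: S --> z $ Some i = 0" "y = pt (g *v z)"
			using X unfolding proj_frame_def by blast
		have e: "act (adj g) y = pt z" using g by (simp add: z(3) act_pt[OF g, symmetric])
		show "y : (?A0 Int X) Un ?N"
		proof (cases "z $ None = 0")
			case False
			hence "y : ?H" using z(1) by (simp add: e pt_nth)
			thus ?thesis using y by blast
		next
			case True
			then obtain k where k: "z $ Some k ~= 0" using z(1) by (auto simp: vec_option_eq_iff)
			have "act (adj (g ** swap_mat k)) y = act (adj (swap_mat k)) (pt z)" by (simp add: adj_mult act_mult e)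
			also have "... = pt (swap_mat k *v z)" by (simp add: act_pt[OF unitary_group_adj[OF swap_mat_unitary]] swap_mat_adj)
			finally have "act (adj (g ** swap_mat k)) y $ None $ None ~= 0"
				using z(1) k by (simp add: pt_nth swap_mat_nth norm_unitary[OF swap_mat_unitary])
			moreover have "y ~: ?H" using True by (simp add: e pt_nth)
			ultimately show ?thesis using y k z(2) by blast
		qed
	qed
	hence "emeasure ?mu (A Int X) <= emeasure ?mu ((?A0 Int X) Un ?N)"
		by (rule emeasure_mono) (use setsI[OF A0] N in \<open>auto simp: null_sets_def\<close>)
	also have "... = emeasure ?mu (?A0 Int X)"
		by (rule emeasure_Un_null_set[OF _ N]) (use setsI[OF A0] in simp)
	also have "... <= emeasure (chart_measure g S X) (?A0 Int X)"
		unfolding emeasure_chart_measure[OF X A0] by (rule local_param_le_chart[OF X lp A0]) auto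
	also have "... <= emeasure (chart_measure g S X) (A Int X)"
		by (rule emeasure_mono) (use setsI[OF A] in \<open>auto simp: chart_measure_def\<close>)
	finally show ?thesis .
qed

text \<open>The Darboux chart dominates every parametrization and is one of them, so the supremum is
  attained.\<close>

lemma fs_volume_proj_frame:
	fixes X :: "'n::finite hmat set"
	assumes X: "proj_frame g S X"
	shows "fs_volume (2 * card S) X = chart_measure g S X"
proof (rule antisym)
	show "fs_volume (2 * card S) X <= chart_measure g S X"
		unfolding fs_volume_def
	proof (rule Sup_least)
		fix mu assume "mu : {distr (density (restrict_space (lborel_on B) U) (%x. ennreal (sqrt (gram_det B (D x))))) (restrict_space borel X) psi |
			B U psi D. local_param (2 * card S) X B U psi D}"
		then obtain B U psi D where mu: "mu = distr (density (restrict_space (lborel_on B) U) (%x. ennreal (sqrt (gram_det B (D x))))) (restrict_space borel X) psi"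
			and lp: "local_param (2 * card S) X B U psi D" by blast
		show "mu <= chart_measure g S X"
		proof (subst le_measure)
			show "ALL A:sets mu. emeasure mu A <= emeasure (chart_measure g S X) A"
			proof
				fix A assume "A : sets mu"
				then obtain A' where "A' : sets borel" "A = A' Int X" by (auto simp: mu sets_restrict_space)
				thus "emeasure mu A <= emeasure (chart_measure g S X) A"
					using local_param_le_chart_measure[OF X lp] by (simp add: mu)
			qed
		qed (simp add: mu chart_measure_def)
	qed
	show "chart_measure g S X <= fs_volume (2 * card S) X"
		unfolding fs_volume_def chart_measure_def
		by (rule Sup_upper) (use ball_chart_local_param[OF X] in blast)
qed

text \<open>\<open>emeasure_cball_aux\<close> measures closed balls; the open unit ball lies in the
  closed one and contains all those of smaller radius.\<close>

lemma lborel_on_ball: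
	assumes B: "B \<subseteq> (Basis :: 'a::euclidean_space set)"
	shows "emeasure (lborel_on B) {w : span B. norm w < 1} = ennreal (unit_ball_vol (real (card B)))"
proof -
	let ?P = "\<Pi>\<^sub>M b\<in>B. (lborel :: real measure)"
	have fin: "finite B" using B finite_Basis finite_subset by blast
	have m: "(%h. SUM b:B. h b *\<^sub>R b) : borel_measurable ?P"
		by (intro borel_measurable_sum borel_measurable_scaleR) (auto intro: measurable_component_singleton)
	have nrm: "norm (SUM b:B. h b *\<^sub>R b) = sqrt (SUM b:B. (h b)\<^sup>2)" for h
	proof -
		have "(SUM b:B. h b *\<^sub>R b) \<bullet> (SUM b:B. h b *\<^sub>R b) = (SUM b:B. SUM c:B. if c = b then (h b)\<^sup>2 else 0)"
			unfolding inner_sum_left inner_sum_right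
			by (intro sum.cong refl) (use B in \<open>auto simp: inner_Basis power2_eq_square subset_iff\<close>)
		thus ?thesis using fin by (simp add: norm_eq_sqrt_inner)
	qed
	have sB: "(SUM b:B. h b *\<^sub>R b) : span B" for h by (intro span_sum span_mul span_base)
	have "closed (span B)" by simp
	moreover have "{w : span B. norm w < 1} = span B Int ball 0 1" by auto
	ultimately have bs: "{w : span B. norm w < 1} : sets borel" by simp
	define v where "v = emeasure (lborel_on B) {w : span B. norm w < 1}"
	have v: "v = emeasure ?P ({h. sqrt (SUM b:B. (h b)\<^sup>2) < 1} Int space ?P)"
	proof -
		have "(%h. SUM b:B. h b *\<^sub>R b) -` {w : span B. norm w < 1} Int space ?P = {h. sqrt (SUM b:B. (h b)\<^sup>2) < 1} Int space ?P"
			using sB by (auto simp: nrm)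
		thus ?thesis unfolding v_def lborel_on_def emeasure_distr[OF m bs] by simp
	qed
	let ?c = "unit_ball_vol (real (card B))"
	have ms: "{h. sqrt (SUM b:B. (h b)\<^sup>2) < 1} Int space ?P : sets ?P" "{h. sqrt (SUM b:B. (h b)\<^sup>2) <= r} Int space ?P : sets ?P" for r
	proof -
		have "(%h. sqrt (SUM b:B. (h b)\<^sup>2)) : borel_measurable ?P"
			using measurable_compose[OF m borel_measurable_norm] by (simp add: nrm)
		from measurable_sets[OF this, of "{..<1}"] measurable_sets[OF this, of "{..r}"]
		show "{h. sqrt (SUM b:B. (h b)\<^sup>2) < 1} Int space ?P : sets ?P" "{h. sqrt (SUM b:B. (h b)\<^sup>2) <= r} Int space ?P : sets ?P"
			by (simp_all add: vimage_def)
	qed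
	have "v <= emeasure ?P ({h. sqrt (SUM b:B. (h b)\<^sup>2) <= 1} Int space ?P)"
		unfolding v by (rule emeasure_mono) (use ms in auto)
	hence up: "v <= ennreal ?c" unfolding emeasure_cball_aux[OF fin zero_less_one] by simp
	have lo: "ennreal (?c * r ^ card B) <= v" if "0 < r" "r < 1" for r
		unfolding v emeasure_cball_aux[OF fin that(1), symmetric]
	proof (rule emeasure_mono)
		show "{h. sqrt (SUM b:B. (h b)\<^sup>2) <= r} Int space ?P \<subseteq> {h. sqrt (SUM b:B. (h b)\<^sup>2) < 1} Int space ?P"
			using that(2) by (blast intro: le_less_trans)
	qed (use ms in auto)
	\<comment> \<open>Radii 1 - 1/(k+2), where the shift by two keeps them positive.\<close>
	have lim: "(%k. ennreal (?c * (1 - inverse (real (Suc (Suc k)))) ^ card B)) \<longlonglongrightarrow> ennreal (?c * (1 - 0) ^ card B)"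
		by (intro tendsto_ennrealI tendsto_intros LIMSEQ_Suc[OF LIMSEQ_inverse_real_of_nat])
	have "ennreal ?c <= v"
		by (rule LIMSEQ_le_const2[OF lim[simplified]]) (auto intro!: exI[of _ 0] lo[simplified] simp: inverse_less_1_iff)
	thus ?thesis using up by (simp add: v_def)
qed

lemma emeasure_fs_volume_proj_frame:
	assumes X: "proj_frame g S X"
	shows "emeasure (fs_volume (2 * card S) X) X = ennreal (pi ^ card S / fact (card S))"
proof -
	have "emeasure (fs_volume (2 * card S) X) X = emeasure (lborel_on (cbasis S)) {w : span (cbasis S). norm w < 1}"
		unfolding fs_volume_proj_frame[OF X] using emeasure_chart_measure[OF X, of UNIV] by simp
	also have "... = ennreal (unit_ball_vol (real (2 * card S)))"
		using lborel_on_ball[OF cbasis_Basis, of S] by (simp only: card_cbasis)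
	finally show ?thesis by (simp only: unit_ball_vol_even)
qed

lemma proj_frame_CP: "proj_frame (mat 1) UNIV (CP :: 'n::finite hmat set)"
proof -
	have "(CP :: 'n hmat set) = (%z. pt (mat 1 *v z)) ` {z. z ~= 0}" by (auto simp: CP_def)
	thus ?thesis by (simp add: proj_frame_def unitary_group_one)
qed

lemma vol_proj_frame:
	"proj_frame g S X ==> vol (2 * card S) X = pi ^ card S / fact (card S)"
	by (simp add: vol_def measure_def emeasure_fs_volume_proj_frame)

section \<open>Projective subspaces as complex submanifolds\<close>

lemma span_coordinate_frame:
	assumes vs: "set vs = (%i. axis i 1) ` I"
	shows "span (set (complexify vs)) = {z :: complex ^ 'm::finite. ALL i. i ~: I --> z $ i = 0}"
proof
	have "subspace {z :: complex ^ 'm. ALL i. i ~: I --> z $ i = 0}" by (auto simp: subspace_def)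
	thus "span (set (complexify vs)) \<subseteq> {z. ALL i. i ~: I --> z $ i = 0}"
		by (rule span_minimal[rotated]) (auto simp: set_complexify vs axis_def)
	show "{z. ALL i. i ~: I --> z $ i = 0} \<subseteq> span (set (complexify vs))"
	proof
		fix z :: "complex ^ 'm" assume z: "z : {z. ALL i. i ~: I --> z $ i = 0}"
		have "z = (SUM i:UNIV. z $ i *s axis i 1)" by (simp add: vec_eq_iff axis_def if_distrib cong: if_cong)
		also have "... : span (set (complexify vs))"
		proof (rule span_sum)
			fix i
			show "z $ i *s axis i 1 : span (set (complexify vs))"
			proof (cases "i : I")
				case True
				hence "axis i 1 : span (set (complexify vs))" by (intro span_base) (auto simp: set_complexify vs)
				thus ?thesis by (rule complex_subspace_scale[OF complex_subspace_span])
			next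
				case False
				hence "z $ i *s axis i 1 = 0" using z by (simp add: vec_eq_iff)
				thus ?thesis by (simp add: span_zero)
			qed
		qed
		finally show "z : span (set (complexify vs))" .
	qed
qed

text \<open>\<open>proj_subspace\<close> counts complex dimension through \<open>vec.dim\<close>,
  while frames are built from real spans. A unitary list is a complex basis of the space whose real
  span its complexification gives.\<close>

lemma unitary_list_vec_dim:
	fixes us :: "(complex ^ 'm::finite) list"
	assumes us: "unitary_list us" and L: "span (set (complexify us)) = L" "vec.subspace L"
	shows "vec.dim L = length us"
proof -
	have herm: "herm f g = (if f = g then 1 else 0)" if "f : set us" "g : set us" for f g
		using us that by (simp add: unitary_list_def)
	have indep: "vec.independent (set us)"
		unfolding vec.dependent_finite[OF finite_set]
	proof clarify
		fix c v assume v: "v : set us" "c v ~= 0" and s: "(SUM v:set us. c v *s v) = 0"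
		have "0 = herm (SUM v:set us. c v *s v) v" by (simp add: s herm_simps)
		also have "... = (SUM x:set us. if x = v then c v else 0)"
			unfolding herm_sum_left herm_simps by (rule sum.cong) (auto simp: herm v)
		finally show False using v by simp
	qed
	have "vec.span (set us) = L"
	proof
		have "set us \<subseteq> L" unfolding L(1)[symmetric] by (auto simp: set_complexify intro: span_base)
		thus "vec.span (set us) \<subseteq> L" by (rule vec.span_minimal[OF _ L(2)])
		have "subspace (vec.span (set us))"
			by (auto simp: subspace_def scaleR_eq_vector_scale intro: vec.span_zero vec.span_add vec.span_scale)
		moreover have "set (complexify us) \<subseteq> vec.span (set us)"
			by (auto simp: set_complexify intro: vec.span_base vec.span_scale)
		ultimately show "L \<subseteq> vec.span (set us)" unfolding L(1)[symmetric] by (rule span_minimal[rotated])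
	qed
	hence "vec.dim L = vec.dim (set us)" by (metis vec.dim_span)
	also have "... = card (set us)" by (rule vec.dim_eq_card_independent[OF indep])
	also have "... = length us" using us by (intro distinct_card) (simp add: unitary_list_def)
	finally show ?thesis .
qed

text \<open>A unitary map carries the coordinate vectors \<open>None\<close> and
  \<open>Some k\<close>, for k in \<open>S\<close>, to a unitary frame of the underlying linear
  subspace.\<close>

lemma proj_subspace_frame:
	fixes X :: "'n::finite hmat set"
	assumes X: "proj_subspace m X"
	obtains g S where "proj_frame g S X" "card S = m" "m <= CARD('n)"
proof -
	obtain L where L: "vec.subspace L" "vec.dim L = m + 1" "X = pt ` (L - {0})"
		using X unfolding proj_subspace_def by blast
	have "complex_subspace L"
		unfolding complex_subspace_def subspace_def scaleR_eq_vector_scale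
		using L(1) by (auto intro: vec.subspace_0 vec.subspace_add vec.subspace_scale)
	then obtain us where us: "unitary_list us" "span (set (complexify us)) = L" by (rule complex_subspace_frame)
	have lus: "length us = m + 1" using unitary_list_vec_dim[OF us L(1)] L(2) by simp
	have "EX vs'. length us + length (vs' :: (complex ^ ('n option)) list) = CARD('n option)"
		using unitary_list_complete[OF us(1)] by metis
	hence mn: "m <= CARD('n)" using lus by auto
	obtain S :: "'n set" where S: "card S = m" using obtain_subset_with_card_n[OF mn] by blast
	obtain ks where ks: "set ks = S" "distinct ks" using finite_distinct_list[of S] by auto
	have lks: "length ks = m" using distinct_card[OF ks(2)] by (simp add: ks(1) S)
	define vs where "vs = axis None 1 # map (%k. axis (Some k) (1 :: complex)) ks"
	have vset: "set vs = (%i. axis i 1) ` (insert None (Some ` S))" by (auto simp: vs_def ks)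
	have ha: "herm (axis i 1) (axis j 1) = (if i = j then 1 else 0)" for i j :: "'n option"
		by (simp add: herm_def axis_def if_distrib[of "%a. a * _"] if_distrib[of cnj] cong: if_cong)
	have "distinct vs" using ks(2) by (auto simp: vs_def distinct_map inj_on_def axis_eq_axis)
	hence vs: "unitary_list vs" by (auto simp: unitary_list_def vset ha axis_eq_axis)
	have "length vs = length us" by (simp add: vs_def lks lus)
	then obtain g where g: "g : unitary_group" "map ((*v) g) vs = us" by (rule unitary_transitive[OF vs us(1)])
	let ?L = "{z. ALL i. i ~: S --> z $ Some i = 0}"
	have "span (set (complexify vs)) = {z. ALL i. i ~: insert None (Some ` S) --> z $ i = 0}"
		by (rule span_coordinate_frame[OF vset])
	also have "... = ?L" by (auto simp: split_option_all)
	finally have spv: "span (set (complexify vs)) = ?L" .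
	have "L = span ((*v) g ` set (complexify vs))"
		unfolding us(2)[symmetric] g(2)[symmetric] map_complexify[symmetric] by simp
	also have "... = (*v) g ` ?L" unfolding linear_span_image[OF linear_matrix_vector] spv ..
	finally have LL: "L = (*v) g ` ?L" .
	have nz: "g *v z = 0 \<longleftrightarrow> z = 0" for z using norm_unitary[OF g(1), of z] by (metis norm_eq_zero)
	have "L - {0} = (*v) g ` {z. z ~= 0 & (ALL i. i ~: S --> z $ Some i = 0)}"
		unfolding LL using nz by auto
	hence "X = (%z. pt (g *v z)) ` {z. z ~= 0 & (ALL i. i ~: S --> z $ Some i = 0)}"
		by (simp add: L(3) image_image)
	hence "proj_frame g S X" using g(1) by (simp add: proj_frame_def)
	thus ?thesis using that S mn by blast
qed

text \<open>In each affine chart \<open>X\<close> is cut out by affine linear functions: the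
  coordinates outside \<open>S\<close>, once the motion \<open>g\<close> is undone.\<close>

lemma proj_frame_submanifold:
	fixes X :: "'n::finite hmat set"
	assumes X: "proj_frame g S X" and j: "j = CARD('n) - card S"
	shows "complex_submanifold j X"
	unfolding complex_submanifold_def
proof (intro conjI ballI)
	have g: "g : unitary_group" using X by (simp add: proj_frame_def)
	have Xe: "X = (%z. pt (g *v z)) ` {z. z ~= 0 & (ALL i. i ~: S --> z $ Some i = 0)}"
		using X by (simp add: proj_frame_def)
	have nz: "h *v z ~= 0" if "h : unitary_group" "z ~= 0" for h :: "'n hmat" and z
		using norm_unitary[OF that(1), of z] that(2) by (metis norm_eq_zero)
	show "X \<subseteq> CP" unfolding Xe using nz[OF g] by (auto intro!: pt_in_CP)
	fix h :: "'n hmat" assume h: "h : unitary_group"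
	define Q where "Q = adj g ** h"
	have Q: "Q : unitary_group" unfolding Q_def by (intro unitary_group_mult unitary_group_adj g h)
	have gQ: "g *v (Q *v x) = h *v x" for x
		unfolding Q_def matrix_vector_mul_assoc[symmetric] using g by simp
	let ?T = "{w. affine_chart h w : X}"
	have T: "affine_chart h w : X \<longleftrightarrow> (ALL i. i ~: S --> (Q *v emb 1 w) $ Some i = 0)" for w
	proof
		assume "affine_chart h w : X"
		then obtain z where z: "ALL i. i ~: S --> z $ Some i = 0" "affine_chart h w = pt (g *v z)" unfolding Xe by blast
		have "pt (g *v (Q *v emb 1 w)) = pt (g *v z)" using z(2) by (simp add: gQ affine_chart_emb)
		hence "act (adj g) (act g (pt (Q *v emb 1 w))) = act (adj g) (act g (pt z))" by (simp only: act_pt[OF g])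
		hence p: "pt (Q *v emb 1 w) = pt z" using g by simp
		show "ALL i. i ~: S --> (Q *v emb 1 w) $ Some i = 0"
		proof (intro allI impI)
			fix i assume "i ~: S"
			hence "pt z $ Some i $ Some i = 0" using z(1) by (simp add: pt_nth)
			hence "pt (Q *v emb 1 w) $ Some i $ Some i = 0" using p by simp
			thus "(Q *v emb 1 w) $ Some i = 0" by (simp add: pt_nth norm_unitary[OF Q])
		qed
	next
		assume a: "ALL i. i ~: S --> (Q *v emb 1 w) $ Some i = 0"
		have "affine_chart h w = pt (g *v (Q *v emb 1 w))" by (simp add: gQ affine_chart_emb)
		thus "affine_chart h w : X" unfolding Xe using a nz[OF Q emb1_nonzero, of w] by blast
	qed
	obtain ks where ks: "set ks = - S" "distinct ks" using finite_distinct_list[of "- S"] by auto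
	have len: "length ks = j" using distinct_card[OF ks(2)] by (simp add: ks(1) j Compl_eq_Diff_UNIV card_Diff_subset)
	define f where "f k w = (Q *v emb 1 w) $ Some (ks ! k)" for k w
	define D where "D k v = (Q *v emb 0 v) $ Some (ks ! k)" for k v
	have fD: "(f k has_derivative D k) (at w)" for k w
		unfolding f_def[abs_def] D_def[abs_def]
		by (rule bounded_linear.has_derivative[OF bounded_linear_vec_nth
					bounded_linear.has_derivative[OF linear_conv_bounded_linear[THEN iffD1, OF linear_matrix_vector] has_derivative_emb1]])
	have Dc: "D k (c *s v) = c * D k v" for k c v
	proof -
		have "emb 0 (c *s v) = c *s emb 0 v" by (simp add: vec_option_eq_iff)
		thus ?thesis by (simp add: D_def vector_scalar_commute)
	qed
	have ball: "(ALL i. i ~: S --> P i) \<longleftrightarrow> (ALL k<j. P (ks ! k))" for P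
		using ks(1) len by (metis Compl_iff in_set_conv_nth)
	show "complex_submanifold_affine j ?T"
		unfolding complex_submanifold_affine_def
	proof
		fix p assume p: "p : ?T"
		have sur: "EX v. ALL k<j. frechet_derivative (f k) (at w) v = c k" for w and c :: "nat => complex"
		proof -
			define x where "x = emb 0 (\<chi> i. \<Sum>k<j. if ks ! k = i then c k else 0)"
			have xk: "x $ Some (ks ! k) = c k" if k: "k < j" for k
			proof -
				have "(\<Sum>l<j. if ks ! l = ks ! k then c l else 0) = (\<Sum>l<j. if l = k then c k else 0)"
					by (rule sum.cong) (use k len ks(2) in \<open>auto simp: nth_eq_iff_index_eq\<close>)
				thus ?thesis using k by (simp add: x_def)
			qed
			define ze where "ze = adj Q *v x"
			\<comment> \<open>\<open>D k\<close> acts on vectors with first coordinate 0. Subtracting a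
			  multiple of \<open>emb 1 p\<close> achieves this and keeps the values, as the equations vanish
			  at \<open>p\<close>.\<close>
			define v where "v = tail ze - ze $ None *s p"
			have "emb 0 v = ze - ze $ None *s emb 1 p" by (simp add: vec_option_eq_iff v_def)
			hence "Q *v emb 0 v = x - ze $ None *s (Q *v emb 1 p)"
				using Q by (simp add: linear_diff[OF linear_matrix_vector] vector_scalar_commute ze_def)
			hence "D k v = c k" if "k < j" for k
				using that p[simplified T ball] xk by (simp add: D_def)
			thus ?thesis using frechet_derivative_at[OF fD] by metis
		qed
		have hol: "holomorphic_several (f k) UNIV" for k
			unfolding holomorphic_several_def using fD Dc by blast
		have "?T = {w. ALL k<j. f k w = 0}" unfolding T ball f_def ..
		thus "EX U f. open U & p : U & (ALL k<j. holomorphic_several (f k) U) & ?T Int U = {w : U. ALL k<j. f k w = 0} &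
				(ALL w:U. ALL c. EX v. ALL k<j. frechet_derivative (f k) (at w) v = c k)"
			using hol sur by (intro exI[of _ UNIV] exI[of _ f]) simp
	qed
qed

theorem proposition7p1:
  fixes \<mu> :: "(complex ^ 'n::finite ^ 'n) measure" and \<eta> :: "'n hmat measure"
    and \<tau> :: "'n hmat \<Rightarrow> 'n hmat" and hyperplane :: "'n hmat set"
    and \<gamma> :: "'n ext vzonoid set" and i1 :: 'n and n :: nat
  assumes n: "n = CARD('n)"
    and \<mu>: "haar_prob unitary_group \<mu>"
    and \<eta>: "haar_prob stabilizer \<eta>"
    and \<tau>: "orbit_section \<tau>"
    and hyperplane: "proj_subspace (n - 1) hyperplane"
    and \<gamma>: "\<gamma> = grass_class \<eta> \<tau> 2 hyperplane"
  shows "\<gamma> \<in> R_deg 2 \<and>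
    \<gamma> = Q_scale (real n / pi) (Q_class (P_zonoid \<mu> i1)) \<and>
    (\<forall>j\<le>n. Q_length (\<gamma> [^]\<^bsub>Q_algebra\<^esub> j) = (1 / pi) ^ j * (fact n / fact (n - j))) \<and>
    (\<forall>j Y. complex_submanifold j Y \<longrightarrow> cohomogeneous (Y :: 'n hmat set)) \<and>
    (\<forall>j\<le>n. \<forall>Y :: 'n hmat set. \<forall>X :: 'n hmat set. complex_submanifold j Y \<longrightarrow> finite_volume (2 * n - 2 * j) Y \<longrightarrow>
      proj_subspace (n - j) X \<longrightarrow>
      grass_class \<eta> \<tau> (2 * j) Y =
        Q_scale (vol (2 * n - 2 * j) Y / vol (2 * n - 2 * j) X) (\<gamma> [^]\<^bsub>Q_algebra\<^esub> j)) \<and>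
    (\<forall>j\<le>n. \<forall>X :: 'n hmat set. proj_subspace (n - j) X \<longrightarrow> grass_class \<eta> \<tau> (2 * j) X = \<gamma> [^]\<^bsub>Q_algebra\<^esub> j)"
proof -
  have n0: "0 < n" by (simp add: n)
  have volX: "vol (2 * n - 2 * j) X = pi ^ (n - j) / fact (n - j)" "complex_submanifold j X"
    if j: "j \<le> n" and X: "proj_subspace (n - j) X" for j and X :: "'n hmat set"
  proof -
    obtain g S where S: "proj_frame g S X" "card S = n - j" by (rule proj_subspace_frame[OF X])
    show "vol (2 * n - 2 * j) X = pi ^ (n - j) / fact (n - j)"
      using vol_proj_frame[OF S(1)] by (simp add: S(2) diff_mult_distrib2)
    show "complex_submanifold j X" by (rule proj_frame_submanifold[OF S(1)]) (use j S(2) n in simp)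
  qed
  have volCP: "vol (2 * CARD('n)) (CP :: 'n hmat set) = pi ^ n / fact n"
    using vol_proj_frame[OF proj_frame_CP] by (simp add: n)
  \<comment> \<open>The class depends on \<open>Y\<close> only through its volume and
    codimension.\<close>
  have cls: "grass_class \<eta> \<tau> (2 * j) Y = Q_class ((vol (2 * n - 2 * j) Y / (pi ^ n / fact n)) *\<^sub>R frame_zonoid \<mu> us)"
    if Y: "complex_submanifold j Y" and us: "unitary_list us" "length us = j" for j us and Y :: "'n hmat set"
  proof -
    have "sets (fs_volume (2 * CARD('n) - 2 * j) Y) = sets (restrict_space borel Y)" by (rule sets_fs_volume) simp
    from grass_zonoid_frame[OF \<mu> \<eta> \<tau> Y us this] show ?thesis by (simp add: grass_class_def volCP n)
  qed
  let ?e = "axis i1 (1 :: complex)"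
  have e: "norm ?e = 1" by (simp add: norm_axis_1)
  have ue: "unitary_list [?e]" using e by (simp add: unitary_list_Cons unitary_list_Nil)
  have H: "vol (2 * n - 2 * 1) hyperplane = pi ^ (n - 1) / fact (n - 1)" "complex_submanifold 1 hyperplane"
    using volX[of 1 hyperplane] n0 hyperplane by simp_all
  \<comment> \<open>The quotient of the volumes of CP^(n-1) and CP^n.\<close>
  have ratio: "(pi ^ (n - 1) / fact (n - 1)) / (pi ^ n / fact n) = real n / pi"
  proof -
    obtain m where m: "n = Suc m" using n0 by (cases n) auto
    have "pi ^ m \<noteq> 0" by simp
    then show ?thesis by (simp add: m field_simps)
  qed
  have \<gamma>c: "\<gamma> = Q_class ((real n / pi) *\<^sub>R frame_zonoid \<mu> [?e])"
    using cls[OF H(2) ue] unfolding H(1) ratio \<gamma> by simp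
  have pow: "\<gamma> [^]\<^bsub>Q_algebra\<^esub> j = Q_class (((1 / pi) ^ j * (fact n / fact (n - j))) *\<^sub>R frame_zonoid \<mu> us)"
    if "j \<le> n" and us: "unitary_list us" "length us = j" for j us
  proof -
    \<comment> \<open>The numerators n of the class cancel the denominators n of the mean squared
      distances.\<close>
    have "(real n / pi) ^ j * (fact n / (fact (n - j) * real n ^ j)) = (1 / pi) ^ j * (fact n / fact (n - j))"
      using n0 by (simp add: power_divide)
    then show ?thesis
      using frame_zonoid_power[OF \<mu> e us, of "real n / pi"] that(1) by (simp add: \<gamma>c n)
  qed
  have frame: "\<exists>us :: (complex ^ 'n) list. unitary_list us \<and> length us = j" if "j \<le> n" for j
    using unitary_list_exists[where 'n = 'n, of j] that n by metis
  have general: "grass_class \<eta> \<tau> (2 * j) Y = Q_scale (vol (2 * n - 2 * j) Y / vol (2 * n - 2 * j) X) (\<gamma> [^]\<^bsub>Q_algebra\<^esub> j)"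
    if j: "j \<le> n" and Y: "complex_submanifold j Y" and X: "proj_subspace (n - j) X" for j and X Y :: "'n hmat set"
  proof -
    obtain us :: "(complex ^ 'n) list" where us: "unitary_list us" "length us = j" using frame[OF j] by blast
    \<comment> \<open>The constant of the j-th power is the quotient of the volumes of CP^(n-j) and
      CP^n, so dividing by the former leaves vol(Y)/vol(CP^n).\<close>
    have "pi ^ n = pi ^ (n - j) * pi ^ j" using j by (simp flip: power_add)
    then have "vol (2 * n - 2 * j) Y / (pi ^ (n - j) / fact (n - j)) * ((1 / pi) ^ j * (fact n / fact (n - j))) =
        vol (2 * n - 2 * j) Y / (pi ^ n / fact n)"
      by (simp add: power_divide)
    then show ?thesis
      unfolding cls[OF Y us] pow[OF j us] Q_scale_class volX(1)[OF j X] scaleR_scaleR by simp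
  qed
  have R: "\<gamma> \<in> R_deg 2"
  proof -
    let ?A = "(real n / pi) *\<^sub>R frame_zonoid \<mu> [?e]"
    have "frame_zonoid \<mu> [?e] \<in> grass_deg 2" using frame_zonoid_grass_deg[OF \<mu>, of "[?e]"] by simp
    then have A: "?A \<in> grass_deg 2" unfolding grass_deg_def by (rule span_mul)
    have "vz_map (ext_map g) ` Q_class ?A = Q_class ?A" if g: "g \<in> unitary_group" for g
    proof -
      have "vz_map (ext_map g) ` Q_class ?A = Q_class (vz_map (ext_map g) ?A)"
        unfolding ext_map_eq by (rule vz_map_Q_class[OF orthogonal_unitary[OF g]])
      also have "vz_map (ext_map g) ?A = (real n / pi) *\<^sub>R vz_map (ext_map g) (frame_zonoid \<mu> [?e])"
        unfolding ext_map_eq by (rule linear_scale[OF linear_vz_map[OF linear_ext_lin]])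
      finally show ?thesis by (simp add: vz_map_frame_zonoid[OF \<mu> g])
    qed
    moreover have "Q_class ?A \<in> carrier Q_algebra" using A grass_deg_carrier by (intro Q_class_carrier) blast
    ultimately show ?thesis using A unfolding \<gamma>c R_deg_def by blast
  qed
  have P: "\<gamma> = Q_scale (real n / pi) (Q_class (P_zonoid \<mu> i1))"
    by (simp add: \<gamma>c Q_scale_class P_zonoid_frame)
  have len: "Q_length (\<gamma> [^]\<^bsub>Q_algebra\<^esub> j) = (1 / pi) ^ j * (fact n / fact (n - j))" if j: "j \<le> n" for j
  proof -
    obtain us :: "(complex ^ 'n) list" where us: "unitary_list us" "length us = j" using frame[OF j] by blast
    show ?thesis
      unfolding pow[OF j us] Q_length_class linear_scale[OF linear_vz_length] vz_length_frame_zonoid[OF \<mu> us(1)] by simp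
  qed
  \<comment> \<open>The case where \<open>Y\<close> is the subspace \<open>X\<close> itself, with
    quotient of volumes 1.\<close>
  have same: "grass_class \<eta> \<tau> (2 * j) X = \<gamma> [^]\<^bsub>Q_algebra\<^esub> j"
    if j: "j \<le> n" and X: "proj_subspace (n - j) X" for j and X :: "'n hmat set"
  proof -
    obtain us :: "(complex ^ 'n) list" where us: "unitary_list us" "length us = j" using frame[OF j] by blast
    have "vol (2 * n - 2 * j) X \<noteq> 0" using volX(1)[OF j X] by simp
    then show ?thesis
      using general[OF j volX(2)[OF j X] X] by (simp add: pow[OF j us] Q_scale_class)
  qed
  have coh: "cohomogeneous Y" if "complex_submanifold j Y" for j and Y :: "'n hmat set"
    by (rule cohomogeneous_complex_submanifold[OF \<tau> that])
  show ?thesis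
    using R P len coh general same by blast
qed

end
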